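(* Let $Z_1,Z_2,\dots$ be i.i.d. real random variables with known strictly increasing cumulative distribution function $F_Z$ and density $f_Z$; let $a=\sup\{x\mid F_Z(x)=0\}$, $b=\inf\{x\mid F_Z(x)=1\}$. Let $g$ be strictly increasing, $Y_i=g(Z_i)$, and let $f_Y$ be the density of $Y_1$. Assume: $g$ is twice continuously differentiable, $f_Z$ is continuously differentiable on $(a,b)$, $f_Z>0$ and $g'>0$ on $(a,b)$, and there is $\gamma>0$ with $$\sup_{a<x<b}\frac{F_Z(x)(1-F_Z(x))}{f_Z^2(x)}\left|f_Z'(x)-f_Z(x)\frac{g''(x)}{g'(x)}\right|\le\gamma.$$ Let $\phi$ be a kernel such that (1) there is a compact interval $[d_1,d_2]$ with $\operatorname{supp}\phi\subseteq[d_1,d_2]$, (2) $\phi$ is continuously differentiable on $[d_1,d_2]$, (3) $\int_{d_1}^{d_2}\phi(x)\,dx=1$. Let $h=h(n)>0$ be a bandwidth with $(\log\log n)^{1/2}h\to0$ and $\frac{\sqrt n h^2}{\log\log n}\to\infty$, and define $$f_n^Y(y)=\frac{1}{nh}\sum_{i=1}^n\phi\Big(\frac{y-Y_i}{h}\Big),\qquad \widehat g(x)=\xi_n^Y(F_Z(x)),$$ where $\xi_n^Y(p)=\inf\{y\mid F_n^Y(y)\ge p\}$, $F_n^Y(y)=\frac1n\sum_{i=1}^n\mathbf{1}_{Y_i\le y}$. Let $[c,d]$ be a closed interval with $a<c<d<b$. Then one can define (on a common probability space with the sample) a Kiefer process $\{K(y,t):0\le y\le1,\ t\ge0\}$ such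 that $$\sup_{c\le x\le d}\left|\sqrt n(\widehat g(x)-g(x))f_n^Y(\widehat g(x))-\frac{K(F_Z(x),n)}{\sqrt n}\right|\to0\quad\text{almost surely.}$$
   Context: A Kiefer process $K(y,t)$, $0\le y\le1$, $t\ge0$, is a centered Gaussian process with covariance $\mathbb{E}[K(y,s)K(y',t)]=\min(s,t)\,(\min(y,y')-yy')$. *)

theory Defs
  imports "HOL-Probability.Probability"
begin

definition kiefer_cov :: "real \<times> real \<Rightarrow> real \<times> real \<Rightarrow> real" where
  "kiefer_cov p q = min (snd p) (snd q) * (min (fst p) (fst q) - fst p * fst q)"

definition centered_gaussian_rv :: "'a measure \<Rightarrow> ('a \<Rightarrow> real) \<Rightarrow> real \<Rightarrow> bool" where
  "centered_gaussian_rv M X v \<longleftrightarrow>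
     X \<in> borel_measurable M \<and>
     (if v = 0 then (AE \<omega> in M. X \<omega> = 0)
      else distributed M lborel X (\<lambda>x. ennreal (normal_density 0 (sqrt v) x)))"

text \<open>Kiefer process on [0,1] x [0,inf): a centered Gaussian process (every finite linear
  combination is centered Gaussian with the variance determined by the covariance)
  with continuous sample paths.\<close>
definition kiefer_process :: "'a measure \<Rightarrow> (real \<Rightarrow> real \<Rightarrow> 'a \<Rightarrow> real) \<Rightarrow> bool" where
  "kiefer_process M K \<longleftrightarrow>
     (\<forall>y t. K y t \<in> borel_measurable M) \<and>
     (\<forall>\<omega>\<in>space M. continuous_on ({0..1} \<times> {0..}) (\<lambda>(y, t). K y t \<omega>)) \<and>
     (\<forall>(ps :: (real \<times> real) list) (cs :: real list).
        length cs = length ps \<and> (\<forall>p\<in>set ps. 0 \<le> fst p \<and> fst p \<le> 1 \<and> 0 \<le> snd p) \<longrightarrow>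
        centered_gaussian_rv M
          (\<lambda>\<omega>. \<Sum>j<length ps. cs ! j * K (fst (ps ! j)) (snd (ps ! j)) \<omega>)
          (\<Sum>j<length ps. \<Sum>k<length ps. cs ! j * cs ! k * kiefer_cov (ps ! j) (ps ! k)))"

definition emp_cdf :: "(nat \<Rightarrow> real) \<Rightarrow> nat \<Rightarrow> real \<Rightarrow> real" where
  "emp_cdf Y n y = (\<Sum>i=1..n. if Y i \<le> y then 1 else 0) / real n"

definition emp_quantile :: "(nat \<Rightarrow> real) \<Rightarrow> nat \<Rightarrow> real \<Rightarrow> real" where
  "emp_quantile Y n p = Inf {y. emp_cdf Y n y \<ge> p}"

definition kde :: "(real \<Rightarrow> real) \<Rightarrow> real \<Rightarrow> (nat \<Rightarrow> real) \<Rightarrow> nat \<Rightarrow> real \<Rightarrow> real" where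
  "kde \<phi> h Y n y = (\<Sum>i=1..n. \<phi> ((y - Y i) / h)) / (real n * h)"

end

theory Submission
  imports Defs "HOL-Real_Asymp.Real_Asymp" "HOL-Library.Discrete_Functions"
begin

text \<open>Replacing \<open>Z i\<close> by \<open>F (Z i)\<close> reduces everything to a uniform sample, for which a Kiefer process
  has to be built on the same space with an almost sure error \<open>o(sqrt n)\<close>. No rate is needed, so a
  coarse dyadic coupling suffices. The sample is cut into blocks of polynomially growing size. In the
  block \<open>j\<close> the points descend a binary tree, each node using its own fair coins to send its visitors
  left or right. The sum of a fixed number of these coins is quantile-coupled to a Gaussian; these
  Gaussians are the coefficients of the Schauder (Levy-Ciesielski) expansion of a Brownian bridge
  that stays close to the empirical process of the block, because the second differences of that
  process on the dyadic grid are the coin sums. Further independent Gaussians interpolate between the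
  block ends and turn the weighted sum of the bridges into a Kiefer process. Ottaviani's inequality
  gives the law of the iterated logarithm, up to a constant, for its Schauder coefficients and hence a
  modulus of continuity of the empirical process.

  For the estimator let \<open>z\<close> be the sample point with \<open>g z = emp_quantile ... (F x)\<close>. Inverting the empirical
  process gives \<open>sqrt n * (F z - F x) = - (empirical process at F x) + o(1)\<close>, the kernel estimate at
  \<open>g z\<close> converges to \<open>fZ / g'\<close> fast enough, and a second order expansion of \<open>g\<close> against \<open>F\<close> on a
  compact neighbourhood of \<open>{c..d}\<close> turns \<open>(g z - g x) * fZ x / g' x\<close> into \<open>F z - F x\<close>.\<close>

section \<open>Normal approximation of coin sums\<close>

text \<open>One Kiefer process has to serve all \<open>n\<close>, but the tree coupling handles one
  sample size at a time. With block sizes growing polynomially, block \<open>J\<close> is at most of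
  order \<open>1/J\<close> of the sample before it, so inside it nothing is coupled: both processes
  are merely bounded by \<open>sqrt (block_size J) * growth J\<close>, which is
  \<open>o(sqrt n)\<close>. Geometric blocks would lose this. Finished blocks contribute errors of
  order \<open>sqrt (block_size j) / j^2\<close>, whose sum is
  \<open>O(sqrt (block_size J))\<close>.

  The Gaussians must be independent, so each is tied to a deterministic number of coins, the
  expected number of visitors. The true number is random; the discrepancy is a stretch of a sign
  walk whose length is about \<open>sqrt (block_size j)\<close>, and it contributes only about the
  square root of that length.

  In the estimator, \<open>sqrt n\<close> times the quantile error has size
  \<open>sqrt (ln (ln n))\<close>. Multiplied by the error of the kernel estimate it leaves terms of
  order \<open>ln (ln n) / (sqrt n * h)\<close> and \<open>sqrt (ln (ln n)) * h\<close>, and the two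
  bandwidth conditions make these vanish.\<close>

lemma LBINT_cdf_diff:
  fixes f :: "real \<Rightarrow> real"
  assumes f: "integrable lborel f" and xy: "x \<le> y"
  shows "(LBINT t:{..y}. f t) - (LBINT t:{..x}. f t) = integral {x..y} f"
proof -
  have si: "set_integrable lborel A f" if "A \<in> sets borel" for A
    unfolding set_integrable_def using f that by (intro integrable_mult_indicator) auto
  have "(LBINT t:{..y}. f t) = (LBINT t:{..x} \<union> {x<..y}. f t)"
    using xy by (simp add: ivl_disj_un)
  also have "\<dots> = (LBINT t:{..x}. f t) + (LBINT t:{x<..y}. f t)"
    by (rule set_integral_Un) (auto intro!: si)
  also have "(LBINT t:{x<..y}. f t) = integral {x<..y} f"
    by (rule set_borel_integral_eq_integral(2) [OF si]) auto
  also have "\<dots> = integral {x..y} f"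
    by (rule integral_subset_negligible) (auto intro: negligible_subset [of "{x}"])
  finally show ?thesis by simp
qed

text \<open>Localised to an open set because \<open>fZ\<close> is known to be continuous only
  between \<open>a\<close> and \<open>b\<close>. Near \<open>x\<close> the integral from minus
  infinity differs by a constant from one over a compact interval, where the fundamental theorem
  applies.\<close>

lemma LBINT_cdf_has_derivative:
  fixes f :: "real \<Rightarrow> real"
  assumes f: "integrable lborel f" and S: "open S" "x \<in> S" "continuous_on S f"
  shows "((\<lambda>x. LBINT t:{..x}. f t) has_real_derivative f x) (at x)"
proof -
  define F where "F = (\<lambda>x. LBINT t:{..x}. f t)"
  obtain e where e: "e > 0" "cball x e \<subseteq> S"
    using S open_contains_cball by blast
  then have c: "continuous_on {x-e..x+e} f"
    using S(3) by (auto simp: cball_eq_atLeastAtMost intro: continuous_on_subset)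
  have "((\<lambda>y. integral {x-e..y} f) has_real_derivative f x) (at x within {x-e..x+e})"
    by (rule integral_has_real_derivative [OF c]) (use e in auto)
  then have "((\<lambda>y. integral {x-e..y} f) has_real_derivative f x) (at x)"
    using e by (simp add: at_within_Icc_at)
  then have "((\<lambda>y. F (x-e) + integral {x-e..y} f) has_real_derivative f x) (at x)"
    by (auto intro!: derivative_eq_intros)
  moreover have "F (x-e) + integral {x-e..y} f = F y" if "dist y x < e" for y
    using LBINT_cdf_diff [OF f, of "x-e" y] that by (simp add: F_def dist_real_def abs_less_iff)
  ultimately have "(F has_real_derivative f x) (at x)"
    using has_field_derivative_transform_within [OF _ e(1), of "\<lambda>y. F (x-e) + integral {x-e..y} f" _ x UNIV F] by auto
  then show ?thesis by (simp add: F_def)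
qed

section \<open>Standard normal density and distribution function\<close>

abbreviation ndens :: "real \<Rightarrow> real" where "ndens \<equiv> std_normal_density"

definition Phi :: "real \<Rightarrow> real" where
  "Phi x = measure std_normal_distribution {..x}"

interpretation std_normal: real_distribution std_normal_distribution
  by (rule real_dist_normal_dist)

lemma ndens_pos: "0 < ndens x" and ndens_le_exp: "ndens x \<le> exp (- x\<^sup>2 / 2)"
proof -
  show "0 < ndens x" by (simp add: normal_density_pos)
  have "1 \<le> sqrt (2 * pi)" using pi_gt3 by simp
  then have "exp (- x\<^sup>2 / 2) / sqrt (2 * pi) \<le> exp (- x\<^sup>2 / 2) / 1"
    by (intro divide_left_mono) auto
  then show "ndens x \<le> exp (- x\<^sup>2 / 2)" unfolding std_normal_density_def by simp
qed

lemma ndens_minus [simp]: "ndens (- x) = ndens x"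
  by (simp add: std_normal_density_def)

lemma ndens_deriv: "(ndens has_real_derivative - (x * ndens x)) (at x)"
proof -
  obtain k where k: "ndens = (\<lambda>x. k * exp (- x\<^sup>2 / 2))"
    unfolding std_normal_density_def [abs_def] by blast
  show ?thesis unfolding k by (auto intro!: derivative_eq_intros)
qed

lemma ndens_continuous: "continuous_on A ndens"
  by (intro continuous_at_imp_continuous_on ballI DERIV_isCont [OF ndens_deriv])

lemma Phi_LBINT: "Phi x = (LBINT t:{..x}. ndens t)"
proof -
  have "Phi x = (\<integral>z. indicator {..x} z \<partial>std_normal_distribution)"
    by (simp add: Phi_def)
  also have "\<dots> = (\<integral>z. ndens z *\<^sub>R indicator {..x} z \<partial>lborel)"
    by (rule integral_density) auto
  finally show ?thesis by (simp add: set_lebesgue_integral_def mult.commute)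
qed

lemma Phi_deriv: "(Phi has_real_derivative ndens x) (at x)"
  unfolding Phi_LBINT [abs_def]
  by (rule LBINT_cdf_has_derivative [of _ UNIV]) (auto intro: ndens_continuous)

lemma Phi_strict_mono: "x < y \<Longrightarrow> Phi x < Phi y"
  by (rule DERIV_pos_imp_increasing) (use Phi_deriv ndens_pos in blast)+

lemma Phi_mono: "x \<le> y \<Longrightarrow> Phi x \<le> Phi y"
  using Phi_strict_mono [of x y] by (cases "x = y") auto

lemma Phi_less_iff: "Phi x < Phi y \<longleftrightarrow> x < y" and Phi_le_iff: "Phi x \<le> Phi y \<longleftrightarrow> x \<le> y"
  using Phi_strict_mono [of x y] Phi_strict_mono [of y x] by (cases x y rule: linorder_cases; force)+

lemma Phi_nonneg: "0 \<le> Phi x" and Phi_le_1: "Phi x \<le> 1"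
  by (simp_all add: Phi_def)

lemma Phi_at_top: "(Phi \<longlongrightarrow> 1) at_top" and Phi_at_bot: "(Phi \<longlongrightarrow> 0) at_bot"
  using std_normal.cdf_lim_at_top_prob std_normal.cdf_lim_at_bot
  by (simp_all add: Phi_def [abs_def] cdf_def [abs_def])

text \<open>For \<open>z > t >= 0\<close> one has \<open>z^2 >= t^2 + (z - t)^2\<close>, so the
  density beyond \<open>t\<close> is dominated by \<open>exp (- t^2 / 2)\<close> times the normal
  density centered at \<open>t\<close>, which has mass 1.\<close>

lemma Phi_tail: assumes "0 \<le> t" shows "1 - Phi t \<le> exp (- t\<^sup>2 / 2)"
proof -
  have "1 - Phi t = std_normal.prob {t<..}"
    unfolding Phi_def using std_normal.prob_compl [of "{..t}"]
    by (simp add: Compl_eq_Diff_UNIV [symmetric])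
  also have "\<dots> = (\<integral>z. indicator {t<..} z \<partial>std_normal_distribution)" by simp
  also have "\<dots> = (\<integral>z. ndens z *\<^sub>R indicator {t<..} z \<partial>lborel)"
    by (rule integral_density) auto
  also have "\<dots> \<le> (\<integral>z. exp (- t\<^sup>2 / 2) * normal_density t 1 z \<partial>lborel)"
  proof (rule integral_mono)
    have "integrable lborel (\<lambda>z. indicator {t<..} z *\<^sub>R ndens z)"
      by (rule integrable_mult_indicator) auto
    then show "integrable lborel (\<lambda>z. ndens z *\<^sub>R indicat_real {t<..} z)"
      by (simp only: real_scaleR_def mult.commute)
    fix z
    have "ndens z \<le> exp (- t\<^sup>2 / 2) * normal_density t 1 z" if "t < z"
    proof -
      have "t * (z - t) \<ge> 0" using that assms by simp
      then have "- z\<^sup>2 / 2 \<le> - t\<^sup>2 / 2 + - (z - t)\<^sup>2 / 2"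
        by (simp add: power2_eq_square algebra_simps)
      then have "exp (- z\<^sup>2 / 2) \<le> exp (- t\<^sup>2 / 2) * exp (- (z - t)\<^sup>2 / 2)"
        by (simp flip: exp_add)
      then have "(1 / sqrt (2*pi)) * exp (- z\<^sup>2 / 2) \<le> (1 / sqrt (2*pi)) * (exp (- t\<^sup>2 / 2) * exp (- (z - t)\<^sup>2 / 2))"
        by (intro mult_left_mono) auto
      then show ?thesis by (simp add: normal_density_def mult_ac)
    qed
    then show "ndens z *\<^sub>R indicator {t<..} z \<le> exp (- t\<^sup>2 / 2) * normal_density t 1 z"
      by (auto simp: indicator_def)
  qed auto
  also have "\<dots> = exp (- t\<^sup>2 / 2)" by simp
  finally show ?thesis .
qed

text \<open>\<open>Phi x + Phi (- x)\<close> has derivative zero, and its constant value is read off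
  at infinity.\<close>

lemma Phi_minus: "Phi (- x) = 1 - Phi x"
proof -
  define D where "D = (\<lambda>x. Phi x + Phi (- x))"
  have "(D has_real_derivative 0) (at x)" for x
  proof -
    have "((\<lambda>x. Phi (- x)) has_real_derivative ndens (- x) * (-1)) (at x)"
      by (rule DERIV_chain2 [OF Phi_deriv]) (auto intro!: derivative_eq_intros)
    from DERIV_add [OF Phi_deriv [of x] this] show ?thesis by (simp add: D_def)
  qed
  then have "D y = D 0" for y using DERIV_isconst_all [of D y 0] by auto
  then obtain k where k: "D = (\<lambda>_. k)" by blast
  have "(D \<longlongrightarrow> 1 + 0) at_top"
    unfolding D_def
    by (intro tendsto_add Phi_at_top filterlim_compose [OF Phi_at_bot] filterlim_uminus_at_bot_at_top)
  then have "k = 1" unfolding k by (simp add: tendsto_const_iff)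
  then show ?thesis using fun_cong [OF k, of x] by (simp add: D_def)
qed

text \<open>The quartic is 8 times the second order Taylor polynomial of
  \<open>exp (z^2 / 2)\<close>, so it is absorbed by the exponential in the density.
  \<open>abs_le_quartic\<close> supplies the three weights that occur below.\<close>

lemma ndens_poly_bound:
  assumes "P \<le> 8 + 4 * z\<^sup>2 + z^4"
  shows "P * ndens z \<le> 8"
proof -
  have "8 + 4 * z\<^sup>2 + z^4 = 8 * (1 + z\<^sup>2/2 + (z\<^sup>2/2)\<^sup>2/2)" by (simp add: power_divide)
  also have "\<dots> \<le> 8 * exp (z\<^sup>2/2)" by (intro mult_left_mono exp_lower_Taylor_quadratic) auto
  finally have "P * ndens z \<le> (8 * exp (z\<^sup>2/2)) * ndens z"
    using assms ndens_pos [of z] by (intro mult_right_mono) auto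
  also have "\<dots> \<le> (8 * exp (z\<^sup>2/2)) * exp (- z\<^sup>2/2)"
    by (intro mult_left_mono ndens_le_exp) auto
  also have "\<dots> = 8" by (simp flip: exp_add)
  finally show ?thesis .
qed

lemma abs_le_quartic:
  fixes z :: real
  shows "\<bar>z\<bar> \<le> 8 + 4 * z\<^sup>2 + z^4" "\<bar>1 - z\<^sup>2\<bar> \<le> 8 + 4 * z\<^sup>2 + z^4" "\<bar>z\<bar> * \<bar>1 - z\<^sup>2\<bar> \<le> 8 + 4 * z\<^sup>2 + z^4"
proof -
  have a: "0 \<le> (1 - \<bar>z\<bar>)\<^sup>2" "0 \<le> (\<bar>z\<bar> - z\<^sup>2)\<^sup>2" by auto
  have q: "z^4 = (z\<^sup>2)\<^sup>2" by simp
  have z1: "\<bar>z\<bar> \<le> 1 + z\<^sup>2"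
  proof -
    have "(1 - \<bar>z\<bar>)\<^sup>2 = 1 - 2 * \<bar>z\<bar> + z\<^sup>2" by (simp add: power2_diff)
    then show ?thesis using a(1) by (smt (verit) zero_le_power2)
  qed
  have z3: "\<bar>z\<bar> * z\<^sup>2 \<le> z\<^sup>2 + z^4"
    using mult_right_mono [OF z1, of "z\<^sup>2"] by (simp add: distrib_right q power2_eq_square)
  show "\<bar>z\<bar> \<le> 8 + 4 * z\<^sup>2 + z^4" using z1 zero_le_power2 [of "z\<^sup>2"] zero_le_power2 [of z] unfolding q by linarith
  show "\<bar>1 - z\<^sup>2\<bar> \<le> 8 + 4 * z\<^sup>2 + z^4" by (smt (verit) zero_le_power2 q)
  have "\<bar>1 - z\<^sup>2\<bar> \<le> 1 + z\<^sup>2" by (smt (verit) zero_le_power2)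
  then have "\<bar>z\<bar> * \<bar>1 - z\<^sup>2\<bar> \<le> \<bar>z\<bar> * (1 + z\<^sup>2)" by (intro mult_left_mono) auto
  also have "\<dots> \<le> 8 + 4 * z\<^sup>2 + z^4" using z1 z3 zero_le_power2 [of "z\<^sup>2"] zero_le_power2 [of z] unfolding q distrib_left by linarith
  finally show "\<bar>z\<bar> * \<bar>1 - z\<^sup>2\<bar> \<le> 8 + 4 * z\<^sup>2 + z^4" .
qed

section \<open>A single coin against the heat flow\<close>

text \<open>Minus the derivative of the normal density. It governs both sides of the heat equation:
  the second derivative of \<open>Phi\<close> in space, and the change of
  \<open>Phi (x / sqrt t)\<close> in \<open>t\<close>.\<close>

definition zdens :: "real \<Rightarrow> real" where "zdens z = z * ndens z"

lemma zdens_deriv: "(zdens has_real_derivative (1 - z\<^sup>2) * ndens z) (at z)"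
proof -
  have "((\<lambda>z. z * ndens z) has_real_derivative 1 * ndens z + - (z * ndens z) * z) (at z)"
    by (rule DERIV_mult' [THEN DERIV_cong]) (auto intro: ndens_deriv DERIV_ident)
  then show ?thesis unfolding zdens_def [abs_def] by (simp add: algebra_simps power2_eq_square)
qed

lemma abs_ndens_mult: "\<bar>a * ndens z\<bar> = \<bar>a\<bar> * ndens z"
  using ndens_pos [of z] by (simp add: abs_mult)

lemma zdens_bound: "\<bar>zdens z\<bar> \<le> 8"
  unfolding zdens_def abs_ndens_mult by (intro ndens_poly_bound abs_le_quartic)

lemma zdens_lipschitz: "\<bar>zdens x - zdens y\<bar> \<le> 8 * \<bar>x - y\<bar>"
proof (induction x y rule: linorder_wlog)
  case (le x y)
  show ?case
  proof (cases "x = y")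
    case False
    then obtain z where "zdens y - zdens x = (y - x) * ((1 - z\<^sup>2) * ndens z)"
      using MVT2 [of x y zdens "\<lambda>z. (1 - z\<^sup>2) * ndens z"] le zdens_deriv by auto
    moreover have "\<bar>(1 - z\<^sup>2) * ndens z\<bar> \<le> 8"
      unfolding abs_ndens_mult by (intro ndens_poly_bound abs_le_quartic)
    ultimately have "\<bar>zdens y - zdens x\<bar> \<le> \<bar>y - x\<bar> * 8"
      by (simp only: abs_mult) (intro mult_left_mono, auto simp: abs_mult)
    then show ?thesis by (simp add: abs_minus_commute mult.commute)
  qed simp
qed (simp add: abs_minus_commute)

text \<open>A relative change of the argument by \<open>q\<close> costs \<open>O(q)\<close>
  uniformly in its size, because \<open>z\<close> times the derivative of \<open>zdens\<close> is
  still bounded. The plain Lipschitz bound would lose a factor \<open>y\<close>.\<close>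

lemma zdens_shrink:
  assumes "0 \<le> y" "y \<le> x" "x - y \<le> y * q" "0 \<le> q"
  shows "\<bar>zdens x - zdens y\<bar> \<le> 8 * q"
proof (cases "x = y")
  case False
  then obtain z where z: "y < z" "zdens x - zdens y = (x - y) * ((1 - z\<^sup>2) * ndens z)"
    using MVT2 [of y x zdens "\<lambda>z. (1 - z\<^sup>2) * ndens z"] assms zdens_deriv by auto
  have "\<bar>zdens x - zdens y\<bar> = (x - y) * (\<bar>1 - z\<^sup>2\<bar> * ndens z)"
    using z assms ndens_pos [of z] by (simp add: abs_mult)
  also have "\<dots> \<le> (\<bar>z\<bar> * q) * (\<bar>1 - z\<^sup>2\<bar> * ndens z)"
    using z assms ndens_pos [of z] by (intro mult_right_mono order_trans [OF assms(3)]) auto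
  also have "\<dots> = q * ((\<bar>z\<bar> * \<bar>1 - z\<^sup>2\<bar>) * ndens z)" by simp
  also have "\<dots> \<le> q * 8" by (intro mult_left_mono ndens_poly_bound abs_le_quartic assms)
  finally show ?thesis by simp
qed (use assms in auto)

text \<open>The expression is the \<open>r\<close>-derivative of the one-coin error in
  \<open>heat_step_unit\<close>. The mean value theorem turns the first summand into
  \<open>- r * zdens z\<close> with \<open>z\<close> within \<open>r\<close> of \<open>x\<close>, so
  the first order parts cancel. What remains is \<open>r\<close> times differences of
  \<open>zdens\<close> values, each of order \<open>r\<close>.\<close>

lemma heat_step_deriv_bound:
  assumes r: "0 \<le> r" "r \<le> 1"
  shows "\<bar>(ndens (x + r) - ndens (x - r)) / 2 + r * zdens (x / sqrt (1 + r\<^sup>2)) / (1 + r\<^sup>2)\<bar> \<le> 24 * r\<^sup>2"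
proof (cases "r = 0")
  case False
  with r have r0: "0 < r" by simp
  define c where "c = sqrt (1 + r\<^sup>2)"
  define y where "y = x / c"
  have c: "1 \<le> c" "c \<le> 1 + r\<^sup>2" "c * c = 1 + r\<^sup>2"
  proof -
    show "1 \<le> c" "c * c = 1 + r\<^sup>2" unfolding c_def by auto
    then show "c \<le> 1 + r\<^sup>2" using mult_left_mono [of 1 c c] by simp
  qed
  obtain z where z: "x - r < z" "z < x + r" "ndens (x + r) - ndens (x - r) = (2 * r) * - zdens z"
    using MVT2 [of "x - r" "x + r" ndens "\<lambda>z. - zdens z"] ndens_deriv r0 by (auto simp: zdens_def)
  have 1: "\<bar>zdens z - zdens x\<bar> \<le> 8 * r"
    using zdens_lipschitz [of z x] z by (smt (verit))
  have xy: "\<bar>x\<bar> = \<bar>y\<bar> * c" using c by (simp add: y_def abs_divide)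
  have s: "\<bar>zdens \<bar>x\<bar> - zdens \<bar>y\<bar>\<bar> \<le> 8 * r\<^sup>2"
  proof (rule zdens_shrink)
    show "\<bar>y\<bar> \<le> \<bar>x\<bar>" using c xy mult_left_mono [of 1 c "\<bar>y\<bar>"] by simp
    have "\<bar>x\<bar> - \<bar>y\<bar> = \<bar>y\<bar> * (c - 1)" by (simp add: xy algebra_simps)
    also have "\<dots> \<le> \<bar>y\<bar> * r\<^sup>2" using c by (intro mult_left_mono) auto
    finally show "\<bar>x\<bar> - \<bar>y\<bar> \<le> \<bar>y\<bar> * r\<^sup>2" .
  qed auto
  have 2: "\<bar>zdens x - zdens y\<bar> \<le> 8 * r\<^sup>2"
  proof (cases "0 \<le> x")
    case True
    then have "0 \<le> y" using c by (simp add: y_def)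
    then show ?thesis using s True by simp
  next
    case False
    then have "y \<le> 0" using c by (simp add: y_def divide_nonpos_pos)
    then have "\<bar>zdens (-x) - zdens (-y)\<bar> \<le> 8 * r\<^sup>2" using s False by simp
    then show ?thesis by (simp add: zdens_def)
  qed
  have 3: "\<bar>zdens y - zdens y / (1 + r\<^sup>2)\<bar> \<le> 8 * r\<^sup>2"
  proof -
    have p: "0 < 1 + r\<^sup>2" by (simp add: add_pos_nonneg)
    have "zdens y - zdens y / (1 + r\<^sup>2) = zdens y * (r\<^sup>2 / (1 + r\<^sup>2))"
      using p by (simp add: field_simps)
    also have "\<bar>\<dots>\<bar> = \<bar>zdens y\<bar> * (r\<^sup>2 / (1 + r\<^sup>2))" using p by (simp add: abs_mult)
    also have "\<dots> \<le> 8 * (r\<^sup>2 / 1)"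
      using p zdens_bound by (intro mult_mono divide_left_mono) auto
    finally show ?thesis by simp
  qed
  have "r\<^sup>2 \<le> r" using r by (simp add: power2_eq_square mult_left_le)
  then have 4: "\<bar>zdens y / (1 + r\<^sup>2) - zdens z\<bar> \<le> 24 * r" using 1 2 3 by (smt (verit))
  have "(ndens (x + r) - ndens (x - r)) / 2 + r * zdens y / (1 + r\<^sup>2) = r * (zdens y / (1 + r\<^sup>2) - zdens z)"
    unfolding z(3) by (simp add: algebra_simps)
  also have "\<bar>\<dots>\<bar> \<le> r * (24 * r)"
    using r0 4 by (simp only: abs_mult) (intro mult_mono, auto)
  finally show ?thesis by (simp add: y_def c_def power2_eq_square)
qed simp

text \<open>The case of variance 1. The error vanishes at \<open>s = 0\<close> and its derivative is
  \<open>O(s^2)\<close>; for \<open>s > 1\<close> the bound exceeds the trivial bound 1.\<close>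

lemma heat_step_unit:
  assumes s: "0 \<le> s"
  shows "\<bar>(Phi (x + s) + Phi (x - s)) / 2 - Phi (x / sqrt (1 + s\<^sup>2))\<bar> \<le> 24 * s^3"
proof -
  consider "s = 0" | "0 < s" "s \<le> 1" | "1 < s" using s by linarith
  then show ?thesis
  proof cases
    case 2
    define w where "w = (\<lambda>r. (Phi (x + r) + Phi (x - r)) / 2 - Phi (x / sqrt (1 + r\<^sup>2)))"
    define w' where "w' = (\<lambda>r. (ndens (x + r) - ndens (x - r)) / 2 + r * zdens (x / sqrt (1 + r\<^sup>2)) / (1 + r\<^sup>2))"
    have d: "(w has_real_derivative w' r) (at r)" for r
    proof -
      have p: "0 < 1 + r\<^sup>2" by (simp add: add_pos_nonneg)
      have q: "sqrt (1 + r\<^sup>2) * sqrt (1 + r\<^sup>2) = 1 + r\<^sup>2" using p by simp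
      have a: "((\<lambda>r. Phi (x + r)) has_real_derivative ndens (x + r) * 1) (at r)"
        by (rule DERIV_chain2 [OF Phi_deriv]) (auto intro!: derivative_eq_intros)
      have b: "((\<lambda>r. Phi (x - r)) has_real_derivative ndens (x - r) * (-1)) (at r)"
        by (rule DERIV_chain2 [OF Phi_deriv]) (auto intro!: derivative_eq_intros)
      have "((\<lambda>r. sqrt (1 + r\<^sup>2)) has_real_derivative r / sqrt (1 + r\<^sup>2)) (at r)"
        using p by (auto intro!: derivative_eq_intros simp: field_simps)
      then have "((\<lambda>r. x / sqrt (1 + r\<^sup>2)) has_real_derivative
          (0 * sqrt (1 + r\<^sup>2) - x * (r / sqrt (1 + r\<^sup>2))) / (sqrt (1 + r\<^sup>2) * sqrt (1 + r\<^sup>2))) (at r)"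
        using p by (intro DERIV_divide) auto
      then have c: "((\<lambda>r. Phi (x / sqrt (1 + r\<^sup>2))) has_real_derivative
          ndens (x / sqrt (1 + r\<^sup>2)) * (- (r * (x / sqrt (1 + r\<^sup>2)) / (1 + r\<^sup>2)))) (at r)"
        by (intro DERIV_chain2 [OF Phi_deriv]) (simp add: q mult.commute)
      show ?thesis unfolding w_def w'_def
        by (rule DERIV_cong [OF DERIV_diff [OF DERIV_cdivide [OF DERIV_add [OF a b], of 2] c]])
           (simp add: zdens_def mult_ac)
    qed
    obtain z where z: "0 < z" "z < s" "w s - w 0 = (s - 0) * w' z"
      using MVT2 [of 0 s w w'] 2 d by auto
    have "\<bar>w s\<bar> = s * \<bar>w' z\<bar>"
      using z 2 by (simp add: w_def abs_mult)
    also have "\<dots> \<le> s * (24 * z\<^sup>2)"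
      unfolding w'_def using z 2 by (intro mult_left_mono heat_step_deriv_bound) auto
    also have "\<dots> \<le> s * (24 * s\<^sup>2)"
      using z 2 by (intro mult_left_mono power_mono) auto
    finally show ?thesis by (simp add: w_def power3_eq_cube power2_eq_square)
  next
    case 3
    have "\<bar>(Phi (x + s) + Phi (x - s)) / 2 - Phi (x / sqrt (1 + s\<^sup>2))\<bar> \<le> 1"
      using Phi_nonneg [of "x+s"] Phi_nonneg [of "x-s"] Phi_nonneg [of "x / sqrt (1 + s\<^sup>2)"]
        Phi_le_1 [of "x+s"] Phi_le_1 [of "x-s"] Phi_le_1 [of "x / sqrt (1 + s\<^sup>2)"] by argo
    moreover have "1 \<le> s^3" using 3 by simp
    ultimately show ?thesis by linarith
  qed simp
qed

text \<open>One Lindeberg step: \<open>(x, t) \<mapsto> Phi (x / sqrt t)\<close> solves the heat equation, so averaging over a coin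
  of size \<open>s\<close> acts like raising the variance \<open>t\<close> by \<open>s\<^sup>2\<close>, up to third order.\<close>

lemma heat_step:
  assumes t: "0 < t"
  shows "\<bar>(Phi ((x + s) / sqrt t) + Phi ((x - s) / sqrt t)) / 2 - Phi (x / sqrt (t + s\<^sup>2))\<bar> \<le> 24 * (\<bar>s\<bar> / sqrt t)^3"
proof -
  have p: "1 + (\<bar>s\<bar> / sqrt t)\<^sup>2 = (t + s\<^sup>2) / t" using t by (simp add: power_divide field_simps)
  have e: "x / sqrt t / sqrt (1 + (\<bar>s\<bar> / sqrt t)\<^sup>2) = x / sqrt (t + s\<^sup>2)"
    unfolding p using t by (simp add: real_sqrt_divide)
  have "\<bar>(Phi (x / sqrt t + \<bar>s\<bar> / sqrt t) + Phi (x / sqrt t - \<bar>s\<bar> / sqrt t)) / 2 - Phi (x / sqrt (t + s\<^sup>2))\<bar> \<le> 24 * (\<bar>s\<bar> / sqrt t)^3"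
    using heat_step_unit [of "\<bar>s\<bar> / sqrt t" "x / sqrt t"] t unfolding e by simp
  then show ?thesis by (cases "0 \<le> s") (simp_all add: add_divide_distrib diff_divide_distrib add.commute)
qed

section \<open>Sums of fair signs\<close>

text \<open>The expectation of \<open>f\<close> at a sum of \<open>n\<close> independent fair signs,
  \<open>A\<close> being the set of heads. Counting subsets keeps this part free of any probability
  space.\<close>

definition coin_avg :: "nat \<Rightarrow> (real \<Rightarrow> real) \<Rightarrow> real" where
  "coin_avg n f = (\<Sum>A\<in>Pow {..<n}. f (2 * real (card A) - real n)) / 2^n"

lemma coin_avg_0: "coin_avg 0 f = f 0"
  by (simp add: coin_avg_def)

lemma coin_avg_Suc: "coin_avg (Suc n) f = (coin_avg n (\<lambda>w. f (w + 1)) + coin_avg n (\<lambda>w. f (w - 1))) / 2"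
proof -
  have inj: "inj_on (insert n) (Pow {..<n})" by (auto simp: inj_on_def)
  have "(\<Sum>A\<in>Pow {..<Suc n}. f (2 * real (card A) - real (Suc n))) =
     (\<Sum>A\<in>Pow {..<n}. f (2 * real (card A) - real (Suc n))) + (\<Sum>A\<in>insert n ` Pow {..<n}. f (2 * real (card A) - real (Suc n)))"
    unfolding lessThan_Suc Pow_insert by (rule sum.union_disjoint) auto
  also have "(\<Sum>A\<in>insert n ` Pow {..<n}. f (2 * real (card A) - real (Suc n))) = (\<Sum>A\<in>Pow {..<n}. f (2 * real (card A) - real n + 1))"
    unfolding sum.reindex [OF inj] o_def
  proof (intro sum.cong refl)
    fix A assume "A \<in> Pow {..<n}"
    then have "card (insert n A) = Suc (card A)"
      by (subst card_insert_disjoint) (auto intro: finite_subset)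
    then show "f (2 * real (card (insert n A)) - real (Suc n)) = f (2 * real (card A) - real n + 1)"
      by (simp add: algebra_simps)
  qed
  finally show ?thesis
    by (simp add: coin_avg_def add_divide_distrib algebra_simps)
qed

text \<open>The signs are replaced one by one by Gaussian variance \<open>s^2\<close>. The variance
  never drops below its initial value \<open>t\<close>, so every \<open>heat_step\<close> costs at
  most what it costs at \<open>t\<close>.\<close>

lemma coin_avg_Phi:
  assumes t: "0 < t"
  shows "\<bar>coin_avg n (\<lambda>w. Phi ((x + s * w) / sqrt t)) - Phi (x / sqrt (t + real n * s\<^sup>2))\<bar> \<le> real n * (24 * (\<bar>s\<bar> / sqrt t)^3)"
proof (induction n arbitrary: x)
  case (Suc n)
  let ?e = "24 * (\<bar>s\<bar> / sqrt t)^3"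
  let ?a = "\<lambda>x. coin_avg n (\<lambda>w. Phi ((x + s * w) / sqrt t))"
  let ?p = "\<lambda>x. Phi (x / sqrt (t + real n * s\<^sup>2))"
  have t': "0 < t + real n * s\<^sup>2" "t \<le> t + real n * s\<^sup>2"
  proof -
    have "0 \<le> real n * s\<^sup>2" by simp
    then show "0 < t + real n * s\<^sup>2" "t \<le> t + real n * s\<^sup>2" using t by linarith+
  qed
  have "coin_avg (Suc n) (\<lambda>w. Phi ((x + s * w) / sqrt t)) = (?a (x + s) + ?a (x - s)) / 2"
    unfolding coin_avg_Suc by (simp add: algebra_simps)
  moreover have "\<bar>(?p (x + s) + ?p (x - s)) / 2 - Phi (x / sqrt (t + real (Suc n) * s\<^sup>2))\<bar> \<le> 24 * (\<bar>s\<bar> / sqrt (t + real n * s\<^sup>2))^3"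
    using heat_step [OF t'(1), of x s] by (simp add: algebra_simps)
  moreover have "24 * (\<bar>s\<bar> / sqrt (t + real n * s\<^sup>2))^3 \<le> ?e"
    by (intro mult_left_mono power_mono divide_left_mono mult_pos_pos) (simp_all add: t t' less_imp_le)
  moreover have "\<bar>?a (x + s) - ?p (x + s)\<bar> \<le> real n * ?e" "\<bar>?a (x - s) - ?p (x - s)\<bar> \<le> real n * ?e"
    by (rule Suc.IH)+
  moreover have "real (Suc n) * ?e = real n * ?e + ?e" by (simp add: algebra_simps)
  ultimately show ?case by argo
qed (simp add: coin_avg_0)

definition coin_frac :: "nat \<Rightarrow> (real \<Rightarrow> bool) \<Rightarrow> real" where
  "coin_frac n P = real (card {A \<in> Pow {..<n}. P (2 * real (card A) - real n)}) / 2^n"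

text \<open>\<open>Phi\<close> at scale \<open>d\<close> smooths the indicator; \<open>1 - Phi R\<close> is the price of shifting it by \<open>R * d\<close>.\<close>

lemma coin_frac_bound:
  assumes n: "0 < n" and d: "0 < d" and sg: "\<bar>sg\<bar> = 1"
  shows "coin_frac n (\<lambda>w. 0 \<le> b + sg * w / sqrt n) \<le>
    Phi ((R * d + b) / sqrt (1 + d\<^sup>2)) + 24 / (sqrt n * d^3) + (1 - Phi R)"
proof -
  let ?s = "sg / sqrt n"
  let ?f = "\<lambda>w. Phi ((R * d + b + ?s * w) / sqrt (d\<^sup>2))"
  have e: "real n * (24 * (\<bar>?s\<bar> / sqrt (d\<^sup>2))^3) = 24 / (sqrt n * d^3)"
  proof -
    define q where "q = sqrt n"
    have q: "0 < q" "real n = q * q" using n by (auto simp: q_def)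
    have "\<bar>?s\<bar> / sqrt (d\<^sup>2) = 1 / (q * d)"
      using d sg q(1) by (simp add: abs_divide flip: q_def)
    then have "real n * (24 * (\<bar>?s\<bar> / sqrt (d\<^sup>2))^3) = q * q * (24 * (1 / (q * d))^3)"
      by (simp only: q(2))
    also have "\<dots> = 24 / (q * d^3)"
      using q(1) d by (simp add: field_simps power3_eq_cube)
    finally show ?thesis by (simp add: q_def)
  qed
  have "sg\<^sup>2 = 1" using power2_abs [of sg] unfolding sg by simp
  moreover have "real n * ?s\<^sup>2 = sg\<^sup>2" using n by (simp add: power_divide)
  ultimately have sn: "real n * ?s\<^sup>2 = 1" by (rule trans [rotated])
  have "coin_avg n ?f \<le> Phi ((R * d + b) / sqrt (1 + d\<^sup>2)) + 24 / (sqrt n * d^3)"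
    using coin_avg_Phi [of "d\<^sup>2" n "R * d + b" ?s] d unfolding e sn by (simp add: abs_le_iff add.commute [of _ 1])
  \<comment> \<open>On the sets counted by the fraction the argument of \<open>Phi\<close> is at
    least \<open>R\<close>, since the shift \<open>R * d\<close> is divided by
    \<open>d\<close>.\<close>
  moreover have "coin_frac n (\<lambda>w. 0 \<le> b + sg * w / sqrt n) * Phi R \<le> coin_avg n ?f"
  proof -
    let ?S = "{A \<in> Pow {..<n}. 0 \<le> b + sg * (2 * real (card A) - real n) / sqrt n}"
    have "real (card ?S) * Phi R = (\<Sum>A\<in>?S. Phi R)" by simp
    also have "\<dots> \<le> (\<Sum>A\<in>?S. ?f (2 * real (card A) - real n))"
      using d by (intro sum_mono Phi_mono) (auto simp: field_simps)
    also have "\<dots> \<le> (\<Sum>A\<in>Pow {..<n}. ?f (2 * real (card A) - real n))"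
      by (intro sum_mono2) (auto simp: Phi_nonneg)
    finally show ?thesis by (simp add: coin_frac_def coin_avg_def divide_right_mono)
  qed
  moreover have "coin_frac n P \<le> 1" "0 \<le> coin_frac n P" for P
  proof -
    have "card {A \<in> Pow {..<n}. P (2 * real (card A) - real n)} \<le> card (Pow {..<n})"
      by (intro card_mono) auto
    then have "card {A \<in> Pow {..<n}. P (2 * real (card A) - real n)} \<le> 2^n"
      by (simp add: card_Pow)
    then have "real (card {A \<in> Pow {..<n}. P (2 * real (card A) - real n)}) \<le> real (2^n)"
      by (rule of_nat_mono)
    then show "coin_frac n P \<le> 1" by (simp add: coin_frac_def)
  qed (simp add: coin_frac_def)
  moreover have "coin_frac n (\<lambda>w. 0 \<le> b + sg * w / sqrt n) * (1 - Phi R) \<le> 1 * (1 - Phi R)"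
    using Phi_le_1 [of R] calculation(3) by (intro mult_right_mono) auto
  ultimately show ?thesis by (simp add: algebra_simps)
qed

text \<open>A lower bound for the slope of \<open>Phi\<close> on a bounded window; it converts
  closeness of distribution functions into closeness of quantiles.\<close>

lemma Phi_gap:
  assumes "\<bar>v\<bar> \<le> T" "0 < r" "r \<le> 1"
  shows "r * ndens (T + 1) \<le> Phi v - Phi (v - r)"
proof -
  obtain z where z: "v - r < z" "z < v" "Phi v - Phi (v - r) = r * ndens z"
    using MVT2 [of "v - r" v Phi ndens] assms Phi_deriv by auto
  have "\<bar>z\<bar> \<le> T + 1" using z assms by linarith
  then have "z\<^sup>2 \<le> (T + 1)\<^sup>2" by (simp add: abs_le_square_iff [symmetric])
  then have "exp (- (T+1)\<^sup>2 / 2) \<le> exp (- z\<^sup>2 / 2)" by simp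
  then have "ndens (T + 1) \<le> ndens z"
    unfolding std_normal_density_def by (intro mult_left_mono) auto
  then show ?thesis unfolding z(3) using assms by (intro mult_left_mono) auto
qed

text \<open>If \<open>X < v - rho\<close>, then the shift \<open>R * d\<close> and the division by
  \<open>sqrt (1 + d^2)\<close> use up at most three quarters of \<open>rho\<close>. The remaining
  gap \<open>rho / 4\<close> already changes \<open>Phi\<close> by more than
  \<open>e\<close>.\<close>

lemma quantile_coupling_one_sided:
  assumes d: "0 < d" "d \<le> 1" and R: "0 \<le> R" and T: "0 \<le> T" "\<bar>v\<bar> \<le> T"
    and rho: "0 < rho" "rho \<le> 4" "(T + R) * d \<le> rho / 4"
    and gap: "e < rho / 4 * ndens (T + 1)"
    and q: "Phi v \<le> Phi ((R * d + X) / sqrt (1 + d\<^sup>2)) + e"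
  shows "v - rho \<le> X"
proof (rule ccontr)
  assume "\<not> v - rho \<le> X"
  then have X: "X < v - rho" by simp
  define c where "c = sqrt (1 + d\<^sup>2)"
  have c: "1 \<le> c" "c \<le> 1 + d" "c \<le> 2"
    using d unfolding c_def by (auto intro!: real_le_lsqrt simp: power2_eq_square algebra_simps)
      (smt (verit) mult_left_le)
  have Rd: "R * d \<le> rho / 4" "T * d \<le> rho / 4" using rho(3) T R d by (auto simp: distrib_right intro: order_trans [rotated])
  have "v - v * c \<le> T * d"
  proof -
    have "v - v * c = - v * (c - 1)" by (simp add: algebra_simps)
    also have "\<dots> \<le> T * d" using T c d by (intro mult_mono) auto
    finally show ?thesis .
  qed
  then have "R * d + X \<le> (v - rho / 4) * c"
  proof -
    have "rho / 4 * c \<le> rho / 4 * 2" using c rho by (intro mult_left_mono) auto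
    then show ?thesis using X Rd \<open>v - v * c \<le> T * d\<close> unfolding left_diff_distrib by linarith
  qed
  then have "(R * d + X) / c \<le> v - rho / 4" using c by (simp add: divide_le_eq)
  then have "Phi ((R * d + X) / c) \<le> Phi (v - rho / 4)" by (rule Phi_mono)
  then show False using Phi_gap [of v T "rho / 4"] T rho gap q by (simp add: c_def)
qed

text \<open>The two hypotheses on \<open>Phi v\<close> say that \<open>v\<close> is a normal quantile matched to the value \<open>w\<close> of the sum of
  \<open>n\<close> signs. The rate is far from optimal, but any negative power of \<open>n\<close> is enough here.\<close>

theorem quantile_coupling:
  "\<forall>\<^sub>F n in sequentially. \<forall>w v. \<bar>v\<bar> \<le> sqrt (ln (real n) / 128) \<longrightarrow>
     coin_frac n (\<lambda>w'. w' < w) \<le> Phi v \<longrightarrow> Phi v \<le> coin_frac n (\<lambda>w'. w' \<le> w) \<longrightarrow>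
     \<bar>w / sqrt (real n) - v\<bar> \<le> real n powr (-1/64)"
proof -
  \<comment> \<open>Smoothing at scale \<open>d\<close> costs about \<open>n powr (-5/16)\<close>
    and a negligible Gaussian tail, while the gap to be beaten is about \<open>rho\<close> times the
    density at \<open>T\<close>, that is \<open>n powr (-3/128)\<close>. The shift
    \<open>(T + R) * d\<close> is about \<open>n powr (-1/32)\<close>, of smaller order than
    \<open>rho\<close>.\<close>
  define d where "d = (\<lambda>n::nat. real n powr (-1/16))"
  define R where "R = (\<lambda>n::nat. real n powr (1/32))"
  define T where "T = (\<lambda>n::nat. sqrt (ln (real n) / 128))"
  define rho where "rho = (\<lambda>n::nat. real n powr (-1/64))"
  have 1: "\<forall>\<^sub>F n in sequentially. (T n + R n) * d n \<le> rho n / 4"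
    unfolding T_def R_def d_def rho_def by real_asymp
  have 2: "\<forall>\<^sub>F n in sequentially. 24 / (sqrt (real n) * d n^3) + exp (- (R n)\<^sup>2 / 2) < rho n / 4 * (1 / 3 * exp (- (ln (real n) / 128) - 1))"
    unfolding R_def d_def rho_def by real_asymp
  show ?thesis
    using 1 2 eventually_gt_at_top [of 1]
  proof eventually_elim
    case (elim n)
    have n: "0 < n" "1 < real n" using elim by auto
    have d: "0 < d n" "d n \<le> 1" and rho: "0 < rho n" "rho n \<le> 4" and R: "0 \<le> R n" and T: "0 \<le> T n"
    proof -
      have "real n powr a \<le> 1" if "a \<le> 0" for a
        using powr_mono [of a 0 "real n"] n that by simp
      from this [of "-1/16"] this [of "-1/64"] show "d n \<le> 1" "rho n \<le> 4" unfolding d_def rho_def by simp_all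
    qed (use n in \<open>auto simp: d_def rho_def R_def T_def\<close>)
    define e where "e = 24 / (sqrt (real n) * d n^3) + (1 - Phi (R n))"
    have "1 / 3 * exp (- (ln (real n) / 128) - 1) \<le> ndens (T n + 1)"
    proof -
      have "0 \<le> (T n - 1)\<^sup>2" by simp
      then have "(T n + 1)\<^sup>2 / 2 \<le> (T n)\<^sup>2 + 1" by (simp add: power2_eq_square algebra_simps)
      also have "(T n)\<^sup>2 = ln (real n) / 128" using n by (simp add: T_def)
      finally have "exp (- (ln (real n) / 128) - 1) \<le> exp (- (T n + 1)\<^sup>2 / 2)" by simp
      moreover have "sqrt (2 * pi) \<le> 3" using pi_less_4 by (intro real_le_lsqrt) auto
      then have "1 / 3 \<le> 1 / sqrt (2 * pi)" by (intro divide_left_mono) auto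
      ultimately show ?thesis unfolding std_normal_density_def by (intro mult_mono) auto
    qed
    then have "rho n / 4 * (1 / 3 * exp (- (ln (real n) / 128) - 1)) \<le> rho n / 4 * ndens (T n + 1)"
      using rho by (intro mult_left_mono) auto
    then have e: "e < rho n / 4 * ndens (T n + 1)"
      using elim(2) Phi_tail [OF R] unfolding e_def by linarith
    show ?case
    proof (intro allI impI)
      fix w v
      assume v: "\<bar>v\<bar> \<le> sqrt (ln (real n) / 128)" and l: "coin_frac n (\<lambda>w'. w' < w) \<le> Phi v" and u: "Phi v \<le> coin_frac n (\<lambda>w'. w' \<le> w)"
      have v': "\<bar>v\<bar> \<le> T n" "\<bar>- v\<bar> \<le> T n" using v by (simp_all add: T_def)
      have s: "0 < sqrt (real n)" using n by simp
      have eq1: "(\<lambda>w'. w' \<le> w) = (\<lambda>w'. 0 \<le> w / sqrt n + (-1) * w' / sqrt n)"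
        using s by (auto simp: fun_eq_iff field_simps)
      have eq2: "(\<lambda>w'. w \<le> w') = (\<lambda>w'. 0 \<le> - w / sqrt n + 1 * w' / sqrt n)"
        using s by (auto simp: fun_eq_iff field_simps)
      have "Phi v \<le> Phi ((R n * d n + w / sqrt n) / sqrt (1 + (d n)\<^sup>2)) + e"
        using u coin_frac_bound [OF n(1) d(1), of "-1" "w / sqrt n" "R n"] unfolding eq1 e_def by simp
      then have A: "v - rho n \<le> w / sqrt n"
        by (rule quantile_coupling_one_sided [OF d R T v'(1) rho elim(1) e])
      \<comment> \<open>The other inequality is the first one for the reflected pair:
        complementation turns the lower hypothesis on \<open>Phi v\<close> into an upper bound for
        \<open>Phi (- v)\<close>.\<close>
      have "coin_frac n (\<lambda>w'. w' < w) + coin_frac n (\<lambda>w'. w \<le> w') = 1"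
      proof -
        have "card {A \<in> Pow {..<n}. 2 * real (card A) - real n < w} + card {A \<in> Pow {..<n}. w \<le> 2 * real (card A) - real n} = card (Pow {..<n})"
          by (subst card_Un_disjoint [symmetric]) (auto intro!: arg_cong [where f = card])
        then have "real (card {A \<in> Pow {..<n}. 2 * real (card A) - real n < w}) + real (card {A \<in> Pow {..<n}. w \<le> 2 * real (card A) - real n}) = 2^n"
          by (simp add: card_Pow flip: of_nat_add)
        then show ?thesis by (simp add: coin_frac_def flip: add_divide_distrib)
      qed
      then have "Phi (- v) \<le> coin_frac n (\<lambda>w'. w \<le> w')"
        using l by (simp add: Phi_minus)
      then have "Phi (- v) \<le> Phi ((R n * d n + - w / sqrt n) / sqrt (1 + (d n)\<^sup>2)) + e"
        using coin_frac_bound [OF n(1) d(1), of 1 "- w / sqrt n" "R n"] unfolding eq2 e_def by simp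
      then have "- v - rho n \<le> - w / sqrt n"
        by (rule quantile_coupling_one_sided [OF d R T v'(2) rho elim(1) e])
      with A show "\<bar>w / sqrt (real n) - v\<bar> \<le> real n powr (-1/64)"
        by (simp add: rho_def abs_le_iff)
    qed
  qed
qed

text \<open>Elements are ranked in the order of \<open>f\<close>, with ties broken arbitrarily. With
  \<open>f = card\<close> on sets of heads this makes the coin sum a monotone function of the
  rank.\<close>

lemma exists_monotone_ranking:
  fixes f :: "'a \<Rightarrow> nat"
  assumes "finite S"
  shows "\<exists>r. bij_betw r S {..<card S} \<and> (\<forall>A\<in>S. \<forall>B\<in>S. f A < f B \<longrightarrow> r A < (r B :: nat))"
  using assms
proof (induction S rule: finite_ranking_induct [of _ _ f])
  case (insert x S)
  note 2 = insert
  show ?case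
  proof (cases "x \<in> S")
    case True
    then show ?thesis using 2 by (simp add: insert_absorb)
  next
    case False
    from 2 obtain r where r: "bij_betw r S {..<card S}" "\<And>A B. A \<in> S \<Longrightarrow> B \<in> S \<Longrightarrow> f A < f B \<Longrightarrow> r A < r B" by blast
    define r' where "r' = r(x := card S)"
    have b: "bij_betw r' S {..<card S}"
      using r(1) False by (subst bij_betw_cong [of _ _ r]) (auto simp: r'_def)
    have lt: "r A < card S" if "A \<in> S" for A
      using r(1) that by (auto simp: bij_betw_def)
    have "bij_betw r' (insert x S) (insert (card S) {..<card S})"
      using bij_betw_combine [OF b, of "{x}" "{card S}"] by (simp add: r'_def bij_betw_singletonI)
    moreover have "r' A < r' B" if "A \<in> insert x S" "B \<in> insert x S" "f A < f B" for A B
      using that r(2) [of A B] lt [of A] 2(2) [of B] False by (auto simp: r'_def)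
    ultimately show ?thesis using 2(1) False by (intro exI [of _ r']) (auto simp: lessThan_Suc)
  qed
qed (simp add: bij_betw_def)

section \<open>Schauder series\<close>

definition hat :: "real \<Rightarrow> real" where
  "hat z = max 0 (1/2 - \<bar>z - 1/2\<bar>)"

text \<open>The antiderivative of the Haar function of the cell \<open>r\<close> on level
  \<open>p\<close>, normalised in the square mean. With this scaling independent standard
  coefficients produce a Brownian bridge.\<close>

definition tent :: "nat \<Rightarrow> nat \<Rightarrow> real \<Rightarrow> real" where
  "tent p r y = hat (2^p * y - real r) / sqrt 2 ^ p"

definition level_sum :: "(nat \<Rightarrow> real) \<Rightarrow> nat \<Rightarrow> real \<Rightarrow> real" where
  "level_sum c p y = (\<Sum>r<2^p. c r * tent p r y)"

definition schauder :: "(nat \<Rightarrow> nat \<Rightarrow> real) \<Rightarrow> real \<Rightarrow> real" where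
  "schauder c y = (\<Sum>p. level_sum (c p) p y)"

text \<open>The growth \<open>sqrt (p + 1)\<close> is the order of the maximum of \<open>2^p\<close>
  standard Gaussians.\<close>

definition coeff_bound :: "real \<Rightarrow> (nat \<Rightarrow> nat \<Rightarrow> real) \<Rightarrow> bool" where
  "coeff_bound l c \<longleftrightarrow> (\<forall>p r. r < 2^p \<longrightarrow> \<bar>c p r\<bar> \<le> l * sqrt (real (Suc p)))"

text \<open>The sum of \<open>2 * (p + 1) * 2 powr (- p / 4)\<close> over all levels, from the
  derivative of the geometric series.\<close>

definition holder_const :: real where
  "holder_const = 2 / (1 - sqrt (sqrt (1/2)))\<^sup>2"

lemma hat_nonneg: "0 \<le> hat z" and hat_le_half: "hat z \<le> 1/2"
  unfolding hat_def by linarith+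

lemma hat_eq_0: "z \<le> 0 \<or> 1 \<le> z \<Longrightarrow> hat z = 0"
  by (auto simp: hat_def)

lemma hat_lower: "z \<le> 1/2 \<Longrightarrow> 0 \<le> z \<Longrightarrow> hat z = z" and hat_upper: "1/2 \<le> z \<Longrightarrow> z \<le> 1 \<Longrightarrow> hat z = 1 - z"
  by (auto simp: hat_def)

lemma hat_lipschitz: "\<bar>hat z - hat z'\<bar> \<le> \<bar>z - z'\<bar>"
  by (auto simp: hat_def)

lemma hat_off_cell: "r \<noteq> nat \<lfloor>z\<rfloor> \<Longrightarrow> hat (z - real r) = 0"
proof (rule hat_eq_0)
  assume "r \<noteq> nat \<lfloor>z\<rfloor>"
  then show "z - real r \<le> 0 \<or> 1 \<le> z - real r"
    by linarith
qed

lemma tent_off_cell: "r \<noteq> nat \<lfloor>2^p * y\<rfloor> \<Longrightarrow> tent p r y = 0"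
  by (simp add: tent_def hat_off_cell)

lemma tent_nonneg: "0 \<le> tent p r y"
  by (simp add: tent_def hat_nonneg)

lemma tent_le: "tent p r y \<le> 1 / 2 / sqrt 2 ^ p"
  unfolding tent_def by (intro divide_right_mono hat_le_half) auto

lemma tent_lipschitz: "\<bar>tent p r y - tent p r y'\<bar> \<le> sqrt 2 ^ p * \<bar>y - y'\<bar>"
proof -
  have "\<bar>tent p r y - tent p r y'\<bar> = \<bar>hat (2^p * y - real r) - hat (2^p * y' - real r)\<bar> / sqrt 2 ^ p"
    by (simp add: tent_def diff_divide_distrib [symmetric])
  also have "\<dots> \<le> \<bar>(2^p * y - real r) - (2^p * y' - real r)\<bar> / sqrt 2 ^ p"
    by (intro divide_right_mono hat_lipschitz) auto
  also have "\<dots> = 2^p * \<bar>y - y'\<bar> / sqrt 2 ^ p"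
    by (simp add: abs_mult right_diff_distrib [symmetric])
  also have "(2::real)^p = sqrt 2 ^ p * sqrt 2 ^ p"
    by (simp add: power_mult_distrib [symmetric])
  finally show ?thesis by simp
qed

lemma tent_Suc: "tent (Suc p) r y = tent p r (2*y) / sqrt 2"
  and tent_Suc_shift: "tent (Suc p) (r + 2^p) y = tent p r (2*y - 1) / sqrt 2"
  by (simp_all add: tent_def algebra_simps)

lemma tent_outside: "y \<le> 0 \<Longrightarrow> tent p r y = 0" "1 \<le> y \<Longrightarrow> r < 2^p \<Longrightarrow> tent p r y = 0"
proof -
  show "y \<le> 0 \<Longrightarrow> tent p r y = 0"
    unfolding tent_def
    using mult_nonneg_nonpos [of "2^p" y] by (subst hat_eq_0) auto
  assume y: "1 \<le> y" "r < 2^p"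
  then have "real r + 1 \<le> 2^p"
    by (metis Suc_leI add.commute of_nat_Suc of_nat_le_iff of_nat_numeral of_nat_power)
  also have "\<dots> \<le> 2^p * y" using y by simp
  finally show "tent p r y = 0"
    unfolding tent_def by (subst hat_eq_0) auto
qed

lemma level_sum_cell:
  "level_sum c p y = (if nat \<lfloor>2^p * y\<rfloor> < 2^p then c (nat \<lfloor>2^p * y\<rfloor>) * tent p (nat \<lfloor>2^p * y\<rfloor>) y else 0)"
proof -
  have "level_sum c p y = (\<Sum>r\<in>{..<2^p}. if r = nat \<lfloor>2^p * y\<rfloor> then c r * tent p r y else 0)"
    unfolding level_sum_def by (intro sum.cong) (auto simp: tent_off_cell)
  then show ?thesis by (simp add: sum.delta)
qed

lemma level_sum_bound:
  assumes "\<And>r. r < 2^p \<Longrightarrow> \<bar>c r\<bar> \<le> B" "0 \<le> B"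
  shows "\<bar>level_sum c p y\<bar> \<le> B / 2 / sqrt 2 ^ p"
proof -
  have "\<bar>c r * tent p r y\<bar> \<le> B * (1 / 2 / sqrt 2 ^ p)" if "r < 2^p" for r
    unfolding abs_mult using assms that tent_le [of p r y] tent_nonneg [of p r y]
    by (intro mult_mono) auto
  then show ?thesis using assms by (auto simp: level_sum_cell)
qed

text \<open>Tents of one level have disjoint interiors, so at most two of them take different values
  at the two points; hence the factor 2.\<close>

lemma level_sum_lipschitz:
  assumes "\<And>r. r < 2^p \<Longrightarrow> \<bar>c r\<bar> \<le> B" "0 \<le> B"
  shows "\<bar>level_sum c p y - level_sum c p y'\<bar> \<le> 2 * B * sqrt 2 ^ p * \<bar>y - y'\<bar>"
proof -
  let ?S = "{nat \<lfloor>2^p * y\<rfloor>, nat \<lfloor>2^p * y'\<rfloor>} \<inter> {..<2^p}"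
  have "level_sum c p y - level_sum c p y' = (\<Sum>r<2^p. c r * (tent p r y - tent p r y'))"
    by (simp add: level_sum_def sum_subtractf algebra_simps)
  also have "\<dots> = (\<Sum>r\<in>?S. c r * (tent p r y - tent p r y'))"
    by (intro sum.mono_neutral_right) (use tent_off_cell in force)+
  also have "\<bar>\<dots>\<bar> \<le> (\<Sum>r\<in>?S. B * (sqrt 2 ^ p * \<bar>y - y'\<bar>))"
    by (rule order_trans [OF sum_abs], rule sum_mono)
       (auto simp only: abs_mult intro!: mult_mono tent_lipschitz assms)
  also have "\<dots> \<le> 2 * (B * (sqrt 2 ^ p * \<bar>y - y'\<bar>))"
  proof -
    have "card ?S \<le> 2"
      by (rule order_trans [OF card_mono [of "{nat \<lfloor>2^p * y\<rfloor>, nat \<lfloor>2^p * y'\<rfloor>}"]])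
         (auto simp: card_insert_if)
    then show ?thesis using assms by (auto simp only: sum_constant intro!: mult_right_mono) auto
  qed
  finally show ?thesis by (simp add: mult.assoc)
qed

section \<open>Hoelder bounds for Schauder series\<close>

lemma holder_const_sums: "(\<lambda>p. 2 * real (Suc p) * sqrt (sqrt (1/2)) ^ p) sums holder_const"
proof -
  have "norm (sqrt (sqrt (1/2))) < 1" by simp
  from sums_mult [OF geometric_deriv_sums [OF this], of 2] show ?thesis
    by (simp add: holder_const_def mult.assoc [symmetric] distrib_left)
qed

lemma holder_const_pos: "0 < holder_const"
proof -
  have "sqrt (sqrt (1/2)) < 1" by simp
  then show ?thesis unfolding holder_const_def by auto
qed

lemma sqrt_le_self_Suc: "sqrt (real (Suc p)) \<le> real (Suc p)"
  using real_sqrt_le_mono [of "real (Suc p)" "(real (Suc p))\<^sup>2"] by (simp add: power2_eq_square)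

text \<open>Interpolating between the sup bound and the Lipschitz bound of a level gives the exponent \<open>1/4\<close>.\<close>

lemma level_sum_holder:
  assumes "coeff_bound l c" "0 \<le> l"
  shows "\<bar>level_sum (c p) p y - level_sum (c p) p y'\<bar>
    \<le> l * sqrt (sqrt \<bar>y - y'\<bar>) * (2 * real (Suc p) * sqrt (sqrt (1/2)) ^ p)"
proof -
  define B where "B = l * sqrt (real (Suc p))"
  have B: "0 \<le> B" using assms by (simp add: B_def)
  have c: "\<bar>c p r\<bar> \<le> B" if "r < 2^p" for r
    using assms that by (auto simp: coeff_bound_def B_def)
  define d where "d = \<bar>y - y'\<bar>"
  define D where "D = \<bar>level_sum (c p) p y - level_sum (c p) p y'\<bar>"
  define a where "a = 1 / sqrt 2 ^ p"
  define b where "b = 2 * sqrt 2 ^ p * d"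
  have ab: "0 \<le> a" "0 \<le> b" "0 \<le> D" "0 \<le> d" by (auto simp: a_def b_def D_def d_def)
  have D1: "D \<le> B * a"
    using level_sum_bound [of p "c p" B y, OF c B] level_sum_bound [of p "c p" B y', OF c B]
    by (simp add: D_def a_def)
  have D2: "D \<le> B * b"
    using level_sum_lipschitz [of p "c p" B y y', OF c B] by (simp add: D_def b_def d_def mult.assoc mult.left_commute)
  have two: "(2::real)^p = sqrt 2 ^ p * sqrt 2 ^ p"
    by (simp add: power_mult_distrib [symmetric])
  \<comment> \<open>The sup bound is used three times and the Lipschitz bound once. In the fourth
    power the product \<open>2^p\<close> drops to \<open>1 / 2^p\<close>, which leaves the summable
    factor \<open>2 powr (- p / 4)\<close>.\<close>
  have "D ^ 4 = D ^ 3 * D" by (simp add: numeral_eq_Suc)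
  also have "\<dots> \<le> (B * a)^3 * (B * b)"
    using D1 D2 ab B by (intro mult_mono power_mono) auto
  also have "\<dots> = B^4 * (2 * d / 2^p)"
  proof -
    have "a * a = 1 / 2^p" "a * b = 2 * d" by (simp_all add: a_def b_def two)
    then have "a^3 * b = 2 * d / 2^p" by (simp add: power3_eq_cube mult.assoc)
    moreover have "(B * a)^3 * (B * b) = B^4 * (a^3 * b)" by (simp add: power_mult_distrib numeral_eq_Suc)
    ultimately show ?thesis by simp
  qed
  also have "\<dots> \<le> B^4 * (16 * d * (1/2)^p)"
    using ab B by (intro mult_left_mono) (auto simp: power_one_over field_simps)
  also have "\<dots> = (B * (2 * sqrt (sqrt d) * sqrt (sqrt (1/2)) ^ p)) ^ 4"
  proof -
    have q: "sqrt (sqrt x) ^ 4 = x" if "0 \<le> x" for x :: real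
    proof -
      have "sqrt (sqrt x) ^ 4 = ((sqrt (sqrt x))\<^sup>2)\<^sup>2" by (simp flip: power_mult)
      then show ?thesis using that by simp
    qed
    have "(sqrt (sqrt (1/2)) ^ p) ^ 4 = (sqrt (sqrt (1/2)) ^ 4) ^ p"
      by (simp flip: power_mult add: mult.commute)
    also have "\<dots> = (1/2)^p" by (subst q) auto
    finally show ?thesis using ab by (simp add: power_mult_distrib q)
  qed
  finally have "D \<le> B * (2 * sqrt (sqrt d) * sqrt (sqrt (1/2)) ^ p)"
    using B ab by (intro power_le_imp_le_base [of D 3]) (auto simp: numeral_eq_Suc)
  also have "\<dots> \<le> (l * real (Suc p)) * (2 * sqrt (sqrt d) * sqrt (sqrt (1/2)) ^ p)"
    unfolding B_def using assms ab sqrt_le_self_Suc [of p] by (intro mult_right_mono mult_left_mono) auto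
  finally show ?thesis unfolding D_def d_def by (simp only: mult_ac)
qed

lemma level_sum_0 [simp]: "level_sum c p 0 = 0" and level_sum_1 [simp]: "level_sum c p 1 = 0"
  by (simp_all add: level_sum_def tent_outside)

lemma level_sum_summable:
  assumes "coeff_bound l c"
  shows "summable (\<lambda>p. level_sum (c p) p y)"
proof -
  have "coeff_bound \<bar>l\<bar> c" unfolding coeff_bound_def
    by (smt (verit) assms coeff_bound_def mult_right_mono real_sqrt_ge_zero of_nat_0_le_iff)
  note h = level_sum_holder [OF this, of _ y 0, simplified]
  show ?thesis
    by (rule summable_comparison_test' [OF summable_mult [OF sums_summable [OF holder_const_sums], of "\<bar>l\<bar> * sqrt (sqrt \<bar>y\<bar>)"]])
       (use h in auto)
qed

lemma schauder_0 [simp]: "schauder c 0 = 0" and schauder_1 [simp]: "schauder c 1 = 0"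
  by (simp_all add: schauder_def)

lemma suminf_abs_le:
  fixes f g :: "nat \<Rightarrow> real"
  assumes "\<And>n. \<bar>f n\<bar> \<le> g n" "summable g"
  shows "\<bar>suminf f\<bar> \<le> suminf g"
proof -
  have s: "summable (\<lambda>n. \<bar>f n\<bar>)"
    by (rule summable_comparison_test' [OF assms(2)]) (use assms(1) in auto)
  show ?thesis
    using summable_rabs [OF s] suminf_le [OF assms(1) s assms(2)] by linarith
qed

lemma schauder_holder:
  assumes "coeff_bound l c" "0 \<le> l"
  shows "\<bar>schauder c y - schauder c y'\<bar> \<le> holder_const * l * sqrt (sqrt \<bar>y - y'\<bar>)"
proof -
  note s = level_sum_summable [OF assms(1)]
  have sm: "summable (\<lambda>p. l * sqrt (sqrt \<bar>y - y'\<bar>) * (2 * real (Suc p) * sqrt (sqrt (1/2)) ^ p))"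
    by (intro summable_mult sums_summable [OF holder_const_sums])
  have "schauder c y - schauder c y' = (\<Sum>p. level_sum (c p) p y - level_sum (c p) p y')"
    unfolding schauder_def by (rule suminf_diff [OF s s])
  also have "\<bar>\<dots>\<bar> \<le> (\<Sum>p. l * sqrt (sqrt \<bar>y - y'\<bar>) * (2 * real (Suc p) * sqrt (sqrt (1/2)) ^ p))"
    by (rule suminf_abs_le [OF level_sum_holder [OF assms] sm])
  also have "\<dots> = l * sqrt (sqrt \<bar>y - y'\<bar>) * holder_const"
    using sums_unique [OF sums_mult [OF holder_const_sums]] by simp
  finally show ?thesis by (simp add: mult_ac)
qed

lemma schauder_bound:
  assumes "coeff_bound l c" "0 \<le> l" "y \<in> {0..1}"
  shows "\<bar>schauder c y\<bar> \<le> holder_const * l"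
proof -
  have "\<bar>schauder c y\<bar> \<le> holder_const * l * sqrt (sqrt y)"
    using schauder_holder [OF assms(1,2), of y 0] assms(3) by simp
  also have "\<dots> \<le> holder_const * l * 1"
    using assms holder_const_pos by (intro mult_left_mono) auto
  finally show ?thesis by simp
qed

lemma level_sum_sum:
  "level_sum (\<lambda>r. \<Sum>i\<in>I. a i * c i r) p y = (\<Sum>i\<in>I. a i * level_sum (c i) p y)"
  unfolding level_sum_def sum_distrib_left sum_distrib_right
  by (subst sum.swap) (simp add: mult_ac)

lemma schauder_sum:
  assumes "\<And>i. i \<in> I \<Longrightarrow> coeff_bound (l i) (c i)"
  shows "schauder (\<lambda>p r. \<Sum>i\<in>I. a i * c i p r) y = (\<Sum>i\<in>I. a i * schauder (c i) y)"
proof -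
  have s: "summable (\<lambda>p. level_sum (c i p) p y)" if "i \<in> I" for i
    by (rule level_sum_summable [OF assms [OF that]])
  have "schauder (\<lambda>p r. \<Sum>i\<in>I. a i * c i p r) y = (\<Sum>p. \<Sum>i\<in>I. a i * level_sum (c i p) p y)"
    unfolding schauder_def by (simp add: level_sum_sum)
  also have "\<dots> = (\<Sum>i\<in>I. \<Sum>p. a i * level_sum (c i p) p y)"
    by (rule suminf_sum) (rule summable_mult [OF s])
  also have "\<dots> = (\<Sum>i\<in>I. a i * schauder (c i) y)"
    unfolding schauder_def by (intro sum.cong refl suminf_mult s)
  finally show ?thesis .
qed

lemma schauder_diff:
  assumes "coeff_bound l c" "coeff_bound l' c'"
  shows "schauder (\<lambda>p r. c p r - c' p r) y = schauder c y - schauder c' y"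
proof -
  have "schauder (\<lambda>p r. c p r - c' p r) y = (\<Sum>p. level_sum (c p) p y - level_sum (c' p) p y)"
    unfolding schauder_def by (simp add: level_sum_def sum_subtractf algebra_simps)
  then show ?thesis
    unfolding schauder_def by (simp add: suminf_diff level_sum_summable [OF assms(1)] level_sum_summable [OF assms(2)])
qed

section \<open>Reconstruction of a function on the dyadic grid\<close>

lemma sum_double_power:
  "(\<Sum>r<2^Suc p. f r) = (\<Sum>r<2^p. f r) + (\<Sum>r<2^p. f (r + 2^p))" for f :: "nat \<Rightarrow> 'a::comm_monoid_add"
proof -
  have "{..<2^Suc p} = {..<2^p} \<union> (\<lambda>r. r + 2^p) ` {..<(2::nat)^p}"
  proof (intro equalityI subsetI)
    fix x :: nat assume x: "x \<in> {..<2^Suc p}"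
    show "x \<in> {..<2^p} \<union> (\<lambda>r. r + 2^p) ` {..<(2::nat)^p}"
    proof (cases "x < 2^p")
      case False
      then show ?thesis using x by (intro UnI2 image_eqI [of _ _ "x - 2^p"]) auto
    qed simp
  qed auto
  then have "(\<Sum>r<2^Suc p. f r) = (\<Sum>r<2^p. f r) + (\<Sum>r\<in>(\<lambda>r. r + 2^p) ` {..<(2::nat)^p}. f r)"
    by (simp only:) (subst sum.union_disjoint, auto)
  then show ?thesis by (simp add: sum.reindex)
qed

text \<open>Induction on \<open>P\<close> by halving the interval: level \<open>p + 1\<close> of
  \<open>f\<close> consists of level \<open>p\<close> of the two rescaled halves, and the factor
  \<open>sqrt 2\<close> of the coefficients cancels the one lost by the tents. The identity is
  purely algebraic, so it applies to the discontinuous empirical process.\<close>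

lemma schauder_interpolation:
  fixes f :: "real \<Rightarrow> real"
  assumes "k \<le> 2^P"
  shows "f (real k / 2^P) = (1 - real k / 2^P) * f 0 + (real k / 2^P) * f 1 +
    (\<Sum>p<P. level_sum (\<lambda>r. sqrt 2 ^ p * (2 * f ((real r + 1/2) / 2^p) - f (real r / 2^p) - f ((real r + 1) / 2^p))) p (real k / 2^P))"
  using assms
proof (induction P arbitrary: f k)
  case 0
  then have "k = 0 \<or> k = 1" by auto
  then show ?case by auto
next
  case (Suc P)
  define y where "y = real k / 2^Suc P"
  define co where "co = (\<lambda>f p r. sqrt 2 ^ p * (2 * f ((real r + 1/2) / 2^p) - f (real r / 2^p) - f ((real r + 1) / 2^p) :: real))"
  define f1 where "f1 = (\<lambda>x. f (x/2))"
  define f2 where "f2 = (\<lambda>x. f ((x+1)/2))"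
  have c1: "co f (Suc p) r = sqrt 2 * co f1 p r" for p r
    by (simp add: co_def f1_def field_simps)
  have c2: "co f (Suc p) (r + 2^p) = sqrt 2 * co f2 p r" for p r
    by (simp add: co_def f2_def add_divide_distrib algebra_simps)
  have block_level: "level_sum (co f (Suc p)) (Suc p) y = level_sum (co f1 p) p (2*y) + level_sum (co f2 p) p (2*y - 1)" for p
    unfolding level_sum_def sum_double_power c2 tent_Suc_shift unfolding c1 tent_Suc
    by (simp add: field_simps)
  have l0: "level_sum (co f 0) 0 y = (2 * f (1/2) - f 0 - f 1) * hat y"
    by (simp add: level_sum_def co_def tent_def)
  have split: "(\<Sum>p<Suc P. level_sum (co f p) p y) =
      (2 * f (1/2) - f 0 - f 1) * hat y + (\<Sum>p<P. level_sum (co f1 p) p (2*y)) + (\<Sum>p<P. level_sum (co f2 p) p (2*y - 1))"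
    by (simp only: sum.lessThan_Suc_shift block_level l0 sum.distrib)
  show ?case
  proof (cases "k \<le> 2^P")
    case True
    have y: "0 \<le> y" "y \<le> 1/2" and y2: "2 * y = real k / 2^P"
      using of_nat_mono [OF True, where 'a=real] by (simp_all add: y_def field_simps)
    have z: "(\<Sum>p<P. level_sum (co f2 p) p (2*y - 1)) = 0"
      unfolding level_sum_def using y by (simp add: tent_outside)
    have "f y = f1 (2*y)" by (simp add: f1_def)
    also have "\<dots> = (1 - 2*y) * f 0 + 2*y * f (1/2) + (\<Sum>p<P. level_sum (co f1 p) p (2*y))"
      using Suc.IH [OF True, of f1] unfolding y2 co_def by (simp add: f1_def)
    also have "\<dots> = (1 - y) * f 0 + y * f 1 + (\<Sum>p<Suc P. level_sum (co f p) p y)"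
      unfolding split z hat_lower [OF y(2,1)] by (simp add: algebra_simps)
    finally show ?thesis unfolding co_def y_def .
  next
    case False
    define k' where "k' = k - 2^P"
    have k': "k' \<le> 2^P" "real k = real k' + 2^P" using False Suc.prems by (auto simp: k'_def)
    have k'': "real k' \<le> 2^P" using of_nat_mono [OF k'(1), where 'a=real] by simp
    have y2: "2 * y - 1 = real k' / 2^P" and y: "1/2 \<le> y" "y \<le> 1"
      using k' k'' by (simp_all add: y_def field_simps)
    have z: "(\<Sum>p<P. level_sum (co f1 p) p (2*y)) = 0"
      unfolding level_sum_def using y by (simp add: tent_outside)
    have "f y = f2 (2*y - 1)" by (simp add: f2_def)
    also have "\<dots> = (1 - (2*y-1)) * f (1/2) + (2*y-1) * f 1 + (\<Sum>p<P. level_sum (co f2 p) p (2*y - 1))"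
      using Suc.IH [OF k'(1), of f2] unfolding y2 co_def by (simp add: f2_def)
    also have "\<dots> = (1 - y) * f 0 + y * f 1 + (\<Sum>p<Suc P. level_sum (co f p) p y)"
      unfolding split z hat_upper [OF y] by (simp add: algebra_simps)
    finally show ?thesis unfolding co_def y_def .
  qed
qed

section \<open>The covariance of the Brownian bridge\<close>

definition tent_cov :: "nat \<Rightarrow> real \<Rightarrow> real \<Rightarrow> real" where
  "tent_cov P y y' = (\<Sum>p<P. \<Sum>r<2^p. tent p r y * tent p r y')"

lemma tent_cov_Suc:
  "tent_cov (Suc P) y y' = hat y * hat y' + tent_cov P (2*y) (2*y') / 2 + tent_cov P (2*y-1) (2*y'-1) / 2"
proof -
  have "(\<Sum>r<2^Suc p. tent (Suc p) r y * tent (Suc p) r y') =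
      (\<Sum>r<2^p. tent p r (2*y) * tent p r (2*y')) / 2 + (\<Sum>r<2^p. tent p r (2*y-1) * tent p r (2*y'-1)) / 2" for p
    unfolding sum_double_power tent_Suc_shift unfolding tent_Suc by (simp add: sum_divide_distrib)
  then have "tent_cov (Suc P) y y' = tent 0 0 y * tent 0 0 y' + (\<Sum>p<P. (\<Sum>r<2^p. tent p r (2*y) * tent p r (2*y')) / 2 + (\<Sum>r<2^p. tent p r (2*y-1) * tent p r (2*y'-1)) / 2)"
    unfolding tent_cov_def sum.lessThan_Suc_shift by simp
  then show ?thesis
    by (simp add: sum.distrib sum_divide_distrib tent_def tent_cov_def)
qed

lemma tent_cov_outside: "y \<le> 0 \<or> 1 \<le> y \<or> y' \<le> 0 \<or> 1 \<le> y' \<Longrightarrow> tent_cov P y y' = 0"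
  unfolding tent_cov_def by (auto intro!: sum.neutral simp: tent_outside)

text \<open>The covariance \<open>min y y' - y * y'\<close> obeys the recursion
  \<open>tent_cov_Suc\<close>: a product of hats plus half of the rescaled covariance if both points
  lie in the same half, and the product of hats alone otherwise. So each level halves the
  error.\<close>

lemma tent_cov_error:
  assumes "y \<in> {0..1}" "y' \<in> {0..1}"
  shows "\<bar>min y y' - y * y' - tent_cov P y y'\<bar> \<le> (1/2)^P"
  using assms
proof (induction P arbitrary: y y')
  case 0
  have "0 \<le> min y y' - y * y'"
    using 0 by (auto simp: min_def intro: mult_left_le mult_left_le_one_le)
  moreover have "min y y' - y * y' \<le> 1" using 0 by (smt (verit) atLeastAtMost_iff mult_nonneg_nonneg)
  ultimately show ?case by (simp add: tent_cov_def)
next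
  case (Suc P)
  consider "y \<le> 1/2" "y' \<le> 1/2" | "1/2 \<le> y" "1/2 \<le> y'" | "y \<le> 1/2" "1/2 \<le> y'" | "1/2 \<le> y" "y' \<le> 1/2"
    by linarith
  then show ?case
  proof cases
    case 1
    then have "tent_cov (Suc P) y y' = y * y' + tent_cov P (2*y) (2*y') / 2"
      using Suc.prems by (simp add: tent_cov_Suc hat_lower tent_cov_outside)
    moreover have "min y y' - y * y' = y * y' + (min (2*y) (2*y') - 2*y * (2*y')) / 2"
      by (auto simp: min_def field_simps)
    moreover have "\<bar>min (2*y) (2*y') - 2*y * (2*y') - tent_cov P (2*y) (2*y')\<bar> \<le> (1/2)^P"
      using 1 Suc.prems by (intro Suc.IH) auto
    ultimately show ?thesis unfolding power_Suc by argo
  next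
    case 2
    then have "tent_cov (Suc P) y y' = (1-y) * (1-y') + tent_cov P (2*y-1) (2*y'-1) / 2"
      using Suc.prems by (simp add: tent_cov_Suc hat_upper tent_cov_outside)
    moreover have "min y y' - y * y' = (1-y) * (1-y') + (min (2*y-1) (2*y'-1) - (2*y-1) * (2*y'-1)) / 2"
      by (auto simp: min_def field_simps)
    moreover have "\<bar>min (2*y-1) (2*y'-1) - (2*y-1) * (2*y'-1) - tent_cov P (2*y-1) (2*y'-1)\<bar> \<le> (1/2)^P"
      using 2 Suc.prems by (intro Suc.IH) auto
    ultimately show ?thesis unfolding power_Suc by argo
  next
    case 3
    then have "tent_cov (Suc P) y y' = y * (1-y')"
      using Suc.prems by (simp add: tent_cov_Suc hat_upper hat_lower tent_cov_outside)
    moreover have "min y y' = y" using 3 by simp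
    ultimately show ?thesis by (simp add: algebra_simps)
  next
    case 4
    then have "tent_cov (Suc P) y y' = (1-y) * y'"
      using Suc.prems by (simp add: tent_cov_Suc hat_upper hat_lower tent_cov_outside)
    moreover have "min y y' = y'" using 4 by simp
    ultimately show ?thesis by (simp add: algebra_simps)
  qed
qed

lemma tent_cov_limit:
  assumes "y \<in> {0..1}" "y' \<in> {0..1}"
  shows "(\<lambda>P. tent_cov P y y') \<longlonglongrightarrow> min y y' - y * y'"
proof -
  have "(\<lambda>P. (1/2::real)^P) \<longlonglongrightarrow> 0" by (simp add: LIMSEQ_power_zero)
  moreover have "\<forall>\<^sub>F P in sequentially. norm (min y y' - y * y' - tent_cov P y y') \<le> (1/2::real)^P"
    using tent_cov_error [OF assms] by (simp add: real_norm_def)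
  ultimately have "(\<lambda>P. min y y' - y * y' - tent_cov P y y') \<longlonglongrightarrow> 0"
    by (rule Lim_null_comparison [rotated])
  then show ?thesis using tendsto_diff [OF tendsto_const, of _ 0 sequentially "min y y' - y * y'"] by fastforce
qed

section \<open>Gaussians and uniform samples from common coins\<close>

definition Phi_inv :: "real \<Rightarrow> real" where
  "Phi_inv u = (if 0 < u \<and> u < 1 then (THE x. Phi x = u) else 0)"

lemma Phi_Phi_inv:
  assumes u: "0 < u" "u < 1"
  shows "Phi (Phi_inv u) = u"
proof -
  obtain a where a: "Phi a < u"
    using order_tendstoD(2) [OF Phi_at_bot u(1)] by (auto simp: eventually_at_bot_linorder)
  obtain b where b: "u < Phi b"
    using order_tendstoD(1) [OF Phi_at_top u(2)] by (auto simp: eventually_at_top_linorder)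
  have "a \<le> b" using a b Phi_less_iff [of a b] by linarith
  then have "\<exists>x. a \<le> x \<and> x \<le> b \<and> Phi x = u"
    using a b by (intro IVT) (auto intro: DERIV_isCont [OF Phi_deriv])
  then obtain x where x: "Phi x = u" by blast
  have "(THE x. Phi x = u) = x"
  proof (rule the_equality [of _ x])
    show "y = x" if "Phi y = u" for y
      using that x Phi_strict_mono [of x y] Phi_strict_mono [of y x] by (cases x y rule: linorder_cases) auto
  qed (rule x)
  then show ?thesis using u x by (simp add: Phi_inv_def)
qed

lemma Phi_inv_le_iff: "0 < u \<Longrightarrow> u < 1 \<Longrightarrow> Phi_inv u \<le> x \<longleftrightarrow> u \<le> Phi x"
  by (metis Phi_Phi_inv Phi_le_iff)

lemma Phi_inv_borel [measurable]: "Phi_inv \<in> borel_measurable borel"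
proof (subst borel_measurable_iff_le, intro allI)
  fix a
  have "{w \<in> space borel. Phi_inv w \<le> a} = ({0<..<1} \<inter> {..Phi a}) \<union> (if 0 \<le> a then - {0<..<1} else {})"
  proof (intro set_eqI)
    fix w
    show "w \<in> {w \<in> space borel. Phi_inv w \<le> a} \<longleftrightarrow> w \<in> ({0<..<1} \<inter> {..Phi a}) \<union> (if 0 \<le> a then - {0<..<1} else {})"
    proof (cases "0 < w \<and> w < 1")
      case False
      then have "Phi_inv w = 0" by (auto simp: Phi_inv_def)
      then show ?thesis using False by auto
    qed (auto simp: Phi_inv_le_iff)
  qed
  then show "{w \<in> space borel. Phi_inv w \<le> a} \<in> sets borel" by (auto split: if_splits)
qed

definition unif :: "real measure" where
  "unif = uniform_measure lborel {0<..<1}"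

definition clamp01 :: "real \<Rightarrow> real" where
  "clamp01 x = max 0 (min 1 x)"

lemma unif_prob_space: "prob_space unif"
  unfolding unif_def by (rule prob_space_uniform_measure) auto

interpretation unif: prob_space unif by (rule unif_prob_space)

lemma sets_unif [measurable_cong, simp]: "sets unif = sets borel" and space_unif [simp]: "space unif = UNIV"
  by (simp_all add: unif_def)

lemma measure_unif: "A \<in> sets borel \<Longrightarrow> measure unif A = measure lborel ({0<..<1} \<inter> A)"
  unfolding unif_def by (subst measure_uniform_measure) auto

lemma measure_unif_atMost: "measure unif {..x} = clamp01 x"
proof -
  consider "x \<le> 0" | "0 < x" "x < 1" | "1 \<le> x" by linarith
  then show ?thesis
  proof cases
    case 1
    then have "{0<..<1} \<inter> {..x} = {}" by auto
    then show ?thesis using 1 by (simp add: measure_unif clamp01_def)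
  next
    case 2
    then have "{0<..<1} \<inter> {..x} = {0<..x}" by auto
    then show ?thesis using 2 by (simp add: measure_unif clamp01_def)
  next
    case 3
    then have "{0<..<1} \<inter> {..x} = {0<..<1}" by auto
    then show ?thesis using 3 by (simp add: measure_unif clamp01_def)
  qed
qed

lemma measure_unif_halves: "measure unif {1/2..} = 1/2" "measure unif {..<1/2} = 1/2"
proof -
  have "{0<..<1} \<inter> {1/2..} = {1/2..<1::real}" "{0<..<1} \<inter> {..<1/2} = {0<..<1/2::real}" by auto
  then show "measure unif {1/2..} = 1/2" "measure unif {..<1/2} = 1/2"
    by (simp_all add: measure_unif)
qed

lemma sum_clamp01: "(\<Sum>k<D. clamp01 (x - real k)) = max 0 (min (real D) x)"
proof (induction D)
  case (Suc D)
  then show ?case by (auto simp: clamp01_def max_def min_def)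
qed simp

text \<open>Choosing one of \<open>D\<close> equal cells with equal probability and a uniform
  position inside it is again uniform. This is used twice, for ranked head sets and for leaves of
  the tree.\<close>

lemma sum_clamp01_scaled:
  assumes "0 < D"
  shows "(\<Sum>k<D. clamp01 (real D * t - real k)) / real D = clamp01 t"
proof -
  have "max 0 (min (real D) (real D * t)) = real D * clamp01 t"
    using assms by (auto simp: clamp01_def max_def min_def mult_le_cancel_left1 zero_le_mult_iff not_le mult_less_0_iff)
  then show ?thesis using assms by (simp add: sum_clamp01)
qed

lemma prod_sum_PiE:
  fixes f :: "'a \<Rightarrow> 'b \<Rightarrow> real"
  assumes "finite I" "\<And>i. i \<in> I \<Longrightarrow> finite (B i)"
  shows "(\<Prod>i\<in>I. \<Sum>b\<in>B i. f i b) = (\<Sum>g\<in>PiE I B. \<Prod>i\<in>I. f i (g i))"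
  using assms
proof (induction I)
  case (insert i I)
  have "(\<Sum>g\<in>PiE (insert i I) B. \<Prod>k\<in>insert i I. f k (g k)) =
      (\<Sum>(b, g)\<in>B i \<times> PiE I B. \<Prod>k\<in>insert i I. f k ((g(i := b)) k))"
    unfolding PiE_insert_eq
    by (subst sum.reindex) (use insert in \<open>auto simp: case_prod_beta o_def intro: inj_combinator\<close>)
  also have "\<dots> = (\<Sum>(b, g)\<in>B i \<times> PiE I B. f i b * (\<Prod>k\<in>I. f k (g k)))"
  proof (intro sum.cong refl, clarsimp)
    fix b g
    have "(\<Prod>k\<in>I. f k (if k = i then b else g k)) = (\<Prod>k\<in>I. f k (g k))"
      using insert by (intro prod.cong) auto
    then show "(\<Prod>k\<in>insert i I. f k (if k = i then b else g k)) = f i b * (\<Prod>k\<in>I. f k (g k))"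
      using insert by simp
  qed
  also have "\<dots> = (\<Sum>b\<in>B i. f i b) * (\<Sum>g\<in>PiE I B. \<Prod>k\<in>I. f k (g k))"
    by (simp add: sum_product sum.cartesian_product)
  finally show ?case using insert by simp
qed simp

section \<open>Ranked head sets and the binary tree\<close>

definition ranking :: "nat \<Rightarrow> nat set \<Rightarrow> nat" where
  "ranking n = (SOME r. bij_betw r (Pow {..<n}) {..<2^n} \<and>
     (\<forall>A\<in>Pow {..<n}. \<forall>B\<in>Pow {..<n}. card A < card B \<longrightarrow> r A < r B))"

lemma ranking_bij: "bij_betw (ranking n) (Pow {..<n}) {..<2^n}"
  and ranking_mono: "A \<subseteq> {..<n} \<Longrightarrow> B \<subseteq> {..<n} \<Longrightarrow> card A < card B \<Longrightarrow> ranking n A < ranking n B"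
proof -
  have "\<exists>r. bij_betw r (Pow {..<n}) {..<2^n} \<and> (\<forall>A\<in>Pow {..<n}. \<forall>B\<in>Pow {..<n}. card A < card B \<longrightarrow> r A < (r B :: nat))"
    using exists_monotone_ranking [of "Pow {..<n}" card] by (simp add: card_Pow)
  from someI_ex [OF this, folded ranking_def]
  show "bij_betw (ranking n) (Pow {..<n}) {..<2^n}"
    "A \<subseteq> {..<n} \<Longrightarrow> B \<subseteq> {..<n} \<Longrightarrow> card A < card B \<Longrightarrow> ranking n A < ranking n B" by auto
qed

lemma ranking_less: "A \<subseteq> {..<n} \<Longrightarrow> ranking n A < 2^n"
  using ranking_bij [of n] by (auto simp: bij_betw_def)

text \<open>All smaller sets precede \<open>A\<close> in the ranking, and everything ranked up to
  \<open>A\<close> is no larger than \<open>A\<close>. Hence \<open>q\<close> lies between the left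
  limit and the value of the distribution function of the coin sum at \<open>w\<close>, as
  \<open>quantile_coupling\<close> demands.\<close>

lemma ranking_coin_frac:
  assumes A: "A \<subseteq> {..<n}" and u: "0 < u" "u < 1"
  defines "w \<equiv> 2 * real (card A) - real n" and "q \<equiv> (real (ranking n A) + u) / 2^n"
  shows "coin_frac n (\<lambda>w'. w' < w) \<le> q" "q \<le> coin_frac n (\<lambda>w'. w' \<le> w)"
proof -
  have inj: "inj_on (ranking n) (Pow {..<n})" using ranking_bij by (auto simp: bij_betw_def)
  have "card {B \<in> Pow {..<n}. card B < card A} \<le> card {..<ranking n A}"
    by (rule card_inj_on_le [of "ranking n"]) (use inj A ranking_mono in \<open>auto intro: inj_on_subset\<close>)
  then have "real (card {B \<in> Pow {..<n}. card B < card A}) \<le> real (ranking n A) + u"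
    using u by simp
  then show "coin_frac n (\<lambda>w'. w' < w) \<le> q"
    unfolding coin_frac_def w_def q_def by (intro divide_right_mono) auto
  have "{..ranking n A} \<subseteq> ranking n ` {B \<in> Pow {..<n}. card B \<le> card A}"
  proof
    fix k assume k: "k \<in> {..ranking n A}"
    then have "k < 2^n" using ranking_less [OF A] by simp
    then obtain B where B: "B \<subseteq> {..<n}" "k = ranking n B"
      using ranking_bij [of n] by (auto simp: bij_betw_def image_iff set_eq_iff)
    have "card B \<le> card A" using ranking_mono [OF A B(1)] k B(2) by force
    then show "k \<in> ranking n ` {B \<in> Pow {..<n}. card B \<le> card A}" using B by auto
  qed
  then have "card {..ranking n A} \<le> card {B \<in> Pow {..<n}. card B \<le> card A}"
    by (rule surj_card_le [rotated]) auto
  then have "real (ranking n A) + u \<le> real (card {B \<in> Pow {..<n}. card B \<le> card A})"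
    using u by (simp add: Suc_le_eq [symmetric])
  then show "q \<le> coin_frac n (\<lambda>w'. w' \<le> w)"
    unfolding coin_frac_def w_def q_def by (intro divide_right_mono) auto
qed

text \<open>\<open>node c p i\<close> is the position of the \<open>i\<close>-th point on level \<open>p\<close>: the \<open>k\<close>-th visitor of the node \<open>(p, r)\<close>
  goes to the left child \<open>2 * r\<close> iff the coin \<open>c p r k\<close> shows heads. Hence the coins of a node are used in
  order, and the numbers of visitors of its children differ by a partial sum of signs.\<close>

primrec node :: "(nat \<Rightarrow> nat \<Rightarrow> nat \<Rightarrow> bool) \<Rightarrow> nat \<Rightarrow> nat \<Rightarrow> nat" where
  "node c 0 = (\<lambda>i. 0)"
| "node c (Suc p) = (\<lambda>i. 2 * node c p i +
     (if c p (node c p i) (card {i'. i' < i \<and> node c p i' = node c p i}) then 0 else 1))"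

lemma node_less: "node c p i < 2^p"
  by (induction p) auto

lemma node_Suc_div2: "node c (Suc p) i div 2 = node c p i"
  by simp

text \<open>A node is a number whose binary digits record the turns, so dividing by a power of two
  yields the ancestor.\<close>

lemma node_div: "node c (p + k) i div 2^k = node c p i"
proof (induction k)
  case (Suc k)
  have "node c (p + Suc k) i div 2^Suc k = (node c (Suc (p + k)) i div 2) div 2^k"
    by (simp add: div_mult2_eq)
  then show ?case using Suc by (simp only: node_Suc_div2)
qed simp

text \<open>Prescribing all leaves \<open>x\<close> fixes all ancestors \<open>y p i\<close> and
  therefore also which coin each point reads. The event becomes a condition on coins at
  deterministic places, although the descent itself reads them adaptively. Heads means left, that is
  an even child.\<close>

lemma node_eq_iff:
  assumes x: "\<And>i. i < m \<Longrightarrow> x i < 2^L"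
  defines "y \<equiv> \<lambda>p i. x i div 2^(L - p)"
  shows "(\<forall>i<m. node c L i = x i) \<longleftrightarrow>
    (\<forall>p<L. \<forall>i<m. c p (y p i) (card {i'. i' < i \<and> y p i' = y p i}) \<longleftrightarrow> even (y (Suc p) i))"
proof
  assume l: "\<forall>i<m. node c L i = x i"
  have n: "node c p i = y p i" if "p \<le> L" "i < m" for p i
    using node_div [of c p "L - p" i] that l by (simp add: y_def)
  show "\<forall>p<L. \<forall>i<m. c p (y p i) (card {i'. i' < i \<and> y p i' = y p i}) \<longleftrightarrow> even (y (Suc p) i)"
  proof (intro allI impI)
    fix p i assume p: "p < L" "i < m"
    have "{i'. i' < i \<and> node c p i' = node c p i} = {i'. i' < i \<and> y p i' = y p i}"
      using p n by auto
    then have "node c (Suc p) i = 2 * y p i + (if c p (y p i) (card {i'. i' < i \<and> y p i' = y p i}) then 0 else 1)"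
      using n [of p i] p by (simp only: node.simps)
    then have "y (Suc p) i = 2 * y p i + (if c p (y p i) (card {i'. i' < i \<and> y p i' = y p i}) then 0 else 1)"
      using n [of "Suc p" i] p by (simp only: Suc_le_eq)
    then show "c p (y p i) (card {i'. i' < i \<and> y p i' = y p i}) \<longleftrightarrow> even (y (Suc p) i)"
      by simp
  qed
next
  assume r: "\<forall>p<L. \<forall>i<m. c p (y p i) (card {i'. i' < i \<and> y p i' = y p i}) \<longleftrightarrow> even (y (Suc p) i)"
  have "\<forall>i<m. node c p i = y p i" if "p \<le> L" for p
    using that
  proof (induction p)
    case 0
    then show ?case using x by (simp add: y_def)
  next
    case (Suc p)
    show ?case
    proof (intro allI impI)
      fix i assume i: "i < m"
      have n: "node c p i' = y p i'" if "i' \<le> i" for i' using Suc i that by auto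
      then have "{i'. i' < i \<and> node c p i' = node c p i} = {i'. i' < i \<and> y p i' = y p i}" by auto
      then have "node c (Suc p) i = 2 * y p i + (if even (y (Suc p) i) then 0 else 1)"
        using r Suc.prems i n by simp
      also have "y p i = y (Suc p) i div 2"
      proof -
        have "L - p = Suc (L - Suc p)" using Suc.prems by simp
        then show ?thesis by (simp add: y_def div_mult2_eq [symmetric] mult.commute)
      qed
      finally show "node c (Suc p) i = y (Suc p) i" by (auto simp: odd_iff_mod_2_eq_one)
    qed
  qed
  from this [of L] show "\<forall>i<m. node c L i = x i" by (simp add: y_def)
qed

text \<open>Two visitors of a node never read the same coin; this makes the coins in
  \<open>node_eq_iff\<close> distinct and hence independent.\<close>

lemma rank_inj:
  fixes y :: "nat \<Rightarrow> 'a"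
  assumes "y i = y k" "card {i'. i' < i \<and> y i' = y i} = card {i'. i' < k \<and> y i' = y k}"
  shows "i = k"
proof (rule ccontr)
  have *: "card {i'. i' < a \<and> y i' = y a} < card {i'. i' < b \<and> y i' = y b}" if "a < b" "y a = y b" for a b
    by (rule psubset_card_mono) (use that in auto)
  assume "i \<noteq> k"
  then show False using *[of i k] *[of k i] assms by (cases "i < k") auto
qed

lemma (in prob_space) indep_vars_reindex:
  assumes "indep_vars M' X I" "inj_on f J" "f ` J \<subseteq> I"
  shows "indep_vars (\<lambda>i. M' (f i)) (\<lambda>i. X (f i)) J"
  unfolding indep_vars_def2
proof (intro conjI ballI indep_setsI)
  fix i assume "i \<in> J"
  then show "X (f i) \<in> M \<rightarrow>\<^sub>M M' (f i)" using assms unfolding indep_vars_def2 by auto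
  then show "{X (f i) -` A \<inter> space M |A. A \<in> sets (M' (f i))} \<subseteq> events" by auto
next
  fix A K assume K: "K \<noteq> {}" "K \<subseteq> J" "finite K" "\<forall>j\<in>K. A j \<in> {X (f j) -` A \<inter> space M |A. A \<in> sets (M' (f j))}"
  then have inj: "inj_on f K" using assms(2) inj_on_subset by blast
  define B where "B = (\<lambda>l. A (the_inv_into K f l))"
  have B: "B (f j) = A j" if "j \<in> K" for j
    using that inj by (simp add: B_def the_inv_into_f_f)
  have "prob (\<Inter>l\<in>f ` K. B l) = (\<Prod>l\<in>f ` K. prob (B l))"
    using assms(1) unfolding indep_vars_def2
  proof (elim conjE, intro indep_setsD [of "\<lambda>i. {X i -` A \<inter> space M |A. A \<in> sets (M' i)}" I])
    show "f ` K \<subseteq> I" using K(2) assms(3) by blast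
    show "\<forall>l\<in>f ` K. B l \<in> {X l -` A \<inter> space M |A. A \<in> sets (M' l)}" using K(4) B by simp
  qed (use K in auto)
  then show "prob (\<Inter>j\<in>K. A j) = (\<Prod>j\<in>K. prob (A j))"
    by (simp add: prod.reindex [OF inj] B)
qed

text \<open>The index lists of the base family \<open>X\<close> carry a tag in front: \<open>0 # e @ [i]\<close> is the \<open>i\<close>-th coin of \<open>e\<close>;
  \<open>[1, j, p, r]\<close> and \<open>[2, j, p, r, q, u]\<close> smooth the coin sums into the Gaussians of block \<open>j\<close>; \<open>[3, j, i]\<close> is
  the position of the sample point \<open>i\<close> of block \<open>j\<close> inside its leaf. The numbers \<open>nc e\<close> of coins (possibly \<open>0\<close>),
  \<open>L j\<close> of tree levels and \<open>m j\<close> of points are parameters.\<close>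

locale uniform_family = prob_space M for M :: "'w measure" +
  fixes X :: "nat list \<Rightarrow> 'w \<Rightarrow> real" and nc :: "nat list \<Rightarrow> nat" and L m :: "nat \<Rightarrow> nat"
  assumes indep: "indep_vars (\<lambda>_. borel) X UNIV"
    and distr_X: "\<And>e. distr M borel (X e) = unif"
    and range_X: "\<And>e \<omega>. \<omega> \<in> space M \<Longrightarrow> 0 < X e \<omega> \<and> X e \<omega> < 1"
begin

section \<open>Coins and the Gaussians built from them\<close>

lemma X_borel [measurable]: "X e \<in> borel_measurable M"
  using indep unfolding indep_vars_def2 by auto

lemma prob_X: "A \<in> sets borel \<Longrightarrow> prob {\<omega> \<in> space M. X e \<omega> \<in> A} = measure unif A"
  unfolding distr_X [of e, symmetric] by (simp add: measure_distr vimage_def Int_def conj_commute)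

lemma prob_base:
  assumes S: "finite S" "inj_on f S" and A: "\<And>s. s \<in> S \<Longrightarrow> A s \<in> sets borel"
  shows "prob {\<omega> \<in> space M. \<forall>s\<in>S. X (f s) \<omega> \<in> A s} = (\<Prod>s\<in>S. measure unif (A s))"
proof (cases "S = {}")
  case False
  have ind: "indep_vars (\<lambda>_. borel) (\<lambda>s. X (f s)) S"
    using indep_vars_reindex [OF indep S(2)] by simp
  have "{\<omega> \<in> space M. \<forall>s\<in>S. X (f s) \<omega> \<in> A s} = (\<Inter>s\<in>S. X (f s) -` A s \<inter> space M)"
    using False by auto
  also have "prob \<dots> = (\<Prod>s\<in>S. prob (X (f s) -` A s \<inter> space M))"
    using False S A by (intro indep_varsD [OF ind]) auto
  also have "\<dots> = (\<Prod>s\<in>S. measure unif (A s))"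
    by (intro prod.cong refl) (simp add: prob_X A vimage_def Int_def conj_commute)
  finally show ?thesis .
qed (simp add: prob_space)

definition coin :: "nat list \<Rightarrow> nat \<Rightarrow> 'w \<Rightarrow> bool" where
  "coin e i \<omega> \<longleftrightarrow> 1/2 \<le> X (0 # e @ [i]) \<omega>"

lemma coin_measurable [measurable]: "Measurable.pred M (coin e i)"
  unfolding coin_def [abs_def] by measurable

definition heads :: "nat list \<Rightarrow> 'w \<Rightarrow> nat set" where
  "heads e \<omega> = {i. i < nc e \<and> coin e i \<omega>}"

text \<open>The set of heads, ranked by size, together with a uniform remainder is again uniform; it determines the
  coin sum monotonically.\<close>

definition quant :: "nat list \<Rightarrow> 'w \<Rightarrow> real" where
  "quant e \<omega> = (real (ranking (nc e) (heads e \<omega>)) + X e \<omega>) / 2 ^ nc e"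

definition gauss :: "nat list \<Rightarrow> 'w \<Rightarrow> real" where
  "gauss e \<omega> = Phi_inv (quant e \<omega>)"

lemma heads_subset: "heads e \<omega> \<subseteq> {..<nc e}"
  by (auto simp: heads_def)

lemma quant_range:
  assumes "\<omega> \<in> space M"
  shows "0 < quant e \<omega>" "quant e \<omega> < 1"
proof -
  have "ranking (nc e) (heads e \<omega>) + 1 \<le> 2 ^ nc e"
    using ranking_less [OF heads_subset, of e \<omega>] by simp
  from of_nat_mono [OF this, where 'a=real]
  have "real (ranking (nc e) (heads e \<omega>)) + 1 \<le> 2 ^ nc e" by simp
  then show "0 < quant e \<omega>" "quant e \<omega> < 1" using range_X [OF assms, of e]
    by (auto simp: quant_def divide_simps intro: add_nonneg_pos)
qed

lemma Phi_gauss: "\<omega> \<in> space M \<Longrightarrow> Phi (gauss e \<omega>) = quant e \<omega>"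
  unfolding gauss_def by (intro Phi_Phi_inv quant_range)

lemma heads_measurable [measurable]: "heads e \<in> measurable M (count_space UNIV)"
proof -
  have "heads e \<in> measurable M (count_space (Pow {..<nc e}))"
  proof (rule measurable_count_space_eq2 [THEN iffD2])
    show "heads e \<in> space M \<rightarrow> Pow {..<nc e} \<and> (\<forall>A\<in>Pow {..<nc e}. heads e -` {A} \<inter> space M \<in> sets M)"
    proof (intro conjI ballI)
      fix A assume "A \<in> Pow {..<nc e}"
      then have "heads e -` {A} \<inter> space M = {\<omega> \<in> space M. \<forall>i<nc e. coin e i \<omega> \<longleftrightarrow> i \<in> A}"
        by (auto simp: heads_def set_eq_iff)
      also have "\<dots> \<in> sets M" by measurable
      finally show "heads e -` {A} \<inter> space M \<in> sets M" .
    qed (use heads_subset in auto)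
  qed auto
  then show ?thesis by (rule measurable_compose) simp
qed

lemma quant_borel [measurable]: "quant e \<in> borel_measurable M"
proof -
  have [measurable]: "(\<lambda>\<omega>. ranking (nc e) (heads e \<omega>)) \<in> measurable M (count_space UNIV)"
    by (rule measurable_compose [OF heads_measurable]) simp
  show ?thesis unfolding quant_def [abs_def] by measurable
qed

lemma gauss_borel [measurable]: "gauss e \<in> borel_measurable M"
  unfolding gauss_def [abs_def] by measurable

text \<open>The condition on \<open>hd e\<close> keeps \<open>X e\<close> apart from the coins,
  whose indices all start with \<open>0\<close>. So the set of heads and the remainder are
  independent.\<close>

lemma prob_heads:
  assumes e: "e \<noteq> []" "hd e \<noteq> 0" and A: "A \<subseteq> {..<nc e}" and B: "B \<in> sets borel"
  shows "prob {\<omega> \<in> space M. heads e \<omega> = A \<and> X e \<omega> \<in> B} = (1/2) ^ nc e * measure unif B"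
proof -
  define n where "n = nc e"
  define f where "f = (\<lambda>s. if s = n then e else 0 # e @ [s])"
  define C where "C = (\<lambda>s. if s = n then B else if s \<in> A then {1/2..} else {..<1/2})"
  have "{\<omega> \<in> space M. heads e \<omega> = A \<and> X e \<omega> \<in> B} = {\<omega> \<in> space M. \<forall>s\<in>{..n}. X (f s) \<omega> \<in> C s}"
  proof (intro Collect_cong conj_cong refl)
    fix \<omega>
    have "heads e \<omega> = A \<longleftrightarrow> (\<forall>i<n. coin e i \<omega> \<longleftrightarrow> i \<in> A)"
      using A by (auto simp: heads_def n_def set_eq_iff)
    also have "\<dots> \<longleftrightarrow> (\<forall>s<n. X (f s) \<omega> \<in> C s)"
      by (auto simp: coin_def f_def C_def not_le)
    finally have "heads e \<omega> = A \<longleftrightarrow> (\<forall>s<n. X (f s) \<omega> \<in> C s)" .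
    then show "heads e \<omega> = A \<and> X e \<omega> \<in> B \<longleftrightarrow> (\<forall>s\<in>{..n}. X (f s) \<omega> \<in> C s)"
    proof -
      have "(\<forall>s\<in>{..n}. P s) \<longleftrightarrow> (\<forall>s<n. P s) \<and> P n" for P :: "nat \<Rightarrow> bool" by (auto simp: le_less)
      from this [of "\<lambda>s. X (f s) \<omega> \<in> C s"] show ?thesis
        using \<open>heads e \<omega> = A \<longleftrightarrow> (\<forall>s<n. X (f s) \<omega> \<in> C s)\<close> by (simp only:) (simp add: f_def C_def)
    qed
  qed
  also have "prob \<dots> = (\<Prod>s\<in>{..n}. measure unif (C s))"
  proof (rule prob_base)
    have ne: "hd e = 0 \<longleftrightarrow> False" using e by simp
    show "inj_on f {..n}"
    proof (rule inj_onI)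
      fix s t assume st: "s \<in> {..n}" "t \<in> {..n}" and eq: "f s = f t"
      have "s = n \<longleftrightarrow> t = n" using arg_cong [OF eq, of hd] by (simp add: f_def ne split: if_splits)
      then show "s = t" using arg_cong [OF eq, of last] by (simp add: f_def split: if_splits)
    qed
  qed (use B in \<open>auto simp: C_def\<close>)
  also have "\<dots> = (\<Prod>s<n. measure unif (C s)) * measure unif B"
    by (simp add: lessThan_Suc_atMost [symmetric] C_def)
  also have "(\<Prod>s<n. measure unif (C s)) = (\<Prod>s<n. 1/2)"
    by (intro prod.cong refl) (auto simp: C_def measure_unif_halves)
  finally show ?thesis by (simp add: n_def)
qed

text \<open>Decompose by the set of heads: each rank below \<open>2 ^ nc e\<close> occurs once, with
  equal probability, and the remainder is uniform inside its cell.\<close>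

lemma prob_quant:
  assumes e: "e \<noteq> []" "hd e \<noteq> 0"
  shows "prob {\<omega> \<in> space M. quant e \<omega> \<le> t} = clamp01 t"
proof -
  define n where "n = nc e"
  have "{\<omega> \<in> space M. quant e \<omega> \<le> t} = (\<Union>A\<in>Pow {..<n}. {\<omega> \<in> space M. heads e \<omega> = A \<and> X e \<omega> \<in> {..2^n * t - real (ranking n A)}})"
    using heads_subset [of e] by (auto simp: quant_def n_def divide_simps algebra_simps)
  also have "prob \<dots> = (\<Sum>A\<in>Pow {..<n}. prob {\<omega> \<in> space M. heads e \<omega> = A \<and> X e \<omega> \<in> {..2^n * t - real (ranking n A)}})"
    by (rule finite_measure_finite_Union) (auto simp: disjoint_family_on_def)
  also have "\<dots> = (\<Sum>A\<in>Pow {..<n}. (1/2)^n * clamp01 (2^n * t - real (ranking n A)))"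
    by (intro sum.cong refl) (subst prob_heads, use e in \<open>auto simp: n_def measure_unif_atMost\<close>)
  also have "\<dots> = (\<Sum>k<2^n. (1/2)^n * clamp01 (2^n * t - real k))"
    by (rule sum.reindex_bij_betw [OF ranking_bij])
  also have "\<dots> = clamp01 t"
    using sum_clamp01_scaled [of "2^n" t] by (simp add: sum_divide_distrib power_one_over)
  finally show ?thesis .
qed

lemma prob_gauss:
  assumes e: "e \<noteq> []" "hd e \<noteq> 0"
  shows "prob {\<omega> \<in> space M. gauss e \<omega> \<le> t} = Phi t"
proof -
  have "{\<omega> \<in> space M. gauss e \<omega> \<le> t} = {\<omega> \<in> space M. quant e \<omega> \<le> Phi t}"
    using quant_range by (auto simp: gauss_def Phi_inv_le_iff)
  then show ?thesis using prob_quant [OF e, of "Phi t"] Phi_nonneg [of t] Phi_le_1 [of t]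
    by (simp add: clamp01_def)
qed

lemma distr_gauss:
  assumes e: "e \<noteq> []" "hd e \<noteq> 0"
  shows "distr M borel (gauss e) = std_normal_distribution"
proof (rule cdf_unique)
  show "real_distribution (distr M borel (gauss e))" by (rule real_distribution_distr) simp
  show "cdf (distr M borel (gauss e)) = cdf std_normal_distribution"
    using prob_gauss [OF e]
    by (auto simp: fun_eq_iff cdf_def measure_distr Phi_def vimage_def Int_def conj_commute)
qed (rule real_dist_normal_dist)

definition gauss_index :: "nat list set" where
  "gauss_index = {e. e \<noteq> [] \<and> hd e \<noteq> 0}"

text \<open>\<open>gauss e\<close> reads only the entries \<open>K e\<close>, namely
  \<open>X e\<close> and the coins of \<open>e\<close>. These index sets are disjoint for different
  \<open>e\<close>, since a coin index contains \<open>e\<close> and starts with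
  \<open>0\<close>.\<close>

lemma indep_gauss: "indep_vars (\<lambda>_. borel) gauss gauss_index"
proof -
  define K where "K = (\<lambda>e. insert e (range (\<lambda>i. 0 # e @ [i :: nat])))"
  have d: "disjoint_family_on K gauss_index"
    by (auto simp: disjoint_family_on_def K_def gauss_index_def)
  have "indep_vars (\<lambda>e. PiM (K e) (\<lambda>_. borel)) (\<lambda>e \<omega>. \<lambda>i\<in>K e. X i \<omega>) gauss_index"
    by (rule indep_vars_restrict [OF indep _ d]) auto
  define H where "H = (\<lambda>e (v :: nat list \<Rightarrow> real). {i. i < nc e \<and> 1/2 \<le> v (0 # e @ [i])})"
  define Y where "Y = (\<lambda>e v. Phi_inv ((real (ranking (nc e) (H e v)) + v e) / 2 ^ nc e))"
  have Hm: "H e \<in> measurable (PiM (K e) (\<lambda>_. borel)) (count_space UNIV)" for e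
  proof -
    have [measurable]: "(\<lambda>v. v (0 # e @ [i])) \<in> borel_measurable (PiM (K e) (\<lambda>_. borel :: real measure))" for i
      by (rule measurable_component_singleton) (auto simp: K_def)
    have "H e \<in> measurable (PiM (K e) (\<lambda>_. borel)) (count_space (Pow {..<nc e}))"
    proof (rule measurable_count_space_eq2 [THEN iffD2])
      show "H e \<in> space (PiM (K e) (\<lambda>_. borel)) \<rightarrow> Pow {..<nc e} \<and> (\<forall>A\<in>Pow {..<nc e}. H e -` {A} \<inter> space (PiM (K e) (\<lambda>_. borel)) \<in> sets (PiM (K e) (\<lambda>_. borel)))"
      proof (intro conjI ballI)
        fix A assume "A \<in> Pow {..<nc e}"
        then have "H e -` {A} \<inter> space (PiM (K e) (\<lambda>_. borel)) = {v \<in> space (PiM (K e) (\<lambda>_. borel)). \<forall>i<nc e. (1/2 \<le> v (0 # e @ [i])) \<longleftrightarrow> i \<in> A}"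
          by (auto simp: H_def set_eq_iff)
        also have "\<dots> \<in> sets (PiM (K e) (\<lambda>_. borel))" by measurable
        finally show "H e -` {A} \<inter> space (PiM (K e) (\<lambda>_. borel)) \<in> sets (PiM (K e) (\<lambda>_. borel))" .
      qed (auto simp: H_def)
    qed auto
    then show ?thesis by (rule measurable_compose) simp
  qed
  have Ym: "Y e \<in> measurable (PiM (K e) (\<lambda>_. borel)) borel" for e
  proof -
    have v: "(\<lambda>v. v e) \<in> borel_measurable (PiM (K e) (\<lambda>_. borel :: real measure))"
      by (rule measurable_component_singleton) (auto simp: K_def)
    have r: "(\<lambda>v. real (ranking (nc e) (H e v))) \<in> borel_measurable (PiM (K e) (\<lambda>_. borel))"
      by (rule measurable_compose [OF Hm]) simp
    have "(\<lambda>v. Phi_inv ((real (ranking (nc e) (H e v)) + v e) / 2 ^ nc e)) \<in> measurable (PiM (K e) (\<lambda>_. borel)) borel"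
      by (rule measurable_compose [OF _ Phi_inv_borel]) (intro borel_measurable_divide borel_measurable_add r v borel_measurable_const)
    then show ?thesis by (simp add: Y_def)
  qed
  have "indep_vars (\<lambda>_. borel) (\<lambda>e \<omega>. Y e (\<lambda>i\<in>K e. X i \<omega>)) gauss_index"
    by (rule indep_vars_compose2 [OF \<open>indep_vars (\<lambda>e. PiM (K e) (\<lambda>_. borel)) (\<lambda>e \<omega>. \<lambda>i\<in>K e. X i \<omega>) gauss_index\<close>]) (rule Ym)
  also have "(\<lambda>e \<omega>. Y e (\<lambda>i\<in>K e. X i \<omega>)) = gauss"
  proof (intro ext)
    fix e \<omega>
    have "H e (\<lambda>i\<in>K e. X i \<omega>) = heads e \<omega>"
      by (auto simp: H_def heads_def coin_def K_def)
    then show "Y e (\<lambda>i\<in>K e. X i \<omega>) = gauss e \<omega>"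
      by (simp add: Y_def gauss_def quant_def K_def)
  qed
  finally show ?thesis .
qed

section \<open>Sample points from the tree\<close>

text \<open>The index \<open>[1, j, p, r]\<close> also belongs to a Gaussian: this sharing is the
  coupling. The number \<open>i\<close> is not limited by \<open>nc\<close>, because a node may have
  more visitors than the number of coins used for its Gaussian.\<close>

definition split_coin :: "nat \<Rightarrow> 'w \<Rightarrow> nat \<Rightarrow> nat \<Rightarrow> nat \<Rightarrow> bool" where
  "split_coin j \<omega> p r i = coin [1, j, p, r] i \<omega>"

definition leaf :: "nat \<times> nat \<Rightarrow> 'w \<Rightarrow> nat" where
  "leaf q \<omega> = node (split_coin (fst q) \<omega>) (L (fst q)) (snd q)"

definition sample :: "nat \<times> nat \<Rightarrow> 'w \<Rightarrow> real" where
  "sample q \<omega> = (real (leaf q \<omega>) + X [3, fst q, snd q] \<omega>) / 2 ^ L (fst q)"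

lemma node_measurable [measurable]: "(\<lambda>\<omega>. node (split_coin j \<omega>) p i) \<in> measurable M (count_space UNIV)"
proof (induction p arbitrary: i)
  case (Suc p)
  note Suc [measurable]
  have card: "(\<lambda>\<omega>. card {i'. i' < i \<and> node (split_coin j \<omega>) p i' = node (split_coin j \<omega>) p i}) \<in> measurable M (count_space UNIV)"
  proof (rule measurable_card)
    fix i'
    have "Measurable.pred M (\<lambda>\<omega>. node (split_coin j \<omega>) p i' = node (split_coin j \<omega>) p i)"
      by (rule measurable_compose_countable [where g = "\<lambda>\<omega>. node (split_coin j \<omega>) p i" and f = "\<lambda>k \<omega>. node (split_coin j \<omega>) p i' = k"]) measurable
    then show "{\<omega> \<in> space M. i' \<in> {i'. i' < i \<and> node (split_coin j \<omega>) p i' = node (split_coin j \<omega>) p i}} \<in> events"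
      by (cases "i' < i") (simp_all add: pred_def)
  qed
  have cm: "Measurable.pred M (\<lambda>\<omega>. split_coin j \<omega> p r k)" for r k
    unfolding split_coin_def by (rule coin_measurable)
  have 1: "Measurable.pred M (\<lambda>\<omega>. split_coin j \<omega> p (node (split_coin j \<omega>) p i) k)" for k
    by (rule measurable_compose_countable [where g = "\<lambda>\<omega>. node (split_coin j \<omega>) p i" and f = "\<lambda>r \<omega>. split_coin j \<omega> p r k"]) (rule cm Suc)+
  have 2: "Measurable.pred M (\<lambda>\<omega>. split_coin j \<omega> p (node (split_coin j \<omega>) p i) (card {i'. i' < i \<and> node (split_coin j \<omega>) p i' = node (split_coin j \<omega>) p i}))"
    by (rule measurable_compose_countable [where f = "\<lambda>k \<omega>. split_coin j \<omega> p (node (split_coin j \<omega>) p i) k"]) (rule 1 card)+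
  have 3: "(\<lambda>\<omega>. if split_coin j \<omega> p (node (split_coin j \<omega>) p i) (card {i'. i' < i \<and> node (split_coin j \<omega>) p i' = node (split_coin j \<omega>) p i}) then 0 else 1 :: nat) \<in> measurable M (count_space UNIV)"
    by (rule measurable_If [OF _ _ 2 [unfolded pred_def]]) auto
  have "(\<lambda>\<omega>. (node (split_coin j \<omega>) p i, if split_coin j \<omega> p (node (split_coin j \<omega>) p i) (card {i'. i' < i \<and> node (split_coin j \<omega>) p i' = node (split_coin j \<omega>) p i}) then 0 else 1 :: nat)) \<in> measurable M (count_space UNIV \<Otimes>\<^sub>M count_space UNIV)"
    by (rule measurable_Pair [OF Suc 3])
  then have "(\<lambda>\<omega>. (node (split_coin j \<omega>) p i, if split_coin j \<omega> p (node (split_coin j \<omega>) p i) (card {i'. i' < i \<and> node (split_coin j \<omega>) p i' = node (split_coin j \<omega>) p i}) then 0 else 1 :: nat)) \<in> measurable M (count_space UNIV)"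
    by (simp add: pair_measure_countable)
  from measurable_compose [OF this, of "\<lambda>(a, b). 2 * a + b" "count_space UNIV"] show ?case
    by simp
qed simp

lemma leaf_measurable [measurable]: "leaf q \<in> measurable M (count_space UNIV)"
  unfolding leaf_def [abs_def] by measurable

lemma sample_borel [measurable]: "sample q \<in> borel_measurable M"
  unfolding sample_def [abs_def] by measurable

lemma leaf_less: "leaf q \<omega> < 2 ^ L (fst q)"
  by (simp add: leaf_def node_less)

lemma sample_range:
  assumes "\<omega> \<in> space M"
  shows "0 < sample q \<omega>" "sample q \<omega> < 1"
proof -
  have "leaf q \<omega> + 1 \<le> 2 ^ L (fst q)" using leaf_less [of q \<omega>] by simp
  from of_nat_mono [OF this, where 'a=real]
  have "real (leaf q \<omega>) + 1 \<le> 2 ^ L (fst q)" by simp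
  then show "0 < sample q \<omega>" "sample q \<omega> < 1" using range_X [OF assms, of "[3, fst q, snd q]"]
    by (auto simp: sample_def divide_simps intro: add_nonneg_pos)
qed

definition blocks :: "nat \<Rightarrow> (nat \<times> nat) set" where
  "blocks J = Sigma {..<J} (\<lambda>j. {..<m j})"

lemma finite_blocks [simp]: "finite (blocks J)"
  by (simp add: blocks_def)

text \<open>By \<open>node_eq_iff\<close> the event fixes one coin per point and level, at pairwise
  different indices by \<open>rank_inj\<close>, together with the positions inside the leaves. All
  of these are distinct members of the base family.\<close>

lemma prob_leaf:
  assumes x: "\<And>q. q \<in> blocks J \<Longrightarrow> x q < 2 ^ L (fst q)" and B: "\<And>q. q \<in> blocks J \<Longrightarrow> B q \<in> sets borel"
  shows "prob {\<omega> \<in> space M. \<forall>q\<in>blocks J. leaf q \<omega> = x q \<and> X [3, fst q, snd q] \<omega> \<in> B q} =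
    (\<Prod>q\<in>blocks J. (1/2) ^ L (fst q) * measure unif (B q))"
proof -
  define y where "y = (\<lambda>p j i. x (j, i) div 2 ^ (L j - p))"
  define rk where "rk = (\<lambda>p j i. card {i'. i' < i \<and> y p j i' = y p j i})"
  define S where "S = (SIGMA q:blocks J. {..<L (fst q)})"
  define f where "f = (\<lambda>s. case s of Inl ((j, i), p) \<Rightarrow> 0 # [1, j, p, y p j i] @ [rk p j i] | Inr (j, i) \<Rightarrow> [3, j, i])"
  define A where "A = (\<lambda>s. case s of Inl ((j, i), p) \<Rightarrow> (if even (y (Suc p) j i) then {1/2..} else {..<1/2}) | Inr q \<Rightarrow> B q)"
  have fin: "finite S" by (simp add: S_def)
  have "{\<omega> \<in> space M. \<forall>q\<in>blocks J. leaf q \<omega> = x q \<and> X [3, fst q, snd q] \<omega> \<in> B q} =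
      {\<omega> \<in> space M. \<forall>s\<in>S <+> blocks J. X (f s) \<omega> \<in> A s}"
  proof (intro Collect_cong conj_cong refl)
    fix \<omega>
    have "(\<forall>q\<in>blocks J. leaf q \<omega> = x q) \<longleftrightarrow> (\<forall>j<J. \<forall>i<m j. node (split_coin j \<omega>) (L j) i = x (j, i))"
      by (auto simp: blocks_def leaf_def)
    also have "\<dots> \<longleftrightarrow> (\<forall>j<J. \<forall>p<L j. \<forall>i<m j. split_coin j \<omega> p (y p j i) (rk p j i) \<longleftrightarrow> even (y (Suc p) j i))"
    proof -
      have "(\<forall>i<m j. node (split_coin j \<omega>) (L j) i = x (j, i)) \<longleftrightarrow> (\<forall>p<L j. \<forall>i<m j. split_coin j \<omega> p (y p j i) (rk p j i) \<longleftrightarrow> even (y (Suc p) j i))"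
        if "j < J" for j
        unfolding y_def rk_def by (rule node_eq_iff) (use x that in \<open>auto simp: blocks_def\<close>)
      then show ?thesis by blast
    qed
    also have "\<dots> \<longleftrightarrow> (\<forall>s\<in>S. X (f (Inl s)) \<omega> \<in> A (Inl s))"
    proof -
      have "X (f (Inl ((j, i), p))) \<omega> \<in> A (Inl ((j, i), p)) \<longleftrightarrow> (split_coin j \<omega> p (y p j i) (rk p j i) \<longleftrightarrow> even (y (Suc p) j i))" for j i p
        by (simp add: f_def A_def split_coin_def coin_def not_le)
      moreover have "(\<forall>s\<in>S. Q s) \<longleftrightarrow> (\<forall>j<J. \<forall>p<L j. \<forall>i<m j. Q ((j, i), p))" for Q
        by (auto simp: S_def blocks_def)
      ultimately show ?thesis by simp
    qed
    finally show "(\<forall>q\<in>blocks J. leaf q \<omega> = x q \<and> X [3, fst q, snd q] \<omega> \<in> B q) \<longleftrightarrow> (\<forall>s\<in>S <+> blocks J. X (f s) \<omega> \<in> A s)"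
      by (auto simp: f_def A_def Plus_def ball_Un)
  qed
  also have "prob \<dots> = (\<Prod>s\<in>S <+> blocks J. measure unif (A s))"
  proof (rule prob_base)
    show "inj_on f (S <+> blocks J)"
    proof (rule inj_onI)
      fix s t assume st: "s \<in> S <+> blocks J" "t \<in> S <+> blocks J" "f s = f t"
      show "s = t"
      proof (cases s; cases t)
        fix s' t' assume *: "s = Inl s'" "t = Inl t'"
        obtain j i p j' i' p' where **: "s' = ((j, i), p)" "t' = ((j', i'), p')" by (metis surj_pair)
        have "j = j'" "p = p'" "y p j i = y p j i'" "rk p j i = rk p j i'"
          using st(3) by (auto simp: * ** f_def)
        then have "i = i'" using rank_inj [of "y p j" i i'] unfolding rk_def by blast
        then show ?thesis using \<open>j = j'\<close> \<open>p = p'\<close> by (simp add: * **)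
      qed (use st(3) in \<open>simp_all add: f_def case_prod_beta prod_eq_iff\<close>)
    qed
  qed (use fin B in \<open>auto simp: A_def\<close>)
  also have "\<dots> = (\<Prod>s\<in>S. measure unif (A (Inl s))) * (\<Prod>q\<in>blocks J. measure unif (B q))"
    using fin by (subst prod.Plus) (auto simp: A_def)
  also have "(\<Prod>s\<in>S. measure unif (A (Inl s))) = (\<Prod>s\<in>S. 1/2)"
    by (intro prod.cong refl) (auto simp: A_def measure_unif_halves)
  also have "\<dots> = (\<Prod>q\<in>blocks J. (1/2) ^ L (fst q))"
  proof -
    have "(\<Prod>q\<in>blocks J. \<Prod>p<L (fst q). 1/2) = (\<Prod>(q, p)\<in>S. 1/2 :: real)"
      unfolding S_def by (rule prod.Sigma) auto
    then show ?thesis by (simp add: case_prod_beta)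
  qed
  finally show ?thesis by (simp add: prod.distrib)
qed

text \<open>The law of one sample point as a mixture over its leaves, the form in which it comes out
  of \<open>prob_sample_blocks\<close>. \<open>cell_distr_atMost\<close> identifies it as uniform
  for every depth \<open>l\<close>.\<close>

definition cell_distr :: "nat \<Rightarrow> real set \<Rightarrow> real" where
  "cell_distr l A = (\<Sum>a<2^l. (1/2)^l * measure unif {v. (real a + v) / 2^l \<in> A})"

lemma vimage_affine_borel: "A \<in> sets borel \<Longrightarrow> {v. (a + v) / b \<in> A} \<in> sets (borel :: real measure)"
proof -
  assume A: "A \<in> sets borel"
  have "(\<lambda>v. (a + v) / b) -` A \<inter> space borel \<in> sets (borel :: real measure)"
    by (rule measurable_sets [OF _ A]) simp
  then show ?thesis by (simp add: vimage_def)
qed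

text \<open>Sum \<open>prob_leaf\<close> over all assignments of leaves and exchange sum and
  product. Treating whole blocks at once is forced, because which coin a point reads depends on its
  predecessors.\<close>

lemma prob_sample_blocks:
  assumes A: "\<And>q. q \<in> blocks J \<Longrightarrow> A q \<in> sets borel"
  shows "prob {\<omega> \<in> space M. \<forall>q\<in>blocks J. sample q \<omega> \<in> A q} = (\<Prod>q\<in>blocks J. cell_distr (L (fst q)) (A q))"
proof -
  define P where "P = PiE (blocks J) (\<lambda>q. {..<(2::nat) ^ L (fst q)})"
  define B where "B = (\<lambda>x q. {v. (real (x q) + v) / 2 ^ L (fst q) \<in> A q})"
  define E where "E = (\<lambda>x. {\<omega> \<in> space M. \<forall>q\<in>blocks J. leaf q \<omega> = x q \<and> X [3, fst q, snd q] \<omega> \<in> B x q})"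
  have P: "finite P" unfolding P_def by (intro finite_PiE) auto
  have Bm: "B x q \<in> sets borel" if "q \<in> blocks J" for x q
    unfolding B_def by (rule vimage_affine_borel [OF A [OF that]])
  have "{\<omega> \<in> space M. \<forall>q\<in>blocks J. sample q \<omega> \<in> A q} = (\<Union>x\<in>P. E x)"
  proof (intro equalityI subsetI)
    fix \<omega> assume w: "\<omega> \<in> {\<omega> \<in> space M. \<forall>q\<in>blocks J. sample q \<omega> \<in> A q}"
    have "(\<lambda>q\<in>blocks J. leaf q \<omega>) \<in> P" by (auto simp: P_def leaf_less)
    moreover have "\<omega> \<in> E (\<lambda>q\<in>blocks J. leaf q \<omega>)" using w by (auto simp: E_def B_def sample_def)
    ultimately show "\<omega> \<in> (\<Union>x\<in>P. E x)" by blast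
  qed (auto simp: E_def B_def sample_def)
  also have "prob \<dots> = (\<Sum>x\<in>P. prob (E x))"
  proof (rule finite_measure_finite_Union [OF P])
    have "E x \<in> events" for x
      unfolding E_def using Bm by measurable
    then show "E ` P \<subseteq> events" by auto
    show "disjoint_family_on E P"
    proof (unfold disjoint_family_on_def, intro ballI impI)
      fix x x' assume xx: "x \<in> P" "x' \<in> P" "x \<noteq> x'"
      then obtain q where "q \<in> blocks J" "x q \<noteq> x' q"
        unfolding P_def by (metis PiE_ext)
      then show "E x \<inter> E x' = {}" by (auto simp: E_def)
    qed
  qed
  also have "\<dots> = (\<Sum>x\<in>P. \<Prod>q\<in>blocks J. (1/2) ^ L (fst q) * measure unif (B x q))"
  proof (intro sum.cong refl)
    fix x assume "x \<in> P"
    then show "prob (E x) = (\<Prod>q\<in>blocks J. (1/2) ^ L (fst q) * measure unif (B x q))"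
      unfolding E_def by (intro prob_leaf Bm) (auto simp: P_def)
  qed
  also have "\<dots> = (\<Prod>q\<in>blocks J. cell_distr (L (fst q)) (A q))"
    unfolding P_def B_def cell_distr_def by (subst prod_sum_PiE) auto
  finally show ?thesis .
qed

lemma cell_distr_UNIV: "cell_distr l UNIV = 1"
  by (simp add: cell_distr_def unif.prob_space [simplified] power_one_over)

lemma cell_distr_atMost: "cell_distr l {..t} = clamp01 t"
proof -
  have "{v. (real a + v) / 2^l \<in> {..t}} = {..2^l * t - real a}" for a
    by (auto simp: divide_simps algebra_simps)
  then show ?thesis using sum_clamp01_scaled [of "2^l" t]
    by (simp add: cell_distr_def measure_unif_atMost sum_divide_distrib power_one_over)
qed

text \<open>Points outside \<open>J\<close> are filled in with the trivial condition
  \<open>UNIV\<close>, which contributes factors 1.\<close>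

lemma prob_sample_finite:
  assumes J: "finite J" "\<And>q. q \<in> J \<Longrightarrow> snd q < m (fst q)" and A: "\<And>q. q \<in> J \<Longrightarrow> A q \<in> sets borel"
  shows "prob {\<omega> \<in> space M. \<forall>q\<in>J. sample q \<omega> \<in> A q} = (\<Prod>q\<in>J. cell_distr (L (fst q)) (A q))"
proof -
  obtain N where N: "\<And>q. q \<in> J \<Longrightarrow> fst q < N"
    using finite_nat_set_iff_bounded [of "fst ` J"] J(1) by auto
  have JN: "J \<subseteq> blocks N" using N J(2) by (auto simp: blocks_def)
  define A' where "A' = (\<lambda>q. if q \<in> J then A q else UNIV)"
  have "{\<omega> \<in> space M. \<forall>q\<in>J. sample q \<omega> \<in> A q} = {\<omega> \<in> space M. \<forall>q\<in>blocks N. sample q \<omega> \<in> A' q}"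
    using JN by (auto simp: A'_def)
  also have "prob \<dots> = (\<Prod>q\<in>blocks N. cell_distr (L (fst q)) (A' q))"
    by (rule prob_sample_blocks) (use A in \<open>auto simp: A'_def\<close>)
  also have "\<dots> = (\<Prod>q\<in>J. cell_distr (L (fst q)) (A' q))"
    by (rule prod.mono_neutral_right) (use JN in \<open>auto simp: A'_def cell_distr_UNIV\<close>)
  finally show ?thesis by (simp add: A'_def)
qed

lemma prob_sample_atMost: "i < m j \<Longrightarrow> prob {\<omega> \<in> space M. sample (j, i) \<omega> \<le> t} = clamp01 t"
  using prob_sample_finite [of "{(j, i)}" "\<lambda>_. {..t}"] by (simp add: cell_distr_atMost)

lemma indep_sample: "indep_vars (\<lambda>_. borel) sample {q. snd q < m (fst q)}"
  unfolding indep_vars_def2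
proof (intro conjI ballI indep_setsI)
  fix A K
  assume K: "K \<noteq> {}" "K \<subseteq> {q. snd q < m (fst q)}" "finite K" "\<forall>q\<in>K. A q \<in> {sample q -` A \<inter> space M |A. A \<in> sets borel}"
  then obtain B where B: "\<And>q. q \<in> K \<Longrightarrow> A q = sample q -` B q \<inter> space M \<and> B q \<in> sets borel"
    unfolding mem_Collect_eq by metis
  have "prob (\<Inter>q\<in>K. A q) = prob {\<omega> \<in> space M. \<forall>q\<in>K. sample q \<omega> \<in> B q}"
    using K(1) B by (intro arg_cong [where f = prob]) auto
  also have "\<dots> = (\<Prod>q\<in>K. cell_distr (L (fst q)) (B q))"
    by (rule prob_sample_finite) (use K B in auto)
  also have "\<dots> = (\<Prod>q\<in>K. prob (A q))"
  proof (intro prod.cong refl)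
    fix q assume q: "q \<in> K"
    have "prob {\<omega> \<in> space M. \<forall>q\<in>{q}. sample q \<omega> \<in> B q} = (\<Prod>q\<in>{q}. cell_distr (L (fst q)) (B q))"
      by (rule prob_sample_finite) (use K B q in auto)
    moreover have "A q = {\<omega> \<in> space M. \<forall>q\<in>{q}. sample q \<omega> \<in> B q}" using B q by auto
    ultimately show "cell_distr (L (fst q)) (B q) = prob (A q)" by simp
  qed
  finally show "prob (\<Inter>q\<in>K. A q) = (\<Prod>q\<in>K. prob (A q))" .
qed auto

end

section \<open>The Kiefer process\<close>

context prob_space
begin

text \<open>The characteristic function covers the degenerate case \<open>v = 0\<close> as well, is
  multiplicative for independent sums, and passes to almost sure limits by dominated
  convergence.\<close>

definition is_gauss :: "real \<Rightarrow> ('a \<Rightarrow> real) \<Rightarrow> bool" where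
  "is_gauss v X \<longleftrightarrow> X \<in> borel_measurable M \<and>
     (\<forall>t. char (distr M borel X) t = complex_of_real (exp (- (v * t\<^sup>2) / 2)))"

lemma is_gauss_borel: "is_gauss v X \<Longrightarrow> X \<in> borel_measurable M"
  by (simp add: is_gauss_def)

lemma char_distr: "X \<in> borel_measurable M \<Longrightarrow> char (distr M borel X) t = (CLINT \<omega>|M. iexp (t * X \<omega>))"
  by (simp add: char_def integral_distr)

lemma is_gauss_1_distr:
  assumes "is_gauss 1 X"
  shows "distr M borel X = std_normal_distribution"
  by (rule Levy_uniqueness)
     (use assms in \<open>auto simp: is_gauss_def char_std_normal_distribution real_dist_normal_dist intro!: real_distribution_distr\<close>)

lemma is_gauss_scale:
  assumes "is_gauss v X"
  shows "is_gauss (a\<^sup>2 * v) (\<lambda>\<omega>. a * X \<omega>)"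
proof -
  have X: "X \<in> borel_measurable M" using assms by (rule is_gauss_borel)
  have "char (distr M borel (\<lambda>\<omega>. a * X \<omega>)) t = char (distr M borel X) (t * a)" for t
    using X by (simp add: char_distr mult.assoc)
  then show ?thesis using assms unfolding is_gauss_def by (auto simp: power_mult_distrib mult_ac)
qed

lemma is_gauss_tail:
  assumes X: "is_gauss 1 X" and t: "0 \<le> t"
  shows "prob {\<omega> \<in> space M. t < \<bar>X \<omega>\<bar>} \<le> 2 * exp (- t\<^sup>2 / 2)"
proof -
  note Xm [measurable] = is_gauss_borel [OF X]
  have "prob {\<omega> \<in> space M. t < \<bar>X \<omega>\<bar>} = measure (distr M borel X) {x. t < \<bar>x\<bar>}"
    by (subst measure_distr) (auto intro!: arg_cong [where f = prob])
  also have "\<dots> = std_normal.prob {x. t < \<bar>x\<bar>}" by (simp add: is_gauss_1_distr [OF X])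
  also have "\<dots> \<le> std_normal.prob (UNIV - {..t}) + std_normal.prob {..-t}"
    by (rule order_trans [OF std_normal.finite_measure_mono measure_Un_le]) auto
  also have "\<dots> = 2 * (1 - Phi t)"
    using std_normal.prob_compl [of "{..t}"] Phi_minus [of t] by (simp add: Phi_def)
  also have "\<dots> \<le> 2 * exp (- t\<^sup>2 / 2)" using Phi_tail [OF t] by simp
  finally show ?thesis .
qed

lemma is_gauss_limit:
  assumes X: "X \<in> borel_measurable M" and XP: "\<And>P. is_gauss (v P) (XP P)"
    and lim: "AE \<omega> in M. (\<lambda>P. XP P \<omega>) \<longlonglongrightarrow> X \<omega>" and v: "v \<longlonglongrightarrow> w"
  shows "is_gauss w X"
  unfolding is_gauss_def
proof (intro conjI allI X)
  fix t
  have [measurable]: "XP P \<in> borel_measurable M" for P by (rule is_gauss_borel [OF XP])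
  note X [measurable]
  have "(\<lambda>P. CLINT \<omega>|M. iexp (t * XP P \<omega>)) \<longlonglongrightarrow> (CLINT \<omega>|M. iexp (t * X \<omega>))"
  proof (rule integral_dominated_convergence [where w = "\<lambda>_. 1"])
    show "AE \<omega> in M. (\<lambda>P. iexp (t * XP P \<omega>)) \<longlonglongrightarrow> iexp (t * X \<omega>)"
      using lim by eventually_elim (intro tendsto_intros)
  qed auto
  then have "(\<lambda>P. char (distr M borel (XP P)) t) \<longlonglongrightarrow> char (distr M borel X) t"
    by (simp add: char_distr)
  moreover have "(\<lambda>P. char (distr M borel (XP P)) t) \<longlonglongrightarrow> complex_of_real (exp (- (w * t\<^sup>2) / 2))"
    using XP unfolding is_gauss_def by (simp only:) (auto intro!: tendsto_intros v)
  ultimately show "char (distr M borel X) t = complex_of_real (exp (- (w * t\<^sup>2) / 2))"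
    by (rule LIMSEQ_unique)
qed

lemma is_gauss_centered:
  assumes X: "is_gauss v X" and v: "0 \<le> v"
  shows "centered_gaussian_rv M X v"
proof (cases "v = 0")
  case True
  have Xm: "X \<in> borel_measurable M" by (rule is_gauss_borel [OF X])
  have "distr M borel X = return borel 0"
  proof (rule Levy_uniqueness)
    show "real_distribution (return borel 0)"
      by (simp add: real_distribution_def real_distribution_axioms_def prob_space_return)
    show "char (distr M borel X) = char (return borel 0)"
      using X True by (auto simp: fun_eq_iff is_gauss_def char_def integral_return)
  qed (use Xm in \<open>auto intro!: real_distribution_distr\<close>)
  moreover have "AE x in return borel (0 :: real). x = 0"
    by (simp add: AE_return)
  ultimately have "AE x in distr M borel X. x = 0"
    by (simp only:)
  then have "AE \<omega> in M. X \<omega> = 0"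
    using Xm by (subst (asm) AE_distr_iff) auto
  then show ?thesis using True Xm by (simp add: centered_gaussian_rv_def)
next
  case False
  then have v: "0 < v" using v by simp
  have "is_gauss ((1 / sqrt v)\<^sup>2 * v) (\<lambda>\<omega>. 1 / sqrt v * X \<omega>)" by (rule is_gauss_scale [OF X])
  moreover have "(1 / sqrt v)\<^sup>2 * v = 1" using v by (simp add: power_divide)
  ultimately have g: "is_gauss 1 (\<lambda>\<omega>. 1 / sqrt v * X \<omega>)" by simp
  have "distr M lborel (\<lambda>\<omega>. 1 / sqrt v * X \<omega>) = distr M borel (\<lambda>\<omega>. 1 / sqrt v * X \<omega>)"
    by (rule distr_cong) auto
  then have "distributed M lborel (\<lambda>\<omega>. (X \<omega> - 0) / sqrt v) (\<lambda>x. ennreal (std_normal_density x))"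
    using is_gauss_1_distr [OF g] is_gauss_borel [OF X] by (simp add: distributed_def)
  then have "distributed M lborel X (\<lambda>x. ennreal (normal_density 0 (sqrt v) x))"
    using v by (subst normal_standard_normal_convert) auto
  then show ?thesis using False is_gauss_borel [OF X] by (simp add: centered_gaussian_rv_def)
qed

text \<open>With \<open>x = exp (- l^2 / 2)\<close> level \<open>q\<close> costs
  \<open>C * x * (2 * x)^q\<close>. The requirement \<open>l >= 2\<close> makes
  \<open>x <= 1/4\<close>, so the levels sum geometrically and the total is still of order
  \<open>x\<close>.\<close>

lemma dyadic_union_tail:
  fixes B :: "nat \<Rightarrow> nat \<Rightarrow> 'a set"
  assumes B [measurable]: "\<And>q u. B q u \<in> events" and l: "2 \<le> l"
    and P: "\<And>q u. u < 2^q \<Longrightarrow> prob (B q u) \<le> C * exp (- (l * sqrt (real (Suc q)))\<^sup>2 / 2)" and C: "0 \<le> C"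
  shows "prob (\<Union>q. \<Union>u<2^q. B q u) \<le> 2 * C * exp (- l\<^sup>2 / 2)"
proof -
  define x where "x = exp (- l\<^sup>2 / 2)"
  have x: "0 < x" "x \<le> 1/4"
  proof -
    have "(2::real)\<^sup>2 \<le> l\<^sup>2" using l by (intro power_mono) auto
    then have "x \<le> exp (- 2)" by (simp add: x_def)
    also have "(4::real) \<le> exp 2" using exp_lower_Taylor_quadratic [of 2] by simp
    then have "exp (-2) \<le> (1/4::real)" by (simp add: exp_minus field_simps)
    finally show "x \<le> 1/4" .
  qed (simp add: x_def)
  have b: "prob (\<Union>u<2^q. B q u) \<le> C * x * (1/2)^q" for q
  proof -
    have e: "exp (- (l * sqrt (real (Suc q)))\<^sup>2 / 2) = x * x^q"
    proof -
      have a: "- (a * S) / 2 = S * (- a / 2)" for a S :: real by simp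
      have "(l * sqrt (real (Suc q)))\<^sup>2 = l\<^sup>2 * real (Suc q)"
        by (simp only: power_mult_distrib real_sqrt_pow2 of_nat_0_le_iff)
      then show ?thesis
        by (simp only: a x_def exp_of_nat_mult power_Suc)
    qed
    have "prob (\<Union>u<2^q. B q u) \<le> (\<Sum>u<2^q. prob (B q u))"
      by (rule finite_measure_subadditive_finite) auto
    also have "\<dots> \<le> (\<Sum>u<(2::nat)^q. C * (x * x^q))"
      by (intro sum_mono) (use P [of _ q, unfolded e] in auto)
    also have "\<dots> = C * x * (2 * x)^q" by (simp add: power_mult_distrib)
    also have "\<dots> \<le> C * x * (1/2)^q"
      using x C by (intro mult_left_mono power_mono) auto
    finally show ?thesis .
  qed
  have s: "(\<lambda>q. C * x * (1/2)^q) sums (C * x * 2)"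
    using sums_mult [OF geometric_sums [of "1/2::real"], of "C * x"] by simp
  have sm: "summable (\<lambda>q. prob (\<Union>u<2^q. B q u))"
    by (rule summable_comparison_test' [OF sums_summable [OF s]]) (use b in auto)
  have "prob (\<Union>q. \<Union>u<2^q. B q u) \<le> (\<Sum>q. prob (\<Union>u<2^q. B q u))"
    by (rule finite_measure_subadditive_countably [OF _ sm]) auto
  also have "\<dots> \<le> (\<Sum>q. C * x * (1/2)^q)"
    by (rule suminf_le [OF b sm sums_summable [OF s]])
  also have "\<dots> = 2 * C * x" using sums_unique [OF s] by simp
  finally show ?thesis by (simp add: x_def)
qed

lemma coeff_bound_tail:
  assumes c: "\<And>p r. r < 2^p \<Longrightarrow> is_gauss 1 (c p r)" and l: "2 \<le> l"
  shows "{\<omega> \<in> space M. \<not> coeff_bound l (\<lambda>p r. c p r \<omega>)} \<in> events"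
    and "prob {\<omega> \<in> space M. \<not> coeff_bound l (\<lambda>p r. c p r \<omega>)} \<le> 4 * exp (- l\<^sup>2 / 2)"
proof -
  define B where "B = (\<lambda>p r. if r < 2^p then {\<omega> \<in> space M. l * sqrt (real (Suc p)) < \<bar>c p r \<omega>\<bar>} else {})"
  have [measurable]: "B p r \<in> events" for p r
  proof (cases "r < 2^p")
    case True
    note is_gauss_borel [OF c [OF True], measurable]
    show ?thesis using True by (simp add: B_def)
  qed (simp add: B_def)
  have eq: "{\<omega> \<in> space M. \<not> coeff_bound l (\<lambda>p r. c p r \<omega>)} = (\<Union>p. \<Union>r<2^p. B p r)"
    by (auto simp: coeff_bound_def B_def not_le)
  show "{\<omega> \<in> space M. \<not> coeff_bound l (\<lambda>p r. c p r \<omega>)} \<in> events" unfolding eq by measurable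
  have "prob (\<Union>p. \<Union>r<2^p. B p r) \<le> 2 * 2 * exp (- l\<^sup>2 / 2)"
  proof (rule dyadic_union_tail [OF _ l])
    show "prob (B q u) \<le> 2 * exp (- (l * sqrt (real (Suc q)))\<^sup>2 / 2)" if "u < 2^q" for q u
      using is_gauss_tail [OF c [OF that], of "l * sqrt (real (Suc q))"] that l by (simp add: B_def)
  qed auto
  then show "prob {\<omega> \<in> space M. \<not> coeff_bound l (\<lambda>p r. c p r \<omega>)} \<le> 4 * exp (- l\<^sup>2 / 2)"
    unfolding eq by simp
qed

end

section \<open>Time inside a block and the two-parameter series\<close>

definition block_start :: "(nat \<Rightarrow> nat) \<Rightarrow> nat \<Rightarrow> nat" where
  "block_start m j = (\<Sum>i<j. m i)"

definition block_time :: "(nat \<Rightarrow> nat) \<Rightarrow> nat \<Rightarrow> real \<Rightarrow> real" where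
  "block_time m j t = clamp01 ((t - real (block_start m j)) / real (m j))"

text \<open>Brownian bridge in \<open>y\<close>, Brownian motion in the time \<open>s \<in> {0..1}\<close> of a block, expanded in the two
  variables: \<open>z\<close> are the coefficients of the value at \<open>s = 1\<close>, and \<open>g\<close> those of a bridge in \<open>s\<close>.\<close>

definition sheet :: "(nat \<Rightarrow> nat \<Rightarrow> real) \<Rightarrow> (nat \<Rightarrow> nat \<Rightarrow> nat \<Rightarrow> nat \<Rightarrow> real) \<Rightarrow> real \<Rightarrow> real \<Rightarrow> real" where
  "sheet z g y s = s * schauder z y + schauder (\<lambda>q u. schauder (g q u) y) s"

definition sheet_bound :: "real \<Rightarrow> (nat \<Rightarrow> nat \<Rightarrow> real) \<Rightarrow> (nat \<Rightarrow> nat \<Rightarrow> nat \<Rightarrow> nat \<Rightarrow> real) \<Rightarrow> bool" where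
  "sheet_bound l z g \<longleftrightarrow> coeff_bound l z \<and> (\<forall>q u. u < 2^q \<longrightarrow> coeff_bound (l * sqrt (real (Suc q))) (g q u))"

text \<open>For fixed \<open>y\<close> the inner series are themselves admissible coefficients in
  the time variable, and so are their increments in \<open>y\<close>. The Schauder estimates can
  therefore be applied twice, which is the origin of \<open>holder_const^2\<close>.\<close>

lemma sheet_inner_bound:
  assumes "sheet_bound l z g" "0 \<le> l"
  shows "coeff_bound (holder_const * l * sqrt (sqrt \<bar>y - y'\<bar>)) (\<lambda>q u. schauder (g q u) y - schauder (g q u) y')"
    and "y \<in> {0..1} \<Longrightarrow> coeff_bound (holder_const * l) (\<lambda>q u. schauder (g q u) y)"
proof -
  have g: "coeff_bound (l * sqrt (real (Suc q))) (g q u)" if "u < 2^q" for q u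
    using assms that by (simp add: sheet_bound_def)
  show "coeff_bound (holder_const * l * sqrt (sqrt \<bar>y - y'\<bar>)) (\<lambda>q u. schauder (g q u) y - schauder (g q u) y')"
    unfolding coeff_bound_def
    using schauder_holder [OF g, of _ _ y y'] assms(2) by (auto simp: mult_ac)
  show "y \<in> {0..1} \<Longrightarrow> coeff_bound (holder_const * l) (\<lambda>q u. schauder (g q u) y)"
    unfolding coeff_bound_def
    using schauder_bound [OF g, of _ _ y] assms(2) by (auto simp: mult_ac)
qed

lemma sheet_le:
  assumes b: "sheet_bound l z g" "0 \<le> l" and y: "y \<in> {0..1}" and s: "s \<in> {0..1}"
  shows "\<bar>sheet z g y s\<bar> \<le> (holder_const + holder_const\<^sup>2) * l"
proof -
  have h: "0 \<le> holder_const" using holder_const_pos by simp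
  have "\<bar>s * schauder z y\<bar> \<le> 1 * (holder_const * l)"
    unfolding abs_mult using s schauder_bound [of l z y] b y by (intro mult_mono) (auto simp: sheet_bound_def)
  moreover have "\<bar>schauder (\<lambda>q u. schauder (g q u) y) s\<bar> \<le> holder_const * (holder_const * l)"
    using b h by (intro schauder_bound sheet_inner_bound(2) y s) auto
  ultimately show ?thesis unfolding sheet_def by (simp add: power2_eq_square algebra_simps)
qed

lemma sheet_continuity_bound:
  assumes b: "sheet_bound l z g" "0 \<le> l" and y: "y \<in> {0..1}" "y' \<in> {0..1}" and s: "s \<in> {0..1}" "s' \<in> {0..1}"
  shows "\<bar>sheet z g y s - sheet z g y' s'\<bar> \<le>
    (holder_const + holder_const\<^sup>2) * l * (sqrt (sqrt \<bar>y - y'\<bar>) + sqrt (sqrt \<bar>s - s'\<bar>) + \<bar>s - s'\<bar>)"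
proof -
  have h: "0 \<le> holder_const" using holder_const_pos by simp
  have z: "coeff_bound l z" using b by (simp add: sheet_bound_def)
  define D where "D = sqrt (sqrt \<bar>y - y'\<bar>)"
  define E where "E = sqrt (sqrt \<bar>s - s'\<bar>)"
  have DE: "0 \<le> D" "0 \<le> E" by (simp_all add: D_def E_def)
  note i = sheet_inner_bound [OF b]
  have 1: "\<bar>s * schauder z y - s' * schauder z y'\<bar> \<le> holder_const * l * D + \<bar>s - s'\<bar> * (holder_const * l)"
  proof -
    have "\<bar>s * (schauder z y - schauder z y')\<bar> \<le> 1 * (holder_const * l * D)"
      unfolding abs_mult D_def using s schauder_holder [OF z b(2)] by (intro mult_mono) auto
    moreover have "\<bar>(s - s') * schauder z y'\<bar> \<le> \<bar>s - s'\<bar> * (holder_const * l)"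
      unfolding abs_mult using schauder_bound [OF z b(2) y(2)] by (intro mult_left_mono) auto
    moreover have "s * schauder z y - s' * schauder z y' = s * (schauder z y - schauder z y') + (s - s') * schauder z y'"
      by (simp add: algebra_simps)
    ultimately show ?thesis by linarith
  qed
  have 2: "\<bar>schauder (\<lambda>q u. schauder (g q u) y) s - schauder (\<lambda>q u. schauder (g q u) y') s\<bar> \<le> holder_const * (holder_const * l * D)"
  proof -
    have "\<bar>schauder (\<lambda>q u. schauder (g q u) y - schauder (g q u) y') s\<bar> \<le> holder_const * (holder_const * l * D)"
      unfolding D_def using i(1) [of y y'] b h DE by (intro schauder_bound s) (auto simp: D_def)
    then show ?thesis by (subst (asm) schauder_diff [OF i(2) [OF y(1)] i(2) [OF y(2)]])
  qed
  have 3: "\<bar>schauder (\<lambda>q u. schauder (g q u) y') s - schauder (\<lambda>q u. schauder (g q u) y') s'\<bar> \<le> holder_const * (holder_const * l) * E"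
    unfolding E_def using b h by (intro schauder_holder i(2) y) auto
  have "\<bar>sheet z g y s - sheet z g y' s'\<bar> \<le> holder_const * l * D + \<bar>s - s'\<bar> * (holder_const * l) + holder_const * (holder_const * l * D) + holder_const * (holder_const * l) * E"
    unfolding sheet_def using 1 2 3 by linarith
  also have "\<dots> \<le> (holder_const + holder_const\<^sup>2) * l * (D + E + \<bar>s - s'\<bar>)"
  proof -
    have "0 \<le> holder_const * l * E" "0 \<le> holder_const\<^sup>2 * l * \<bar>s - s'\<bar>" using b h DE by auto
    then show ?thesis by (simp add: power2_eq_square algebra_simps)
  qed
  finally show ?thesis by (simp add: D_def E_def)
qed

lemma sheet_0 [simp]: "sheet z g y 0 = 0"
  by (simp add: sheet_def)

lemma clamp01_range: "clamp01 x \<in> {0..1}" and clamp01_mono: "x \<le> y \<Longrightarrow> clamp01 x \<le> clamp01 y"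
  by (auto simp: clamp01_def)

lemma block_time_range: "block_time m j t \<in> {0..1}"
  unfolding block_time_def by (rule clamp01_range)

lemma block_time_mono: "t \<le> t' \<Longrightarrow> block_time m j t \<le> block_time m j t'"
  unfolding block_time_def by (intro clamp01_mono divide_right_mono) auto

lemma block_time_min: "min (block_time m j t) (block_time m j t') = block_time m j (min t t')"
  using block_time_mono [of t t' m j] block_time_mono [of t' t m j] by (auto simp: min_def)

lemma block_time_continuous: "continuous_on A (block_time m j)"
  unfolding block_time_def [abs_def] clamp01_def [abs_def] by (cases "m j = 0") (auto intro!: continuous_intros)

lemma block_start_Suc: "block_start m (Suc j) = block_start m j + m j"
  by (simp add: block_start_def)

lemma block_start_ge: "(\<And>j. 0 < m j) \<Longrightarrow> j \<le> block_start m j"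
proof (induction j)
  case (Suc j)
  then show ?case using Suc.IH [OF Suc.prems] Suc.prems [of j] unfolding block_start_Suc by linarith
qed simp

lemma block_time_0: "(\<And>j. 0 < m j) \<Longrightarrow> t \<le> real j \<Longrightarrow> block_time m j t = 0"
proof -
  assume m: "\<And>j. 0 < m j" and t: "t \<le> real j"
  have "real j \<le> real (block_start m j)" using block_start_ge [of m j, OF m] by (rule of_nat_mono)
  then have "t - real (block_start m j) \<le> 0" using t by linarith
  then have "(t - real (block_start m j)) / real (m j) \<le> 0" using m [of j] by (simp add: divide_nonpos_pos)
  then show ?thesis by (simp add: block_time_def clamp01_def)
qed

text \<open>The blocks run one after another, each from 0 to 1, so their weighted times add up to
  the clock. Applied to the minimum of two times, this yields the factor \<open>min s t\<close> of
  the covariance.\<close>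

lemma sum_block_time:
  assumes m: "\<And>j. 0 < m j" and t: "0 \<le> t" "t \<le> real N"
  shows "(\<Sum>j<N. real (m j) * block_time m j t) = t"
proof -
  have "(\<Sum>j<N. real (m j) * block_time m j t) = min (real (block_start m N)) t" for N
  proof (induction N)
    case 0
    then show ?case using t by (simp add: block_start_def)
  next
    case (Suc N)
    have mN: "0 < real (m N)" using m by simp
    define b where "b = real (block_start m N)"
    define k where "k = real (m N)"
    have "k * clamp01 ((t - b) / k) = max 0 (min k (t - b))"
    proof -
      consider "t - b \<le> 0" | "0 \<le> t - b" "t - b \<le> k" | "k \<le> t - b" by linarith
      then show ?thesis
        using mN unfolding k_def [symmetric]
        by cases (auto simp: clamp01_def max_def min_def divide_simps split: if_splits)
    qed
    then show ?case using Suc mN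
      by (simp add: block_time_def block_start_Suc b_def [symmetric] k_def [symmetric] min_def max_def)
  qed
  moreover have "real N \<le> real (block_start m N)" using block_start_ge [of m N, OF m] by (rule of_nat_mono)
  ultimately show ?thesis using t by (simp add: min_def)
qed

section \<open>The random sheets and their sum\<close>

context uniform_family
begin

lemma is_gauss_gauss: "e \<in> gauss_index \<Longrightarrow> is_gauss 1 (gauss e)"
  by (auto simp: is_gauss_def gauss_index_def distr_gauss char_std_normal_distribution)

lemma is_gauss_sum:
  assumes I: "finite I" "I \<subseteq> gauss_index"
  shows "is_gauss (\<Sum>e\<in>I. (a e)\<^sup>2) (\<lambda>\<omega>. \<Sum>e\<in>I. a e * gauss e \<omega>)"
  unfolding is_gauss_def
proof (intro conjI allI)
  fix t
  have "indep_vars (\<lambda>_. borel) (\<lambda>e \<omega>. a e * gauss e \<omega>) I"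
    by (rule indep_vars_compose2 [OF indep_vars_subset [OF indep_gauss I(2)]]) auto
  then have "char (distr M borel (\<lambda>\<omega>. \<Sum>e\<in>I. a e * gauss e \<omega>)) t = (\<Prod>e\<in>I. char (distr M borel (\<lambda>\<omega>. a e * gauss e \<omega>)) t)"
    by (rule char_distr_sum)
  also have "\<dots> = (\<Prod>e\<in>I. complex_of_real (exp (- ((a e)\<^sup>2 * 1 * t\<^sup>2) / 2)))"
    using is_gauss_scale [OF is_gauss_gauss] I by (intro prod.cong refl) (auto simp: is_gauss_def)
  also have "\<dots> = complex_of_real (exp (- ((\<Sum>e\<in>I. (a e)\<^sup>2) * t\<^sup>2) / 2))"
    using I(1) by (simp add: exp_sum [symmetric] sum_negf sum_divide_distrib sum_distrib_right flip: of_real_prod)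
  finally show "char (distr M borel (\<lambda>\<omega>. \<Sum>e\<in>I. a e * gauss e \<omega>)) t = complex_of_real (exp (- ((\<Sum>e\<in>I. (a e)\<^sup>2) * t\<^sup>2) / 2))" .
qed simp

definition zeta :: "nat \<Rightarrow> 'w \<Rightarrow> nat \<Rightarrow> nat \<Rightarrow> real" where
  "zeta j \<omega> p r = gauss [1, j, p, r] \<omega>"

definition inner :: "nat \<Rightarrow> 'w \<Rightarrow> nat \<Rightarrow> nat \<Rightarrow> nat \<Rightarrow> nat \<Rightarrow> real" where
  "inner j \<omega> q u p r = gauss [2, j, p, r, q, u] \<omega>"

definition good :: "nat \<Rightarrow> real \<Rightarrow> 'w \<Rightarrow> bool" where
  "good j l \<omega> \<longleftrightarrow> sheet_bound l (zeta j \<omega>) (inner j \<omega>)"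

text \<open>The constant is 4 for the endpoint coefficients plus \<open>2 * 4\<close> for the arrays
  of the time levels, summed by \<open>dyadic_union_tail\<close>.\<close>

lemma good_tail:
  assumes l: "2 \<le> l"
  shows "{\<omega> \<in> space M. \<not> good j l \<omega>} \<in> events"
    and "prob {\<omega> \<in> space M. \<not> good j l \<omega>} \<le> 12 * exp (- l\<^sup>2 / 2)"
proof -
  have g1: "is_gauss 1 (\<lambda>\<omega>. zeta j \<omega> p r)" for p r
    unfolding zeta_def by (rule is_gauss_gauss) (simp add: gauss_index_def)
  have g2: "is_gauss 1 (\<lambda>\<omega>. inner j \<omega> q u p r)" for p r q u
    unfolding inner_def by (rule is_gauss_gauss) (simp add: gauss_index_def)
  define A where "A = {\<omega> \<in> space M. \<not> coeff_bound l (zeta j \<omega>)}"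
  define B where "B = (\<lambda>q u. {\<omega> \<in> space M. \<not> coeff_bound (l * sqrt (real (Suc q))) (inner j \<omega> q u)})"
  have lq: "2 \<le> l * sqrt (real (Suc q))" for q
    using mult_mono [of 2 l 1 "sqrt (real (Suc q))"] l by simp
  have A: "A \<in> events" "prob A \<le> 4 * exp (- l\<^sup>2 / 2)"
    using coeff_bound_tail [of "\<lambda>p r \<omega>. zeta j \<omega> p r" l] g1 l by (simp_all add: A_def)
  have B: "B q u \<in> events" "prob (B q u) \<le> 4 * exp (- (l * sqrt (real (Suc q)))\<^sup>2 / 2)" for q u
    using coeff_bound_tail [of "\<lambda>p r \<omega>. inner j \<omega> q u p r" "l * sqrt (real (Suc q))"] g2 lq by (simp_all add: B_def)
  have eq: "{\<omega> \<in> space M. \<not> good j l \<omega>} = A \<union> (\<Union>q. \<Union>u<2^q. B q u)"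
    by (auto simp: good_def sheet_bound_def A_def B_def)
  have U: "(\<Union>q. \<Union>u<2^q. B q u) \<in> events" using B(1) by auto
  show "{\<omega> \<in> space M. \<not> good j l \<omega>} \<in> events" unfolding eq using A(1) U by auto
  have "prob (A \<union> (\<Union>q. \<Union>u<2^q. B q u)) \<le> prob A + prob (\<Union>q. \<Union>u<2^q. B q u)"
    by (rule measure_Un_le [OF A(1) U])
  also have "\<dots> \<le> 4 * exp (- l\<^sup>2 / 2) + 2 * 4 * exp (- l\<^sup>2 / 2)"
    by (intro add_mono A(2) dyadic_union_tail B l) auto
  finally show "prob {\<omega> \<in> space M. \<not> good j l \<omega>} \<le> 12 * exp (- l\<^sup>2 / 2)" unfolding eq by simp
qed

text \<open>A finite constant for each block, without uniformity in \<open>j\<close>.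
  \<open>kiefer_sum\<close> is 0 off this almost sure event, since \<open>kiefer_process\<close>
  asks for continuity of every path. The shift by 2 meets the hypothesis of
  \<open>good_tail\<close>.\<close>

definition all_good :: "'w \<Rightarrow> bool" where
  "all_good \<omega> \<longleftrightarrow> (\<forall>j. \<exists>l. good j (real (l + 2)) \<omega>)"

lemma all_good_measurable: "{\<omega> \<in> space M. all_good \<omega>} \<in> events"
proof -
  define B where "B = (\<lambda>j l. {\<omega> \<in> space M. \<not> good j (real (l + 2)) \<omega>})"
  have [measurable]: "B j l \<in> events" for j l unfolding B_def by (rule good_tail) simp
  have "{\<omega> \<in> space M. all_good \<omega>} = (\<Inter>j. \<Union>l. space M - B j l)"
    by (auto simp: all_good_def B_def)
  also have "\<dots> \<in> events" by measurable
  finally show ?thesis .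
qed

lemma AE_all_good: "AE \<omega> in M. all_good \<omega>"
proof -
  have "AE \<omega> in M. \<exists>l. good j (real (l + 2)) \<omega>" for j
  proof -
    define C where "C = {\<omega> \<in> space M. \<not> (\<exists>l. good j (real (l + 2)) \<omega>)}"
    have "C = (\<Inter>l. {\<omega> \<in> space M. \<not> good j (real (l + 2)) \<omega>})" by (auto simp: C_def)
    then have Cm: "C \<in> events" by (auto intro!: sets.countable_INT good_tail)
    have "prob C \<le> 12 * exp (- (real (l + 2))\<^sup>2 / 2)" for l
      by (rule order_trans [OF finite_measure_mono good_tail(2)]) (auto simp: C_def intro!: good_tail(1))
    moreover have "(\<lambda>l. 12 * exp (- (real (l + 2))\<^sup>2 / 2)) \<longlonglongrightarrow> 0" by real_asymp
    ultimately have "prob C \<le> 0"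
      using LIMSEQ_le_const by blast
    then have "prob C = 0" using measure_nonneg [of M C] by linarith
    then have "C \<in> null_sets M" using Cm by (simp add: emeasure_eq_measure null_sets_def)
    then show ?thesis by (rule AE_I') (auto simp: C_def)
  qed
  then show ?thesis unfolding all_good_def by (subst AE_all_countable) blast
qed

text \<open>The minus sign matches the estimator: a large empirical distribution function means a small quantile.
  Terms with \<open>j \<ge> t\<close> vanish, since the block \<open>j\<close> starts at time at least \<open>j\<close>.\<close>

definition kiefer_sum :: "real \<Rightarrow> real \<Rightarrow> 'w \<Rightarrow> real" where
  "kiefer_sum y t \<omega> = (if all_good \<omega> then
     - (\<Sum>j<nat \<lceil>t\<rceil>. sqrt (real (m j)) * sheet (zeta j \<omega>) (inner j \<omega>) y (block_time m j t)) else 0)"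

lemma kiefer_sum_eq:
  assumes m: "\<And>j. 0 < m j" and g: "all_good \<omega>" and N: "t \<le> real N"
  shows "kiefer_sum y t \<omega> = - (\<Sum>j<N. sqrt (real (m j)) * sheet (zeta j \<omega>) (inner j \<omega>) y (block_time m j t))"
proof -
  have z: "sheet (zeta j \<omega>) (inner j \<omega>) y (block_time m j t) = 0" if "t \<le> real j" for j
    using block_time_0 [OF m that] by simp
  have "(\<Sum>j<nat \<lceil>t\<rceil>. sqrt (real (m j)) * sheet (zeta j \<omega>) (inner j \<omega>) y (block_time m j t)) =
      (\<Sum>j<N. sqrt (real (m j)) * sheet (zeta j \<omega>) (inner j \<omega>) y (block_time m j t))"
  proof (rule sum.mono_neutral_left)
    show "\<forall>j\<in>{..<N} - {..<nat \<lceil>t\<rceil>}. sqrt (real (m j)) * sheet (zeta j \<omega>) (inner j \<omega>) y (block_time m j t) = 0"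
    proof
      fix j assume "j \<in> {..<N} - {..<nat \<lceil>t\<rceil>}"
      then have "t \<le> real j" by simp
      then show "sqrt (real (m j)) * sheet (zeta j \<omega>) (inner j \<omega>) y (block_time m j t) = 0" by (simp add: z)
    qed
    show "{..<nat \<lceil>t\<rceil>} \<subseteq> {..<N}" using N by (auto simp: less_le_trans nat_le_iff ceiling_le_iff)
  qed auto
  then show ?thesis using g by (simp add: kiefer_sum_def)
qed

lemma good_nonneg_ex: "all_good \<omega> \<Longrightarrow> \<exists>l\<ge>0. sheet_bound l (zeta j \<omega>) (inner j \<omega>)"
  unfolding all_good_def good_def by (meson of_nat_0_le_iff)

lemma sheet_continuous:
  assumes g: "all_good \<omega>"
  shows "continuous_on ({0..1} \<times> {0..1}) (\<lambda>(y, s). sheet (zeta j \<omega>) (inner j \<omega>) y s)"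
proof -
  obtain l where l: "0 \<le> l" "sheet_bound l (zeta j \<omega>) (inner j \<omega>)" using good_nonneg_ex [OF g] by blast
  show ?thesis
    unfolding continuous_on_def
  proof (intro ballI)
    fix x :: "real \<times> real" assume x: "x \<in> {0..1} \<times> {0..1}"
    define B where "B = (\<lambda>z. (holder_const + holder_const\<^sup>2) * l * (sqrt (sqrt \<bar>fst z - fst x\<bar>) + sqrt (sqrt \<bar>snd z - snd x\<bar>) + \<bar>snd z - snd x\<bar>))"
    have "((\<lambda>z. B z) \<longlongrightarrow> B x) (at x within {0..1} \<times> {0..1})"
      unfolding B_def by (intro tendsto_intros)
    then have "((\<lambda>z. B z) \<longlongrightarrow> 0) (at x within {0..1} \<times> {0..1})" by (simp add: B_def)
    moreover have "\<forall>\<^sub>F z in at x within {0..1} \<times> {0..1}.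
        norm ((case z of (y, s) \<Rightarrow> sheet (zeta j \<omega>) (inner j \<omega>) y s) - (case x of (y, s) \<Rightarrow> sheet (zeta j \<omega>) (inner j \<omega>) y s)) \<le> B z"
      unfolding eventually_at_filter
      by (intro always_eventually allI impI)
         (use x sheet_continuity_bound [OF l(2,1)] in \<open>auto simp: B_def case_prod_beta\<close>)
    ultimately have "((\<lambda>z. (case z of (y, s) \<Rightarrow> sheet (zeta j \<omega>) (inner j \<omega>) y s) - (case x of (y, s) \<Rightarrow> sheet (zeta j \<omega>) (inner j \<omega>) y s)) \<longlongrightarrow> 0) (at x within {0..1} \<times> {0..1})"
      by (rule Lim_null_comparison [rotated])
    then show "((\<lambda>(y, s). sheet (zeta j \<omega>) (inner j \<omega>) y s) \<longlongrightarrow> (case x of (y, s) \<Rightarrow> sheet (zeta j \<omega>) (inner j \<omega>) y s)) (at x within {0..1} \<times> {0..1})"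
      by (simp add: LIM_zero_iff)
  qed
qed

text \<open>On \<open>t < N\<close> the number of summands can be fixed to \<open>N\<close>, so the
  jumping summation range does no harm; continuity is then local in \<open>t\<close>.\<close>

lemma kiefer_sum_continuous:
  assumes m: "\<And>j. 0 < m j"
  shows "continuous_on ({0..1} \<times> {0..}) (\<lambda>(y, t). kiefer_sum y t \<omega>)"
proof (cases "all_good \<omega>")
  case g: True
  have c: "continuous_on ({0..1} \<times> {0..<real N}) (\<lambda>(y, t). kiefer_sum y t \<omega>)" for N
  proof -
    have 1: "continuous_on ({0..1} \<times> {0..<real N}) (\<lambda>x. - (\<Sum>j<N. sqrt (real (m j)) * (\<lambda>(y, s). sheet (zeta j \<omega>) (inner j \<omega>) y s) (fst x, block_time m j (snd x))))"
    proof (intro continuous_intros)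
      fix j
      show "continuous_on ({0..1} \<times> {0..<real N}) (\<lambda>x. (\<lambda>(y, s). sheet (zeta j \<omega>) (inner j \<omega>) y s) (fst x, block_time m j (snd x)))"
      proof (rule continuous_on_compose2 [OF sheet_continuous [OF g]])
        show "continuous_on ({0..1} \<times> {0..<real N}) (\<lambda>x. (fst x, block_time m j (snd x)))"
          by (intro continuous_intros continuous_on_compose2 [OF block_time_continuous [of UNIV]]) auto
      qed (use block_time_range [of m j] in auto)
    qed
    show ?thesis
      by (rule continuous_on_eq [OF 1]) (use kiefer_sum_eq [OF m g, where N = N] in auto)
  qed
  show ?thesis
    unfolding continuous_on_eq_continuous_within
  proof
    fix x :: "real \<times> real" assume x: "x \<in> {0..1} \<times> {0..}"
    obtain N :: nat where N: "snd x < real N" using reals_Archimedean2 by blast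
    have "continuous (at x within ({0..1} \<times> {0..}) \<inter> (UNIV \<times> {..<real N})) (\<lambda>(y, t). kiefer_sum y t \<omega>)"
    proof -
      have "({0..1} \<times> {0..}) \<inter> (UNIV \<times> {..<real N}) = ({0..1::real} \<times> {0..<real N})" by auto
      then show ?thesis using c [of N] x N by (auto simp: continuous_on_eq_continuous_within)
    qed
    moreover have "at x within ({0..1} \<times> {0..}) \<inter> (UNIV \<times> {..<real N}) = at x within ({0..1} \<times> {0..})"
      by (rule at_within_nhd [of _ "UNIV \<times> {..<real N}"]) (use x N in \<open>auto intro: open_Times simp: mem_Times_iff\<close>)
    ultimately show "continuous (at x within {0..1} \<times> {0..}) (\<lambda>(y, t). kiefer_sum y t \<omega>)" by simp
  qed
qed (simp add: kiefer_sum_def)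

section \<open>Covariance of the truncated sums and the Gaussian limit\<close>

text \<open>The Schauder basis of Brownian motion in time: index 0 is the linear function belonging
  to the value at the end of the block, and the others form the bridge. \<open>tindex\<close> and
  \<open>gindex\<close> number the functions of a level and their Gaussians.\<close>

definition tbasis :: "nat \<Rightarrow> nat \<Rightarrow> real \<Rightarrow> real" where
  "tbasis k u s = (if k = 0 then s else tent (k - 1) u s)"

definition tindex :: "nat \<Rightarrow> nat" where
  "tindex k = (if k = 0 then 1 else 2 ^ (k - 1))"

definition gindex :: "nat \<times> nat \<times> nat \<times> nat \<times> nat \<Rightarrow> nat list" where
  "gindex = (\<lambda>(j, k, u, p, r). if k = 0 then [1, j, p, r] else [2, j, p, r, k - 1, u])"

definition tuples :: "nat \<Rightarrow> nat \<Rightarrow> nat \<Rightarrow> (nat \<times> nat \<times> nat \<times> nat \<times> nat) set" where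
  "tuples N Q P = (SIGMA j:{..<N}. SIGMA k:{..<Suc Q}. SIGMA u:{..<tindex k}. SIGMA p:{..<P}. {..<2^p})"

definition trunc_sheet :: "nat \<Rightarrow> nat \<Rightarrow> nat \<Rightarrow> real \<Rightarrow> real \<Rightarrow> 'w \<Rightarrow> real" where
  "trunc_sheet Q P j y s \<omega> = s * (\<Sum>p<P. level_sum (zeta j \<omega> p) p y) +
     (\<Sum>q<Q. level_sum (\<lambda>u. \<Sum>p<P. level_sum (inner j \<omega> q u p) p y) q s)"

lemma sum_tuples:
  "(\<Sum>x\<in>tuples N Q P. f x) = (\<Sum>j<N. \<Sum>k<Suc Q. \<Sum>u<tindex k. \<Sum>p<P. \<Sum>r<2^p. f (j, k, u, p, r))"
proof -
  have S: "sum f (Sigma A B) = (\<Sum>a\<in>A. \<Sum>b\<in>B a. f (a, b))" if "finite A" "\<And>a. finite (B a)"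
    for A and B :: "'b \<Rightarrow> 'c set" and f :: "'b \<times> 'c \<Rightarrow> 'd :: comm_monoid_add"
    using that by (subst sum.Sigma) auto
  show ?thesis
    unfolding tuples_def by (simp add: S del: sum.lessThan_Suc lessThan_Suc)
qed

lemma sum_time_index:
  "(\<Sum>k<Suc Q. \<Sum>u<tindex k. f k u) = f 0 0 + (\<Sum>q<Q. \<Sum>u<2^q. f (Suc q) u)" for f :: "nat \<Rightarrow> nat \<Rightarrow> real"
  by (simp only: sum.lessThan_Suc_shift) (simp add: tindex_def)

lemma trunc_sheet_eq:
  "trunc_sheet Q P j y s \<omega> = (\<Sum>k<Suc Q. \<Sum>u<tindex k. \<Sum>p<P. \<Sum>r<2^p. tent p r y * tbasis k u s * gauss (gindex (j, k, u, p, r)) \<omega>)"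
  unfolding sum_time_index trunc_sheet_def level_sum_def
  by (simp add: tbasis_def gindex_def zeta_def inner_def sum_distrib_left sum_distrib_right mult_ac)

lemma basis_cov:
  "(\<Sum>k<Suc Q. \<Sum>u<tindex k. \<Sum>p<P. \<Sum>r<2^p. (tent p r y * tbasis k u s) * (tent p r y' * tbasis k u s')) =
   (s * s' + tent_cov Q s s') * tent_cov P y y'"
proof -
  have "(\<Sum>p<P. \<Sum>r<2^p. (tent p r y * tbasis k u s) * (tent p r y' * tbasis k u s')) = (tbasis k u s * tbasis k u s') * tent_cov P y y'" for k u
    unfolding tent_cov_def sum_distrib_left by (simp add: mult_ac)
  then have "(\<Sum>k<Suc Q. \<Sum>u<tindex k. \<Sum>p<P. \<Sum>r<2^p. (tent p r y * tbasis k u s) * (tent p r y' * tbasis k u s')) =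
      (\<Sum>k<Suc Q. \<Sum>u<tindex k. tbasis k u s * tbasis k u s') * tent_cov P y y'"
    by (simp only: sum_distrib_right)
  also have "(\<Sum>k<Suc Q. \<Sum>u<tindex k. tbasis k u s * tbasis k u s') = s * s' + tent_cov Q s s'"
    unfolding sum_time_index tent_cov_def by (simp add: tbasis_def)
  finally show ?thesis .
qed

text \<open>After truncation everything is one finite combination of independent Gaussians with
  distinct indices. Its variance, a sum of squared coefficients, is regrouped into covariances by
  \<open>basis_cov\<close>.\<close>

lemma trunc_combination_gauss:
  fixes c :: "nat \<Rightarrow> real" and ys :: "nat \<Rightarrow> real" and ss :: "nat \<Rightarrow> nat \<Rightarrow> real" and amp :: "nat \<Rightarrow> real"
  shows "is_gauss (\<Sum>i<n. \<Sum>i'<n. c i * c i' * (\<Sum>j<N. (amp j)\<^sup>2 * ((ss i j * ss i' j + tent_cov Q (ss i j) (ss i' j)) * tent_cov P (ys i) (ys i'))))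
     (\<lambda>\<omega>. \<Sum>i<n. c i * (\<Sum>j<N. amp j * trunc_sheet Q P j (ys i) (ss i j) \<omega>))"
proof -
  define T where "T = tuples N Q P"
  define b where "b = (\<lambda>i (j, k, u, p, r). amp j * (tent p r (ys i) * tbasis k u (ss i j)))"
  define a where "a = (\<lambda>x. \<Sum>i<n. c i * b i x)"
  have inj: "inj_on gindex T"
    by (auto simp: inj_on_def gindex_def T_def tuples_def tindex_def split: if_splits)
  have fin: "finite T" by (simp add: T_def tuples_def)
  have "(\<Sum>i<n. c i * (\<Sum>j<N. amp j * trunc_sheet Q P j (ys i) (ss i j) \<omega>)) = (\<Sum>x\<in>T. a x * gauss (gindex x) \<omega>)" for \<omega>
  proof -
    have "(\<Sum>j<N. amp j * trunc_sheet Q P j (ys i) (ss i j) \<omega>) = (\<Sum>x\<in>T. b i x * gauss (gindex x) \<omega>)" for i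
      unfolding T_def sum_tuples trunc_sheet_eq b_def by (simp add: sum_distrib_left mult_ac del: sum.lessThan_Suc)
    then have "(\<Sum>i<n. c i * (\<Sum>j<N. amp j * trunc_sheet Q P j (ys i) (ss i j) \<omega>)) = (\<Sum>i<n. \<Sum>x\<in>T. c i * (b i x * gauss (gindex x) \<omega>))"
      by (simp add: sum_distrib_left)
    also have "\<dots> = (\<Sum>x\<in>T. \<Sum>i<n. c i * (b i x * gauss (gindex x) \<omega>))" by (rule sum.swap)
    finally show ?thesis by (simp add: a_def sum_distrib_right mult.assoc)
  qed
  then have X: "(\<lambda>\<omega>. \<Sum>i<n. c i * (\<Sum>j<N. amp j * trunc_sheet Q P j (ys i) (ss i j) \<omega>)) =
      (\<lambda>\<omega>. \<Sum>e\<in>gindex ` T. a (the_inv_into T gindex e) * gauss e \<omega>)"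
    by (simp add: sum.reindex [OF inj] the_inv_into_f_f [OF inj])
  have "(\<Sum>i<n. \<Sum>i'<n. c i * c i' * (\<Sum>j<N. (amp j)\<^sup>2 * ((ss i j * ss i' j + tent_cov Q (ss i j) (ss i' j)) * tent_cov P (ys i) (ys i')))) =
      (\<Sum>i<n. \<Sum>i'<n. c i * c i' * (\<Sum>x\<in>T. b i x * b i' x))"
    unfolding T_def sum_tuples b_def basis_cov [symmetric]
    by (simp add: sum_distrib_left power2_eq_square mult_ac del: sum.lessThan_Suc)
  also have "\<dots> = (\<Sum>i<n. \<Sum>i'<n. \<Sum>x\<in>T. (c i * b i x) * (c i' * b i' x))"
    by (simp add: sum_distrib_left mult_ac)
  also have "\<dots> = (\<Sum>i<n. \<Sum>x\<in>T. \<Sum>i'<n. (c i * b i x) * (c i' * b i' x))"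
    by (intro sum.cong refl sum.swap)
  also have "\<dots> = (\<Sum>x\<in>T. \<Sum>i<n. \<Sum>i'<n. (c i * b i x) * (c i' * b i' x))"
    by (rule sum.swap)
  also have "\<dots> = (\<Sum>x\<in>T. (a x)\<^sup>2)"
    by (simp add: a_def power2_eq_square sum_product)
  also have "\<dots> = (\<Sum>e\<in>gindex ` T. (a (the_inv_into T gindex e))\<^sup>2)"
    by (simp add: sum.reindex [OF inj] the_inv_into_f_f [OF inj])
  finally have V: "(\<Sum>i<n. \<Sum>i'<n. c i * c i' * (\<Sum>j<N. (amp j)\<^sup>2 * ((ss i j * ss i' j + tent_cov Q (ss i j) (ss i' j)) * tent_cov P (ys i) (ys i')))) =
      (\<Sum>e\<in>gindex ` T. (a (the_inv_into T gindex e))\<^sup>2)" .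
  show ?thesis unfolding X V
    by (rule is_gauss_sum) (use fin in \<open>auto simp: gindex_def gauss_index_def split: if_splits\<close>)
qed

text \<open>Two limits in succession: first \<open>P\<close> for the series in \<open>y\<close> with
  finitely many time levels \<open>Q\<close>, then \<open>Q\<close>. The order matters, because the
  completed inner series are the coefficients of the outer one.\<close>

lemma sheet_combination_gauss:
  fixes n :: nat and c ys amp :: "nat \<Rightarrow> real" and ss :: "nat \<Rightarrow> nat \<Rightarrow> real"
  assumes ys: "\<And>i. i < n \<Longrightarrow> ys i \<in> {0..1}" and ss: "\<And>i j. i < n \<Longrightarrow> ss i j \<in> {0..1}"
  shows "is_gauss (\<Sum>i<n. \<Sum>i'<n. c i * c i' * (\<Sum>j<N. (amp j)\<^sup>2 * (min (ss i j) (ss i' j) * (min (ys i) (ys i') - ys i * ys i'))))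
     (\<lambda>\<omega>. if all_good \<omega> then \<Sum>i<n. c i * (\<Sum>j<N. amp j * sheet (zeta j \<omega>) (inner j \<omega>) (ys i) (ss i j)) else 0)"
proof -
  define SQ where "SQ = (\<lambda>Q j y s \<omega>. s * schauder (zeta j \<omega>) y + (\<Sum>q<Q. level_sum (\<lambda>u. schauder (inner j \<omega> q u) y) q s))"
  note [measurable] = all_good_measurable
  have [measurable]: "(\<lambda>\<omega>. zeta j \<omega> p r) \<in> borel_measurable M" "(\<lambda>\<omega>. inner j \<omega> q u p r) \<in> borel_measurable M" for j p r q u
    by (simp_all add: zeta_def inner_def)
  have [measurable]: "(\<lambda>\<omega>. level_sum (f \<omega>) p y) \<in> borel_measurable M" if "\<And>r. (\<lambda>\<omega>. f \<omega> r) \<in> borel_measurable M" for f p y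
    unfolding level_sum_def using that by measurable
  have tm: "trunc_sheet Q P j y s \<in> borel_measurable M" for Q P j y s
    unfolding trunc_sheet_eq [abs_def] by measurable
  have sl: "(\<lambda>P. \<Sum>p<P. level_sum (f p) p y) \<longlonglongrightarrow> schauder f y" if "coeff_bound l f" for l f y
    unfolding schauder_def by (rule summable_LIMSEQ [OF level_sum_summable [OF that]])
  have l1: "(\<lambda>P. trunc_sheet Q P j y s \<omega>) \<longlonglongrightarrow> SQ Q j y s \<omega>" if g: "all_good \<omega>" for Q j y s \<omega>
  proof -
    obtain l where l: "0 \<le> l" "sheet_bound l (zeta j \<omega>) (inner j \<omega>)" using good_nonneg_ex [OF g] by blast
    show ?thesis unfolding trunc_sheet_def SQ_def level_sum_def [of _ _ s]
    proof (intro tendsto_intros)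
      show "(\<lambda>P. \<Sum>p<P. level_sum (zeta j \<omega> p) p y) \<longlonglongrightarrow> schauder (zeta j \<omega>) y"
        using l sl [of l "zeta j \<omega>" y] by (simp add: sheet_bound_def)
      fix q u assume "u \<in> {..<(2::nat)^q}"
      then show "(\<lambda>P. \<Sum>p<P. level_sum (inner j \<omega> q u p) p y) \<longlonglongrightarrow> schauder (inner j \<omega> q u) y"
        using l sl [of "l * sqrt (real (Suc q))" "inner j \<omega> q u" y] by (simp add: sheet_bound_def)
    qed
  qed
  have l2: "(\<lambda>Q. SQ Q j y s \<omega>) \<longlonglongrightarrow> sheet (zeta j \<omega>) (inner j \<omega>) y s" if g: "all_good \<omega>" and y: "y \<in> {0..1}" for j y s \<omega>
  proof -
    obtain l where l: "0 \<le> l" "sheet_bound l (zeta j \<omega>) (inner j \<omega>)" using good_nonneg_ex [OF g] by blast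
    show ?thesis unfolding SQ_def sheet_def
      by (intro tendsto_intros sl [OF sheet_inner_bound(2) [OF l(2,1) y]])
  qed
  have agm: "(\<lambda>\<omega>. if all_good \<omega> then f \<omega> else 0) \<in> borel_measurable M"
    if "\<And>P. fP P \<in> borel_measurable M" "\<And>\<omega>. all_good \<omega> \<Longrightarrow> (\<lambda>P. fP P \<omega>) \<longlonglongrightarrow> f \<omega>" for f :: "'w \<Rightarrow> real" and fP
  proof (rule borel_measurable_LIMSEQ_real [where u = "\<lambda>P \<omega>. if all_good \<omega> then fP P \<omega> else 0"])
    show "(\<lambda>\<omega>. if all_good \<omega> then fP P \<omega> else 0) \<in> borel_measurable M" for P
      by (rule measurable_If [OF that(1)]) (auto intro: all_good_measurable)
  qed (use that in auto)
  define Z where "Z = (\<lambda>Q \<omega>. if all_good \<omega> then \<Sum>i<n. c i * (\<Sum>j<N. amp j * SQ Q j (ys i) (ss i j) \<omega>) else 0)"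
  define Y where "Y = (\<lambda>\<omega>. if all_good \<omega> then \<Sum>i<n. c i * (\<Sum>j<N. amp j * sheet (zeta j \<omega>) (inner j \<omega>) (ys i) (ss i j)) else 0)"
  have ZP: "(\<lambda>P. \<Sum>i<n. c i * (\<Sum>j<N. amp j * trunc_sheet Q P j (ys i) (ss i j) \<omega>)) \<longlonglongrightarrow> (\<Sum>i<n. c i * (\<Sum>j<N. amp j * SQ Q j (ys i) (ss i j) \<omega>))" if "all_good \<omega>" for Q \<omega>
    by (intro tendsto_intros l1 that)
  have Zm: "Z Q \<in> borel_measurable M" for Q
    unfolding Z_def by (rule agm [OF _ ZP]) (use tm in measurable)
  have Zl: "(\<lambda>Q. Z Q \<omega>) \<longlonglongrightarrow> Y \<omega>" for \<omega>
    unfolding Z_def Y_def using l2 ys by (cases "all_good \<omega>") (auto intro!: tendsto_intros)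
  have Ym: "Y \<in> borel_measurable M"
    by (rule borel_measurable_LIMSEQ_real [OF Zl Zm])
  have ZG: "is_gauss (\<Sum>i<n. \<Sum>i'<n. c i * c i' * (\<Sum>j<N. (amp j)\<^sup>2 * ((ss i j * ss i' j + tent_cov Q (ss i j) (ss i' j)) * (min (ys i) (ys i') - ys i * ys i')))) (Z Q)" for Q
  proof (rule is_gauss_limit [OF Zm trunc_combination_gauss [where n = n and c = c and N = N and amp = amp and ss = ss and Q = Q and ys = ys]])
    show "AE \<omega> in M. (\<lambda>P. \<Sum>i<n. c i * (\<Sum>j<N. amp j * trunc_sheet Q P j (ys i) (ss i j) \<omega>)) \<longlonglongrightarrow> Z Q \<omega>"
      using AE_all_good by eventually_elim (use ZP in \<open>simp add: Z_def\<close>)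
  qed (intro tendsto_intros tent_cov_limit; use ys in auto)
  have "is_gauss (\<Sum>i<n. \<Sum>i'<n. c i * c i' * (\<Sum>j<N. (amp j)\<^sup>2 * ((ss i j * ss i' j + (min (ss i j) (ss i' j) - ss i j * ss i' j)) * (min (ys i) (ys i') - ys i * ys i')))) Y"
  proof (rule is_gauss_limit [OF Ym ZG])
    show "AE \<omega> in M. (\<lambda>Q. Z Q \<omega>) \<longlonglongrightarrow> Y \<omega>" using Zl by simp
  qed (intro tendsto_intros tent_cov_limit; use ss in auto)
  then show ?thesis by (simp add: Y_def)
qed

text \<open>The squared weights \<open>block_size j\<close> together with
  \<open>sum_block_time\<close> give the covariance. The value 0 off the parameter domain is needed
  because measurability is demanded for all real \<open>y\<close> and \<open>t\<close>.\<close>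

theorem kiefer_sum_kiefer_process:
  assumes m: "\<And>j. 0 < m j"
  shows "kiefer_process M (\<lambda>y t. if y \<in> {0..1} \<and> 0 \<le> t then kiefer_sum y t else (\<lambda>_. 0))"
proof -
  let ?K = "\<lambda>y t. if y \<in> {0..1} \<and> 0 \<le> t then kiefer_sum y t else (\<lambda>_. 0)"
  have comb: "is_gauss (\<Sum>i<n. \<Sum>i'<n. c i * c i' * kiefer_cov (ps i) (ps i')) (\<lambda>\<omega>. \<Sum>i<n. c i * kiefer_sum (fst (ps i)) (snd (ps i)) \<omega>)"
    if ps: "\<And>i. i < n \<Longrightarrow> fst (ps i) \<in> {0..1} \<and> 0 \<le> snd (ps i)"
    for n :: nat and c :: "nat \<Rightarrow> real" and ps :: "nat \<Rightarrow> real \<times> real"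
  proof -
    obtain N where N: "\<And>i. i < n \<Longrightarrow> snd (ps i) \<le> real N"
    proof -
      have "snd (ps i) \<le> real (\<Sum>i<n. nat \<lceil>snd (ps i)\<rceil>)" if "i < n" for i
      proof -
        have "nat \<lceil>snd (ps i)\<rceil> \<le> (\<Sum>i<n. nat \<lceil>snd (ps i)\<rceil>)" using that by (intro member_le_sum) auto
        then show ?thesis by linarith
      qed
      then show ?thesis using that by blast
    qed
    have g: "is_gauss (\<Sum>i<n. \<Sum>i'<n. c i * c i' * (\<Sum>j<N. (- sqrt (real (m j)))\<^sup>2 * (min (block_time m j (snd (ps i))) (block_time m j (snd (ps i'))) * (min (fst (ps i)) (fst (ps i')) - fst (ps i) * fst (ps i')))))
      (\<lambda>\<omega>. if all_good \<omega> then \<Sum>i<n. c i * (\<Sum>j<N. - sqrt (real (m j)) * sheet (zeta j \<omega>) (inner j \<omega>) (fst (ps i)) (block_time m j (snd (ps i)))) else 0)"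
      using ps block_time_range by (intro sheet_combination_gauss) auto
    have v: "(\<Sum>j<N. (- sqrt (real (m j)))\<^sup>2 * (min (block_time m j (snd (ps i))) (block_time m j (snd (ps i'))) * (min (fst (ps i)) (fst (ps i')) - fst (ps i) * fst (ps i')))) = kiefer_cov (ps i) (ps i')"
      if "i < n" "i' < n" for i i'
    proof -
      have "(\<Sum>j<N. real (m j) * block_time m j (min (snd (ps i)) (snd (ps i')))) = min (snd (ps i)) (snd (ps i'))"
        using that ps N by (intro sum_block_time m) (auto simp: min_le_iff_disj)
      then show ?thesis
        by (simp add: block_time_min kiefer_cov_def sum_distrib_right [symmetric] mult.assoc [symmetric])
    qed
    have x: "(\<lambda>\<omega>. if all_good \<omega> then \<Sum>i<n. c i * (\<Sum>j<N. - sqrt (real (m j)) * sheet (zeta j \<omega>) (inner j \<omega>) (fst (ps i)) (block_time m j (snd (ps i)))) else 0) =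
        (\<lambda>\<omega>. \<Sum>i<n. c i * kiefer_sum (fst (ps i)) (snd (ps i)) \<omega>)"
    proof
      fix \<omega>
      show "(if all_good \<omega> then \<Sum>i<n. c i * (\<Sum>j<N. - sqrt (real (m j)) * sheet (zeta j \<omega>) (inner j \<omega>) (fst (ps i)) (block_time m j (snd (ps i)))) else 0) = (\<Sum>i<n. c i * kiefer_sum (fst (ps i)) (snd (ps i)) \<omega>)"
      proof (cases "all_good \<omega>")
        case True
        then show ?thesis using kiefer_sum_eq [OF m True N] by (simp add: sum_negf)
      qed (simp add: kiefer_sum_def)
    qed
    have V: "(\<Sum>i<n. \<Sum>i'<n. c i * c i' * (\<Sum>j<N. (- sqrt (real (m j)))\<^sup>2 * (min (block_time m j (snd (ps i))) (block_time m j (snd (ps i'))) * (min (fst (ps i)) (fst (ps i')) - fst (ps i) * fst (ps i'))))) =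
      (\<Sum>i<n. \<Sum>i'<n. c i * c i' * kiefer_cov (ps i) (ps i'))"
    proof (intro sum.cong refl)
      fix i i' assume "i \<in> {..<n}" "i' \<in> {..<n}"
      then show "c i * c i' * (\<Sum>j<N. (- sqrt (real (m j)))\<^sup>2 * (min (block_time m j (snd (ps i))) (block_time m j (snd (ps i'))) * (min (fst (ps i)) (fst (ps i')) - fst (ps i) * fst (ps i')))) = c i * c i' * kiefer_cov (ps i) (ps i')"
        using v [of i i'] by (simp only: lessThan_iff)
    qed
    show ?thesis using g unfolding x V .
  qed
  have Km: "kiefer_sum y t \<in> borel_measurable M" if "y \<in> {0..1}" "0 \<le> t" for y t
    using is_gauss_borel [OF comb [of 1 "\<lambda>_. (y, t)" "\<lambda>_. 1"]] that by simp
  show ?thesis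
    unfolding kiefer_process_def
  proof (intro conjI allI ballI impI)
    show "?K y t \<in> borel_measurable M" for y t using Km by auto
    show "continuous_on ({0..1} \<times> {0..}) (\<lambda>(y, t). ?K y t \<omega>)" for \<omega>
      by (rule continuous_on_eq [OF kiefer_sum_continuous [OF m, of \<omega>]]) auto
    fix ps :: "(real \<times> real) list" and cs :: "real list"
    assume a: "length cs = length ps \<and> (\<forall>p\<in>set ps. 0 \<le> fst p \<and> fst p \<le> 1 \<and> 0 \<le> snd p)"
    then have ps: "fst (ps ! i) \<in> {0..1} \<and> 0 \<le> snd (ps ! i)" if "i < length ps" for i
      using that nth_mem by fastforce
    define v where "v = (\<Sum>j<length ps. \<Sum>k<length ps. cs ! j * cs ! k * kiefer_cov (ps ! j) (ps ! k))"
    define Y where "Y = (\<lambda>\<omega>. \<Sum>i<length ps. cs ! i * kiefer_sum (fst (ps ! i)) (snd (ps ! i)) \<omega>)"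
    have g: "is_gauss v Y" unfolding v_def Y_def by (rule comb) (rule ps)
    \<comment> \<open>Nonnegativity of the covariance form comes for free: for negative
      \<open>v\<close> the characteristic function would exceed 1 in modulus.\<close>
    have "0 \<le> v"
    proof (rule ccontr)
      assume "\<not> 0 \<le> v"
      then have "1 < exp (- (v * 1\<^sup>2) / 2)" by simp
      moreover have "cmod (char (distr M borel Y) 1) \<le> 1"
        by (rule real_distribution.cmod_char_le_1) (use is_gauss_borel [OF g] in \<open>auto intro!: real_distribution_distr\<close>)
      moreover have "char (distr M borel Y) 1 = complex_of_real (exp (- (v * 1\<^sup>2) / 2))"
        using g unfolding is_gauss_def by blast
      ultimately show False by simp
    qed
    moreover have "(\<lambda>\<omega>. \<Sum>j<length ps. cs ! j * ?K (fst (ps ! j)) (snd (ps ! j)) \<omega>) = Y"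
      unfolding Y_def using ps by (intro ext sum.cong) auto
    ultimately show "centered_gaussian_rv M (\<lambda>\<omega>. \<Sum>j<length ps. cs ! j * ?K (fst (ps ! j)) (snd (ps ! j)) \<omega>)
        (\<Sum>j<length ps. \<Sum>k<length ps. cs ! j * cs ! k * kiefer_cov (ps ! j) (ps ! k))"
      using is_gauss_centered [OF g] by (simp add: v_def)
  qed
qed

end

section \<open>Coupling inside one block\<close>

text \<open>Only a lower bound on \<open>alpha\<close> matters: when it is large, the rate \<open>n powr (-1/64)\<close> of the quantile coupling
  beats all losses that are polynomial in \<open>block_scale\<close>.\<close>

definition alpha :: nat where "alpha = 1152"

text \<open>\<open>block_scale j\<close> is the largest power of two up to \<open>j + 1\<close>.
  Polynomial growth is thus expressed by powers of two, so that a block can be halved evenly at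
  every node.\<close>

definition block_level :: "nat \<Rightarrow> nat" where "block_level j = floor_log (Suc j)"

definition block_scale :: "nat \<Rightarrow> real" where "block_scale j = 2 ^ block_level j"

definition block_size :: "nat \<Rightarrow> nat" where "block_size j = 2 ^ (8 * (alpha * block_level j))"

text \<open>The leaves of a block of \<open>m\<close> points have width
  \<open>m powr (-3/4)\<close>, finer than the fluctuation scale \<open>m powr (-1/2)\<close>, and
  still each node expects a whole number \<open>m / 2^p\<close> of visitors.\<close>

definition block_depth :: "nat \<Rightarrow> nat" where "block_depth j = 6 * (alpha * block_level j)"

text \<open>The expected number of visitors of a splitting node. All other indices get no coins, and
  then \<open>quant e\<close> is just \<open>X e\<close>.\<close>

definition coin_count :: "nat list \<Rightarrow> nat" where
  "coin_count e = (case e of [t, j, p, r] \<Rightarrow> if t = 1 \<and> p < block_depth j then 2 ^ (8 * (alpha * block_level j) - p) else 0 | _ \<Rightarrow> 0)"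

lemma alpha_ge: "1152 \<le> alpha" by (simp add: alpha_def)

lemma block_scale_bounds: "1 \<le> block_scale j" "block_scale j \<le> real (Suc j)" "real (Suc j) \<le> 2 * block_scale j"
proof -
  show "1 \<le> block_scale j" by (simp add: block_scale_def)
  have "2 ^ block_level j \<le> Suc j" unfolding block_level_def by (rule floor_log_exp2_le) simp
  from of_nat_mono [OF this, where 'a=real] show "block_scale j \<le> real (Suc j)" by (simp add: block_scale_def)
  have "Suc j < 2 * 2 ^ block_level j" unfolding block_level_def by (rule floor_log_exp2_gt)
  then have "real (Suc j) \<le> real (2 * 2 ^ block_level j)" by (intro of_nat_mono) simp
  then show "real (Suc j) \<le> 2 * block_scale j" by (simp add: block_scale_def)
qed

lemma block_size_pos: "0 < block_size j" by (simp add: block_size_def)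

lemma block_size_block_scale: "real (block_size j) = block_scale j ^ (8 * alpha)" and sqrt_block_size: "sqrt (real (block_size j)) = block_scale j ^ (4 * alpha)"
proof -
  show a: "real (block_size j) = block_scale j ^ (8 * alpha)"
    by (simp add: block_size_def block_scale_def mult_ac flip: power_mult)
  have "block_scale j ^ (8 * alpha) = (block_scale j ^ (4 * alpha))\<^sup>2" by (simp flip: power_mult)
  then show "sqrt (real (block_size j)) = block_scale j ^ (4 * alpha)"
    using block_scale_bounds(1) [of j] by (simp only: a) (simp add: real_sqrt_unique)
qed

lemma block_level_le_block_scale: "real (block_level j) \<le> block_scale j"
proof -
  have "block_level j \<le> 2 ^ block_level j" by (simp add: less_imp_le)
  from of_nat_mono [OF this, where 'a=real] show ?thesis by (simp add: block_scale_def)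
qed

section \<open>Walks along the tree and second differences\<close>

lemma sum_signs: "(\<Sum>i<n. if P i then 1 else - 1) = 2 * real (card {i. i < n \<and> P i}) - real n"
proof (induction n)
  case (Suc n)
  have "{i. i < Suc n \<and> P i} = (if P n then insert n {i. i < n \<and> P i} else {i. i < n \<and> P i})"
    by (auto simp: less_Suc_eq)
  then show ?case using Suc by simp
qed simp

lemma rank_bij:
  fixes y :: "nat \<Rightarrow> nat"
  shows "bij_betw (\<lambda>i. card {i'. i' < i \<and> y i' = y i}) {i. i < m \<and> y i = r} {..<card {i. i < m \<and> y i = r}}"
proof -
  let ?A = "{i. i < m \<and> y i = r}" and ?f = "\<lambda>i. card {i'. i' < i \<and> y i' = y i}"
  have inj: "inj_on ?f ?A"
  proof (rule inj_onI)
    fix i k assume "i \<in> ?A" "k \<in> ?A" "?f i = ?f k"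
    then show "i = k" using rank_inj [of y i k] by simp
  qed
  have sub: "?f ` ?A \<subseteq> {..<card ?A}"
  proof (clarsimp)
    fix i assume "i < m" "r = y i"
    then show "card {i'. i' < i \<and> y i' = y i} < card {ia. ia < m \<and> y ia = y i}"
      by (intro psubset_card_mono) auto
  qed
  have "card (?f ` ?A) = card {..<card ?A}" unfolding card_image [OF inj] by simp
  then have "?f ` ?A = {..<card ?A}"
    by (rule card_subset_eq [OF finite_lessThan sub])
  with inj show ?thesis by (simp add: bij_betw_def)
qed

text \<open>The visitors of a node read its coins in order and without gaps, by
  \<open>rank_bij\<close>. The difference of the children is therefore a partial sum of one fixed
  walk, stopped at the number of visitors.\<close>

lemma node_children:
  defines "N \<equiv> \<lambda>c p r m. card {i. i < m \<and> node c p i = r}"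
  shows "real (N c (Suc p) (2*r) m) - real (N c (Suc p) (2*r+1) m) = (\<Sum>k<N c p r m. if c p r k then 1 else - 1)"
proof -
  let ?A = "{i. i < m \<and> node c p i = r}" and ?f = "\<lambda>i. card {i'. i' < i \<and> node c p i' = node c p i}"
  have fin: "finite ?A" by simp
  have e0: "{i. i < m \<and> node c (Suc p) i = 2*r} = {i \<in> ?A. c p r (?f i)}"
    and e1: "{i. i < m \<and> node c (Suc p) i = 2*r+1} = {i \<in> ?A. \<not> c p r (?f i)}"
    by (auto split: if_splits) presburger+
  have "(\<Sum>k<N c p r m. if c p r k then 1 else - 1 :: real) = (\<Sum>i\<in>?A. if c p r (?f i) then 1 else - 1)"
    unfolding N_def by (rule sum.reindex_bij_betw [OF rank_bij, symmetric])
  also have "\<dots> = real (card {i \<in> ?A. c p r (?f i)}) - real (card {i \<in> ?A. \<not> c p r (?f i)})"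
    by (subst sum.If_cases [OF fin]) (simp add: Int_def)
  finally show ?thesis unfolding N_def e0 e1 by simp
qed

locale coupling = uniform_family M X coin_count block_depth block_size for M :: "'w measure" and X
begin

definition block_dev :: "nat \<Rightarrow> nat \<Rightarrow> real \<Rightarrow> 'w \<Rightarrow> real" where
  "block_dev j u y \<omega> = real (card {i. i < u \<and> sample (j, i) \<omega> \<le> y}) - real u * y"

definition walk :: "nat list \<Rightarrow> nat \<Rightarrow> 'w \<Rightarrow> real" where
  "walk e k \<omega> = (\<Sum>i<k. if coin e i \<omega> then 1 else - 1)"

lemma coin_count_node: "p < block_depth j \<Longrightarrow> coin_count [1, j, p, r] = 2 ^ (8 * (alpha * block_level j) - p)"
  by (simp add: coin_count_def)

lemma walk_heads: "walk e (coin_count e) \<omega> = 2 * real (card (heads e \<omega>)) - real (coin_count e)"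
  unfolding walk_def sum_signs heads_def ..

text \<open>The position inside a leaf is strictly between 0 and 1, so comparison with a grid point
  of level \<open>p\<close> depends on the node of level \<open>p\<close> only.\<close>

lemma sample_le_grid:
  assumes w: "\<omega> \<in> space M" and p: "p \<le> block_depth j"
  shows "sample (j, i) \<omega> \<le> real k / 2^p \<longleftrightarrow> node (split_coin j \<omega>) p i < k"
proof -
  define l where "l = leaf (j, i) \<omega>"
  define V where "V = X [3, j, i] \<omega>"
  have V: "0 < V" "V < 1" using range_X [OF w] by (simp_all add: V_def)
  obtain d where d: "block_depth j = p + d" using p le_Suc_ex by blast
  have "sample (j, i) \<omega> \<le> real k / 2^p \<longleftrightarrow> real l + V \<le> real k * 2^d"
  proof -
    have "a / (P * D) \<le> c / P \<longleftrightarrow> a \<le> c * D" if "0 < P" "0 < D" for a c P D :: real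
    proof -
      have "a / (P * D) = (a / D) / P" by simp
      then show ?thesis using that by (simp only: divide_le_cancel pos_divide_le_eq) auto
    qed
    from this [of "2^p" "2^d"] show ?thesis by (simp add: sample_def l_def V_def d power_add)
  qed
  also have "\<dots> \<longleftrightarrow> real l + V \<le> real (k * 2^d)" by simp
  also have "\<dots> \<longleftrightarrow> l < k * 2^d" using V by linarith
  also have "\<dots> \<longleftrightarrow> l div 2^d < k" by (simp add: div_less_iff_less_mult)
  also have "l div 2^d = node (split_coin j \<omega>) p i"
    using node_div [of "split_coin j \<omega>" p d i] by (simp add: l_def leaf_def d)
  finally show ?thesis .
qed

lemma block_dev_grid:
  assumes w: "\<omega> \<in> space M" and p: "p \<le> block_depth j"
  shows "block_dev j u (real k / 2^p) \<omega> = real (card {i. i < u \<and> node (split_coin j \<omega>) p i < k}) - real u * (real k / 2^p)"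
  by (simp add: block_dev_def sample_le_grid [OF w p])

lemma card_less_Suc: "card {i. i < u \<and> f i < Suc k} = card {i. i < u \<and> f i < k} + card {i. i < (u::nat) \<and> f i = k}"
proof -
  have "{i. i < u \<and> f i < Suc k} = {i. i < u \<and> f i < k} \<union> {i. i < u \<and> f i = k}" by auto
  then show ?thesis by (simp only:) (rule card_Un_disjoint, auto)
qed

definition visits :: "nat \<Rightarrow> nat \<Rightarrow> nat \<Rightarrow> 'w \<Rightarrow> nat" where
  "visits j p r \<omega> = card {i. i < block_size j \<and> node (split_coin j \<omega>) p i = r}"

text \<open>The linear centering has zero second difference, so only the difference of the visitor
  numbers of the two children remains.\<close>

lemma block_dev_second_difference:
  assumes w: "\<omega> \<in> space M" and p: "p < block_depth j"
  defines "f \<equiv> \<lambda>y. block_dev j (block_size j) y \<omega>"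
  shows "2 * f ((real r + 1/2) / 2^p) - f (real r / 2^p) - f ((real r + 1) / 2^p) = walk [1, j, p, r] (visits j p r \<omega>) \<omega>"
proof -
  have g: "(real r + 1/2) / 2^p = real (2*r+1) / 2^Suc p" "real r / 2^p = real (2*r) / 2^Suc p" "(real r + 1) / 2^p = real (2*r+2) / 2^Suc p"
    by (simp_all add: field_simps)
  define m where "m = block_size j"
  define c where "c = (\<lambda>k. card {i. i < m \<and> node (split_coin j \<omega>) (Suc p) i < k})"
  define e where "e = (\<lambda>k. card {i. i < m \<and> node (split_coin j \<omega>) (Suc p) i = k})"
  have f: "f (real k / 2^Suc p) = real (c k) - real m * (real k / 2^Suc p)" for k
    unfolding f_def c_def m_def by (rule block_dev_grid [OF w]) (use p in simp)
  have "c (2*r+1) = c (2*r) + e (2*r)" "c (2*r+2) = c (2*r+1) + e (2*r+1)"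
    using card_less_Suc [of m "node (split_coin j \<omega>) (Suc p)" "2*r"] card_less_Suc [of m "node (split_coin j \<omega>) (Suc p)" "2*r+1"]
    by (simp_all add: c_def e_def del: node.simps)
  then have "2 * f ((real r + 1/2) / 2^p) - f (real r / 2^p) - f ((real r + 1) / 2^p) = real (e (2*r)) - real (e (2*r+1))"
    unfolding g f by (simp add: field_simps)
  also have "\<dots> = (\<Sum>k<visits j p r \<omega>. if split_coin j \<omega> p r k then 1 else - 1)"
    unfolding e_def visits_def m_def by (rule node_children)
  finally show ?thesis by (simp add: walk_def split_coin_def)
qed

lemma block_dev_0: "\<omega> \<in> space M \<Longrightarrow> block_dev j u 0 \<omega> = 0" and block_dev_1: "\<omega> \<in> space M \<Longrightarrow> block_dev j u 1 \<omega> = 0"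
proof -
  assume w: "\<omega> \<in> space M"
  have "{i. i < u \<and> sample (j, i) \<omega> \<le> 0} = {}" "{i. i < u \<and> sample (j, i) \<omega> \<le> 1} = {..<u}"
    using sample_range [OF w] by (auto simp: not_le less_imp_le)
  then show "block_dev j u 0 \<omega> = 0" "block_dev j u 1 \<omega> = 0" by (simp_all add: block_dev_def)
qed

lemma block_dev_grid_expansion:
  assumes w: "\<omega> \<in> space M" and k: "k \<le> 2 ^ block_depth j"
  shows "block_dev j (block_size j) (real k / 2 ^ block_depth j) \<omega> =
    (\<Sum>p<block_depth j. level_sum (\<lambda>r. sqrt 2 ^ p * walk [1, j, p, r] (visits j p r \<omega>) \<omega>) p (real k / 2 ^ block_depth j))"
  using schauder_interpolation [OF k, of "\<lambda>y. block_dev j (block_size j) y \<omega>"]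
  by (simp add: block_dev_0 [OF w] block_dev_1 [OF w] block_dev_second_difference [OF w])

lemma tent_grid_zero:
  assumes "P \<le> p" shows "tent p r (real k / 2^P) = 0"
proof -
  obtain d where d: "p = P + d" using assms le_Suc_ex by blast
  have "2^p * (real k / 2^P) - real r = of_int (int k * 2^d - int r)"
    by (simp add: d power_add)
  moreover have "hat (of_int z) = 0" for z
  proof (rule hat_eq_0)
    show "real_of_int z \<le> 0 \<or> 1 \<le> real_of_int z" by (cases "z \<le> 0") auto
  qed
  ultimately show ?thesis by (simp only: tent_def div_0)
qed

lemma schauder_grid:
  assumes "coeff_bound l c"
  shows "schauder c (real k / 2^P) = (\<Sum>p<P. level_sum (c p) p (real k / 2^P))"
  unfolding schauder_def
  by (rule suminf_finite) (auto simp: level_sum_def tent_grid_zero not_less)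

text \<open>The summands stand for the growth of the centering across one grid cell, the oscillation
  of the bridge across one cell, and the coefficient errors summed over the levels.\<close>

definition block_const :: real where
  "block_const = 1 + 2 * holder_const + 3 * real alpha * (9 + 16 * real alpha)"

text \<open>The pathwise part of the coupling. On the grid the two expansions are compared
  coefficient by coefficient, in two moves: from the actual to the expected number of coins, and
  from the coin sum to the Gaussian. Between grid points monotonicity of the counts and the Hoelder
  bound of the bridge suffice.\<close>

lemma block_coupling_det:
  assumes w: "\<omega> \<in> space M" and W: "1 \<le> W" "W \<le> 2 * block_scale j"
    and ev1: "\<And>r. r \<le> block_size j \<Longrightarrow> \<bar>block_dev j (block_size j) (real r / real (block_size j)) \<omega>\<bar> \<le> sqrt (real (block_size j)) * W"
    and ev2: "\<And>p r k. p < block_depth j \<Longrightarrow> r < 2^p \<Longrightarrow> k \<le> block_size j \<Longrightarrow>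
        \<bar>walk [1, j, p, r] k \<omega> - walk [1, j, p, r] (coin_count [1, j, p, r]) \<omega>\<bar> \<le> sqrt \<bar>real k - real (coin_count [1, j, p, r])\<bar> * W"
    and ev3: "coeff_bound W (zeta j \<omega>)"
    and ev4: "\<And>p r. p < 16 * block_level j \<Longrightarrow> r < 2^p \<Longrightarrow>
        \<bar>walk [1, j, p, r] (coin_count [1, j, p, r]) \<omega> / sqrt (real (coin_count [1, j, p, r])) - zeta j \<omega> p r\<bar> \<le> real (coin_count [1, j, p, r]) powr (- 1/64)"
    and y: "y \<in> {0..1}"
  shows "\<bar>block_dev j (block_size j) y \<omega> - sqrt (real (block_size j)) * schauder (zeta j \<omega>) y\<bar> \<le> block_const * sqrt (real (block_size j)) / (block_scale j)\<^sup>2"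
proof -
  define x where "x = block_scale j"
  define s where "s = sqrt (real (block_size j))"
  define m where "m = real (block_size j)"
  define L where "L = block_depth j"
  define n where "n = (\<lambda>p. real (2 ^ (8 * (alpha * block_level j) - p)))"
  define V where "V = (\<lambda>p r. walk [1, j, p, r] (visits j p r \<omega>) \<omega>)"
  have x: "1 \<le> x" using block_scale_bounds by (simp add: x_def)
  have W2: "W \<le> 2 * x" using W by (simp add: x_def)
  have s: "s = x ^ (4 * alpha)" "1 \<le> s" "m = s * s"
  proof -
    show a: "s = x ^ (4 * alpha)" by (simp add: s_def x_def sqrt_block_size)
    show "1 \<le> s" using x by (simp add: a)
    show "m = s * s" by (simp add: m_def s_def)
  qed
  have Lle: "L \<le> 8 * (alpha * block_level j)" by (simp add: L_def block_depth_def)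
  have nm: "n p * 2^p = m" if "p < L" for p
  proof -
    have "8 * (alpha * block_level j) - p + p = 8 * (alpha * block_level j)" using that Lle by simp
    then have "(2::real) ^ (8 * (alpha * block_level j) - p) * 2^p = 2 ^ (8 * (alpha * block_level j))"
      by (simp only: power_add [symmetric])
    then show ?thesis by (simp add: n_def m_def block_size_def)
  qed
  have nn: "coin_count [1, j, p, r] = 2 ^ (8 * (alpha * block_level j) - p)" if "p < L" for p r
    using that unfolding L_def by (rule coin_count_node)
  have nr: "real (coin_count [1, j, p, r]) = n p" if "p < L" for p r
    unfolding nn [OF that] n_def ..
  have n1: "1 \<le> n p" for p by (simp add: n_def)
  have ss: "s = sqrt 2 ^ p * sqrt (n p)" if "p < L" for p
  proof -
    have "s = sqrt (n p * 2^p)" by (simp add: nm [OF that] s_def m_def)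
    then show ?thesis by (simp add: real_sqrt_mult real_sqrt_power)
  qed
  have Lx: "real L \<le> 6 * real alpha * x"
    using mult_left_mono [OF block_level_le_block_scale [of j], of "real alpha"] by (simp add: L_def block_depth_def x_def)
  \<comment> \<open>The number of visitors is an increment of the counting function over one cell.
    Since \<open>2^p\<close> divides the block size, the cell ends belong to the grid of
    \<open>ev1\<close>.\<close>
  have vis: "\<bar>real (visits j p r \<omega>) - n p\<bar> \<le> 2 * s * W" if p: "p < L" and r: "r < 2^p" for p r
  proof -
    define R where "R = (2::nat) ^ (8 * (alpha * block_level j) - p)"
    have Rm: "R * 2^p = block_size j"
    proof -
      have "8 * (alpha * block_level j) - p + p = 8 * (alpha * block_level j)" using that Lle by simp
      then show ?thesis by (simp only: R_def block_size_def power_add [symmetric])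
    qed
    have g: "real k / 2^p = real (k * R) / real (block_size j)" for k
      unfolding Rm [symmetric] by (simp add: R_def)
    have b: "\<bar>block_dev j (block_size j) (real k / 2^p) \<omega>\<bar> \<le> s * W" if "k \<le> 2^p" for k
    proof -
      have "k * R \<le> block_size j" using mult_le_mono1 [OF that, of R] by (simp add: Rm [symmetric] mult.commute)
      then show ?thesis unfolding g s_def by (rule ev1)
    qed
    have "real (visits j p r \<omega>) - n p = block_dev j (block_size j) (real (Suc r) / 2^p) \<omega> - block_dev j (block_size j) (real r / 2^p) \<omega>"
    proof -
      have "m / 2^p = n p" using nm [OF p] by (simp add: field_simps)
      then have "m * (real (Suc r) / 2^p) - m * (real r / 2^p) = n p"
        by (simp add: add_divide_distrib distrib_left)
      moreover have "p \<le> block_depth j" using p by (simp add: L_def)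
      ultimately show ?thesis
        unfolding block_dev_grid [OF w \<open>p \<le> block_depth j\<close>] visits_def card_less_Suc m_def by simp
    qed
    then show ?thesis using b [of "Suc r"] b [of r] r by (simp add: Suc_le_eq abs_le_iff)
  qed
  have visle: "visits j p r \<omega> \<le> block_size j" for p r
    using card_mono [of "{..<block_size j}" "{i. i < block_size j \<and> node (split_coin j \<omega>) p i = r}"] by (auto simp: visits_def)
  \<comment> \<open>The stretch between actual and expected number of coins has length at most
    \<open>2 * s * W\<close>, so the walk moves there by about the square root of \<open>s\<close>,
    much less than \<open>s / x^6\<close>.\<close>
  have V1: "\<bar>V p r - walk [1, j, p, r] (coin_count [1, j, p, r]) \<omega>\<bar> \<le> 8 * s / x^6" if p: "p < L" and r: "r < 2^p" for p r
  proof -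
    have "\<bar>V p r - walk [1, j, p, r] (coin_count [1, j, p, r]) \<omega>\<bar> \<le> sqrt \<bar>real (visits j p r \<omega>) - n p\<bar> * W"
      using ev2 [of p r "visits j p r \<omega>"] p r visle unfolding V_def nr [OF p] L_def by blast
    also have "\<dots> \<le> sqrt (2 * s * W) * W"
      using vis [OF p r] W by (intro mult_right_mono) auto
    also have "\<dots> \<le> sqrt ((2 * x ^ (2 * alpha) * W)\<^sup>2) * W"
    proof -
      have "2 * s * W \<le> (2 * x ^ (2 * alpha) * W)\<^sup>2"
      proof -
        have "s = (x ^ (2 * alpha))\<^sup>2" by (simp add: s(1) flip: power_mult)
        then have "(2 * x ^ (2 * alpha) * W)\<^sup>2 = 2 * s * W * (2 * W)" by (simp add: power2_eq_square)
        moreover have "2 * s * W * 1 \<le> 2 * s * W * (2 * W)" using s W by (intro mult_left_mono) auto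
        ultimately show ?thesis by simp
      qed
      then show ?thesis using W by (intro mult_right_mono real_sqrt_le_mono) auto
    qed
    also have "\<dots> = 2 * x ^ (2 * alpha) * W * W" using x W by (simp add: abs_mult)
    also have "\<dots> \<le> 2 * x ^ (2 * alpha) * (2 * x) * (2 * x)"
      using x W W2 by (intro mult_mono) auto
    also have "\<dots> = 8 * x ^ (2 * alpha + 2)" by (simp add: power_add power2_eq_square)
    also have "\<dots> \<le> 8 * (s / x^6)"
    proof -
      have "x ^ (2 * alpha + 2) * x^6 \<le> s"
        unfolding s(1) power_add [symmetric] using x alpha_ge by (intro power_increasing) auto
      then show ?thesis using x by (simp add: pos_le_divide_eq)
    qed
    finally show ?thesis by simp
  qed
  \<comment> \<open>Below level \<open>16 * block_level j\<close> the nodes hold at least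
    \<open>s\<close> coins and the quantile coupling applies. Deeper down
    \<open>sqrt (n p) <= s / x^8\<close>, so the coin sum and the Gaussian term are both small and
    need not be compared.\<close>
  have V2: "\<bar>walk [1, j, p, r] (coin_count [1, j, p, r]) \<omega> - sqrt (n p) * zeta j \<omega> p r\<bar> \<le> (1 + 16 * real alpha) * s / x^6" if p: "p < L" and r: "r < 2^p" for p r
  proof (cases "p < 16 * block_level j")
    case True
    have sn: "0 < sqrt (n p)" using n1 [of p] by simp
    have "s * x^16 \<le> m"
    proof -
      have "x^16 \<le> s" unfolding s(1) using x alpha_ge by (intro power_increasing) auto
      then show ?thesis using s by simp
    qed
    moreover have "(2::real)^p \<le> x^16"
    proof -
      have "(2::real)^p \<le> 2^(16 * block_level j)" using True by (intro power_increasing) auto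
      also have "\<dots> = x^16" by (simp add: x_def block_scale_def mult.commute flip: power_mult)
      finally show ?thesis .
    qed
    ultimately have "s * 2^p \<le> n p * 2^p"
      unfolding nm [OF p] using s(2) by (meson mult_left_mono order_trans zero_le_one)
    then have ns: "s \<le> n p" by simp
    have nle: "sqrt (n p) \<le> s"
      unfolding ss [OF p] using n1 [of p] by (simp add: mult_le_cancel_right1)
    have "\<bar>walk [1, j, p, r] (coin_count [1, j, p, r]) \<omega> / sqrt (n p) - zeta j \<omega> p r\<bar> \<le> n p powr (- 1/64)"
      using ev4 [OF True r] unfolding nr [OF p] .
    also have "\<dots> \<le> s powr (- 1/64)" using ns s(2) by (intro powr_mono2') auto
    also have "\<dots> = x powr (- (real (4 * alpha) / 64))"
      using x by (simp add: s(1) powr_realpow [symmetric] powr_powr del: of_nat_mult)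
    also have "\<dots> \<le> x powr (- 6)"
      using x alpha_ge by (intro powr_mono) auto
    also have "\<dots> = 1 / x^6" using x by (simp add: powr_minus_divide)
    finally have 1: "\<bar>walk [1, j, p, r] (coin_count [1, j, p, r]) \<omega> / sqrt (n p) - zeta j \<omega> p r\<bar> \<le> 1 / x^6" .
    have "walk [1, j, p, r] (coin_count [1, j, p, r]) \<omega> - sqrt (n p) * zeta j \<omega> p r = sqrt (n p) * (walk [1, j, p, r] (coin_count [1, j, p, r]) \<omega> / sqrt (n p) - zeta j \<omega> p r)"
      using sn by (simp add: right_diff_distrib)
    also have "\<bar>\<dots>\<bar> \<le> s * (1 / x^6)"
      unfolding abs_mult using 1 nle sn s(2) by (intro mult_mono) auto
    also have "\<dots> \<le> (1 + 16 * real alpha) * s / x^6"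
    proof -
      have "1 * (s / x^6) \<le> (1 + 16 * real alpha) * (s / x^6)"
        using s(2) x by (intro mult_right_mono) auto
      then show ?thesis by simp
    qed
    finally show ?thesis .
  next
    case False
    have "x^16 \<le> 2^p"
    proof -
      have "x^16 = 2^(16 * block_level j)" by (simp add: x_def block_scale_def mult.commute flip: power_mult)
      also have "\<dots> \<le> (2::real)^p" using False by (intro power_increasing) auto
      finally show ?thesis .
    qed
    then have "x^16 * n p \<le> m" unfolding nm [OF p, symmetric] using n1 [of p] by (simp add: mult.commute)
    then have "n p \<le> m / x^16" using x by (simp add: pos_le_divide_eq mult.commute)
    also have "m / x^16 = (s / x^8)\<^sup>2"
      by (simp add: s(3) power_divide power2_eq_square [of s] flip: power_mult)
    finally have "n p \<le> (s / x^8)\<^sup>2" .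
    then have sn: "sqrt (n p) \<le> s / x^8"
      using s(2) x n1 [of p] by (intro real_le_lsqrt) auto
    have "\<bar>walk [1, j, p, r] 0 \<omega> - walk [1, j, p, r] (coin_count [1, j, p, r]) \<omega>\<bar> \<le> sqrt \<bar>real 0 - n p\<bar> * W"
      using ev2 [of p r 0] p r unfolding nr [OF p] L_def by blast
    then have a: "\<bar>walk [1, j, p, r] (coin_count [1, j, p, r]) \<omega>\<bar> \<le> sqrt (n p) * W"
      using n1 [of p] by (simp add: walk_def)
    have z: "\<bar>zeta j \<omega> p r\<bar> \<le> W * (real L)"
    proof -
      have "\<bar>zeta j \<omega> p r\<bar> \<le> W * sqrt (real (Suc p))" using ev3 r by (simp add: coeff_bound_def)
      also have "sqrt (real (Suc p)) \<le> real (Suc p)" by (rule sqrt_le_self_Suc)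
      also have "real (Suc p) \<le> real L" using p by simp
      finally show ?thesis using W by simp
    qed
    have L1: "1 \<le> real L" using p by simp
    have "\<bar>walk [1, j, p, r] (coin_count [1, j, p, r]) \<omega> - sqrt (n p) * zeta j \<omega> p r\<bar> \<le> sqrt (n p) * W + sqrt (n p) * (W * real L)"
    proof -
      have "\<bar>sqrt (n p) * zeta j \<omega> p r\<bar> \<le> sqrt (n p) * (W * real L)"
        unfolding abs_mult using z n1 [of p] by (intro mult_mono) auto
      then show ?thesis using a by linarith
    qed
    also have "\<dots> = sqrt (n p) * (W * (1 + real L))" by (simp add: algebra_simps)
    also have "\<dots> \<le> (s / x^8) * ((2 * x) * (8 * real alpha * x))"
    proof (intro mult_mono sn W2)
      have "1 \<le> 2 * real alpha * x" using x alpha_ge mult_mono [of 1 "2 * real alpha" 1 x] by simp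
      then show "1 + real L \<le> 8 * real alpha * x" using Lx by (simp add: algebra_simps)
    qed (use s x W L1 in auto)
    also have "\<dots> = 16 * real alpha * s / x^6"
    proof -
      have "x^8 = x^6 * (x * x)" by (simp add: eval_nat_numeral)
      then show ?thesis using x by simp
    qed
    also have "\<dots> \<le> (1 + 16 * real alpha) * s / x^6"
      using s(2) x by (intro divide_right_mono mult_right_mono) auto
    finally show ?thesis .
  qed
  define D where "D = (9 + 16 * real alpha) * s / x^6"
  have D0: "0 \<le> D" using s(2) x by (simp add: D_def)
  have V3: "\<bar>V p r - sqrt (n p) * zeta j \<omega> p r\<bar> \<le> D" if "p < L" "r < 2^p" for p r
  proof -
    have "D = 8 * s / x^6 + (1 + 16 * real alpha) * s / x^6"
      by (simp add: D_def distrib_right add_divide_distrib)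
    then show ?thesis using V1 [OF that] V2 [OF that] by linarith
  qed
  \<comment> \<open>The weight \<open>sqrt 2 ^ p\<close> cancels the height of the tents and their
    supports do not overlap, so each level contributes at most \<open>D / 2\<close>, whatever
    \<open>p\<close> is.\<close>
  have grid: "\<bar>block_dev j (block_size j) (real k / 2^L) \<omega> - s * schauder (zeta j \<omega>) (real k / 2^L)\<bar> \<le> real L * (D / 2)" if k: "k \<le> 2^L" for k
  proof -
    define yk where "yk = real k / 2^L"
    have "block_dev j (block_size j) yk \<omega> = (\<Sum>p<L. level_sum (\<lambda>r. sqrt 2 ^ p * V p r) p yk)"
      using block_dev_grid_expansion [OF w, of k j] k by (simp add: yk_def L_def V_def)
    moreover have "schauder (zeta j \<omega>) yk = (\<Sum>p<L. level_sum (zeta j \<omega> p) p yk)"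
      unfolding yk_def by (rule schauder_grid [OF ev3])
    ultimately have "block_dev j (block_size j) yk \<omega> - s * schauder (zeta j \<omega>) yk =
        (\<Sum>p<L. level_sum (\<lambda>r. sqrt 2 ^ p * V p r) p yk - s * level_sum (zeta j \<omega> p) p yk)"
      by (simp add: sum_distrib_left sum_subtractf)
    also have "\<bar>\<dots>\<bar> \<le> (\<Sum>p<L. D / 2)"
    proof (rule order_trans [OF sum_abs], rule sum_mono)
      fix p assume p: "p \<in> {..<L}"
      have "level_sum (\<lambda>r. sqrt 2 ^ p * V p r) p yk - s * level_sum (zeta j \<omega> p) p yk =
          level_sum (\<lambda>r. sqrt 2 ^ p * (V p r - sqrt (n p) * zeta j \<omega> p r)) p yk"
        unfolding level_sum_def using ss [of p] p
        by (simp add: sum_distrib_left sum_subtractf algebra_simps)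
      also have "\<bar>\<dots>\<bar> \<le> (sqrt 2 ^ p * D) / 2 / sqrt 2 ^ p"
        using V3 [of p] p D0 by (intro level_sum_bound) (auto simp: abs_mult)
      also have "\<dots> = D / 2" by simp
      finally show "\<bar>level_sum (\<lambda>r. sqrt 2 ^ p * V p r) p yk - s * level_sum (zeta j \<omega> p) p yk\<bar> \<le> D / 2" .
    qed
    finally show ?thesis by (simp add: yk_def)
  qed
  have gridD: "real L * (D / 2) \<le> 3 * real alpha * (9 + 16 * real alpha) * s / x\<^sup>2"
  proof -
    have "real L * (D / 2) \<le> (6 * real alpha * x) * (D / 2)"
      using Lx D0 by (intro mult_right_mono) auto
    also have "\<dots> = 3 * real alpha * (9 + 16 * real alpha) * s * (x / x^6)" by (simp add: D_def)
    also have "\<dots> \<le> 3 * real alpha * (9 + 16 * real alpha) * s * (1 / x\<^sup>2)"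
    proof (intro mult_left_mono)
      have "x ^ 3 \<le> x ^ 6" using x by (intro power_increasing) auto
      then show "x / x^6 \<le> 1 / x\<^sup>2"
        using x by (simp add: divide_simps power3_eq_cube power2_eq_square mult.assoc)
    qed (use s in auto)
    finally show ?thesis by simp
  qed
  define h where "h = (1/2::real) ^ L"
  have h: "0 < h" "h * 2^L = 1" by (simp_all add: h_def power_one_over)
  have mh: "m * h \<le> s / x\<^sup>2"
  proof -
    have "(2::real)^L = x ^ (6 * alpha)"
      by (simp add: L_def block_depth_def x_def block_scale_def mult_ac flip: power_mult)
    then have "m * h = s * s / x ^ (6 * alpha)" using s(3) by (simp add: h_def power_one_over)
    also have "\<dots> \<le> s * (1 / x\<^sup>2)"
    proof -
      have "s * x\<^sup>2 \<le> x ^ (6 * alpha)"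
        unfolding s(1) power_add [symmetric] using x alpha_ge by (intro power_increasing) auto
      then have "s / x ^ (6 * alpha) \<le> 1 / x\<^sup>2" using x by (simp add: divide_simps mult.commute)
      then have "s * (s / x ^ (6 * alpha)) \<le> s * (1 / x\<^sup>2)" using s(2) by (intro mult_left_mono) auto
      then show ?thesis by simp
    qed
    finally show ?thesis by simp
  qed
  have hol: "s * (holder_const * W * sqrt (sqrt h)) \<le> 2 * holder_const * s / x\<^sup>2"
  proof -
    have "h \<le> (1 / x ^ alpha)^4"
    proof -
      have "(2::real)^L = x ^ (6 * alpha)"
        by (simp add: L_def block_depth_def x_def block_scale_def mult_ac flip: power_mult)
      then have "h = 1 / x ^ (6 * alpha)" by (simp add: h_def power_one_over)
      also have "\<dots> \<le> 1 / x ^ (alpha * 4)" using x by (intro divide_left_mono power_increasing) auto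
      finally show ?thesis by (simp add: power_one_over power_mult power_divide)
    qed
    then have "sqrt (sqrt h) \<le> sqrt (sqrt ((1 / x ^ alpha)^4))" by simp
    also have "(1 / x ^ alpha)^4 = ((1 / x ^ alpha)\<^sup>2)\<^sup>2" by simp
    also have "sqrt (sqrt (((1 / x ^ alpha)\<^sup>2)\<^sup>2)) = 1 / x ^ alpha" using x by (simp only: real_sqrt_abs abs_power2) simp
    finally have 1: "sqrt (sqrt h) \<le> 1 / x ^ alpha" .
    have "s * (holder_const * W * sqrt (sqrt h)) \<le> s * (holder_const * (2 * x) * (1 / x ^ alpha))"
      using s W2 W holder_const_pos 1 h x by (intro mult_left_mono mult_mono) auto
    also have "\<dots> = 2 * holder_const * s * (x / x ^ alpha)" by simp
    also have "\<dots> \<le> 2 * holder_const * s * (1 / x\<^sup>2)"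
    proof (intro mult_left_mono)
      have "x ^ 3 \<le> x ^ alpha" using x alpha_ge by (intro power_increasing) auto
      then show "x / x^alpha \<le> 1 / x\<^sup>2"
        using x by (simp add: divide_simps power3_eq_cube power2_eq_square mult.assoc)
    qed (use s holder_const_pos in auto)
    finally show ?thesis by simp
  qed
  define G where "G = (\<lambda>y. s * schauder (zeta j \<omega>) y)"
  have near: "\<bar>G y - G y'\<bar> \<le> 2 * holder_const * s / x\<^sup>2" if "\<bar>y - y'\<bar> \<le> h" for y'
  proof -
    have "\<bar>G y - G y'\<bar> = s * \<bar>schauder (zeta j \<omega>) y - schauder (zeta j \<omega>) y'\<bar>"
      using s(2) by (simp add: G_def abs_mult flip: right_diff_distrib)
    also have "\<dots> \<le> s * (holder_const * W * sqrt (sqrt \<bar>y - y'\<bar>))"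
      using s(2) W by (intro mult_left_mono schauder_holder [OF ev3]) auto
    also have "\<dots> \<le> s * (holder_const * W * sqrt (sqrt h))"
      using s(2) W that holder_const_pos by (intro mult_left_mono) auto
    finally show ?thesis using hol by linarith
  qed
  define k where "k = nat \<lfloor>y * 2^L\<rfloor>"
  show ?thesis
  proof (cases "y = 1")
    case True
    then show ?thesis
      using grid [of "2^L"] gridD mh holder_const_pos x s(2)
      by (simp add: block_dev_1 [OF w] block_const_def flip: s_def x_def)
  next
    case False
    have y01: "0 \<le> y" "y < 1" using y False by auto
    have k1: "real k \<le> y * 2^L" "y * 2^L < real k + 1" using y01 by (auto simp: k_def)
    have kL: "Suc k \<le> 2^L"
    proof -
      have "y * 2^L < 1 * 2^L" using y01 by (intro mult_strict_right_mono) auto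
      then have "real k < 2^L" using k1(1) by linarith
      then have "real k < real (2^L)" by simp
      then show ?thesis by (simp only: of_nat_less_iff Suc_le_eq)
    qed
    define y0 where "y0 = real k / 2^L"
    define y1 where "y1 = real (Suc k) / 2^L"
    have yy: "y0 \<le> y" "y \<le> y1" "y1 = y0 + h"
      using k1 by (simp_all add: y0_def y1_def h_def power_one_over field_simps)
    have e0: "\<bar>block_dev j (block_size j) y0 \<omega> - G y0\<bar> \<le> 3 * real alpha * (9 + 16 * real alpha) * s / x\<^sup>2"
      using grid [of k] gridD kL by (simp add: y0_def G_def)
    have e1: "\<bar>block_dev j (block_size j) y1 \<omega> - G y1\<bar> \<le> 3 * real alpha * (9 + 16 * real alpha) * s / x\<^sup>2"
      using grid [of "Suc k"] gridD kL unfolding y1_def G_def by linarith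
    \<comment> \<open>Adding back the centering gives a monotone count, so an arbitrary
      \<open>y\<close> is enclosed between its two grid neighbours at a cost of
      \<open>m * h\<close>.\<close>
    have mono: "block_dev j (block_size j) a \<omega> + m * a \<le> block_dev j (block_size j) b \<omega> + m * b" if "a \<le> b" for a b
    proof -
      have "card {i. i < block_size j \<and> sample (j, i) \<omega> \<le> a} \<le> card {i. i < block_size j \<and> sample (j, i) \<omega> \<le> b}"
        using that by (intro card_mono) auto
      then show ?thesis by (simp add: block_dev_def m_def)
    qed
    have up: "block_dev j (block_size j) y \<omega> \<le> block_dev j (block_size j) y1 \<omega> + m * h"
    proof -
      have "m * (y1 - y) \<le> m * h" using yy by (intro mult_left_mono) (auto simp: m_def)
      then show ?thesis using mono [OF yy(2)] by (simp add: right_diff_distrib)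
    qed
    have lo: "block_dev j (block_size j) y0 \<omega> - m * h \<le> block_dev j (block_size j) y \<omega>"
    proof -
      have "m * (y - y0) \<le> m * h" using yy by (intro mult_left_mono) (auto simp: m_def)
      then show ?thesis using mono [OF yy(1)] by (simp add: right_diff_distrib)
    qed
    have n0: "\<bar>G y - G y0\<bar> \<le> 2 * holder_const * s / x\<^sup>2" "\<bar>G y - G y1\<bar> \<le> 2 * holder_const * s / x\<^sup>2"
      using yy h by (auto intro!: near)
    have "\<bar>block_dev j (block_size j) y \<omega> - G y\<bar> \<le> s / x\<^sup>2 + 2 * holder_const * s / x\<^sup>2 + 3 * real alpha * (9 + 16 * real alpha) * s / x\<^sup>2"
      using up lo n0 e0 e1 mh by linarith
    also have "\<dots> = block_const * s / x\<^sup>2"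
      by (simp add: block_const_def add_divide_distrib distrib_right)
    finally show ?thesis by (simp add: G_def s_def x_def)
  qed
qed

end

section \<open>Almost sure bounds on the blocks\<close>

lemma (in prob_space) hoeffding_abs:
  fixes Y :: "'i \<Rightarrow> 'a \<Rightarrow> real"
  assumes ind: "indep_vars (\<lambda>_. borel) Y I" and I: "finite I" "I \<noteq> {}"
    and Y: "\<And>i \<omega>. i \<in> I \<Longrightarrow> \<omega> \<in> space M \<Longrightarrow> a \<le> Y i \<omega> \<and> Y i \<omega> \<le> b" and ab: "a < b" and t: "0 \<le> t"
  shows "prob {\<omega> \<in> space M. t \<le> \<bar>(\<Sum>i\<in>I. Y i \<omega>) - (\<Sum>i\<in>I. expectation (Y i))\<bar>} \<le> 2 * exp (- 2 * t\<^sup>2 / (real (card I) * (b - a)\<^sup>2))"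
proof -
  have H: "Hoeffding_ineq M I Y (\<lambda>_. a) (\<lambda>_. b)"
    unfolding Hoeffding_ineq_def indep_interval_bounded_random_variables_def
      indep_interval_bounded_random_variables_axioms_def
    using ind I Y by (auto intro!: prob_space_axioms AE_I2)
  have "0 < real (card I) * (b - a)\<^sup>2" using I ab by (simp add: card_gt_0_iff)
  then show ?thesis using Hoeffding_ineq.Hoeffding_ineq_abs_ge [OF H t] by simp
qed

lemma (in prob_space) prob_UN_le:
  assumes "finite I" "\<And>i. i \<in> I \<Longrightarrow> A i \<in> events" "\<And>i. i \<in> I \<Longrightarrow> prob (A i) \<le> c"
  shows "prob (\<Union>i\<in>I. A i) \<le> real (card I) * c"
proof -
  have "prob (\<Union>i\<in>I. A i) \<le> (\<Sum>i\<in>I. prob (A i))"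
    using assms by (intro finite_measure_subadditive_finite) auto
  also have "\<dots> \<le> real (card I) * c" using assms(3) by (rule sum_bounded_above)
  finally show ?thesis .
qed

text \<open>The shape of the union bounds below: polynomially many events per block, each with tail
  \<open>exp (- (growth j)^2 / 2)\<close>.\<close>

lemma summable_poly_exp_sqrt:
  fixes N :: nat and C :: real
  shows "summable (\<lambda>j. C * real (Suc j) ^ N * exp (- sqrt (real (Suc j)) / 2))"
proof (rule summable_comparison_test_ev [OF _ summable_mult [OF summable_Suc_iff [THEN iffD2, OF inverse_power_summable [of 2]], of "\<bar>C\<bar>"]])
  have "filterlim (\<lambda>j. sqrt (real (Suc j)) / 2) at_top sequentially" by real_asymp
  with tendsto_power_div_exp_0 [of "2 * N + 4"] have "((\<lambda>j. (sqrt (real (Suc j)) / 2) ^ (2 * N + 4) / exp (sqrt (real (Suc j)) / 2)) \<longlongrightarrow> 0) sequentially"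
    by (rule filterlim_compose)
  then have "\<forall>\<^sub>F j in sequentially. (sqrt (real (Suc j)) / 2) ^ (2 * N + 4) / exp (sqrt (real (Suc j)) / 2) < (1/2) ^ (2 * N + 4)"
    by (rule order_tendstoD) simp
  then show "\<forall>\<^sub>F j in sequentially. norm (C * real (Suc j) ^ N * exp (- sqrt (real (Suc j)) / 2)) \<le> \<bar>C\<bar> * inverse (real (Suc j) ^ 2)"
  proof eventually_elim
    case (elim j)
    define q where "q = real (Suc j)"
    have q: "0 < q" by (simp add: q_def)
    have "(sqrt q) ^ (2 * N + 4) = q ^ N * q ^ 2"
    proof -
      have "2 * N + 4 = 2 * (N + 2)" by simp
      then have "(sqrt q) ^ (2 * N + 4) = ((sqrt q)\<^sup>2) ^ (N + 2)" by (simp only: power_mult)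
      then show ?thesis using q by (simp add: power_add power2_eq_square)
    qed
    then have "q ^ N * q ^ 2 / exp (sqrt q / 2) < 1"
    proof -
      have "(sqrt q) ^ (2 * N + 4) / exp (sqrt q / 2) < 1"
        using elim [folded q_def] by (simp add: power_divide divide_simps)
      then show ?thesis using \<open>(sqrt q) ^ (2 * N + 4) = q ^ N * q ^ 2\<close> by (simp only:)
    qed
    then have "q ^ N * exp (- sqrt q / 2) \<le> inverse (q ^ 2)"
      using q by (simp add: exp_minus field_simps)
    then have "\<bar>C\<bar> * (q ^ N * exp (- sqrt q / 2)) \<le> \<bar>C\<bar> * inverse (q ^ 2)" by (intro mult_left_mono) auto
    then show ?case using q unfolding q_def [symmetric] by (simp add: abs_mult mult.assoc)
  qed
qed simp

lemma (in prob_space) AE_eventually_notin: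
  assumes "\<And>j. A j \<in> events" "summable f" "\<forall>\<^sub>F j in sequentially. prob (A j) \<le> f j"
  shows "AE \<omega> in M. \<forall>\<^sub>F j in sequentially. \<omega> \<notin> A j"
proof -
  have "summable (\<lambda>j. prob (A j))"
    by (rule summable_comparison_test_ev [OF _ assms(2)]) (use assms(3) in simp)
  then have "AE \<omega> in M. \<forall>\<^sub>F j in sequentially. \<omega> \<in> space M - A j"
    by (intro borel_cantelli_AE1) (use assms(1) in \<open>auto simp: emeasure_eq_measure\<close>)
  then show ?thesis by eventually_elim (auto elim: eventually_mono)
qed

lemma (in prob_space) is_gauss_tail_le:
  assumes X: "is_gauss v X" and v: "0 < v" "v \<le> V" and l: "0 \<le> l"
  shows "prob {\<omega> \<in> space M. l * sqrt V < \<bar>X \<omega>\<bar>} \<le> 2 * exp (- l\<^sup>2 / 2)"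
proof -
  note [measurable] = is_gauss_borel [OF X]
  have "is_gauss ((1 / sqrt v)\<^sup>2 * v) (\<lambda>\<omega>. 1 / sqrt v * X \<omega>)" by (rule is_gauss_scale [OF X])
  moreover have "(1 / sqrt v)\<^sup>2 * v = 1" using v by (simp add: power_divide)
  ultimately have g: "is_gauss 1 (\<lambda>\<omega>. 1 / sqrt v * X \<omega>)" by simp
  have "prob {\<omega> \<in> space M. l * sqrt V < \<bar>X \<omega>\<bar>} \<le> prob {\<omega> \<in> space M. l < \<bar>1 / sqrt v * X \<omega>\<bar>}"
  proof (rule finite_measure_mono)
    show "{\<omega> \<in> space M. l * sqrt V < \<bar>X \<omega>\<bar>} \<subseteq> {\<omega> \<in> space M. l < \<bar>1 / sqrt v * X \<omega>\<bar>}"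
    proof safe
      fix \<omega> assume "l * sqrt V < \<bar>X \<omega>\<bar>"
      moreover have "l * sqrt v \<le> l * sqrt V" using v l by (intro mult_left_mono) auto
      ultimately show "l < \<bar>1 / sqrt v * X \<omega>\<bar>" using v by (simp add: abs_mult pos_less_divide_eq)
    qed
  qed measurable
  also have "\<dots> \<le> 2 * exp (- l\<^sup>2 / 2)" by (rule is_gauss_tail [OF g l])
  finally show ?thesis .
qed

text \<open>Split according to the first \<open>k\<close> at which the partial sum exceeds
  \<open>2 * t\<close>, the sets \<open>T k\<close>. The rest of the sum is independent of
  \<open>T k\<close> and stays within \<open>t\<close> with probability at least 1/2, and then the
  full sum still exceeds \<open>t\<close>.\<close>

lemma (in prob_space) ottaviani:
  fixes Y :: "nat \<Rightarrow> 'a \<Rightarrow> real"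
  assumes ind: "indep_vars (\<lambda>_. borel) Y UNIV"
    and half: "\<And>k. k < J \<Longrightarrow> prob {\<omega> \<in> space M. t < \<bar>\<Sum>i\<in>{k..<J}. Y i \<omega>\<bar>} \<le> 1/2" and t: "0 \<le> t"
  shows "prob {\<omega> \<in> space M. \<exists>k\<le>J. 2 * t < \<bar>\<Sum>i<k. Y i \<omega>\<bar>} \<le> 2 * prob {\<omega> \<in> space M. t < \<bar>\<Sum>i<J. Y i \<omega>\<bar>}"
proof -
  have [measurable]: "Y i \<in> borel_measurable M" for i using ind unfolding indep_vars_def2 by auto
  define S where "S = (\<lambda>k \<omega>. \<Sum>i<k. Y i \<omega>)"
  define T where "T = (\<lambda>k. {\<omega> \<in> space M. 2 * t < \<bar>S k \<omega>\<bar> \<and> (\<forall>l<k. \<bar>S l \<omega>\<bar> \<le> 2 * t)})"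
  define R where "R = (\<lambda>k. {\<omega> \<in> space M. \<bar>\<Sum>i\<in>{k..<J}. Y i \<omega>\<bar> \<le> t})"
  have [measurable]: "S k \<in> borel_measurable M" for k unfolding S_def by measurable
  have [measurable]: "T k \<in> events" "R k \<in> events" for k unfolding T_def R_def by measurable
  have disj: "disjoint_family_on T {..J}"
    unfolding disjoint_family_on_def
  proof (intro ballI impI)
    fix k l :: nat assume "k \<noteq> l"
    then consider "k < l" | "l < k" by linarith
    then show "T k \<inter> T l = {}" by cases (force simp: T_def)+
  qed
  have un: "{\<omega> \<in> space M. \<exists>k\<le>J. 2 * t < \<bar>S k \<omega>\<bar>} = (\<Union>k\<in>{..J}. T k)"
  proof (intro equalityI subsetI)
    fix \<omega> assume "\<omega> \<in> {\<omega> \<in> space M. \<exists>k\<le>J. 2 * t < \<bar>S k \<omega>\<bar>}"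
    then obtain k where k: "k \<le> J" "2 * t < \<bar>S k \<omega>\<bar>" and w: "\<omega> \<in> space M" by auto
    define k0 where "k0 = (LEAST k. 2 * t < \<bar>S k \<omega>\<bar>)"
    have "2 * t < \<bar>S k0 \<omega>\<bar>" "k0 \<le> k" "\<And>l. l < k0 \<Longrightarrow> \<not> 2 * t < \<bar>S l \<omega>\<bar>"
      unfolding k0_def
      by (rule LeastI [of "\<lambda>k. 2 * t < \<bar>S k \<omega>\<bar>", OF k(2)], rule Least_le [of "\<lambda>k. 2 * t < \<bar>S k \<omega>\<bar>", OF k(2)], rule not_less_Least)
    then show "\<omega> \<in> (\<Union>k\<in>{..J}. T k)" using w k(1) by (auto simp: T_def not_less intro!: bexI [of _ k0])
  qed (auto simp: T_def)
  have ind2: "prob (T k \<inter> R k) = prob (T k) * prob (R k)" for k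
  proof -
    define P where "P = PiM {..<k} (\<lambda>_. borel :: real measure)"
    define Q where "Q = PiM {k..<J} (\<lambda>_. borel :: real measure)"
    have iv: "indep_var P (\<lambda>\<omega>. restrict (\<lambda>i. Y i \<omega>) {..<k}) Q (\<lambda>\<omega>. restrict (\<lambda>i. Y i \<omega>) {k..<J})"
      unfolding P_def Q_def by (rule indep_var_restrict [OF ind]) auto
    define A where "A = {v \<in> space P. 2 * t < \<bar>\<Sum>i<k. v i\<bar> \<and> (\<forall>l<k. \<bar>\<Sum>i<l. v i\<bar> \<le> 2 * t)}"
    define B where "B = {v \<in> space Q. \<bar>\<Sum>i\<in>{k..<J}. v i\<bar> \<le> t}"
    have cP: "(\<lambda>v. v i) \<in> borel_measurable P" if "i < k" for i
      unfolding P_def by (rule measurable_component_singleton) (use that in simp)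
    have cQ: "(\<lambda>v. v i) \<in> borel_measurable Q" if "i \<in> {k..<J}" for i
      unfolding Q_def by (rule measurable_component_singleton) (use that in simp)
    have sP: "(\<lambda>v. \<Sum>i<l. v i) \<in> borel_measurable P" if "l \<le> k" for l
      by (rule borel_measurable_sum) (use that cP in auto)
    have sQ: "(\<lambda>v. \<Sum>i\<in>{k..<J}. v i) \<in> borel_measurable Q"
      by (rule borel_measurable_sum) (use cQ in auto)
    have A1: "A \<in> sets P"
    proof -
      have "A = {v \<in> space P. 2 * t < \<bar>\<Sum>i<k. v i\<bar>} \<inter> {v \<in> space P. \<forall>l\<in>{..<k}. \<bar>\<Sum>i<l. v i\<bar> \<le> 2 * t}"
        by (auto simp: A_def)
      also have "\<dots> \<in> sets P"
      proof (intro sets.Int sets.sets_Collect_finite_All)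
        note sP [OF order_refl, measurable]
        show "{v \<in> space P. 2 * t < \<bar>\<Sum>i<k. v i\<bar>} \<in> sets P" by measurable
        fix l assume "l \<in> {..<k}"
        then have [measurable]: "(\<lambda>v. \<Sum>i<l. v i) \<in> borel_measurable P" by (intro sP) auto
        show "{v \<in> space P. \<bar>\<Sum>i<l. v i\<bar> \<le> 2 * t} \<in> sets P" by measurable
      qed auto
      finally show ?thesis .
    qed
    have B1: "B \<in> sets Q" unfolding B_def using sQ by measurable
    have spP: "restrict (\<lambda>i. Y i \<omega>) {..<k} \<in> space P" "restrict (\<lambda>i. Y i \<omega>) {k..<J} \<in> space Q" for \<omega>
      by (auto simp: P_def Q_def space_PiM)
    have TA: "T k = (\<lambda>\<omega>. restrict (\<lambda>i. Y i \<omega>) {..<k}) -` A \<inter> space M"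
      by (auto simp: T_def A_def spP S_def)
    have RB: "R k = (\<lambda>\<omega>. restrict (\<lambda>i. Y i \<omega>) {k..<J}) -` B \<inter> space M"
      by (auto simp: R_def B_def spP)
    have "(\<lambda>\<omega>. (restrict (\<lambda>i. Y i \<omega>) {..<k}, restrict (\<lambda>i. Y i \<omega>) {k..<J})) -` (A \<times> B) \<inter> space M = T k \<inter> R k"
      unfolding TA RB by auto
    then show ?thesis using indep_varD [OF iv A1 B1] unfolding TA RB by simp
  qed
  have Rh: "1/2 \<le> prob (R k)" if "k \<le> J" for k
  proof (cases "k = J")
    case True
    then have "R k = space M" using t by (auto simp: R_def)
    then show ?thesis by (simp add: prob_space)
  next
    case False
    have "R k = space M - {\<omega> \<in> space M. t < \<bar>\<Sum>i\<in>{k..<J}. Y i \<omega>\<bar>}" by (auto simp: R_def not_less)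
    then have "prob (R k) = 1 - prob {\<omega> \<in> space M. t < \<bar>\<Sum>i\<in>{k..<J}. Y i \<omega>\<bar>}"
      by (simp only:) (rule prob_compl, measurable)
    then show ?thesis using half [of k] that False by simp
  qed
  have "prob {\<omega> \<in> space M. \<exists>k\<le>J. 2 * t < \<bar>S k \<omega>\<bar>} = (\<Sum>k\<le>J. prob (T k))"
    unfolding un by (rule finite_measure_finite_Union) (use disj in auto)
  also have "\<dots> \<le> (\<Sum>k\<le>J. 2 * prob (T k \<inter> R k))"
  proof (rule sum_mono)
    fix k assume "k \<in> {..J}"
    then have "prob (T k) * (1/2) \<le> prob (T k) * prob (R k)" by (intro mult_left_mono Rh) auto
    then show "prob (T k) \<le> 2 * prob (T k \<inter> R k)" by (simp add: ind2)
  qed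
  also have "\<dots> = 2 * prob (\<Union>k\<in>{..J}. T k \<inter> R k)"
    unfolding sum_distrib_left [symmetric]
    by (subst finite_measure_finite_Union) (use disj in \<open>auto simp: disjoint_family_on_def\<close>)
  also have "\<dots> \<le> 2 * prob {\<omega> \<in> space M. t < \<bar>S J \<omega>\<bar>}"
  proof (intro mult_left_mono finite_measure_mono)
    show "(\<Union>k\<in>{..J}. T k \<inter> R k) \<subseteq> {\<omega> \<in> space M. t < \<bar>S J \<omega>\<bar>}"
    proof safe
      fix k \<omega> assume k: "k \<le> J" "\<omega> \<in> T k" "\<omega> \<in> R k"
      have "S J \<omega> = S k \<omega> + (\<Sum>i\<in>{k..<J}. Y i \<omega>)"
        unfolding S_def using sum.atLeastLessThan_concat [of 0 k J "\<lambda>i. Y i \<omega>"] k(1)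
        by (simp add: lessThan_atLeast0)
      then show "t < \<bar>S J \<omega>\<bar>" "\<omega> \<in> space M" using k by (auto simp: T_def R_def)
    qed
  qed auto
  finally show ?thesis by (simp add: S_def)
qed

section \<open>Exceptional events of a block\<close>

context coupling
begin

text \<open>A fourth root is a compromise: \<open>exp (- (growth j)^2 / 2)\<close> beats the
  polynomial number of events, and yet \<open>growth J\<close> is of smaller order than
  \<open>sqrt J\<close>, the factor by which \<open>sqrt n\<close> outweighs the root of the last
  block size.\<close>

definition growth :: "nat \<Rightarrow> real" where "growth j = sqrt (sqrt (real (Suc j)))"

lemma growth_sq: "(growth j)\<^sup>2 = sqrt (real (Suc j))" and growth_ge_1: "1 \<le> growth j" and growth_le: "growth j \<le> 2 * block_scale j"
proof -
  show "(growth j)\<^sup>2 = sqrt (real (Suc j))" by (simp add: growth_def)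
  show "1 \<le> growth j" by (simp add: growth_def)
  have "growth j \<le> sqrt (real (Suc j))"
    unfolding growth_def using sqrt_le_self_Suc [of j] by (intro real_sqrt_le_mono)
  also have "\<dots> \<le> real (Suc j)" by (rule sqrt_le_self_Suc)
  also have "\<dots> \<le> 2 * block_scale j" by (rule block_scale_bounds)
  finally show "growth j \<le> 2 * block_scale j" .
qed

lemma walk_measurable [measurable]: "walk e k \<in> borel_measurable M"
  unfolding walk_def [abs_def] by measurable

lemma walk_tail:
  assumes w: "0 \<le> w"
  shows "prob {\<omega> \<in> space M. sqrt \<bar>real k - real n\<bar> * w < \<bar>walk e k \<omega> - walk e n \<omega>\<bar>} \<le> 2 * exp (- w\<^sup>2 / 2)"
proof (cases "k = n")
  case False
  define I where "I = {min k n..<max k n}"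
  define Y where "Y = (\<lambda>i \<omega>. if coin e i \<omega> then 1 else - 1 :: real)"
  have I: "finite I" "I \<noteq> {}" and cI: "real (card I) = \<bar>real k - real n\<bar>" using False by (auto simp: I_def)
  have inj: "inj_on (\<lambda>i. 0 # e @ [i]) I" by (auto simp: inj_on_def)
  have ind: "indep_vars (\<lambda>_. borel) Y I"
  proof -
    have "indep_vars (\<lambda>_. borel) (\<lambda>i \<omega>. (\<lambda>x. if 1/2 \<le> x then 1 else - 1 :: real) (X (0 # e @ [i]) \<omega>)) I"
      by (rule indep_vars_compose2 [OF indep_vars_reindex [OF indep inj]]) auto
    then show ?thesis by (simp add: Y_def coin_def)
  qed
  have E: "expectation (Y i) = 0" for i
  proof -
    have "prob {\<omega> \<in> space M. coin e i \<omega>} = 1/2"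
      using prob_X [of "{1/2..}" "0 # e @ [i]"] by (simp add: coin_def measure_unif_halves)
    moreover have "expectation (Y i) = expectation (\<lambda>\<omega>. 2 * indicator {\<omega> \<in> space M. coin e i \<omega>} \<omega> - 1)"
      by (rule Bochner_Integration.integral_cong) (auto simp: Y_def)
    ultimately show ?thesis by (simp add: prob_space emeasure_eq_measure)
  qed
  have d: "\<bar>walk e k \<omega> - walk e n \<omega>\<bar> = \<bar>\<Sum>i\<in>I. Y i \<omega>\<bar>" for \<omega>
  proof -
    have "walk e (max k n) \<omega> = walk e (min k n) \<omega> + (\<Sum>i\<in>I. Y i \<omega>)"
      unfolding walk_def Y_def I_def using sum.atLeastLessThan_concat [of 0 "min k n" "max k n" "\<lambda>i. if coin e i \<omega> then 1 else - 1 :: real"]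
      by (simp add: lessThan_atLeast0)
    then show ?thesis by (auto simp: max_def min_def split: if_splits)
  qed
  have "prob {\<omega> \<in> space M. sqrt \<bar>real k - real n\<bar> * w < \<bar>walk e k \<omega> - walk e n \<omega>\<bar>}
      \<le> prob {\<omega> \<in> space M. sqrt \<bar>real k - real n\<bar> * w \<le> \<bar>(\<Sum>i\<in>I. Y i \<omega>) - (\<Sum>i\<in>I. expectation (Y i))\<bar>}"
  proof (rule finite_measure_mono)
    have [measurable]: "Y i \<in> borel_measurable M" for i unfolding Y_def by measurable
    show "{\<omega> \<in> space M. sqrt \<bar>real k - real n\<bar> * w \<le> \<bar>(\<Sum>i\<in>I. Y i \<omega>) - (\<Sum>i\<in>I. expectation (Y i))\<bar>} \<in> events" by measurable
  qed (auto simp: d E)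
  also have "\<dots> \<le> 2 * exp (- 2 * (sqrt \<bar>real k - real n\<bar> * w)\<^sup>2 / (real (card I) * (1 - (-1))\<^sup>2))"
    by (rule hoeffding_abs [OF ind I]) (use w in \<open>auto simp: Y_def\<close>)
  also have "- 2 * (sqrt \<bar>real k - real n\<bar> * w)\<^sup>2 / (real (card I) * (1 - (-1))\<^sup>2) = - w\<^sup>2 / 2"
    using False by (simp add: cI power_mult_distrib)
  finally show ?thesis .
qed simp

lemma block_dev_measurable [measurable]: "block_dev j u y \<in> borel_measurable M"
proof -
  have eq: "block_dev j u y = (\<lambda>\<omega>. (\<Sum>i<u. if sample (j, i) \<omega> \<le> y then 1 else 0) - real u * y)"
    by (rule ext) (simp add: block_dev_def sum.If_cases Int_def)
  show ?thesis unfolding eq by measurable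
qed

lemma block_dev_tail:
  assumes u: "u \<le> block_size j" and y: "y \<in> {0..1}" and w: "0 \<le> w"
  shows "prob {\<omega> \<in> space M. sqrt (real (block_size j)) * w < \<bar>block_dev j u y \<omega>\<bar>} \<le> 2 * exp (- w\<^sup>2 / 2)"
proof (cases "u = 0")
  case True
  have "\<not> sqrt (real (block_size j)) * w < 0" using w by (simp add: not_less)
  then have "{\<omega> \<in> space M. sqrt (real (block_size j)) * w < \<bar>block_dev j u y \<omega>\<bar>} = {}" using True by (auto simp: block_dev_def)
  then show ?thesis by (simp only:) simp
next
  case False
  define Y where "Y = (\<lambda>i \<omega>. indicator {..y} (sample (j, i) \<omega>) :: real)"
  have ind: "indep_vars (\<lambda>_. borel) Y {..<u}"
    unfolding Y_def
    by (rule indep_vars_compose2 [OF indep_vars_reindex [OF indep_sample, of "\<lambda>i. (j, i)"]])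
       (use u in \<open>auto simp: inj_on_def\<close>)
  have E: "expectation (Y i) = y" if "i < u" for i
  proof -
    have "expectation (Y i) = expectation (\<lambda>\<omega>. indicator {\<omega> \<in> space M. sample (j, i) \<omega> \<le> y} \<omega>)"
      by (rule Bochner_Integration.integral_cong) (auto simp: Y_def indicator_def)
    also have "\<dots> = prob {\<omega> \<in> space M. sample (j, i) \<omega> \<le> y}" by simp
    also have "\<dots> = y" using that u y by (subst prob_sample_atMost) (auto simp: clamp01_def)
    finally show ?thesis .
  qed
  have eq: "block_dev j u y \<omega> = (\<Sum>i<u. Y i \<omega>) - (\<Sum>i<u. expectation (Y i))" for \<omega>
    using E by (simp add: block_dev_def Y_def indicator_def sum.If_cases Int_def)
  have "prob {\<omega> \<in> space M. sqrt (real (block_size j)) * w < \<bar>block_dev j u y \<omega>\<bar>}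
      \<le> prob {\<omega> \<in> space M. sqrt (real (block_size j)) * w \<le> \<bar>(\<Sum>i<u. Y i \<omega>) - (\<Sum>i<u. expectation (Y i))\<bar>}"
  proof (rule finite_measure_mono)
    have [measurable]: "Y i \<in> borel_measurable M" for i unfolding Y_def by measurable
    show "{\<omega> \<in> space M. sqrt (real (block_size j)) * w \<le> \<bar>(\<Sum>i<u. Y i \<omega>) - (\<Sum>i<u. expectation (Y i))\<bar>} \<in> events" by measurable
  qed (auto simp: eq)
  also have "\<dots> \<le> 2 * exp (- 2 * (sqrt (real (block_size j)) * w)\<^sup>2 / (real (card {..<u}) * (1 - 0)\<^sup>2))"
    by (rule hoeffding_abs [OF ind]) (use w False in \<open>auto simp: Y_def indicator_def\<close>)
  also have "\<dots> \<le> 2 * exp (- w\<^sup>2 / 2)"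
  proof -
    have "w\<^sup>2 * real u \<le> w\<^sup>2 * real (block_size j)" using u by (intro mult_left_mono) auto
    then have "w\<^sup>2 \<le> real (block_size j) * w\<^sup>2 / real u" using False by (simp add: pos_le_divide_eq mult.commute)
    moreover have "0 \<le> w\<^sup>2" by simp
    ultimately have "w\<^sup>2 / 2 \<le> 2 * (real (block_size j) * w\<^sup>2 / real u)" by linarith
    then show ?thesis by (simp add: power_mult_distrib)
  qed
  finally show ?thesis .
qed

text \<open>All partial lengths of the block are included, since \<open>n\<close> may fall inside
  it. The grid of mesh \<open>1 / block_size j\<close> keeps the union finite.\<close>

definition bad_empirical :: "nat \<Rightarrow> 'w set" where
  "bad_empirical j = (\<Union>q\<in>{..block_size j} \<times> {..block_size j}. {\<omega> \<in> space M. sqrt (real (block_size j)) * growth j < \<bar>block_dev j (fst q) (real (snd q) / real (block_size j)) \<omega>\<bar>})"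

definition bad_walk :: "nat \<Rightarrow> 'w set" where
  "bad_walk j = (\<Union>q\<in>(SIGMA p:{..<block_depth j}. {..<2^p} \<times> {..block_size j}).
     {\<omega> \<in> space M. sqrt \<bar>real (snd (snd q)) - real (coin_count [1, j, fst q, fst (snd q)])\<bar> * growth j <
        \<bar>walk [1, j, fst q, fst (snd q)] (snd (snd q)) \<omega> - walk [1, j, fst q, fst (snd q)] (coin_count [1, j, fst q, fst (snd q)]) \<omega>\<bar>})"

text \<open>The maximum with 2 makes \<open>good_tail\<close> applicable to the early blocks
  too.\<close>

definition bad_sheet :: "nat \<Rightarrow> 'w set" where
  "bad_sheet j = {\<omega> \<in> space M. \<not> good j (max 2 (growth j)) \<omega>}"

text \<open>Beyond this threshold \<open>quantile_coupling\<close> says nothing about the node. Only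
  the levels on which it is used are included.\<close>

definition bad_gauss :: "nat \<Rightarrow> 'w set" where
  "bad_gauss j = (\<Union>q\<in>(SIGMA p:{..<16 * block_level j}. {..<2^p}).
     {\<omega> \<in> space M. sqrt (ln (real (coin_count [1, j, fst q, snd q])) / 128) < \<bar>zeta j \<omega> (fst q) (snd q)\<bar>})"

lemma is_gauss_zeta: "is_gauss 1 (\<lambda>\<omega>. zeta j \<omega> p r)"
  unfolding zeta_def by (rule is_gauss_gauss) (simp add: gauss_index_def)

lemma zeta_measurable [measurable]: "(\<lambda>\<omega>. zeta j \<omega> p r) \<in> borel_measurable M"
  by (rule is_gauss_borel [OF is_gauss_zeta])

lemma bad_events: "bad_empirical j \<in> events" "bad_walk j \<in> events" "bad_sheet j \<in> events" "bad_gauss j \<in> events"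
proof -
  show "bad_empirical j \<in> events" unfolding bad_empirical_def by (intro sets.finite_UN) auto
  show "bad_walk j \<in> events" unfolding bad_walk_def by (intro sets.finite_UN) auto
  show "bad_sheet j \<in> events" unfolding bad_sheet_def by (rule good_tail) simp
  show "bad_gauss j \<in> events" unfolding bad_gauss_def by (intro sets.finite_UN) auto
qed

lemma sum_pow2: "(\<Sum>p<n. (2::nat)^p) = 2^n - 1"
  by (induction n) auto

lemma block_size_poly: "real (block_size j) \<le> real (Suc j) ^ (8 * alpha)"
  unfolding block_size_block_scale using block_scale_bounds [of j] by (intro power_mono) auto

lemma prob_bad_empirical: "prob (bad_empirical j) \<le> 8 * real (Suc j) ^ (16 * alpha) * exp (- sqrt (real (Suc j)) / 2)"
proof -
  let ?e = "exp (- sqrt (real (Suc j)) / 2)"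
  have "prob (bad_empirical j) \<le> real (card ({..block_size j} \<times> {..block_size j})) * (2 * ?e)"
    unfolding bad_empirical_def
  proof (rule prob_UN_le)
    fix q assume "q \<in> {..block_size j} \<times> {..block_size j}"
    then show "prob {\<omega> \<in> space M. sqrt (real (block_size j)) * growth j < \<bar>block_dev j (fst q) (real (snd q) / real (block_size j)) \<omega>\<bar>} \<le> 2 * ?e"
      using block_dev_tail [of "fst q" j "real (snd q) / real (block_size j)" "growth j"] growth_ge_1 [of j] block_size_pos [of j]
      by (auto simp: growth_sq divide_simps)
  qed auto
  also have "\<dots> \<le> (4 * (real (Suc j) ^ (8 * alpha))\<^sup>2) * (2 * ?e)"
  proof (intro mult_right_mono)
    have m1: "1 \<le> real (block_size j)" using block_size_pos [of j] by simp
    have "real (card ({..block_size j} \<times> {..block_size j})) = (real (block_size j) + 1)\<^sup>2" by (simp add: card_cartesian_product power2_eq_square algebra_simps)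
    also have "\<dots> \<le> (2 * real (block_size j))\<^sup>2" using m1 by (intro power_mono) auto
    also have "\<dots> \<le> (2 * real (Suc j) ^ (8 * alpha))\<^sup>2" using block_size_poly [of j] by (intro power_mono mult_left_mono) auto
    finally show "real (card ({..block_size j} \<times> {..block_size j})) \<le> 4 * (real (Suc j) ^ (8 * alpha))\<^sup>2" by (simp add: power_mult_distrib)
  qed auto
  finally show ?thesis by (simp flip: power_mult)
qed

lemma prob_bad_walk: "prob (bad_walk j) \<le> 4 * real (Suc j) ^ (16 * alpha) * exp (- sqrt (real (Suc j)) / 2)"
proof -
  let ?e = "exp (- sqrt (real (Suc j)) / 2)"
  let ?I = "SIGMA p:{..<block_depth j}. {..<(2::nat)^p} \<times> {..block_size j}"
  have "prob (bad_walk j) \<le> real (card ?I) * (2 * ?e)"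
    unfolding bad_walk_def
  proof (rule prob_UN_le)
    fix q
    show "prob {\<omega> \<in> space M. sqrt \<bar>real (snd (snd q)) - real (coin_count [1, j, fst q, fst (snd q)])\<bar> * growth j <
        \<bar>walk [1, j, fst q, fst (snd q)] (snd (snd q)) \<omega> - walk [1, j, fst q, fst (snd q)] (coin_count [1, j, fst q, fst (snd q)]) \<omega>\<bar>} \<le> 2 * ?e"
      using walk_tail [of "growth j" "snd (snd q)" "coin_count [1, j, fst q, fst (snd q)]" "[1, j, fst q, fst (snd q)]"] growth_ge_1 [of j]
      by (simp add: growth_sq)
  qed auto
  also have "\<dots> \<le> (2 * (real (Suc j) ^ (8 * alpha))\<^sup>2) * (2 * ?e)"
  proof (intro mult_right_mono)
    have m1: "1 \<le> real (block_size j)" using block_size_pos [of j] by simp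
    have "card ?I = (\<Sum>p<block_depth j. 2^p * (block_size j + 1))" by (simp add: card_cartesian_product)
    also have "\<dots> = (\<Sum>p<block_depth j. 2^p) * (block_size j + 1)" by (simp only: sum_distrib_right)
    also have "\<dots> \<le> block_size j * (block_size j + 1)"
    proof (intro mult_right_mono)
      have "(\<Sum>p<block_depth j. 2^p) \<le> (2::nat) ^ block_depth j" by (simp add: sum_pow2)
      also have "(2::nat) ^ block_depth j \<le> block_size j" unfolding block_size_def block_depth_def by (intro power_increasing) auto
      finally show "(\<Sum>p<block_depth j. 2^p) \<le> block_size j" .
    qed simp
    finally have "card ?I \<le> block_size j * (block_size j + 1)" .
    from of_nat_mono [OF this, where 'a=real] have "real (card ?I) \<le> real (block_size j) * (real (block_size j) + 1)" by (simp add: distrib_left)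
    also have "\<dots> \<le> real (block_size j) * (2 * real (block_size j))" using m1 by (intro mult_left_mono) auto
    also have "\<dots> = 2 * (real (block_size j))\<^sup>2" by (simp add: power2_eq_square)
    also have "\<dots> \<le> 2 * (real (Suc j) ^ (8 * alpha))\<^sup>2" using block_size_poly [of j] by (intro mult_left_mono power_mono) auto
    finally show "real (card ?I) \<le> 2 * (real (Suc j) ^ (8 * alpha))\<^sup>2" .
  qed auto
  finally show ?thesis by (simp flip: power_mult)
qed

lemma prob_bad_sheet: "prob (bad_sheet j) \<le> 12 * real (Suc j) ^ 0 * exp (- sqrt (real (Suc j)) / 2)"
proof -
  have "prob (bad_sheet j) \<le> 12 * exp (- (max 2 (growth j))\<^sup>2 / 2)" unfolding bad_sheet_def by (rule good_tail(2)) simp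
  also have "\<dots> \<le> 12 * exp (- (growth j)\<^sup>2 / 2)"
  proof -
    have "(growth j)\<^sup>2 \<le> (max 2 (growth j))\<^sup>2" using growth_ge_1 [of j] by (intro power_mono) auto
    then show ?thesis by simp
  qed
  finally show ?thesis by (simp add: growth_sq)
qed

lemma coin_count_large:
  assumes p: "p < 16 * block_level j"
  shows "block_scale j ^ (4 * alpha) \<le> real (coin_count [1, j, p, r])" "1 \<le> coin_count [1, j, p, r]"
proof -
  have pL: "p < block_depth j"
  proof -
    have "16 * block_level j \<le> (6 * alpha) * block_level j" using alpha_ge by (intro mult_le_mono1) simp
    with p have "p < (6 * alpha) * block_level j" by (rule less_le_trans)
    then show ?thesis by (simp add: block_depth_def mult.assoc)
  qed
  have n: "coin_count [1, j, p, r] = 2 ^ (8 * (alpha * block_level j) - p)" by (rule coin_count_node [OF pL])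
  then show "1 \<le> coin_count [1, j, p, r]" by simp
  have "4 * (alpha * block_level j) \<le> 8 * (alpha * block_level j) - p"
  proof -
    have "16 * block_level j \<le> (4 * alpha) * block_level j" using alpha_ge by (intro mult_le_mono1) simp
    with p have "p < (4 * alpha) * block_level j" by (rule less_le_trans)
    then show ?thesis by simp
  qed
  then have "(2::real) ^ (4 * (alpha * block_level j)) \<le> 2 ^ (8 * (alpha * block_level j) - p)" by (intro power_increasing) auto
  moreover have "block_scale j ^ (4 * alpha) = 2 ^ (4 * (alpha * block_level j))" by (simp add: block_scale_def mult_ac flip: power_mult)
  ultimately show "block_scale j ^ (4 * alpha) \<le> real (coin_count [1, j, p, r])" unfolding n by simp
qed

lemma prob_bad_gauss: "prob (bad_gauss j) \<le> 8 * inverse (real (Suc j) ^ 2)"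
proof -
  let ?I = "SIGMA p:{..<16 * block_level j}. {..<(2::nat)^p}"
  define x where "x = block_scale j"
  have x: "1 \<le> x" using block_scale_bounds by (simp add: x_def)
  have "prob (bad_gauss j) \<le> real (card ?I) * (2 * x powr (- 18))"
    unfolding bad_gauss_def
  proof (rule prob_UN_le)
    fix q assume q: "q \<in> ?I"
    define n where "n = real (coin_count [1, j, fst q, snd q])"
    have n: "x ^ (4 * alpha) \<le> n" "1 \<le> n"
      using coin_count_large [of "fst q" j "snd q"] q by (auto simp: n_def x_def)
    have "prob {\<omega> \<in> space M. sqrt (ln n / 128) < \<bar>zeta j \<omega> (fst q) (snd q)\<bar>} \<le> 2 * exp (- (sqrt (ln n / 128))\<^sup>2 / 2)"
      by (rule is_gauss_tail [OF is_gauss_zeta]) (use n in simp)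
    also have "exp (- (sqrt (ln n / 128))\<^sup>2 / 2) = n powr (- 1/256)"
      using n by (simp add: powr_def)
    also have "\<dots> \<le> (x ^ (4 * alpha)) powr (- 1/256)" using n x by (intro powr_mono2') auto
    also have "\<dots> = x powr (- (real (4 * alpha) / 256))"
      using x by (simp add: powr_realpow [symmetric] powr_powr del: of_nat_mult)
    \<comment> \<open>\<open>4 * 1152 / 256 = 18\<close> is the origin of the value of
      \<open>alpha\<close>: a union over at most \<open>x^16\<close> nodes leaves
      \<open>x powr (-2)\<close>, which is summable.\<close>
    also have "\<dots> \<le> x powr (- 18)" using x alpha_ge by (intro powr_mono) auto
    finally show "prob {\<omega> \<in> space M. sqrt (ln (real (coin_count [1, j, fst q, snd q])) / 128) < \<bar>zeta j \<omega> (fst q) (snd q)\<bar>} \<le> 2 * x powr (- 18)"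
      by (simp add: n_def)
  qed auto
  also have "\<dots> \<le> x ^ 16 * (2 * x powr (- 18))"
  proof (intro mult_right_mono)
    have "card ?I = (\<Sum>p<16 * block_level j. 2^p)" by simp
    also have "\<dots> \<le> 2 ^ (16 * block_level j)" by (simp add: sum_pow2)
    finally have "card ?I \<le> 2 ^ (16 * block_level j)" .
    from of_nat_mono [OF this, where 'a=real] show "real (card ?I) \<le> x ^ 16"
      by (simp add: x_def block_scale_def mult.commute flip: power_mult)
  qed auto
  also have "\<dots> = 2 * inverse (x\<^sup>2)"
  proof -
    have "x powr (- 18) = inverse (x ^ 18)" using x by (simp add: powr_minus powr_numeral)
    also have "x ^ 18 = x ^ 16 * x\<^sup>2" by (simp flip: power_add)
    finally show ?thesis using x by (simp add: field_simps)
  qed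
  also have "\<dots> \<le> 2 * (4 * inverse (real (Suc j) ^ 2))"
  proof (intro mult_left_mono)
    have "(real (Suc j))\<^sup>2 \<le> (2 * x)\<^sup>2" using block_scale_bounds(3) [of j] by (intro power_mono) (auto simp: x_def)
    then show "inverse (x\<^sup>2) \<le> 4 * inverse (real (Suc j) ^ 2)"
      using x by (simp add: power_mult_distrib divide_simps)
  qed auto
  finally show ?thesis by simp
qed

definition block_ok :: "nat \<Rightarrow> 'w \<Rightarrow> bool" where
  "block_ok j \<omega> \<longleftrightarrow> good j (growth j) \<omega> \<and>
     (\<forall>u\<le>block_size j. \<forall>r\<le>block_size j. \<bar>block_dev j u (real r / real (block_size j)) \<omega>\<bar> \<le> sqrt (real (block_size j)) * growth j) \<and>
     (\<forall>y\<in>{0..1}. \<bar>block_dev j (block_size j) y \<omega> - sqrt (real (block_size j)) * schauder (zeta j \<omega>) y\<bar> \<le> block_const * sqrt (real (block_size j)) / (block_scale j)\<^sup>2)"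

text \<open>Borel-Cantelli for the four exceptional events, followed by
  \<open>block_coupling_det\<close> on the remaining paths.\<close>

lemma AE_block_ok: "AE \<omega> in M. \<forall>\<^sub>F j in sequentially. block_ok j \<omega>"
proof -
  have 1: "AE \<omega> in M. \<forall>\<^sub>F j in sequentially. \<omega> \<notin> bad_empirical j"
    by (rule AE_eventually_notin [OF bad_events(1) summable_poly_exp_sqrt [of 8 "16 * alpha"]]) (intro always_eventually allI prob_bad_empirical)
  have 2: "AE \<omega> in M. \<forall>\<^sub>F j in sequentially. \<omega> \<notin> bad_walk j"
    by (rule AE_eventually_notin [OF bad_events(2) summable_poly_exp_sqrt [of 4 "16 * alpha"]]) (intro always_eventually allI prob_bad_walk)
  have 3: "AE \<omega> in M. \<forall>\<^sub>F j in sequentially. \<omega> \<notin> bad_sheet j"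
    by (rule AE_eventually_notin [OF bad_events(3) summable_poly_exp_sqrt [of 12 0]]) (intro always_eventually allI prob_bad_sheet)
  have s: "summable (\<lambda>j. 8 * inverse (real (Suc j) ^ 2))"
    by (rule summable_mult [OF summable_Suc_iff [THEN iffD2, OF inverse_power_summable [of 2]]]) simp
  have 4: "AE \<omega> in M. \<forall>\<^sub>F j in sequentially. \<omega> \<notin> bad_gauss j"
    by (rule AE_eventually_notin [OF bad_events(4) s]) (intro always_eventually allI prob_bad_gauss)
  obtain n0 where n0: "\<And>n w v. n \<ge> n0 \<Longrightarrow> \<bar>v\<bar> \<le> sqrt (ln (real n) / 128) \<Longrightarrow>
     coin_frac n (\<lambda>w'. w' < w) \<le> Phi v \<Longrightarrow> Phi v \<le> coin_frac n (\<lambda>w'. w' \<le> w) \<Longrightarrow>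
     \<bar>w / sqrt (real n) - v\<bar> \<le> real n powr (-1/64)"
    using quantile_coupling unfolding eventually_sequentially by blast
  have wl: "\<forall>\<^sub>F j in sequentially. 2 \<le> growth j" unfolding growth_def by real_asymp
  have nl: "\<forall>\<^sub>F j in sequentially. 2 * real n0 \<le> real (Suc j)" by real_asymp
  show ?thesis
    using 1 2 3 4 AE_space
  proof eventually_elim
    case (elim \<omega>)
    note w = elim(5)
    show ?case using elim(1) elim(2) elim(3) elim(4) wl nl
    proof eventually_elim
      case (elim j)
      have e1: "\<bar>block_dev j u (real r / real (block_size j)) \<omega>\<bar> \<le> sqrt (real (block_size j)) * growth j" if "u \<le> block_size j" "r \<le> block_size j" for u r
        using elim(1) that w unfolding bad_empirical_def by force
      have e2: "\<bar>walk [1, j, p, r] k \<omega> - walk [1, j, p, r] (coin_count [1, j, p, r]) \<omega>\<bar> \<le> sqrt \<bar>real k - real (coin_count [1, j, p, r])\<bar> * growth j"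
        if "p < block_depth j" "r < 2^p" "k \<le> block_size j" for p r k
      proof (rule ccontr)
        assume "\<not> ?thesis"
        then have "\<omega> \<in> bad_walk j" unfolding bad_walk_def using that w by (intro UN_I [of "(p, r, k)"]) auto
        then show False using elim(2) by simp
      qed
      \<comment> \<open>Once \<open>growth j\<close> has reached 2, the maximum in
        \<open>bad_sheet\<close> is \<open>growth j\<close> itself.\<close>
      have e3: "good j (growth j) \<omega>" using elim(3) elim(5) w by (auto simp: bad_sheet_def max_def split: if_splits)
      have e4: "\<bar>walk [1, j, p, r] (coin_count [1, j, p, r]) \<omega> / sqrt (real (coin_count [1, j, p, r])) - zeta j \<omega> p r\<bar> \<le> real (coin_count [1, j, p, r]) powr (- 1/64)"
        if p: "p < 16 * block_level j" and r: "r < 2^p" for p r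
      proof (rule n0)
        define e where "e = [1, j, p, r]"
        have "real n0 \<le> block_scale j" using elim(6) block_scale_bounds(3) [of j] by linarith
        also have "block_scale j \<le> block_scale j ^ (4 * alpha)" using block_scale_bounds(1) [of j] alpha_ge by (intro self_le_power) auto
        also have "\<dots> \<le> real (coin_count e)" unfolding e_def by (rule coin_count_large [OF p])
        finally show "n0 \<le> coin_count [1, j, p, r]" by (simp only: e_def of_nat_le_iff)
        show "\<bar>zeta j \<omega> p r\<bar> \<le> sqrt (ln (real (coin_count [1, j, p, r])) / 128)"
        proof (rule ccontr)
          assume "\<not> ?thesis"
          then have "\<omega> \<in> bad_gauss j" unfolding bad_gauss_def using that w by (intro UN_I [of "(p, r)"]) auto
          then show False using elim(4) by simp
        qed
        \<comment> \<open>The Gaussian is by construction the normal quantile of the ranked heads,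
          so the bracket required by \<open>quantile_coupling\<close> is
          \<open>ranking_coin_frac\<close>.\<close>
        have P: "Phi (zeta j \<omega> p r) = quant e \<omega>" unfolding zeta_def e_def by (rule Phi_gauss [OF w])
        have X: "0 < X e \<omega>" "X e \<omega> < 1" using range_X [OF w] by auto
        show "coin_frac (coin_count [1, j, p, r]) (\<lambda>w'. w' < walk [1, j, p, r] (coin_count [1, j, p, r]) \<omega>) \<le> Phi (zeta j \<omega> p r)"
          "Phi (zeta j \<omega> p r) \<le> coin_frac (coin_count [1, j, p, r]) (\<lambda>w'. w' \<le> walk [1, j, p, r] (coin_count [1, j, p, r]) \<omega>)"
          unfolding P walk_heads quant_def unfolding e_def [symmetric]
          by (rule ranking_coin_frac [OF heads_subset X])+
      qed
      have cb: "coeff_bound (growth j) (zeta j \<omega>)" using e3 by (simp add: good_def sheet_bound_def)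
      show ?case unfolding block_ok_def
        using e1 e3 block_coupling_det [OF w growth_ge_1 growth_le e1 [OF order_refl] e2 cb e4] by blast
    qed
  qed
qed

section \<open>Iterated logarithm for the Schauder coefficients\<close>

text \<open>Chosen so that \<open>exp (- (lil_factor k)^2 / 2)\<close> equals
  \<open>(k + 3) powr (-2)\<close>, summable over the dyadic stages. As \<open>k\<close> is of order
  \<open>ln n\<close> at most, the factor is of order \<open>sqrt (ln (ln n))\<close>.\<close>

definition lil_factor :: "nat \<Rightarrow> real" where "lil_factor k = 2 * sqrt (ln (real (k + 3)))"

lemma lil_factor_ge_2: "2 \<le> lil_factor k"
proof -
  have "exp 1 \<le> (3::real)" by (rule exp_le)
  also have "\<dots> \<le> real (k + 3)" by simp
  finally have "1 \<le> ln (real (k + 3))" by (subst ln_ge_iff) auto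
  then have "1 \<le> sqrt (ln (real (k + 3)))" by simp
  then show ?thesis by (simp add: lil_factor_def)
qed

text \<open>Ottaviani's inequality for the Gaussian partial sums of one coefficient. Every stretch
  has variance at most \<open>block_start block_size J\<close>, and \<open>l >= 2\<close> brings its
  tail below 1/2.\<close>

lemma block_sum_tail:
  assumes l: "2 \<le> l"
  shows "prob {\<omega> \<in> space M. \<exists>j\<le>J. 2 * (l * sqrt (real (block_start block_size J))) < \<bar>\<Sum>i<j. sqrt (real (block_size i)) * zeta i \<omega> p r\<bar>} \<le> 4 * exp (- l\<^sup>2 / 2)"
proof -
  define V where "V = real (block_start block_size J)"
  define Y where "Y = (\<lambda>i \<omega>. sqrt (real (block_size i)) * zeta i \<omega> p r)"
  have G: "is_gauss (\<Sum>i\<in>I. real (block_size i)) (\<lambda>\<omega>. \<Sum>i\<in>I. Y i \<omega>)" if "finite I" for I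
  proof -
    have inj: "inj_on (\<lambda>i. [1, i, p, r]) I" by (auto simp: inj_on_def)
    have "is_gauss (\<Sum>e\<in>(\<lambda>i. [1, i, p, r]) ` I. (sqrt (real (block_size (e ! 1))))\<^sup>2) (\<lambda>\<omega>. \<Sum>e\<in>(\<lambda>i. [1, i, p, r]) ` I. sqrt (real (block_size (e ! 1))) * gauss e \<omega>)"
      by (rule is_gauss_sum) (use that in \<open>auto simp: gauss_index_def\<close>)
    then show ?thesis unfolding sum.reindex [OF inj] by (simp add: Y_def zeta_def o_def)
  qed
  have tail: "prob {\<omega> \<in> space M. l * sqrt V < \<bar>\<Sum>i\<in>I. Y i \<omega>\<bar>} \<le> 2 * exp (- l\<^sup>2 / 2)" if I: "I \<subseteq> {..<J}" for I
  proof (cases "I = {}")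
    case True
    have "\<not> l * sqrt V < 0" using l by (simp add: not_less V_def)
    then show ?thesis using True by simp
  next
    case False
    have fin: "finite I" using I finite_subset by blast
    show ?thesis
    proof (rule is_gauss_tail_le [OF G [OF fin]])
      show "0 < (\<Sum>i\<in>I. real (block_size i))" using fin False block_size_pos by (intro sum_pos) auto
      show "(\<Sum>i\<in>I. real (block_size i)) \<le> V" unfolding V_def block_start_def of_nat_sum using I by (intro sum_mono2) auto
    qed (use l in auto)
  qed
  have e: "exp (- l\<^sup>2 / 2) \<le> 1/4"
  proof -
    have "(2::real)\<^sup>2 \<le> l\<^sup>2" using l by (intro power_mono) auto
    then have "exp (- l\<^sup>2 / 2) \<le> exp (- 2)" by simp
    also have "(4::real) \<le> exp 2" using exp_lower_Taylor_quadratic [of 2] by simp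
    then have "exp (-2) \<le> (1/4::real)" by (simp add: exp_minus field_simps)
    finally show ?thesis .
  qed
  have ind: "indep_vars (\<lambda>_. borel) Y UNIV"
  proof -
    have "indep_vars (\<lambda>_. borel) (\<lambda>i. gauss [1, i, p, r]) UNIV"
      by (rule indep_vars_reindex [OF indep_gauss]) (auto simp: inj_on_def gauss_index_def)
    then show ?thesis unfolding Y_def zeta_def by (rule indep_vars_compose2) auto
  qed
  have "prob {\<omega> \<in> space M. \<exists>j\<le>J. 2 * (l * sqrt V) < \<bar>\<Sum>i<j. Y i \<omega>\<bar>} \<le> 2 * prob {\<omega> \<in> space M. l * sqrt V < \<bar>\<Sum>i<J. Y i \<omega>\<bar>}"
  proof (rule ottaviani [OF ind])
    show "prob {\<omega> \<in> space M. l * sqrt V < \<bar>\<Sum>i\<in>{k..<J}. Y i \<omega>\<bar>} \<le> 1/2" for k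
      using tail [of "{k..<J}"] e by force
  qed (use l in \<open>simp add: V_def\<close>)
  also have "\<dots> \<le> 2 * (2 * exp (- l\<^sup>2 / 2))" using tail [of "{..<J}"] by simp
  finally show ?thesis by (simp add: Y_def V_def)
qed

text \<open>The maximal inequality handles all \<open>j <= 2^k\<close>, the dyadic union all
  coefficients at once, and Borel-Cantelli all stages \<open>k\<close>.\<close>

lemma AE_lil: "AE \<omega> in M. \<forall>\<^sub>F k in sequentially. \<forall>j\<le>2^k.
  coeff_bound (2 * lil_factor k * sqrt (real (block_start block_size (2^k)))) (\<lambda>p r. \<Sum>i<j. sqrt (real (block_size i)) * zeta i \<omega> p r)"
proof -
  define S where "S = (\<lambda>j p r \<omega>. \<Sum>i<j. sqrt (real (block_size i)) * zeta i \<omega> p r)"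
  define V where "V = (\<lambda>k. real (block_start block_size (2^k)))"
  define B where "B = (\<lambda>k p r. {\<omega> \<in> space M. \<exists>j\<le>2^k. 2 * ((lil_factor k * sqrt (real (Suc p))) * sqrt (V k)) < \<bar>S j p r \<omega>\<bar>})"
  have [measurable]: "S j p r \<in> borel_measurable M" for j p r unfolding S_def by measurable
  have Bm [measurable]: "B k p r \<in> events" for k p r unfolding B_def by measurable
  have "AE \<omega> in M. \<forall>\<^sub>F k in sequentially. \<omega> \<notin> (\<Union>p. \<Union>r<2^p. B k p r)"
  proof (rule AE_eventually_notin)
    show "(\<Union>p. \<Union>r<2^p. B k p r) \<in> events" for k by measurable
    show "summable (\<lambda>k. 8 * inverse (real (k + 3) ^ 2))"
      by (intro summable_mult summable_ignore_initial_segment [OF inverse_power_summable]) simp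
    have "prob (\<Union>p. \<Union>r<2^p. B k p r) \<le> 8 * inverse (real (k + 3) ^ 2)" for k
    proof -
      have "prob (\<Union>p. \<Union>r<2^p. B k p r) \<le> 2 * 4 * exp (- (lil_factor k)\<^sup>2 / 2)"
      proof (rule dyadic_union_tail [OF Bm lil_factor_ge_2])
        fix q u :: nat
        have "2 * 1 \<le> lil_factor k * sqrt (real (Suc q))" using lil_factor_ge_2 [of k] by (intro mult_mono) auto
        then show "prob (B k q u) \<le> 4 * exp (- (lil_factor k * sqrt (real (Suc q)))\<^sup>2 / 2)"
          unfolding B_def V_def S_def by (intro block_sum_tail) simp
      qed auto
      also have "exp (- (lil_factor k)\<^sup>2 / 2) = inverse (real (k + 3) ^ 2)"
      proof -
        have "0 \<le> ln (real (k + 3))" by simp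
        then have "(lil_factor k)\<^sup>2 / 2 = ln (real (k + 3)) + ln (real (k + 3))" by (simp add: lil_factor_def power_mult_distrib)
        then have "exp (- (lil_factor k)\<^sup>2 / 2) = inverse (exp (ln (real (k + 3)) + ln (real (k + 3))))"
          by (simp only: exp_minus minus_divide_left [symmetric])
        also have "exp (ln (real (k + 3)) + ln (real (k + 3))) = real (k + 3) * real (k + 3)"
          by (simp only: exp_add) simp
        finally show ?thesis by (simp only: power2_eq_square)
      qed
      finally show ?thesis by simp
    qed
    then show "\<forall>\<^sub>F k in sequentially. prob (\<Union>p. \<Union>r<2^p. B k p r) \<le> 8 * inverse (real (k + 3) ^ 2)" by simp
  qed
  then show ?thesis
    using AE_space
  proof eventually_elim
    case (elim \<omega>)
    from elim(1) show ?case
    proof eventually_elim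
      case (elim k)
      have "\<bar>S j p r \<omega>\<bar> \<le> 2 * lil_factor k * sqrt (V k) * sqrt (real (Suc p))" if "j \<le> 2^k" "r < 2^p" for j p r
        using elim that \<open>\<omega> \<in> space M\<close> by (force simp: B_def mult_ac not_less)
      then show ?case by (simp add: coeff_bound_def S_def V_def)
    qed
  qed
qed

end

section \<open>Approximation of the uniform empirical process\<close>

lemma block_level_mono: "i \<le> j \<Longrightarrow> block_level i \<le> block_level j"
  unfolding block_level_def using floor_log_mono by (auto simp: mono_def)

lemma block_size_mono: "i \<le> j \<Longrightarrow> block_size i \<le> block_size j"
  unfolding block_size_def using block_level_mono by (intro power_increasing) auto

abbreviation block_offset :: "nat \<Rightarrow> nat" where "block_offset \<equiv> block_start block_size"

lemma block_offset_mono: "i \<le> j \<Longrightarrow> block_offset i \<le> block_offset j"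
  unfolding block_start_def by (intro sum_mono2) auto

lemma block_offset_ge: "j \<le> block_offset j"
  by (rule block_start_ge) (rule block_size_pos)

definition block_of :: "nat \<Rightarrow> nat" where "block_of n = (LEAST j. n < block_offset (Suc j))"

lemma block_of_bounds: "block_offset (block_of n) \<le> n" "n < block_offset (Suc (block_of n))"
proof -
  have "n < block_offset (Suc n)" using block_offset_ge [of "Suc n"] by simp
  then show u: "n < block_offset (Suc (block_of n))" unfolding block_of_def by (rule LeastI)
  show "block_offset (block_of n) \<le> n"
  proof (cases "block_of n")
    case (Suc j)
    then have "\<not> n < block_offset (Suc j)" using not_less_Least [of j "\<lambda>j. n < block_offset (Suc j)"] by (simp add: block_of_def)
    then show ?thesis using Suc by simp
  qed (simp add: block_start_def)
qed

lemma block_of_unique: "block_offset j \<le> i \<Longrightarrow> i < block_offset (Suc j) \<Longrightarrow> block_of i = j"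
  using block_of_bounds [of i] block_offset_mono [of "Suc j" "block_of i"] block_offset_mono [of "Suc (block_of i)" j]
  by (meson le_less_trans not_less not_less_eq order_antisym)

lemma block_of_at_top: "filterlim block_of at_top sequentially"
  unfolding filterlim_at_top
proof
  fix K
  show "\<forall>\<^sub>F n in sequentially. K \<le> block_of n"
    using eventually_ge_at_top [of "block_offset K"]
  proof eventually_elim
    case (elim n)
    show "K \<le> block_of n"
    proof (rule ccontr)
      assume "\<not> K \<le> block_of n"
      then have "block_offset (Suc (block_of n)) \<le> block_offset K" by (intro block_offset_mono) auto
      then show False using elim block_of_bounds(2) [of n] by simp
    qed
  qed
qed

text \<open>The loss in block size when the scale changes by a factor 4. This covers both
  comparisons below: with half the block number and with the next power of two.\<close>

definition size_ratio :: real where "size_ratio = 1 / 4 ^ (8 * alpha)"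

lemma size_ratio_pos: "0 < size_ratio" by (simp add: size_ratio_def)

lemma block_size_le_scale: "block_scale i \<le> 4 * block_scale j \<Longrightarrow> real (block_size i) * size_ratio \<le> real (block_size j)"
proof -
  assume "block_scale i \<le> 4 * block_scale j"
  then have "block_scale i ^ (8 * alpha) \<le> (4 * block_scale j) ^ (8 * alpha)"
    using block_scale_bounds(1) [of i] by (intro power_mono) auto
  then show ?thesis by (simp add: block_size_block_scale size_ratio_def power_mult_distrib divide_simps mult.commute)
qed

text \<open>By polynomial growth the blocks between \<open>J / 2\<close> and \<open>J\<close> are
  all comparable to block \<open>J\<close>. There are about \<open>J / 2\<close> of them, so the
  last block is negligible against the sample before it.\<close>

lemma block_offset_lower: "real J / 2 * (size_ratio * real (block_size J)) \<le> real (block_offset J)"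
proof -
  define H where "H = J div 2"
  have H: "H \<le> J" "real J / 2 \<le> real (J - H)"
  proof -
    show "H \<le> J" by (simp add: H_def)
    then show "real J / 2 \<le> real (J - H)" unfolding H_def by linarith
  qed
  have "block_scale J \<le> 4 * block_scale H"
  proof -
    have "Suc J \<le> 2 * Suc H" unfolding H_def by presburger
    then have "real (Suc J) \<le> real (2 * Suc H)" by (rule of_nat_mono)
    then have "real (Suc J) \<le> 2 * real (Suc H)" by simp
    then show ?thesis using block_scale_bounds(2) [of J] block_scale_bounds(3) [of H] by (smt (verit))
  qed
  then have m: "size_ratio * real (block_size J) \<le> real (block_size H)" using block_size_le_scale [of J H] by (simp add: mult.commute)
  have "real J / 2 * (size_ratio * real (block_size J)) \<le> real (J - H) * real (block_size H)"
    using H m size_ratio_pos by (intro mult_mono) auto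
  also have "\<dots> = (\<Sum>i\<in>{H..<J}. real (block_size H))" by simp
  also have "\<dots> \<le> (\<Sum>i\<in>{H..<J}. real (block_size i))" by (intro sum_mono of_nat_mono block_size_mono) auto
  also have "\<dots> \<le> (\<Sum>i<J. real (block_size i))" by (intro sum_mono2) auto
  finally show ?thesis by (simp add: block_start_def)
qed

lemma sqrt_block_size_le: "0 < J \<Longrightarrow> sqrt (real (block_size J)) \<le> sqrt (2 / size_ratio) * sqrt (real (block_offset J)) / sqrt (real J)"
proof -
  assume J: "0 < J"
  have "real (block_size J) \<le> 2 / size_ratio * real (block_offset J) / real J"
    using block_offset_lower [of J] J size_ratio_pos by (simp add: field_simps)
  then have "sqrt (real (block_size J)) \<le> sqrt (2 / size_ratio * real (block_offset J) / real J)" by (rule real_sqrt_le_mono)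
  then show ?thesis by (simp only: real_sqrt_mult real_sqrt_divide)
qed

text \<open>Transfers the iterated logarithm from the dyadic stage to \<open>J\<close>: rounding the
  block number up to a power of two enlarges the sample size only by a constant factor.\<close>

lemma block_offset_pow2_le: "0 < J \<Longrightarrow> real (block_offset (2 ^ Suc (block_level J))) \<le> 8 / size_ratio\<^sup>2 * real (block_offset J)"
proof -
  assume J: "0 < J"
  define N where "N = (2::nat) ^ Suc (block_level J)"
  have N: "real N = 2 * block_scale J" by (simp add: N_def block_scale_def)
  have "block_scale N \<le> 4 * block_scale J"
    using block_scale_bounds(2) [of N] block_scale_bounds(1) [of J] by (simp add: N)
  then have m: "real (block_size N) \<le> real (block_size J) / size_ratio" using block_size_le_scale [of N J] size_ratio_pos by (simp add: field_simps)
  have "real (block_offset N) \<le> (\<Sum>i<N. real (block_size N))"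
    unfolding block_start_def of_nat_sum by (intro sum_mono of_nat_mono block_size_mono) auto
  also have "\<dots> = 2 * block_scale J * real (block_size N)" by (simp add: N)
  also have "\<dots> \<le> (4 * real J) * (real (block_size J) / size_ratio)"
  proof (rule mult_mono [OF _ m])
    show "2 * block_scale J \<le> 4 * real J" using block_scale_bounds(2) [of J] J by simp
  qed (use J in auto)
  also have "\<dots> = 8 / size_ratio\<^sup>2 * (real J / 2 * (size_ratio * real (block_size J)))"
    using size_ratio_pos by (simp add: field_simps power2_eq_square)
  also have "\<dots> \<le> 8 / size_ratio\<^sup>2 * real (block_offset J)" by (intro mult_left_mono block_offset_lower) auto
  finally show ?thesis by (simp add: N_def)
qed

lemma sum_inverse_squares: "(\<Sum>j<J. 1 / (real (Suc j))\<^sup>2) \<le> 2"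
proof -
  have "(\<Sum>j<Suc K. 1 / (real (Suc j))\<^sup>2) \<le> 2 - 1 / real (Suc K)" for K
  proof (induction K)
    case (Suc K)
    define q where "q = real (Suc K)"
    have q: "0 < q" by (simp add: q_def)
    have "1 / (q + 1)\<^sup>2 \<le> 1 / (q * (q + 1))"
      using q by (intro divide_left_mono) (auto simp: power2_eq_square intro!: mult_right_mono)
    also have "\<dots> = 1 / q - 1 / (q + 1)" using q by (simp add: field_simps)
    finally have "1 / (q + 1)\<^sup>2 \<le> 1 / q - 1 / (q + 1)" .
    moreover have "real (Suc (Suc K)) = q + 1" by (simp add: q_def)
    ultimately show ?case using Suc unfolding sum.lessThan_Suc [of _ "Suc K"] q_def [symmetric] by (simp add: add.commute)
  qed simp
  from this [of J] have "(\<Sum>j<Suc J. 1 / (real (Suc j))\<^sup>2) \<le> 2" by (rule order_trans) simp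
  moreover have "(\<Sum>j<J. 1 / (real (Suc j))\<^sup>2) \<le> (\<Sum>j<Suc J. 1 / (real (Suc j))\<^sup>2)" by simp
  ultimately show ?thesis by linarith
qed

lemma sum_block_offset_split: "(\<Sum>i<block_offset J. g i) = (\<Sum>j<J. \<Sum>i<block_size j. g (block_offset j + i))" for g :: "nat \<Rightarrow> real"
proof (induction J)
  case (Suc J)
  have "(\<Sum>i<a + b. g i) = (\<Sum>i<a. g i) + (\<Sum>i<b. g (a + i))" for a b
    by (induction b) auto
  then show ?case using Suc by (simp add: block_start_Suc)
qed (simp add: block_start_def)

section \<open>From the blocks to the whole sample\<close>

context coupling
begin

definition U :: "nat \<Rightarrow> 'w \<Rightarrow> real" where
  "U i \<omega> = sample (block_of i, i - block_offset (block_of i)) \<omega>"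

definition emp_dev :: "nat \<Rightarrow> real \<Rightarrow> 'w \<Rightarrow> real" where
  "emp_dev n y \<omega> = real (card {i. i < n \<and> U i \<omega> \<le> y}) - real n * y"

lemma U_block: "i < block_size j \<Longrightarrow> U (block_offset j + i) \<omega> = sample (j, i) \<omega>"
  using block_of_unique [of j "block_offset j + i"] by (simp add: U_def block_start_Suc)

lemma emp_dev_sum: "emp_dev n y \<omega> = (\<Sum>i<n. (if U i \<omega> \<le> y then 1 else 0) - y)"
  by (simp add: emp_dev_def sum_subtractf sum.If_cases Int_def)

lemma block_dev_sum: "block_dev j u y \<omega> = (\<Sum>i<u. (if sample (j, i) \<omega> \<le> y then 1 else 0) - y)"
  by (simp add: block_dev_def sum_subtractf sum.If_cases Int_def)

lemma emp_dev_split: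
  assumes u: "u \<le> block_size J"
  shows "emp_dev (block_offset J + u) y \<omega> = (\<Sum>j<J. block_dev j (block_size j) y \<omega>) + block_dev J u y \<omega>"
proof -
  have "(\<Sum>i<block_offset J + u. g i) = (\<Sum>i<block_offset J. g i) + (\<Sum>i<u. g (block_offset J + i))" for g :: "nat \<Rightarrow> real"
    by (induction u) auto
  then have "emp_dev (block_offset J + u) y \<omega> = (\<Sum>j<J. \<Sum>i<block_size j. (if U (block_offset j + i) \<omega> \<le> y then 1 else 0) - y) + (\<Sum>i<u. (if U (block_offset J + i) \<omega> \<le> y then 1 else 0) - y)"
    by (simp only: emp_dev_sum sum_block_offset_split)
  then show ?thesis using u by (simp add: block_dev_sum U_block)
qed

lemma kiefer_sum_split:
  assumes g: "all_good \<omega>" and u: "u \<le> block_size J"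
  shows "kiefer_sum y (real (block_offset J + u)) \<omega> =
    - ((\<Sum>j<J. sqrt (real (block_size j)) * schauder (zeta j \<omega>) y) + sqrt (real (block_size J)) * sheet (zeta J \<omega>) (inner J \<omega>) y (real u / real (block_size J)))"
proof -
  define t where "t = real (block_offset J + u)"
  define N where "N = Suc J + (block_offset J + u)"
  have tN: "t \<le> real N" by (simp add: t_def N_def)
  let ?f = "\<lambda>j. sqrt (real (block_size j)) * sheet (zeta j \<omega>) (inner j \<omega>) y (block_time block_size j t)"
  have k: "kiefer_sum y t \<omega> = - (\<Sum>j<N. ?f j)" by (rule kiefer_sum_eq [OF block_size_pos g tN])
  have z: "?f j = 0" if "J < j" for j
  proof -
    have "block_offset (Suc J) \<le> block_offset j" using that by (intro block_offset_mono) simp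
    then have "t \<le> real (block_offset j)" using u by (simp add: t_def block_start_Suc)
    then have "(t - real (block_offset j)) / real (block_size j) \<le> 0" using block_size_pos [of j] by (simp add: divide_nonpos_pos)
    then have "block_time block_size j t = 0" by (simp add: block_time_def clamp01_def)
    then show ?thesis by simp
  qed
  have o: "?f j = sqrt (real (block_size j)) * schauder (zeta j \<omega>) y" if "j < J" for j
  proof -
    have "block_offset (Suc j) \<le> block_offset J" using that by (intro block_offset_mono) simp
    then have "real (block_offset j) + real (block_size j) \<le> t" by (simp add: t_def block_start_Suc)
    then have "1 \<le> (t - real (block_offset j)) / real (block_size j)" using block_size_pos [of j] by (simp add: pos_le_divide_eq)
    then have "block_time block_size j t = 1" by (simp add: block_time_def clamp01_def)
    then show ?thesis by (simp add: sheet_def)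
  qed
  have l: "block_time block_size J t = real u / real (block_size J)"
  proof -
    have "real u / real (block_size J) \<le> 1" using u block_size_pos [of J] by (simp add: divide_le_eq)
    then show ?thesis by (simp add: block_time_def clamp01_def t_def)
  qed
  have "(\<Sum>j<N. ?f j) = (\<Sum>j<Suc J. ?f j)"
    by (rule sum.mono_neutral_right) (use z in \<open>auto simp: N_def\<close>)
  also have "\<dots> = (\<Sum>j<J. ?f j) + ?f J" by simp
  also have "(\<Sum>j<J. ?f j) = (\<Sum>j<J. sqrt (real (block_size j)) * schauder (zeta j \<omega>) y)"
    by (rule sum.cong [OF refl], rule o) simp
  finally show ?thesis unfolding t_def [symmetric] using k by (simp add: l)
qed

definition node_sum :: "nat \<Rightarrow> 'w \<Rightarrow> nat \<Rightarrow> nat \<Rightarrow> real" where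
  "node_sum J \<omega> p r = (\<Sum>i<J. sqrt (real (block_size i)) * zeta i \<omega> p r)"

lemma good_coeff: "all_good \<omega> \<Longrightarrow> \<exists>l\<ge>0. coeff_bound l (zeta j \<omega>)"
  using good_nonneg_ex [of \<omega> j] by (auto simp: sheet_bound_def)

lemma schauder_node_sum:
  assumes g: "all_good \<omega>"
  shows "schauder (node_sum J \<omega>) y = (\<Sum>j<J. sqrt (real (block_size j)) * schauder (zeta j \<omega>) y)"
proof -
  obtain l where l: "\<And>j. coeff_bound (l j) (zeta j \<omega>)" using good_coeff [OF g] by metis
  show ?thesis
    using schauder_sum [of "{..<J}" l "\<lambda>j. zeta j \<omega>" "\<lambda>j. sqrt (real (block_size j))" y] l
    by (simp add: node_sum_def [abs_def])
qed

text \<open>Between neighbouring grid points the count is monotone and the centering moves by at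
  most \<open>u / block_size j <= 1\<close>.\<close>

lemma block_dev_interpolate:
  assumes e: "\<And>r. r \<le> block_size j \<Longrightarrow> \<bar>block_dev j u (real r / real (block_size j)) \<omega>\<bar> \<le> B" and u: "u \<le> block_size j" and y: "y \<in> {0..1}"
  shows "\<bar>block_dev j u y \<omega>\<bar> \<le> B + 1"
proof (cases "y = 1")
  case True
  then show ?thesis using e [of "block_size j"] block_size_pos [of j] by simp
next
  case False
  define m where "m = real (block_size j)"
  have m: "0 < m" using block_size_pos [of j] by (simp add: m_def)
  define k where "k = nat \<lfloor>y * m\<rfloor>"
  have y01: "0 \<le> y" "y < 1" using y False by auto
  have k1: "real k \<le> y * m" "y * m < real k + 1" using y01 m by (auto simp: k_def)
  have km: "Suc k \<le> block_size j"
  proof -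
    have "y * m < 1 * m" using y01 m by (intro mult_strict_right_mono) auto
    then have "real k < real (block_size j)" using k1(1) by (simp add: m_def)
    then show ?thesis by simp
  qed
  have yy: "real k / m \<le> y" "y \<le> real (Suc k) / m" using k1 m by (simp_all add: field_simps)
  have mono: "block_dev j u a \<omega> + real u * a \<le> block_dev j u b \<omega> + real u * b" if "a \<le> b" for a b
  proof -
    have "card {i. i < u \<and> sample (j, i) \<omega> \<le> a} \<le> card {i. i < u \<and> sample (j, i) \<omega> \<le> b}"
      using that by (intro card_mono) auto
    then show ?thesis by (simp add: block_dev_def)
  qed
  have um: "real u * (1 / m) \<le> 1" using u m by (simp add: m_def)
  have "real (Suc k) / m = real k / m + 1 / m" by (simp add: add_divide_distrib)
  then have d: "real (Suc k) / m - y \<le> 1 / m" "y - real k / m \<le> 1 / m" using yy by linarith+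
  have "real u * (real (Suc k) / m - y) \<le> 1" "real u * (y - real k / m) \<le> 1"
    using mult_left_mono [OF d(1), of "real u"] mult_left_mono [OF d(2), of "real u"] um by linarith+
  then have "block_dev j u y \<omega> \<le> block_dev j u (real (Suc k) / m) \<omega> + 1" "block_dev j u (real k / m) \<omega> - 1 \<le> block_dev j u y \<omega>"
    using mono [OF yy(1)] mono [OF yy(2)] by (simp_all add: right_diff_distrib)
  moreover have "\<bar>block_dev j u (real (Suc k) / m) \<omega>\<bar> \<le> B" "\<bar>block_dev j u (real k / m) \<omega>\<bar> \<le> B"
    using e [of "Suc k"] e [of k] km unfolding m_def by auto
  ultimately show ?thesis by (simp add: abs_le_iff)
qed

text \<open>The contributions of the finished blocks, of the empirical process of the current block,
  and of its unfinished sheet.\<close>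

definition error_const :: real where "error_const = 8 * block_const + 2 + holder_const + holder_const\<^sup>2"

text \<open>Finished blocks are coupled; since block sizes increase, their errors sum to a multiple
  of \<open>sqrt (block_size J)\<close> through the inverse squares. The finitely many blocks before
  \<open>j0\<close> go into \<open>C0\<close>. For the current block both processes are only
  bounded. The first claim serves the modulus of continuity, the second the Kiefer
  approximation.\<close>

lemma approximation_at_block:
  assumes g: "all_good \<omega>" and ok_all: "\<forall>j\<ge>j0. block_ok j \<omega>"
  shows "\<exists>C0\<ge>0. \<forall>J\<ge>j0. \<forall>u\<le>block_size J. \<forall>y\<in>{0..1}.
    \<bar>emp_dev (block_offset J + u) y \<omega> - schauder (node_sum J \<omega>) y\<bar> \<le> C0 + error_const * sqrt (real (block_size J)) * growth J \<and>
    \<bar>emp_dev (block_offset J + u) y \<omega> + kiefer_sum y (real (block_offset J + u)) \<omega>\<bar> \<le> C0 + error_const * sqrt (real (block_size J)) * growth J"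
proof -
  note ok = ok_all [rule_format]
  obtain l where l: "\<And>j. 0 \<le> l j \<and> coeff_bound (l j) (zeta j \<omega>)" using good_coeff [OF g] by metis
  define D where "D = (\<lambda>j y. block_dev j (block_size j) y \<omega> - sqrt (real (block_size j)) * schauder (zeta j \<omega>) y)"
  define B where "B = (\<lambda>j. real (block_size j) + sqrt (real (block_size j)) * (holder_const * l j))"
  have h: "0 \<le> holder_const" using holder_const_pos by simp
  have bc: "0 \<le> block_const" unfolding block_const_def using h by (intro add_nonneg_nonneg mult_nonneg_nonneg) auto
  have DB: "\<bar>D j y\<bar> \<le> B j" if y: "y \<in> {0..1}" for j y
  proof -
    have "card {i. i < block_size j \<and> sample (j, i) \<omega> \<le> y} \<le> card {..<block_size j}" by (intro card_mono) auto
    then have c: "real (card {i. i < block_size j \<and> sample (j, i) \<omega> \<le> y}) \<le> real (block_size j)" by simp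
    have "real (block_size j) * y \<le> real (block_size j) * 1" using y by (intro mult_left_mono) auto
    moreover have "0 \<le> real (block_size j) * y" using y by (intro mult_nonneg_nonneg) auto
    ultimately have "\<bar>block_dev j (block_size j) y \<omega>\<bar> \<le> real (block_size j)" using c by (simp add: block_dev_def abs_le_iff)
    moreover have "\<bar>sqrt (real (block_size j)) * schauder (zeta j \<omega>) y\<bar> \<le> sqrt (real (block_size j)) * (holder_const * l j)"
      unfolding abs_mult using schauder_bound [of "l j" "zeta j \<omega>" y] l y by (intro mult_mono) auto
    ultimately show ?thesis by (simp add: D_def B_def abs_le_iff)
  qed
  have B0: "0 \<le> B j" for j unfolding B_def using l h by auto
  define C0 where "C0 = (\<Sum>j<j0. B j)"
  have C0: "0 \<le> C0" unfolding C0_def by (intro sum_nonneg B0)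
  have main: "\<bar>\<Sum>j<J. D j y\<bar> \<le> C0 + 8 * block_const * sqrt (real (block_size J))" if y: "y \<in> {0..1}" and J: "j0 \<le> J" for J y
  proof -
    have "\<bar>\<Sum>j<J. D j y\<bar> \<le> (\<Sum>j<J. \<bar>D j y\<bar>)" by (rule sum_abs)
    also have "\<dots> \<le> (\<Sum>j<J. (if j < j0 then B j else 0) + 4 * block_const * sqrt (real (block_size J)) * (1 / (real (Suc j))\<^sup>2))"
    proof (rule sum_mono)
      fix j assume j: "j \<in> {..<J}"
      show "\<bar>D j y\<bar> \<le> (if j < j0 then B j else 0) + 4 * block_const * sqrt (real (block_size J)) * (1 / (real (Suc j))\<^sup>2)"
      proof (cases "j < j0")
        case True
        then show ?thesis using DB [OF y, of j] bc by (simp add: add_increasing2)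
      next
        case False
        then have "\<bar>D j y\<bar> \<le> block_const * sqrt (real (block_size j)) / (block_scale j)\<^sup>2"
          using ok [of j] y by (simp add: block_ok_def D_def)
        also have "\<dots> = block_const * sqrt (real (block_size j)) * (1 / (block_scale j)\<^sup>2)" by simp
        also have "\<dots> \<le> block_const * sqrt (real (block_size J)) * (4 * (1 / (real (Suc j))\<^sup>2))"
        proof (intro mult_mono mult_left_mono bc)
          show "sqrt (real (block_size j)) \<le> sqrt (real (block_size J))" using block_size_mono [of j J] j by simp
          have "(real (Suc j))\<^sup>2 \<le> (2 * block_scale j)\<^sup>2" using block_scale_bounds(3) [of j] by (intro power_mono) auto
          then show "1 / (block_scale j)\<^sup>2 \<le> 4 * (1 / (real (Suc j))\<^sup>2)"
            using block_scale_bounds(1) [of j] by (simp add: power_mult_distrib divide_simps)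
        qed (use bc in auto)
        finally show ?thesis using False by (simp add: mult_ac)
      qed
    qed
    also have "\<dots> = (\<Sum>j<J. if j < j0 then B j else 0) + 4 * block_const * sqrt (real (block_size J)) * (\<Sum>j<J. 1 / (real (Suc j))\<^sup>2)"
      by (simp only: sum.distrib sum_distrib_left)
    also have "(\<Sum>j<J. if j < j0 then B j else 0) = C0"
    proof -
      have "{..<J} \<inter> {j. j < j0} = {..<j0}" using J by auto
      then show ?thesis by (simp add: sum.If_cases C0_def)
    qed
    also have "4 * block_const * sqrt (real (block_size J)) * (\<Sum>j<J. 1 / (real (Suc j))\<^sup>2) \<le> 4 * block_const * sqrt (real (block_size J)) * 2"
      using bc by (intro mult_left_mono sum_inverse_squares) auto
    finally show ?thesis by simp
  qed
  show ?thesis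
  proof (intro exI [of _ C0] conjI allI ballI impI C0)
    fix J u y assume J: "j0 \<le> J" and u: "u \<le> block_size J" and y: "y \<in> {0..1 :: real}"
    define s where "s = sqrt (real (block_size J))"
    have s: "1 \<le> s" using block_size_pos [of J] by (simp add: s_def)
    have w: "1 \<le> growth J" by (rule growth_ge_1)
    have sw: "s \<le> s * growth J" "1 \<le> s * growth J" using s w mult_mono [of 1 s 1 "growth J"] by (simp_all add: mult_le_cancel_left1)
    have e: "\<bar>block_dev J u y \<omega>\<bar> \<le> s * growth J + 1"
      by (rule block_dev_interpolate) (use ok [OF J] u y in \<open>auto simp: block_ok_def s_def\<close>)
    have d: "(\<Sum>j<J. block_dev j (block_size j) y \<omega>) = (\<Sum>j<J. D j y) + schauder (node_sum J \<omega>) y"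
      by (simp add: schauder_node_sum [OF g] D_def sum_subtractf)
    have k8: "8 * block_const * s \<le> 8 * block_const * (s * growth J)" using bc sw by (intro mult_left_mono) auto
    have ex: "error_const * s * growth J = 8 * block_const * (s * growth J) + 2 * (s * growth J) + (holder_const + holder_const\<^sup>2) * (s * growth J)"
      by (simp add: error_const_def algebra_simps)
    have hh: "0 \<le> (holder_const + holder_const\<^sup>2) * (s * growth J)" using h s w by (intro mult_nonneg_nonneg add_nonneg_nonneg) auto
    have md: "\<bar>\<Sum>j<J. D j y\<bar> \<le> C0 + 8 * block_const * s" using main [OF y J] by (simp add: s_def)
    show "\<bar>emp_dev (block_offset J + u) y \<omega> - schauder (node_sum J \<omega>) y\<bar> \<le> C0 + error_const * sqrt (real (block_size J)) * growth J"
      unfolding emp_dev_split [OF u] d s_def [symmetric] ex using md e k8 sw hh by linarith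
    have sh: "\<bar>s * sheet (zeta J \<omega>) (inner J \<omega>) y (real u / real (block_size J))\<bar> \<le> (holder_const + holder_const\<^sup>2) * (s * growth J)"
    proof -
      have "real u / real (block_size J) \<in> {0..1}" using u block_size_pos [of J] by (simp add: divide_le_eq)
      then have "\<bar>sheet (zeta J \<omega>) (inner J \<omega>) y (real u / real (block_size J))\<bar> \<le> (holder_const + holder_const\<^sup>2) * growth J"
        using ok [OF J] w y by (intro sheet_le) (auto simp: block_ok_def good_def)
      then have "s * \<bar>sheet (zeta J \<omega>) (inner J \<omega>) y (real u / real (block_size J))\<bar> \<le> s * ((holder_const + holder_const\<^sup>2) * growth J)"
        using s by (intro mult_left_mono) auto
      then show ?thesis using s by (simp add: abs_mult mult_ac)
    qed
    show "\<bar>emp_dev (block_offset J + u) y \<omega> + kiefer_sum y (real (block_offset J + u)) \<omega>\<bar> \<le> C0 + error_const * sqrt (real (block_size J)) * growth J"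
      unfolding emp_dev_split [OF u] kiefer_sum_split [OF g u] schauder_node_sum [OF g, symmetric] d s_def [symmetric] ex
      using md e k8 sw sh by linarith
  qed
qed

definition lil_const :: real where "lil_const = 16 * holder_const / size_ratio"

text \<open>The Kiefer approximation comes straight from \<open>approximation_at_block\<close>. For
  the modulus the finished blocks are represented by a single Schauder series, whose coefficients
  obey the iterated logarithm; its Hoelder exponent 1/4 appears as the double square root.\<close>

theorem AE_empirical:
  "AE \<omega> in M. \<exists>eps :: nat \<Rightarrow> real. eps \<longlonglongrightarrow> 0 \<and> (\<forall>\<^sub>F n in sequentially.
     (\<forall>y\<in>{0..1}. \<bar>emp_dev n y \<omega> + kiefer_sum y (real n) \<omega>\<bar> \<le> eps n * sqrt (real n)) \<and>
     (\<forall>y\<in>{0..1}. \<forall>y'\<in>{0..1}. \<bar>emp_dev n y \<omega> - emp_dev n y' \<omega>\<bar> \<le>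
        (lil_const * sqrt (ln (ln (real n))) * sqrt (sqrt \<bar>y - y'\<bar>) + eps n) * sqrt (real n)))"
  using AE_block_ok AE_lil AE_all_good AE_space
proof eventually_elim
  case (elim \<omega>)
  note g = elim(3)
  obtain j0 where j0: "\<forall>j\<ge>j0. block_ok j \<omega>"
    using elim(1) unfolding eventually_sequentially by blast
  obtain k0 where k0: "\<And>k j. k0 \<le> k \<Longrightarrow> j \<le> 2^k \<Longrightarrow> coeff_bound (2 * lil_factor k * sqrt (real (block_offset (2^k)))) (node_sum j \<omega>)"
    using elim(2) unfolding eventually_sequentially node_sum_def [abs_def] by blast
  from approximation_at_block [OF g j0] obtain C0 where C0: "0 \<le> C0" and ap': "\<forall>J\<ge>j0. \<forall>u\<le>block_size J. \<forall>y\<in>{0..1}.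
    \<bar>emp_dev (block_offset J + u) y \<omega> - schauder (node_sum J \<omega>) y\<bar> \<le> C0 + error_const * sqrt (real (block_size J)) * growth J \<and>
    \<bar>emp_dev (block_offset J + u) y \<omega> + kiefer_sum y (real (block_offset J + u)) \<omega>\<bar> \<le> C0 + error_const * sqrt (real (block_size J)) * growth J"
    by (elim exE conjE) (rule that)
  note ap = ap' [rule_format]
  \<comment> \<open>Of order \<open>J powr (-1/4)\<close>, by \<open>sqrt_block_size_le\<close>. The
    leading factor 2 pays for the two points in the modulus of continuity.\<close>
  define eJ where "eJ = (\<lambda>J::nat. 2 * (C0 / sqrt (real J) + error_const * sqrt (2 / size_ratio) * sqrt (sqrt (real (Suc J))) / sqrt (real J)))"
  define eps where "eps = (\<lambda>n. eJ (block_of n))"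
  have eJ0: "eJ \<longlonglongrightarrow> 0"
  proof -
    have 1: "(\<lambda>J::nat. 1 / sqrt (real J)) \<longlonglongrightarrow> 0" by real_asymp
    have 2: "(\<lambda>J::nat. sqrt (sqrt (real (Suc J))) / sqrt (real J)) \<longlonglongrightarrow> 0" by real_asymp
    have "(\<lambda>J::nat. 2 * (C0 * (1 / sqrt (real J)) + error_const * sqrt (2 / size_ratio) * (sqrt (sqrt (real (Suc J))) / sqrt (real J)))) \<longlonglongrightarrow> 2 * (C0 * 0 + error_const * sqrt (2 / size_ratio) * 0)"
      by (intro tendsto_mult tendsto_add tendsto_const 1 2)
    then show ?thesis by (simp add: eJ_def)
  qed
  have eps0: "eps \<longlonglongrightarrow> 0" unfolding eps_def by (rule filterlim_compose [OF eJ0 block_of_at_top])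
  have bl: "\<forall>\<^sub>F n in sequentially. max (Suc j0) (2 ^ Suc k0) \<le> block_of n"
    using block_of_at_top unfolding filterlim_at_top by blast
  \<comment> \<open>With \<open>k = Suc (block_level J)\<close> and \<open>block_level J\<close> at
    most the binary logarithm of \<open>n + 1\<close>, this gives \<open>k + 3 <= (ln n)^2\<close>,
    hence \<open>lil_factor k\<close> of order \<open>sqrt (ln (ln n))\<close>.\<close>
  have ll: "\<forall>\<^sub>F n::nat in sequentially. ln (real (n + 1)) / ln 2 + 4 \<le> (ln (real n))\<^sup>2" by real_asymp
  have "\<forall>\<^sub>F n in sequentially.
     (\<forall>y\<in>{0..1}. \<bar>emp_dev n y \<omega> + kiefer_sum y (real n) \<omega>\<bar> \<le> eps n * sqrt (real n)) \<and>
     (\<forall>y\<in>{0..1}. \<forall>y'\<in>{0..1}. \<bar>emp_dev n y \<omega> - emp_dev n y' \<omega>\<bar> \<le>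
        (lil_const * sqrt (ln (ln (real n))) * sqrt (sqrt \<bar>y - y'\<bar>) + eps n) * sqrt (real n))"
    using bl ll eventually_gt_at_top [of 3]
  proof eventually_elim
    case (elim n)
    define J where "J = block_of n"
    define u where "u = n - block_offset J"
    have J: "j0 \<le> J" "0 < J" "2 ^ Suc k0 \<le> J" using elim(1) by (auto simp: J_def)
    have n: "n = block_offset J + u" "u \<le> block_size J" using block_of_bounds [of n] by (auto simp: u_def J_def block_start_Suc)
    have bn: "sqrt (real (block_offset J)) \<le> sqrt (real n)" using n by simp
    define E where "E = C0 + error_const * sqrt (real (block_size J)) * growth J"
    have ec: "0 \<le> error_const" unfolding error_const_def block_const_def using holder_const_pos by (intro add_nonneg_nonneg mult_nonneg_nonneg) auto
    have EJ: "2 * E \<le> eps n * sqrt (real n)"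
    proof -
      have sJ: "0 < sqrt (real J)" using J by simp
      have "sqrt (real J) \<le> sqrt (real n)" using block_offset_ge [of J] n by simp
      then have "C0 * sqrt (real J) \<le> C0 * sqrt (real n)" using C0 by (intro mult_left_mono)
      then have 1: "C0 \<le> C0 / sqrt (real J) * sqrt (real n)" using sJ by (simp add: pos_le_divide_eq)
      have "error_const * sqrt (real (block_size J)) * growth J \<le> error_const * (sqrt (2 / size_ratio) * sqrt (real n) / sqrt (real J)) * growth J"
      proof (intro mult_right_mono mult_left_mono ec)
        have "sqrt (2 / size_ratio) * sqrt (real (block_offset J)) / sqrt (real J) \<le> sqrt (2 / size_ratio) * sqrt (real n) / sqrt (real J)"
          using bn size_ratio_pos by (intro divide_right_mono mult_left_mono) auto
        then show "sqrt (real (block_size J)) \<le> sqrt (2 / size_ratio) * sqrt (real n) / sqrt (real J)"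
          using sqrt_block_size_le [OF J(2)] by linarith
      qed (use growth_ge_1 [of J] in simp)
      then have "E \<le> C0 / sqrt (real J) * sqrt (real n) + error_const * (sqrt (2 / size_ratio) * sqrt (real n) / sqrt (real J)) * growth J"
        unfolding E_def using 1 by linarith
      also have "\<dots> = (C0 / sqrt (real J) + error_const * sqrt (2 / size_ratio) * growth J / sqrt (real J)) * sqrt (real n)"
        by (simp add: distrib_right)
      finally have EX: "E \<le> (C0 / sqrt (real J) + error_const * sqrt (2 / size_ratio) * growth J / sqrt (real J)) * sqrt (real n)" .
      have "eps n = 2 * (C0 / sqrt (real J) + error_const * sqrt (2 / size_ratio) * growth J / sqrt (real J))"
        by (simp only: eps_def eJ_def J_def growth_def)
      then show ?thesis using mult_left_mono [OF EX, of 2] by (simp only: mult.assoc)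
    qed
    have E0: "0 \<le> E" unfolding E_def using C0 ec growth_ge_1 [of J] by auto
    have Ele: "E \<le> eps n * sqrt (real n)" using EJ E0 by linarith
    define k where "k = Suc (block_level J)"
    have kk: "k0 \<le> k"
    proof -
      have "2 ^ Suc k0 \<le> Suc J" using J(3) by simp
      then have "floor_log (2 ^ Suc k0) \<le> floor_log (Suc J)" using floor_log_mono by (simp only: mono_def)
      then show ?thesis by (simp add: k_def block_level_def del: power_Suc)
    qed
    have Jk: "J \<le> 2^k"
    proof -
      have "Suc J < 2 * 2 ^ block_level J" unfolding block_level_def by (rule floor_log_exp2_gt)
      then show ?thesis by (simp add: k_def)
    qed
    define l where "l = 2 * lil_factor k * sqrt (real (block_offset (2^k)))"
    have cb: "coeff_bound l (node_sum J \<omega>)" unfolding l_def by (rule k0 [OF kk Jk])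
    have l0: "0 \<le> l" using lil_factor_ge_2 [of k] by (simp add: l_def)
    have lamk: "lil_factor k \<le> 2 * sqrt 2 * sqrt (ln (ln (real n)))"
    proof -
      have n1: "1 < real n" using elim(3) by simp
      have "real (k + 3) \<le> (ln (real n))\<^sup>2"
      proof -
        have "2 ^ block_level J \<le> Suc J" unfolding block_level_def by (rule floor_log_exp2_le) simp
        also have "Suc J \<le> n + 1" using block_offset_ge [of J] n by simp
        finally have "(2::real) ^ block_level J \<le> real (n + 1)" by (metis of_nat_le_iff of_nat_numeral of_nat_power)
        then have "ln ((2::real) ^ block_level J) \<le> ln (real (n + 1))" by (subst ln_le_cancel_iff) auto
        then have "real (block_level J) * ln 2 \<le> ln (real (n + 1))" by (simp add: ln_realpow)
        then have "real (block_level J) \<le> ln (real (n + 1)) / ln 2" by (simp add: pos_le_divide_eq)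
        then show ?thesis using elim(2) by (simp add: k_def)
      qed
      then have "ln (real (k + 3)) \<le> ln ((ln (real n))\<^sup>2)" by (subst ln_le_cancel_iff) auto
      also have "\<dots> = 2 * ln (ln (real n))" using n1 by (simp add: ln_realpow)
      finally have "sqrt (ln (real (k + 3))) \<le> sqrt (2 * ln (ln (real n)))" by (rule real_sqrt_le_mono)
      then show ?thesis by (simp add: lil_factor_def real_sqrt_mult)
    qed
    have lb: "holder_const * l \<le> lil_const * sqrt (ln (ln (real n))) * sqrt (real n)"
    proof -
      have "real (block_offset (2^k)) \<le> 8 / size_ratio\<^sup>2 * real n"
      proof -
        have "8 / size_ratio\<^sup>2 * real (block_offset J) \<le> 8 / size_ratio\<^sup>2 * real n" using n by (intro mult_left_mono) auto
        then show ?thesis using block_offset_pow2_le [OF J(2)] unfolding k_def by linarith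
      qed
      then have "sqrt (real (block_offset (2^k))) \<le> sqrt (8 / size_ratio\<^sup>2 * real n)" by (rule real_sqrt_le_mono)
      also have "\<dots> = 2 * sqrt 2 / size_ratio * sqrt (real n)"
      proof -
        have "sqrt 8 = 2 * sqrt 2" using real_sqrt_mult [of 4 2] by simp
        then show ?thesis using size_ratio_pos by (simp add: real_sqrt_mult real_sqrt_divide)
      qed
      finally have b: "sqrt (real (block_offset (2^k))) \<le> 2 * sqrt 2 / size_ratio * sqrt (real n)" .
      \<comment> \<open>The product of the three constants is the 16 of
        \<open>lil_const\<close>.\<close>
      have "l \<le> 2 * (2 * sqrt 2 * sqrt (ln (ln (real n)))) * (2 * sqrt 2 / size_ratio * sqrt (real n))"
        unfolding l_def using lamk b lil_factor_ge_2 [of k] by (intro mult_mono) auto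
      also have "\<dots> = 16 / size_ratio * sqrt (ln (ln (real n))) * sqrt (real n)" by simp
      finally have "holder_const * l \<le> holder_const * (16 / size_ratio * sqrt (ln (ln (real n))) * sqrt (real n))"
        using holder_const_pos by (intro mult_left_mono) auto
      then show ?thesis by (simp add: lil_const_def mult_ac)
    qed
    show ?case
    proof (intro conjI ballI)
      fix y assume y: "y \<in> {0..1 :: real}"
      show "\<bar>emp_dev n y \<omega> + kiefer_sum y (real n) \<omega>\<bar> \<le> eps n * sqrt (real n)"
        using ap [OF J(1) n(2) y] Ele unfolding n(1) [symmetric] E_def by linarith
      fix y' assume y': "y' \<in> {0..1 :: real}"
      have 1: "\<bar>emp_dev n y \<omega> - schauder (node_sum J \<omega>) y\<bar> \<le> E" "\<bar>emp_dev n y' \<omega> - schauder (node_sum J \<omega>) y'\<bar> \<le> E"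
        using ap [OF J(1) n(2) y] ap [OF J(1) n(2) y'] unfolding n(1) [symmetric] E_def by auto
      have "\<bar>schauder (node_sum J \<omega>) y - schauder (node_sum J \<omega>) y'\<bar> \<le> holder_const * l * sqrt (sqrt \<bar>y - y'\<bar>)"
        by (rule schauder_holder [OF cb l0])
      also have "\<dots> \<le> lil_const * sqrt (ln (ln (real n))) * sqrt (real n) * sqrt (sqrt \<bar>y - y'\<bar>)"
        by (intro mult_right_mono lb) auto
      finally have 2: "\<bar>schauder (node_sum J \<omega>) y - schauder (node_sum J \<omega>) y'\<bar> \<le> lil_const * sqrt (ln (ln (real n))) * sqrt (real n) * sqrt (sqrt \<bar>y - y'\<bar>)" .
      have "\<bar>emp_dev n y \<omega> - emp_dev n y' \<omega>\<bar> \<le> lil_const * sqrt (ln (ln (real n))) * sqrt (real n) * sqrt (sqrt \<bar>y - y'\<bar>) + eps n * sqrt (real n)"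
        using 1 2 EJ by linarith
      then show "\<bar>emp_dev n y \<omega> - emp_dev n y' \<omega>\<bar> \<le> (lil_const * sqrt (ln (ln (real n))) * sqrt (sqrt \<bar>y - y'\<bar>) + eps n) * sqrt (real n)"
        by (simp add: algebra_simps)
    qed
  qed
  then show ?case using eps0 by blast
qed

lemma indep_U: "indep_vars (\<lambda>_. borel) U UNIV"
proof -
  define f where "f = (\<lambda>i. (block_of i, i - block_offset (block_of i)))"
  have "inj f"
  proof (rule injI)
    fix i k assume "f i = f k"
    then show "i = k" using block_of_bounds(1) [of i] block_of_bounds(1) [of k] by (auto simp: f_def)
  qed
  moreover have "f ` UNIV \<subseteq> {q. snd q < block_size (fst q)}"
    using block_of_bounds by (auto simp: f_def block_start_Suc less_diff_conv2 add.commute)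
  ultimately have "indep_vars (\<lambda>_. borel) (\<lambda>i. sample (f i)) UNIV"
    by (rule indep_vars_reindex [OF indep_sample])
  then show ?thesis by (simp add: U_def [abs_def] f_def)
qed

lemma U_range: "\<omega> \<in> space M \<Longrightarrow> 0 < U i \<omega> \<and> U i \<omega> < 1"
  unfolding U_def using sample_range by blast

lemma prob_U: "prob {\<omega> \<in> space M. U i \<omega> \<le> t} = clamp01 t"
  unfolding U_def using block_of_bounds [of i] by (intro prob_sample_atMost) (auto simp: block_start_Suc)

end

section \<open>Empirical quantiles and kernel density estimates\<close>

lemma emp_cdf_card: "emp_cdf Y n y = real (card {i \<in> {1..n}. Y i \<le> y}) / real n"
  by (simp add: emp_cdf_def sum.If_cases Int_def)

lemma finite_attains_max:
  fixes Y :: "'i \<Rightarrow> real"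
  assumes "finite B" "B \<noteq> {}"
  obtains i where "i \<in> B" "\<And>k. k \<in> B \<Longrightarrow> Y k \<le> Y i"
proof -
  have "Max (Y ` B) \<in> Y ` B" using assms by (intro Max_in) auto
  then obtain i where "i \<in> B" "Y i = Max (Y ` B)" by auto
  then show thesis using that [of i] assms by simp
qed

text \<open>The infimum is attained at the least sample value whose empirical distribution function
  reaches \<open>p\<close>. The two rank inequalities depend only on the order of the sample, so
  they can be stated for \<open>v\<close>, later \<open>F (Z i)\<close> instead of
  \<open>g (Z i)\<close>.\<close>

lemma emp_quantile_order_statistic:
  fixes Y v :: "nat \<Rightarrow> real"
  assumes n: "0 < n" and p: "0 < p" "p \<le> 1"
    and order: "\<And>i k. i \<in> {1..n} \<Longrightarrow> k \<in> {1..n} \<Longrightarrow> Y i \<le> Y k \<longleftrightarrow> v i \<le> v k"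
  obtains i where "i \<in> {1..n}" "emp_quantile Y n p = Y i"
    "p * real n \<le> real (card {k \<in> {1..n}. v k \<le> v i})" "real (card {k \<in> {1..n}. v k < v i}) < p * real n"
proof -
  define S where "S = {y. p \<le> emp_cdf Y n y}"
  define T where "T = {i \<in> {1..n}. Y i \<in> S}"
  have rep: "\<exists>i\<in>T. Y i \<le> y" if y: "y \<in> S" for y
  proof -
    define B where "B = {i \<in> {1..n}. Y i \<le> y}"
    have "B \<noteq> {}"
    proof
      assume "B = {}"
      then have "emp_cdf Y n y = 0" unfolding emp_cdf_card B_def by simp
      then show False using y p by (simp add: S_def)
    qed
    moreover have "finite B" by (simp add: B_def)
    ultimately obtain i where i: "i \<in> B" "\<And>k. k \<in> B \<Longrightarrow> Y k \<le> Y i"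
      using finite_attains_max [of B Y] by blast
    have "{k \<in> {1..n}. Y k \<le> Y i} = B" using i by (force simp: B_def)
    then have "emp_cdf Y n (Y i) = emp_cdf Y n y" unfolding emp_cdf_card B_def by simp
    then have "i \<in> T" using i y by (simp add: T_def S_def B_def)
    then show ?thesis using i by (auto simp: B_def)
  qed
  have "Max (Y ` {1..n}) \<in> S"
  proof -
    have "{i \<in> {1..n}. Y i \<le> Max (Y ` {1..n})} = {1..n}" by auto
    then show ?thesis using n p by (simp add: S_def emp_cdf_card)
  qed
  then have "T \<noteq> {}" using rep by blast
  moreover have "finite T" by (simp add: T_def)
  ultimately obtain i where i: "i \<in> T" "\<And>k. k \<in> T \<Longrightarrow> Y i \<le> Y k"
    using finite_attains_max [of T "\<lambda>i. - Y i"] by auto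
  have i1: "i \<in> {1..n}" using i by (simp add: T_def)
  have "Inf S = Y i"
  proof (rule cInf_eq_minimum)
    show "Y i \<in> S" using i by (simp add: T_def)
    show "Y i \<le> y" if "y \<in> S" for y using rep [OF that] i(2) by force
  qed
  then have q: "emp_quantile Y n p = Y i" by (simp add: emp_quantile_def S_def)
  have le: "p * real n \<le> real (card {k \<in> {1..n}. v k \<le> v i})"
  proof -
    have "{k \<in> {1..n}. v k \<le> v i} = {k \<in> {1..n}. Y k \<le> Y i}" using order i1 by auto
    then show ?thesis using i(1) n by (simp add: T_def S_def emp_cdf_card pos_le_divide_eq)
  qed
  have lt: "real (card {k \<in> {1..n}. v k < v i}) < p * real n"
  proof -
    define B where "B = {k \<in> {1..n}. Y k < Y i}"
    have B: "{k \<in> {1..n}. v k < v i} = B" unfolding B_def using order i1 by (auto simp: not_le [symmetric])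
    have "real (card B) < p * real n"
    proof (cases "B = {}")
      case True
      then show ?thesis using n p by simp
    next
      case False
      moreover have "finite B" by (simp add: B_def)
      ultimately obtain k where k: "k \<in> B" "\<And>l. l \<in> B \<Longrightarrow> Y l \<le> Y k"
        using finite_attains_max [of B Y] by blast
      have "k \<notin> T" using i(2) [of k] k by (auto simp: B_def)
      then have "Y k \<notin> S" using k by (auto simp: T_def B_def)
      then have "real (card {l \<in> {1..n}. Y l \<le> Y k}) < p * real n"
        using n by (simp add: S_def emp_cdf_card not_le pos_divide_less_eq)
      moreover have "card B \<le> card {l \<in> {1..n}. Y l \<le> Y k}"
        using k by (intro card_mono) (auto simp: B_def)
      ultimately show ?thesis by linarith
    qed
    then show ?thesis by (simp only: B)
  qed
  show ?thesis by (rule that [OF i1 q le lt])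
qed

text \<open>Indices run from 1 as in \<open>emp_cdf\<close>, while \<open>emp_dev\<close> counts
  from 0; \<open>card_shift_diff\<close> bounds the difference by 1.\<close>

definition count_dev :: "(nat \<Rightarrow> real) \<Rightarrow> nat \<Rightarrow> real \<Rightarrow> real" where
  "count_dev v n y = real (card {i \<in> {1..n}. v i \<le> y}) - real n * y"

text \<open>A strict count is a limit of counts from the left: a nearby smaller point loses at most
  \<open>e\<close> in the centering, for every positive \<open>e\<close>.\<close>

lemma count_dev_strict_bounds:
  assumes y: "0 < y" "y \<le> 1" and B: "\<And>y. y \<in> {0..1} \<Longrightarrow> \<bar>count_dev v n y\<bar> \<le> B"
  shows "\<bar>real (card {i \<in> {1..n}. v i < y}) - real n * y\<bar> \<le> B"
proof -
  define N where "N = real (card {i \<in> {1..n}. v i < y})"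
  have "card {i \<in> {1..n}. v i < y} \<le> card {i \<in> {1..n}. v i \<le> y}" by (intro card_mono) auto
  then have "N \<le> real n * y + count_dev v n y" by (simp add: N_def count_dev_def)
  then have 1: "N - real n * y \<le> B" using B [of y] y by auto
  have "real n * y - B \<le> N + e" if "0 < e" for e
  proof -
    define y' where "y' = max (y / 2) (y - e / (real n + 1))"
    have y': "0 < y'" "y' < y" "y - y' \<le> e / (real n + 1)" using y that by (auto simp: y'_def)
    have "card {i \<in> {1..n}. v i \<le> y'} \<le> card {i \<in> {1..n}. v i < y}" using y' by (intro card_mono) auto
    then have "count_dev v n y' + real n * y' \<le> N" by (simp add: N_def count_dev_def)
    moreover have "- B \<le> count_dev v n y'" using B [of y'] y y' by auto
    moreover have "real n * (y - y') \<le> e"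
    proof -
      have "real n * (y - y') \<le> real n * (e / (real n + 1))" using y' by (intro mult_left_mono) auto
      also have "\<dots> \<le> e" using that by (simp add: divide_simps)
      finally show ?thesis .
    qed
    ultimately show ?thesis by (simp add: right_diff_distrib)
  qed
  then have "real n * y - B \<le> N" by (rule field_le_epsilon)
  with 1 show ?thesis by (simp add: N_def abs_le_iff)
qed

lemma divide_by_positive:
  fixes s z c q :: real
  assumes "0 < s"
  shows "s * s * z \<le> c + q * s \<Longrightarrow> s * z \<le> c / s + q"
    and "c - q * s - 1 \<le> s * s * z \<Longrightarrow> c / s - q - 1 / s \<le> s * z"
proof -
  have e: "(s * z) * s = s * s * z" "(c / s + q) * s = c + q * s" "(c / s - q - 1 / s) * s = c - q * s - 1"
    using assms by (simp_all add: distrib_right left_diff_distrib)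
  show "s * s * z \<le> c + q * s \<Longrightarrow> s * z \<le> c / s + q"
    by (rule mult_right_le_imp_le [OF _ assms]) (simp only: e)
  show "c - q * s - 1 \<le> s * s * z \<Longrightarrow> c / s - q - 1 / s \<le> s * z"
    by (rule mult_right_le_imp_le [OF _ assms]) (simp only: e)
qed

text \<open>The rank inequalities put \<open>n * p\<close> between the strict and the weak count at
  \<open>u\<close>, so \<open>n * (u - p)\<close> is minus the deviation at \<open>u\<close> up to a
  small error. Comparison with the deviation at 1, which vanishes, gives the crude first bound; it
  localises \<open>u\<close>, and then the modulus of continuity moves the deviation from
  \<open>u\<close> to \<open>p\<close>.\<close>

lemma quantile_inversion:
  fixes v :: "nat \<Rightarrow> real"
  assumes n: "0 < n" and u: "0 < u" "u < 1" and p: "0 < p" "p < 1"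
    and v: "\<And>i. i \<in> {1..n} \<Longrightarrow> v i < 1"
    and le: "p * real n \<le> real (card {k \<in> {1..n}. v k \<le> u})" and lt: "real (card {k \<in> {1..n}. v k < u}) < p * real n"
    and osc: "\<And>y y'. y \<in> {0..1} \<Longrightarrow> y' \<in> {0..1} \<Longrightarrow> \<bar>count_dev v n y - count_dev v n y'\<bar> \<le> (Q * sqrt (sqrt \<bar>y - y'\<bar>) + e) * sqrt (real n)"
    and Q: "0 \<le> Q"
  shows "\<bar>u - p\<bar> \<le> (Q + e) / sqrt (real n)"
    and "\<bar>sqrt (real n) * (u - p) + count_dev v n p / sqrt (real n)\<bar> \<le> Q * sqrt (sqrt ((Q + e) / sqrt (real n) + 1 / real n)) + e + 1 / sqrt (real n)"
proof -
  define s where "s = sqrt (real n)"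
  have s: "0 < s" "s * s = real n" using n by (simp_all add: s_def)
  have B: "\<bar>count_dev v n y\<bar> \<le> (Q + e) * s" if y: "y \<in> {0..1}" for y
  proof -
    have "{i \<in> {1..n}. v i \<le> 1} = {1..n}" using v by force
    then have "count_dev v n 1 = 0" by (simp add: count_dev_def)
    then have "\<bar>count_dev v n y\<bar> \<le> (Q * sqrt (sqrt \<bar>y - 1\<bar>) + e) * s" using osc [OF y, of 1] by (simp add: s_def)
    also have "\<dots> \<le> (Q * 1 + e) * s"
      using y Q s by (intro mult_right_mono add_right_mono mult_left_mono) auto
    finally show ?thesis by simp
  qed
  have up: "s * s * (p - u) \<le> count_dev v n u" using le s by (simp add: count_dev_def right_diff_distrib mult.commute)
  have lo: "count_dev v n u' < s * s * (p - u')" if "u' < u" for u'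
  proof -
    have "card {k \<in> {1..n}. v k \<le> u'} \<le> card {k \<in> {1..n}. v k < u}" using that by (intro card_mono) auto
    then have "real (card {k \<in> {1..n}. v k \<le> u'}) < p * real n" using lt by linarith
    then show ?thesis using s by (simp add: count_dev_def right_diff_distrib mult.commute)
  qed
  define r where "r = (Q + e) / s"
  have rs: "r * s = Q + e" using s by (simp add: r_def)
  have "s * s * (p - u) \<le> s * s * r"
    using up B [of u] u rs by (simp add: abs_le_iff mult.assoc) (simp add: mult.commute)
  then have 1: "p - u \<le> r" using s n by simp
  have "real n * u - (Q + e) * s \<le> real (card {k \<in> {1..n}. v k < u})"
    using count_dev_strict_bounds [of u v n "(Q + e) * s"] B u by (simp add: abs_le_iff)
  moreover have rsn: "real n * r = (Q + e) * s"
  proof -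
    have "s * s * r = (r * s) * s" by simp
    then show ?thesis by (simp only: s(2) rs)
  qed
  moreover have "real n * (u - p) = real n * u - p * real n" by (simp add: algebra_simps)
  ultimately have "real n * (u - p) \<le> real n * r" using lt by linarith
  then have 2: "u - p \<le> r" using n by simp
  show up_r: "\<bar>u - p\<bar> \<le> (Q + e) / sqrt (real n)"
    using 1 2 by (simp add: r_def s_def abs_le_iff)
  have r0: "\<bar>u - p\<bar> \<le> r" "0 \<le> r" using 1 2 by auto
  define w where "w = sqrt (sqrt (r + 1 / real n))"
  have near: "\<bar>count_dev v n y - count_dev v n p\<bar> \<le> (Q * w + e) * s" if "y \<in> {0..1}" "\<bar>y - p\<bar> \<le> r + 1 / real n" for y
  proof -
    have "\<bar>count_dev v n y - count_dev v n p\<bar> \<le> (Q * sqrt (sqrt \<bar>y - p\<bar>) + e) * s"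
      using osc [OF that(1), of p] p by (simp add: s_def)
    also have "\<dots> \<le> (Q * w + e) * s"
      unfolding w_def using that Q s by (intro mult_right_mono add_right_mono mult_left_mono) auto
    finally show ?thesis .
  qed
  have n1: "0 < 1 / real n" using n by simp
  have a: "s * (p - u) \<le> count_dev v n p / s + (Q * w + e)"
  proof -
    have "s * s * (p - u) \<le> count_dev v n p + (Q * w + e) * s"
    proof -
      have "\<bar>u - p\<bar> \<le> r + 1 / real n" using r0 n1 by linarith
      then show ?thesis using up near [of u] u by (simp add: abs_le_iff)
    qed
    then show ?thesis by (rule divide_by_positive(1) [OF s(1)])
  qed
  \<comment> \<open>A point just left of \<open>u\<close> bounds the strict count by an ordinary
    deviation. The distance \<open>1 / n\<close> costs at most 1 in the count, hence
    \<open>1 / sqrt n\<close> in the result.\<close>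
  define u' where "u' = max (u / 2) (u - 1 / real n)"
  have u': "0 < u'" "u' < u" "u - u' \<le> 1 / real n" using u n1 by (auto simp: u'_def)
  have b: "count_dev v n p / s - (Q * w + e) - 1 / s \<le> s * (p - u)"
  proof -
    have "count_dev v n p - (Q * w + e) * s \<le> count_dev v n u'"
    proof -
      have "\<bar>u' - p\<bar> \<le> r + 1 / real n" using r0 u' by linarith
      then show ?thesis using near [of u'] u u' by (simp add: abs_le_iff)
    qed
    also have "\<dots> \<le> s * s * (p - u')" using lo [OF u'(2)] by simp
    also have "\<dots> = s * s * (p - u) + real n * (u - u')" by (simp add: s(2) algebra_simps)
    also have "real n * (u - u') \<le> 1"
      using mult_left_mono [OF u'(3), of "real n"] n by simp
    finally have "count_dev v n p - (Q * w + e) * s - 1 \<le> s * s * (p - u)" by simp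
    then show ?thesis by (rule divide_by_positive(2) [OF s(1)])
  qed
  have n2: "0 < 1 / s" using s by simp
  have eq: "s * (u - p) = - (s * (p - u))" by (simp add: algebra_simps)
  have "\<bar>s * (u - p) + count_dev v n p / s\<bar> \<le> Q * w + e + 1 / s"
    unfolding eq using a b n2 by linarith
  then show "\<bar>sqrt (real n) * (u - p) + count_dev v n p / sqrt (real n)\<bar> \<le> Q * sqrt (sqrt ((Q + e) / sqrt (real n) + 1 / real n)) + e + 1 / sqrt (real n)"
    by (simp add: w_def r_def s_def)
qed

section \<open>Kernel sums as functionals of counts\<close>

locale compact_kernel =
  fixes phi phi' :: "real \<Rightarrow> real" and d1 d2 :: real
  assumes d12: "d1 \<le> d2"
    and phi_supp: "\<forall>x. x \<notin> {d1..d2} \<longrightarrow> phi x = 0"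
    and phi_deriv: "\<forall>x\<in>{d1..d2}. (phi has_real_derivative phi' x) (at x within {d1..d2})"
    and phi'_cont: "continuous_on {d1..d2} phi'"
    and phi_int: "integral {d1..d2} phi = 1"
begin

text \<open>Writing \<open>phi t = phi d1 + (integral of phi' over {d1..t})\<close> turns a kernel sum into \<open>functional\<close> of the counting
  functions \<open>s \<mapsto> #{i. s \<le> t i \<and> t i \<le> d2}\<close>; thus only counts in intervals have to be controlled.\<close>

definition functional :: "(real \<Rightarrow> real) \<Rightarrow> real" where
  "functional w = phi d1 * w d1 + integral {d1..d2} (\<lambda>s. phi' s * w s)"

lemma phi'_bound: "\<exists>B\<ge>0. \<forall>s\<in>{d1..d2}. \<bar>phi' s\<bar> \<le> B"
proof -
  have "bounded (phi' ` {d1..d2})"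
    by (intro compact_imp_bounded compact_continuous_image phi'_cont) simp
  then obtain B where B: "\<forall>x\<in>phi' ` {d1..d2}. norm x \<le> B" unfolding bounded_iff by blast
  have "\<bar>phi' s\<bar> \<le> \<bar>B\<bar>" if "s \<in> {d1..d2}" for s
    using B that by (simp add: order_trans [OF _ abs_ge_self])
  then show ?thesis by (intro exI [of _ "\<bar>B\<bar>"]) simp
qed

lemma phi_continuous: "continuous_on {d1..d2} phi"
  using phi_deriv by (auto simp: continuous_on_eq_continuous_within intro: DERIV_continuous)

text \<open>Integration by parts; this is where the total mass 1 of the kernel enters. For uniformly
  distributed points the counting function is linear, so this is the exact value of the
  estimate.\<close>

lemma functional_linear: "functional (\<lambda>s. d2 - s) = 1"
proof -
  have "((\<lambda>s. phi' s * (d2 - s) - phi s) has_integral (phi d2 * (d2 - d2) - phi d1 * (d2 - d1))) {d1..d2}"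
  proof (rule fundamental_theorem_of_calculus [OF d12])
    fix s assume s: "s \<in> {d1..d2}"
    have "((\<lambda>s. phi s * (d2 - s)) has_real_derivative phi' s * (d2 - s) - phi s) (at s within {d1..d2})"
      using phi_deriv s by (auto intro!: derivative_eq_intros)
    then show "((\<lambda>s. phi s * (d2 - s)) has_vector_derivative phi' s * (d2 - s) - phi s) (at s within {d1..d2})"
      by (simp add: has_real_derivative_iff_has_vector_derivative)
  qed
  moreover have i1: "(\<lambda>s. phi' s * (d2 - s)) integrable_on {d1..d2}"
    by (intro integrable_continuous_real continuous_intros phi'_cont)
  moreover have "phi integrable_on {d1..d2}" by (intro integrable_continuous_real phi_continuous)
  ultimately have "integral {d1..d2} (\<lambda>s. phi' s * (d2 - s)) - integral {d1..d2} phi = - phi d1 * (d2 - d1)"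
    by (simp add: integral_diff [symmetric] integral_unique)
  then show ?thesis by (simp add: functional_def phi_int)
qed

definition step :: "real \<Rightarrow> real \<Rightarrow> real" where
  "step t s = (if s \<le> t \<and> t \<le> d2 then 1 else 0)"

text \<open>The kernel may jump at both ends of its interval: the boundary term carries the jump at
  \<open>d1\<close>, and the cut-off at \<open>d2\<close> inside \<open>step\<close> the other
  one.\<close>

lemma phi_step_integral: "((\<lambda>s. phi' s * step t s) has_integral (phi t - phi d1 * step t d1)) {d1..d2}"
proof -
  consider "t \<in> {d1..d2}" | "t < d1" | "d2 < t" by fastforce
  then show ?thesis
  proof cases
    case 1
    have "(phi' has_integral (phi t - phi d1)) {d1..t}"
    proof (rule fundamental_theorem_of_calculus)
      fix s assume "s \<in> {d1..t}"
      then have "(phi has_real_derivative phi' s) (at s within {d1..d2})"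
        using phi_deriv 1 by auto
      then have "(phi has_real_derivative phi' s) (at s within {d1..t})"
        by (rule has_field_derivative_subset) (use 1 in auto)
      then show "(phi has_vector_derivative phi' s) (at s within {d1..t})"
        by (simp add: has_real_derivative_iff_has_vector_derivative)
    qed (use 1 in auto)
    then have "((\<lambda>s. if s \<in> {d1..t} then phi' s else 0) has_integral (phi t - phi d1)) {d1..d2}"
      by (subst has_integral_restrict) (use 1 in auto)
    moreover have "(if s \<in> {d1..t} then phi' s else 0) = phi' s * step t s" if "s \<in> {d1..d2}" for s
      using 1 that by (auto simp: step_def)
    ultimately have "((\<lambda>s. phi' s * step t s) has_integral (phi t - phi d1)) {d1..d2}"
      by (rule has_integral_eq [rotated]) auto
    then show ?thesis using 1 by (simp add: step_def)
  next
    case 2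
    have "((\<lambda>s. phi' s * step t s) has_integral 0) {d1..d2}"
      by (rule has_integral_is_0) (use 2 in \<open>auto simp: step_def\<close>)
    then show ?thesis using 2 phi_supp by (auto simp: step_def)
  next
    case 3
    have "((\<lambda>s. phi' s * step t s) has_integral 0) {d1..d2}"
      by (rule has_integral_is_0) (use 3 in \<open>auto simp: step_def\<close>)
    then show ?thesis using 3 phi_supp by (auto simp: step_def)
  qed
qed

text \<open>A bound for the norm of \<open>functional\<close> with respect to the supremum norm; the
  choice operator picks some bound of \<open>phi'\<close>.\<close>

definition kernel_var :: real where
  "kernel_var = \<bar>phi d1\<bar> + (SOME B. 0 \<le> B \<and> (\<forall>s\<in>{d1..d2}. \<bar>phi' s\<bar> \<le> B)) * (d2 - d1)"

text \<open>The rescaled sum is \<open>functional\<close> of the counting function \<open>W\<close>.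
  Its linear approximation has the value \<open>r * h\<close> by \<open>functional_linear\<close>,
  and the error \<open>eta\<close> is multiplied by at most \<open>kernel_var\<close>; dividing by
  \<open>h\<close> restores the estimate.\<close>

lemma kde_error:
  assumes n: "0 < n" and h: "0 < h"
    and w: "\<And>s. s \<in> {d1..d2} \<Longrightarrow> \<bar>real (card {i \<in> {1..n}. y - d2 * h \<le> Y i \<and> Y i \<le> y - s * h}) / real n - r * (d2 - s) * h\<bar> \<le> eta"
    and eta: "0 \<le> eta"
  shows "\<bar>kde phi h Y n y - r\<bar> \<le> kernel_var * eta / h"
proof -
  define t where "t = (\<lambda>i. (y - Y i) / h)"
  define W where "W = (\<lambda>s. (\<Sum>i=1..n. step (t i) s) / real n)"
  define err where "err = (\<lambda>s. W s - r * h * (d2 - s))"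
  have W: "W s = real (card {i \<in> {1..n}. y - d2 * h \<le> Y i \<and> Y i \<le> y - s * h}) / real n" for s
  proof -
    have "s \<le> t i \<and> t i \<le> d2 \<longleftrightarrow> y - d2 * h \<le> Y i \<and> Y i \<le> y - s * h" for i
      using h by (auto simp: t_def field_simps)
    then show ?thesis by (simp add: W_def step_def sum.If_cases Int_def)
  qed
  have eb: "\<bar>err s\<bar> \<le> eta" if "s \<in> {d1..d2}" for s
    using w [OF that] by (simp add: err_def W mult_ac)
  have "((\<lambda>s. \<Sum>i=1..n. phi' s * step (t i) s) has_integral (\<Sum>i=1..n. phi (t i) - phi d1 * step (t i) d1)) {d1..d2}"
    by (intro has_integral_sum phi_step_integral) auto
  then have "((\<lambda>s. (\<Sum>i=1..n. phi' s * step (t i) s) * (1 / real n)) has_integral (\<Sum>i=1..n. phi (t i) - phi d1 * step (t i) d1) * (1 / real n)) {d1..d2}"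
    by (rule has_integral_mult_left)
  moreover have "(\<Sum>i=1..n. phi' s * step (t i) s) * (1 / real n) = phi' s * W s" for s
    by (simp add: W_def sum_distrib_left)
  moreover have "(\<Sum>i=1..n. phi (t i) - phi d1 * step (t i) d1) * (1 / real n) = (\<Sum>i=1..n. phi (t i)) / real n - phi d1 * W d1"
    by (simp add: W_def sum_subtractf sum_distrib_left diff_divide_distrib)
  ultimately have iW: "((\<lambda>s. phi' s * W s) has_integral ((\<Sum>i=1..n. phi (t i)) / real n - phi d1 * W d1)) {d1..d2}"
    by simp
  have i1: "(\<lambda>s. phi' s * (d2 - s)) integrable_on {d1..d2}"
    by (intro integrable_continuous_real continuous_intros phi'_cont)
  have i2: "((\<lambda>s. r * h * (phi' s * (d2 - s))) has_integral (r * h * (1 - phi d1 * (d2 - d1)))) {d1..d2}"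
  proof -
    have "integral {d1..d2} (\<lambda>s. phi' s * (d2 - s)) = 1 - phi d1 * (d2 - d1)"
      using functional_linear by (simp add: functional_def)
    then show ?thesis using has_integral_mult_right [OF integrable_integral [OF i1], of "r * h"] by simp
  qed
  have "((\<lambda>s. phi' s * W s - r * h * (phi' s * (d2 - s))) has_integral
      ((\<Sum>i=1..n. phi (t i)) / real n - phi d1 * W d1 - r * h * (1 - phi d1 * (d2 - d1)))) {d1..d2}"
    by (rule has_integral_diff [OF iW i2])
  moreover have "phi' s * W s - r * h * (phi' s * (d2 - s)) = phi' s * err s" for s
    by (simp add: err_def algebra_simps)
  ultimately have ie: "((\<lambda>s. phi' s * err s) has_integral
      ((\<Sum>i=1..n. phi (t i)) / real n - phi d1 * W d1 - r * h * (1 - phi d1 * (d2 - d1)))) {d1..d2}"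
    by simp
  define B where "B = (SOME B. 0 \<le> B \<and> (\<forall>s\<in>{d1..d2}. \<bar>phi' s\<bar> \<le> B))"
  have B: "0 \<le> B" "\<And>s. s \<in> {d1..d2} \<Longrightarrow> \<bar>phi' s\<bar> \<le> B"
    unfolding B_def using someI_ex [OF phi'_bound] by blast+
  have "norm ((\<Sum>i=1..n. phi (t i)) / real n - phi d1 * W d1 - r * h * (1 - phi d1 * (d2 - d1))) \<le> (B * eta) * measure lborel {d1..d2}"
  proof (rule has_integral_bound_real [OF _ _ ie])
    show "0 \<le> B * eta" using B eta by simp
    show "norm (phi' s * err s) \<le> B * eta" if "s \<in> {d1..d2} - {}" for s
      unfolding real_norm_def abs_mult using B eb that eta by (intro mult_mono) auto
  qed auto
  then have 1: "\<bar>(\<Sum>i=1..n. phi (t i)) / real n - phi d1 * W d1 - r * h * (1 - phi d1 * (d2 - d1))\<bar> \<le> B * (d2 - d1) * eta"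
    using d12 by (simp add: mult_ac)
  have 2: "\<bar>phi d1 * err d1\<bar> \<le> \<bar>phi d1\<bar> * eta"
    unfolding abs_mult using eb [of d1] d12 by (intro mult_left_mono) auto
  have "(\<Sum>i=1..n. phi (t i)) / real n - r * h =
      ((\<Sum>i=1..n. phi (t i)) / real n - phi d1 * W d1 - r * h * (1 - phi d1 * (d2 - d1))) + phi d1 * err d1"
    by (simp add: err_def algebra_simps)
  then have "\<bar>(\<Sum>i=1..n. phi (t i)) / real n - r * h\<bar> \<le> B * (d2 - d1) * eta + \<bar>phi d1\<bar> * eta"
    using 1 2 by linarith
  also have "\<dots> = kernel_var * eta" by (simp add: kernel_var_def B_def algebra_simps)
  finally have "\<bar>(\<Sum>i=1..n. phi (t i)) / real n - r * h\<bar> / h \<le> kernel_var * eta / h"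
    using h by (intro divide_right_mono) auto
  moreover have k: "kde phi h Y n y - r = ((\<Sum>i=1..n. phi (t i)) / real n - r * h) / h"
    using h n by (simp add: kde_def t_def diff_divide_distrib)
  ultimately show ?thesis unfolding k abs_divide using h by (simp only: abs_of_pos)
qed

end

section \<open>Limit of the quantile estimator\<close>

lemma compact_interval_bound:
  fixes f :: "real \<Rightarrow> real"
  assumes "continuous_on {p..q} f"
  shows "\<exists>B\<ge>0. \<forall>x\<in>{p..q}. \<bar>f x\<bar> \<le> B"
proof -
  have "bounded (f ` {p..q})" by (intro compact_imp_bounded compact_continuous_image assms) simp
  then obtain B where B: "\<forall>x\<in>f ` {p..q}. norm x \<le> B" unfolding bounded_iff by blast
  have "\<bar>f x\<bar> \<le> \<bar>B\<bar>" if "x \<in> {p..q}" for x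
    using B that by (simp add: order_trans [OF _ abs_ge_self])
  then show ?thesis by (intro exI [of _ "\<bar>B\<bar>"]) simp
qed

lemma lipschitz_from_derivative:
  fixes f :: "real \<Rightarrow> real"
  assumes "\<And>x. x \<in> {p..q} \<Longrightarrow> (f has_real_derivative f' x) (at x)" "\<And>x. x \<in> {p..q} \<Longrightarrow> \<bar>f' x\<bar> \<le> B"
    and "x \<in> {p..q}" "y \<in> {p..q}"
  shows "\<bar>f x - f y\<bar> \<le> B * \<bar>x - y\<bar>"
proof -
  have "norm (f x - f y) \<le> B * norm (x - y)"
    by (rule field_differentiable_bound [of "{p..q}" f f'])
       (use assms in \<open>auto intro: has_field_derivative_at_within\<close>)
  then show ?thesis by simp
qed

lemma expanding_from_derivative:
  fixes f :: "real \<Rightarrow> real"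
  assumes "\<And>x. x \<in> {p..q} \<Longrightarrow> (f has_real_derivative f' x) (at x)" "\<And>x. x \<in> {p..q} \<Longrightarrow> k \<le> f' x" "0 \<le> k"
    and "x \<in> {p..q}" "y \<in> {p..q}"
  shows "k * \<bar>x - y\<bar> \<le> \<bar>f x - f y\<bar>"
  using assms(4,5)
proof (induction x y rule: linorder_wlog)
  case (le x y)
  show ?case
  proof (cases "x = y")
    case False
    then obtain z where z: "x < z" "z < y" "f y - f x = (y - x) * f' z"
      using MVT2 [of x y f f'] assms(1) le by auto
    have "(y - x) * k \<le> (y - x) * f' z" using z le assms(2) by (intro mult_left_mono) auto
    then have "k * \<bar>x - y\<bar> \<le> f y - f x" using z le by (simp add: mult.commute)
    then show ?thesis by simp
  qed simp
qed (simp add: abs_minus_commute)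

section \<open>Expansion and density estimate near the interval\<close>

locale quantile_setup = compact_kernel phi phi' d1 d2 for phi phi' :: "real \<Rightarrow> real" and d1 d2 :: real +
  fixes F fZ fZ' g g' g'' :: "real \<Rightarrow> real" and I :: "real set" and c d :: real
  assumes I_open: "open I" and I_interval: "is_interval I" and cI: "c \<in> I" and dI: "d \<in> I" and cd: "c < d"
    and F_deriv: "\<And>x. x \<in> I \<Longrightarrow> (F has_real_derivative fZ x) (at x)"
    and fZ_deriv: "\<And>x. x \<in> I \<Longrightarrow> (fZ has_real_derivative fZ' x) (at x)"
    and g_deriv: "\<And>x. x \<in> I \<Longrightarrow> (g has_real_derivative g' x) (at x)"
    and g'_deriv: "\<And>x. x \<in> I \<Longrightarrow> (g' has_real_derivative g'' x) (at x)"
    and fZ'_cont: "continuous_on I fZ'" and g''_cont: "continuous_on I g''"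
    and fZ_pos: "\<And>x. x \<in> I \<Longrightarrow> 0 < fZ x" and g'_pos: "\<And>x. x \<in> I \<Longrightarrow> 0 < g' x"
    and F_range: "\<And>x. x \<in> I \<Longrightarrow> 0 < F x \<and> F x < 1"
begin

text \<open>The density of \<open>Y = g Z\<close> at the point \<open>g x\<close>.\<close>

definition rho :: "real \<Rightarrow> real" where "rho x = fZ x / g' x"

lemma Icc_subset: "x \<in> I \<Longrightarrow> y \<in> I \<Longrightarrow> {x..y} \<subseteq> I"
  using I_interval by (metis atLeastAtMost_iff is_interval_1 subsetI)

lemma F_less_iff: "x \<in> I \<Longrightarrow> y \<in> I \<Longrightarrow> F x < F y \<longleftrightarrow> x < y" and g_less_iff: "x \<in> I \<Longrightarrow> y \<in> I \<Longrightarrow> g x < g y \<longleftrightarrow> x < y"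
proof -
  have F: "F x < F y" if "x < y" "x \<in> I" "y \<in> I" for x y
    by (rule DERIV_pos_imp_increasing [OF that(1)]) (use F_deriv fZ_pos Icc_subset [OF that(2,3)] in \<open>meson atLeastAtMost_iff subsetD\<close>)
  have g: "g x < g y" if "x < y" "x \<in> I" "y \<in> I" for x y
    by (rule DERIV_pos_imp_increasing [OF that(1)]) (use g_deriv g'_pos Icc_subset [OF that(2,3)] in \<open>meson atLeastAtMost_iff subsetD\<close>)
  assume xy: "x \<in> I" "y \<in> I"
  show "F x < F y \<longleftrightarrow> x < y" using F [of x y] F [of y x] xy by (cases x y rule: linorder_cases) auto
  show "g x < g y \<longleftrightarrow> x < y" using g [of x y] g [of y x] xy by (cases x y rule: linorder_cases) auto
qed

lemma F_le_iff: "x \<in> I \<Longrightarrow> y \<in> I \<Longrightarrow> F x \<le> F y \<longleftrightarrow> x \<le> y" and g_le_iff: "x \<in> I \<Longrightarrow> y \<in> I \<Longrightarrow> g x \<le> g y \<longleftrightarrow> x \<le> y"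
  by (simp_all add: not_less [symmetric] F_less_iff g_less_iff)

text \<open>A slightly larger interval is needed because the empirical quantile and the kernel
  window may leave \<open>{c..d}\<close>. In the last estimate the difference has derivative
  \<open>g' x * rho x - fZ x = 0\<close> at \<open>z = x\<close>, and its derivative is Lipschitz,
  so it is of second order.\<close>

lemma local_constants:
  "\<exists>c' d' l k G R2 T. c' < c \<and> d < d' \<and> {c'..d'} \<subseteq> I \<and> 0 < l \<and> 0 < k \<and> 0 \<le> G \<and> 0 \<le> R2 \<and> 0 \<le> T \<and>
    (\<forall>z\<in>{c'..d'}. \<forall>x\<in>{c'..d'}. l * \<bar>z - x\<bar> \<le> \<bar>F z - F x\<bar> \<and> k * \<bar>z - x\<bar> \<le> \<bar>g z - g x\<bar> \<and>
       \<bar>g z - g x\<bar> \<le> G * \<bar>z - x\<bar> \<and> \<bar>rho z - rho x\<bar> \<le> R2 * \<bar>z - x\<bar> \<and>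
       \<bar>(g z - g x) * rho x - (F z - F x)\<bar> \<le> T * \<bar>z - x\<bar>\<^sup>2)"
proof -
  obtain e1 where e1: "0 < e1" "cball c e1 \<subseteq> I" using I_open cI open_contains_cball by blast
  obtain e2 where e2: "0 < e2" "cball d e2 \<subseteq> I" using I_open dI open_contains_cball by blast
  define c' where "c' = c - e1"
  define d' where "d' = d + e2"
  have "c' \<in> cball c e1" "d' \<in> cball d e2" using e1(1) e2(1) by (simp_all add: c'_def d'_def dist_real_def)
  then have "c' \<in> I" "d' \<in> I" using e1(2) e2(2) by (simp_all only: subsetD)
  then have J: "{c'..d'} \<subseteq> I" by (rule Icc_subset)
  have cd': "c' < c" "d < d'" "c' \<le> d'" using e1 e2 cd by (auto simp: c'_def d'_def)
  have cont: "continuous_on {c'..d'} fZ" "continuous_on {c'..d'} g'"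
    using J fZ_deriv g'_deriv by (meson DERIV_isCont continuous_at_imp_continuous_on subsetD)+
  have cont': "continuous_on {c'..d'} fZ'" "continuous_on {c'..d'} g''"
    using J fZ'_cont g''_cont continuous_on_subset by blast+
  have gne: "g' x \<noteq> 0" if "x \<in> {c'..d'}" for x using g'_pos [of x] J that by auto
  have rcont: "continuous_on {c'..d'} rho" "continuous_on {c'..d'} (\<lambda>x. (fZ' x * g' x - fZ x * g'' x) / (g' x * g' x))"
    unfolding rho_def [abs_def] by (intro continuous_intros cont cont'; use gne in simp)+
  have rder: "(rho has_real_derivative (fZ' x * g' x - fZ x * g'' x) / (g' x * g' x)) (at x)" if "x \<in> {c'..d'}" for x
    unfolding rho_def [abs_def] using J that gne by (intro DERIV_divide fZ_deriv g'_deriv) auto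
  obtain xl where xl: "xl \<in> {c'..d'}" "\<And>x. x \<in> {c'..d'} \<Longrightarrow> fZ xl \<le> fZ x"
    using continuous_attains_inf [OF _ _ cont(1)] cd' by auto
  obtain xk where xk: "xk \<in> {c'..d'}" "\<And>x. x \<in> {c'..d'} \<Longrightarrow> g' xk \<le> g' x"
    using continuous_attains_inf [OF _ _ cont(2)] cd' by auto
  obtain G where G: "0 \<le> G" "\<forall>x\<in>{c'..d'}. \<bar>g' x\<bar> \<le> G" using compact_interval_bound [OF cont(2)] by blast
  obtain G2 where G2: "0 \<le> G2" "\<forall>x\<in>{c'..d'}. \<bar>g'' x\<bar> \<le> G2" using compact_interval_bound [OF cont'(2)] by blast
  obtain F2 where F2: "0 \<le> F2" "\<forall>x\<in>{c'..d'}. \<bar>fZ' x\<bar> \<le> F2" using compact_interval_bound [OF cont'(1)] by blast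
  obtain R where R: "0 \<le> R" "\<forall>x\<in>{c'..d'}. \<bar>rho x\<bar> \<le> R" using compact_interval_bound [OF rcont(1)] by blast
  obtain R2 where R2: "0 \<le> R2" "\<forall>x\<in>{c'..d'}. \<bar>(fZ' x * g' x - fZ x * g'' x) / (g' x * g' x)\<bar> \<le> R2"
    using compact_interval_bound [OF rcont(2)] by blast
  have l: "0 < fZ xl" using fZ_pos xl J by auto
  have k: "0 < g' xk" using g'_pos xk J by auto
  define T where "T = G2 * R + F2"
  have T: "\<bar>(g z - g x) * rho x - (F z - F x)\<bar> \<le> T * \<bar>z - x\<bar>\<^sup>2" if z: "z \<in> {c'..d'}" and x: "x \<in> {c'..d'}" for z x
  proof -
    define psi where "psi = (\<lambda>z. (g z - g x) * rho x - (F z - F x))"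
    have "\<bar>psi z - psi x\<bar> \<le> (T * \<bar>z - x\<bar>) * \<bar>z - x\<bar>"
    proof (rule lipschitz_from_derivative [of "min z x" "max z x" psi "\<lambda>y. g' y * rho x - fZ y"])
      fix y assume y: "y \<in> {min z x..max z x}"
      then have yJ: "y \<in> {c'..d'}" using z x by auto
      show "(psi has_real_derivative g' y * rho x - fZ y) (at y)"
        unfolding psi_def using yJ J by (auto intro!: derivative_eq_intros g_deriv F_deriv)
      have 1: "\<bar>g' y - g' x\<bar> \<le> G2 * \<bar>y - x\<bar>"
        by (rule lipschitz_from_derivative [of c' d' g' g'']) (use g'_deriv J G2 yJ x in auto)
      have 2: "\<bar>fZ y - fZ x\<bar> \<le> F2 * \<bar>y - x\<bar>"
        by (rule lipschitz_from_derivative [of c' d' fZ fZ']) (use fZ_deriv J F2 yJ x in auto)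
      have "g' x * rho x = fZ x" using gne [OF x] by (simp add: rho_def)
      then have "g' y * rho x - fZ y = (g' y - g' x) * rho x - (fZ y - fZ x)" by (simp add: algebra_simps)
      also have "\<bar>\<dots>\<bar> \<le> \<bar>(g' y - g' x) * rho x\<bar> + \<bar>fZ y - fZ x\<bar>" by (rule abs_triangle_ineq4)
      also have "\<dots> \<le> G2 * \<bar>y - x\<bar> * R + F2 * \<bar>y - x\<bar>"
        unfolding abs_mult using 1 2 R G2 x by (intro add_mono mult_mono) auto
      also have "\<dots> = T * \<bar>y - x\<bar>" by (simp add: T_def algebra_simps)
      also have "\<dots> \<le> T * \<bar>z - x\<bar>" using y G2 R F2 by (intro mult_left_mono) (auto simp: T_def)
      finally show "\<bar>g' y * rho x - fZ y\<bar> \<le> T * \<bar>z - x\<bar>" .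
    qed auto
    then show ?thesis by (simp add: psi_def power2_eq_square mult.assoc)
  qed
  show ?thesis
  proof (intro exI conjI ballI)
    show "c' < c" "d < d'" "{c'..d'} \<subseteq> I" "0 < fZ xl" "0 < g' xk" "0 \<le> G" "0 \<le> R2" "0 \<le> T"
      using cd' J l k G R2 G2 R F2 by (auto simp: T_def)
    fix z x assume zx: "z \<in> {c'..d'}" "x \<in> {c'..d'}"
    show "fZ xl * \<bar>z - x\<bar> \<le> \<bar>F z - F x\<bar>"
      by (rule expanding_from_derivative [of c' d' F fZ]) (use F_deriv J xl l zx in auto)
    show "g' xk * \<bar>z - x\<bar> \<le> \<bar>g z - g x\<bar>"
      by (rule expanding_from_derivative [of c' d' g g']) (use g_deriv J xk k zx in auto)
    show "\<bar>g z - g x\<bar> \<le> G * \<bar>z - x\<bar>"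
      by (rule lipschitz_from_derivative [of c' d' g g']) (use g_deriv J G zx in auto)
    show "\<bar>rho z - rho x\<bar> \<le> R2 * \<bar>z - x\<bar>"
      by (rule lipschitz_from_derivative [OF rder]) (use R2 zx in auto)
    show "\<bar>(g z - g x) * rho x - (F z - F x)\<bar> \<le> T * \<bar>z - x\<bar>\<^sup>2" by (rule T [OF zx])
  qed
qed

text \<open>The window ends are images under \<open>g\<close> of points \<open>z1\<close>,
  \<open>z2\<close> of the neighbourhood, by the intermediate value theorem and the
  \<open>room\<close> hypotheses. The count in the window is then one of the uniform sample between
  \<open>F z1\<close> and \<open>F z2\<close>: the empirical deviation gives the stochastic error,
  and the second order expansion gives the bias.\<close>

lemma kde_consistency:
  fixes Z :: "nat \<Rightarrow> real"
  assumes Z: "\<And>i. i \<in> {1..n} \<Longrightarrow> Z i \<in> I" and n: "0 < n" and h: "0 < h"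
    and J: "{c'..d'} \<subseteq> I" "z0 \<in> {c'..d'}" and const: "0 < k" "0 \<le> T" "\<bar>d1\<bar> \<le> D" "\<bar>d2\<bar> \<le> D"
    and est: "\<And>z x. z \<in> {c'..d'} \<Longrightarrow> x \<in> {c'..d'} \<Longrightarrow> k * \<bar>z - x\<bar> \<le> \<bar>g z - g x\<bar> \<and> \<bar>(g z - g x) * rho x - (F z - F x)\<bar> \<le> T * \<bar>z - x\<bar>\<^sup>2"
    and room: "D * h \<le> k * (z0 - c')" "D * h \<le> k * (d' - z0)"
    and B: "\<And>y. y \<in> {0..1} \<Longrightarrow> \<bar>count_dev (\<lambda>i. F (Z i)) n y\<bar> \<le> b * sqrt (real n)" and b: "0 \<le> b"
  shows "\<bar>kde phi h (\<lambda>i. g (Z i)) n (g z0) - rho z0\<bar> \<le> kernel_var * (2 * (b / (sqrt (real n) * h)) + 2 * T * (D / k)\<^sup>2 * h)"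
proof -
  define eta where "eta = 2 * b / sqrt (real n) + 2 * T * (D * h / k)\<^sup>2"
  have sn: "0 < sqrt (real n)" using n by simp
  have eta0: "0 \<le> eta" unfolding eta_def using b const by (intro add_nonneg_nonneg) auto
  have cz: "c' \<le> z0" "z0 \<le> d'" using J by auto
  have ex: "\<exists>z\<in>{c'..d'}. g z = g z0 + t \<and> \<bar>z - z0\<bar> \<le> D * h / k" if t: "\<bar>t\<bar> \<le> D * h" for t
  proof -
    have cJ: "c' \<in> {c'..d'}" "d' \<in> {c'..d'}" using cz by auto
    have "k * \<bar>z0 - c'\<bar> \<le> \<bar>g z0 - g c'\<bar>" "k * \<bar>d' - z0\<bar> \<le> \<bar>g d' - g z0\<bar>"
      using est cJ J(2) by blast+
    moreover have "g c' \<le> g z0" "g z0 \<le> g d'" using cz J cJ by (auto simp: g_le_iff subset_iff)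
    ultimately have "g c' \<le> g z0 + t" "g z0 + t \<le> g d'" using room t cz by (auto simp: abs_le_iff)
    moreover have "continuous_on {c'..d'} g"
      using J g_deriv by (meson DERIV_isCont continuous_at_imp_continuous_on subsetD)
    ultimately obtain z where z: "c' \<le> z" "z \<le> d'" "g z = g z0 + t"
      using IVT' [of g c' "g z0 + t" d'] cz by auto
    then have "k * \<bar>z - z0\<bar> \<le> \<bar>t\<bar>" using est [of z z0] J(2) by auto
    then have "\<bar>z - z0\<bar> \<le> D * h / k" using t const by (simp add: pos_le_divide_eq mult.commute)
    then show ?thesis using z by auto
  qed
  have "\<bar>kde phi h (\<lambda>i. g (Z i)) n (g z0) - rho z0\<bar> \<le> kernel_var * eta / h"
  proof (rule kde_error [OF n h _ eta0])
    fix s assume s: "s \<in> {d1..d2}"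
    have sD: "\<bar>- (d2 * h)\<bar> \<le> D * h" "\<bar>- (s * h)\<bar> \<le> D * h"
      using s const h by (auto simp: abs_mult intro!: mult_right_mono)
    obtain z1 where z1: "z1 \<in> {c'..d'}" "g z1 = g z0 - d2 * h" "\<bar>z1 - z0\<bar> \<le> D * h / k" using ex [OF sD(1)] by auto
    obtain z2 where z2: "z2 \<in> {c'..d'}" "g z2 = g z0 - s * h" "\<bar>z2 - z0\<bar> \<le> D * h / k" using ex [OF sD(2)] by auto
    have zI: "z1 \<in> I" "z2 \<in> I" using z1 z2 J by auto
    have "g z1 \<le> g z2" using z1 z2 s h by (simp add: mult_right_mono)
    then have F12: "F z1 \<le> F z2" using zI by (simp add: F_le_iff g_le_iff)
    have Fr: "0 < F z1" "F z1 < 1" "0 < F z2" "F z2 < 1" using F_range zI by auto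
    define N2 where "N2 = real (card {i \<in> {1..n}. F (Z i) \<le> F z2})"
    define N1 where "N1 = real (card {i \<in> {1..n}. F (Z i) < F z1})"
    have N2: "\<bar>N2 - real n * F z2\<bar> \<le> b * sqrt (real n)" using B [of "F z2"] Fr by (simp add: N2_def count_dev_def)
    have N1: "\<bar>N1 - real n * F z1\<bar> \<le> b * sqrt (real n)"
      unfolding N1_def using count_dev_strict_bounds [of "F z1" "\<lambda>i. F (Z i)" n] B Fr by auto
    have set: "{i \<in> {1..n}. g z0 - d2 * h \<le> g (Z i) \<and> g (Z i) \<le> g z0 - s * h} = {i \<in> {1..n}. F (Z i) \<le> F z2} - {i \<in> {1..n}. F (Z i) < F z1}"
      unfolding z1(2) [symmetric] z2(2) [symmetric] using Z zI by (auto simp: F_le_iff g_le_iff F_less_iff)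
    have "card {i \<in> {1..n}. g z0 - d2 * h \<le> g (Z i) \<and> g (Z i) \<le> g z0 - s * h} =
        card {i \<in> {1..n}. F (Z i) \<le> F z2} - card {i \<in> {1..n}. F (Z i) < F z1}"
      unfolding set using F12 by (intro card_Diff_subset) auto
    moreover have "card {i \<in> {1..n}. F (Z i) < F z1} \<le> card {i \<in> {1..n}. F (Z i) \<le> F z2}"
      using F12 by (intro card_mono) auto
    ultimately have cd: "real (card {i \<in> {1..n}. g z0 - d2 * h \<le> g (Z i) \<and> g (Z i) \<le> g z0 - s * h}) = N2 - N1"
      by (simp add: N1_def N2_def of_nat_diff)
    have "\<bar>(N2 - N1) - real n * (F z2 - F z1)\<bar> \<le> 2 * (b * sqrt (real n))"
      using N1 N2 by (simp add: right_diff_distrib abs_le_iff)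
    moreover have "(N2 - N1) / real n - (F z2 - F z1) = ((N2 - N1) - real n * (F z2 - F z1)) / real n"
      using n by (simp add: diff_divide_distrib)
    ultimately have "\<bar>(N2 - N1) / real n - (F z2 - F z1)\<bar> \<le> 2 * (b * sqrt (real n)) / real n"
      by (simp add: divide_right_mono)
    also have "\<dots> = 2 * b / sqrt (real n)"
      using n by (simp add: real_div_sqrt divide_simps)
    finally have 1: "\<bar>(N2 - N1) / real n - (F z2 - F z1)\<bar> \<le> 2 * b / sqrt (real n)" .
    have sq: "\<bar>z1 - z0\<bar>\<^sup>2 \<le> (D * h / k)\<^sup>2" "\<bar>z2 - z0\<bar>\<^sup>2 \<le> (D * h / k)\<^sup>2"
      using z1(3) z2(3) by (intro power_mono; simp)+
    have "\<bar>(g z1 - g z0) * rho z0 - (F z1 - F z0)\<bar> \<le> T * (D * h / k)\<^sup>2" "\<bar>(g z2 - g z0) * rho z0 - (F z2 - F z0)\<bar> \<le> T * (D * h / k)\<^sup>2"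
      using est [OF z1(1) J(2)] est [OF z2(1) J(2)] mult_left_mono [OF sq(1) const(2)] mult_left_mono [OF sq(2) const(2)] by linarith+
    moreover have "rho z0 * (d2 - s) * h = (g z2 - g z0) * rho z0 - (g z1 - g z0) * rho z0"
      by (simp add: z1(2) z2(2) algebra_simps)
    ultimately have "\<bar>(F z2 - F z1) - rho z0 * (d2 - s) * h\<bar> \<le> 2 * T * (D * h / k)\<^sup>2" by linarith
    then show "\<bar>real (card {i \<in> {1..n}. g z0 - d2 * h \<le> g (Z i) \<and> g (Z i) \<le> g z0 - s * h}) / real n - rho z0 * (d2 - s) * h\<bar> \<le> eta"
      unfolding cd eta_def using 1 by linarith
  qed
  also have "kernel_var * eta / h = kernel_var * (2 * (b / (sqrt (real n) * h)) + 2 * T * (D / k)\<^sup>2 * h)"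
    using h by (simp add: eta_def power_divide power_mult_distrib power2_eq_square field_simps)
  finally show ?thesis .
qed

text \<open>A statement about one fixed path: the probabilistic input is the hypothesis
  \<open>emp\<close> alone, with \<open>kf\<close> in the place of the Kiefer process.\<close>

theorem quantile_estimator_limit:
  fixes Z :: "nat \<Rightarrow> real" and h :: "nat \<Rightarrow> real" and kf :: "real \<Rightarrow> nat \<Rightarrow> real" and eps :: "nat \<Rightarrow> real"
  assumes Z: "\<And>i. Z i \<in> I" and h: "\<And>n. 0 < h n"
    and h1: "(\<lambda>n. sqrt (ln (ln (real n))) * h n) \<longlonglongrightarrow> 0"
    and h2: "filterlim (\<lambda>n. sqrt (real n) * (h n)\<^sup>2 / ln (ln (real n))) at_top sequentially"
    and eps: "eps \<longlonglongrightarrow> 0" and C: "0 \<le> C"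
    and emp: "\<forall>\<^sub>F n in sequentially.
      (\<forall>y\<in>{0..1}. \<bar>count_dev (\<lambda>i. F (Z i)) n y + kf y n\<bar> \<le> eps n * sqrt (real n)) \<and>
      (\<forall>y\<in>{0..1}. \<forall>y'\<in>{0..1}. \<bar>count_dev (\<lambda>i. F (Z i)) n y - count_dev (\<lambda>i. F (Z i)) n y'\<bar> \<le>
         (C * sqrt (ln (ln (real n))) * sqrt (sqrt \<bar>y - y'\<bar>) + eps n) * sqrt (real n))"
  shows "(\<lambda>n. SUP x\<in>{c..d}. ereal \<bar>sqrt (real n) * (emp_quantile (\<lambda>i. g (Z i)) n (F x) - g x)
       * kde phi (h n) (\<lambda>i. g (Z i)) n (emp_quantile (\<lambda>i. g (Z i)) n (F x)) - kf (F x) n / sqrt (real n)\<bar>) \<longlonglongrightarrow> 0"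
proof -
  obtain c' d' l k G R2 T where cc: "c' < c" "d < d'" and J: "{c'..d'} \<subseteq> I"
    and pos: "0 < l" "0 < k" "0 \<le> G" "0 \<le> R2" "0 \<le> T"
    and est: "\<forall>z\<in>{c'..d'}. \<forall>x\<in>{c'..d'}. l * \<bar>z - x\<bar> \<le> \<bar>F z - F x\<bar> \<and> k * \<bar>z - x\<bar> \<le> \<bar>g z - g x\<bar> \<and>
       \<bar>g z - g x\<bar> \<le> G * \<bar>z - x\<bar> \<and> \<bar>rho z - rho x\<bar> \<le> R2 * \<bar>z - x\<bar> \<and>
       \<bar>(g z - g x) * rho x - (F z - F x)\<bar> \<le> T * \<bar>z - x\<bar>\<^sup>2"
    using local_constants by (elim exE conjE) (rule that)
  \<comment> \<open>Half of the room around \<open>{c..d}\<close>: one half absorbs the quantile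
    error \<open>z - x\<close>, the other the kernel window.\<close>
  define mm where "mm = min (c - c') (d' - d) / 2"
  have mm: "0 < mm" "mm \<le> (c - c') / 2" "mm \<le> (d' - d) / 2" using cc by (auto simp: mm_def)
  define D where "D = max \<bar>d1\<bar> \<bar>d2\<bar>"
  have D: "\<bar>d1\<bar> \<le> D" "\<bar>d2\<bar> \<le> D" "0 \<le> D" by (auto simp: D_def)
  define q where "q = (\<lambda>n::nat. sqrt (ln (ln (real n))))"
  define b where "b = (\<lambda>n. (C + 1) * q n)"
  \<comment> \<open>\<open>K1\<close> and \<open>K2\<close> multiply the quantile deviation by the
    stochastic error and the bias of the kernel estimate. \<open>K3\<close> collects the variation
    of \<open>rho\<close> between \<open>z\<close> and \<open>x\<close> and the second order term of
    the expansion.\<close>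
  define K1 where "K1 = G / l * kernel_var * 2"
  define K2 where "K2 = G / l * kernel_var * (2 * T * (D / k)\<^sup>2)"
  define K3 where "K3 = G / l * (R2 / l) + T / l\<^sup>2"
  define delta where "delta = (\<lambda>n. K1 * ((b n)\<^sup>2 / (sqrt (real n) * h n)) + K2 * (b n * h n) + K3 * ((b n)\<^sup>2 / sqrt (real n)) +
      (C * q n * sqrt (sqrt (b n / sqrt (real n) + 1 / real n)) + eps n + 1 / sqrt (real n)) + eps n)"
  have q1: "\<forall>\<^sub>F n in sequentially. 1 \<le> q n" unfolding q_def by real_asymp
  have lnln: "\<forall>\<^sub>F n::nat in sequentially. 0 < ln (ln (real n))" by real_asymp
  have h0: "h \<longlonglongrightarrow> 0"
  proof (rule Lim_null_comparison [OF _ h1])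
    show "\<forall>\<^sub>F n in sequentially. norm (h n) \<le> sqrt (ln (ln (real n))) * h n"
      using q1
    proof eventually_elim
      case (elim n)
      then have "1 * h n \<le> sqrt (ln (ln (real n))) * h n" using h [of n] by (intro mult_right_mono) (auto simp: q_def)
      then show ?case using h [of n] by simp
    qed
  qed
  have i0: "(\<lambda>n. inverse (sqrt (real n) * (h n)\<^sup>2 / ln (ln (real n)))) \<longlonglongrightarrow> 0"
    by (rule tendsto_inverse_0_at_top [OF h2])
  \<comment> \<open>The term is a constant times the reciprocal of the second bandwidth quantity
    times \<open>h n\<close>, and both factors tend to 0.\<close>
  have L1: "(\<lambda>n. (b n)\<^sup>2 / (sqrt (real n) * h n)) \<longlonglongrightarrow> 0"
  proof -
    have "(\<lambda>n. (C + 1)\<^sup>2 * (inverse (sqrt (real n) * (h n)\<^sup>2 / ln (ln (real n))) * h n)) \<longlonglongrightarrow> (C + 1)\<^sup>2 * (0 * 0)"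
      by (intro tendsto_mult tendsto_const i0 h0)
    then have "(\<lambda>n. (C + 1)\<^sup>2 * (inverse (sqrt (real n) * (h n)\<^sup>2 / ln (ln (real n))) * h n)) \<longlonglongrightarrow> 0" by simp
    moreover have "\<forall>\<^sub>F n in sequentially. (C + 1)\<^sup>2 * (inverse (sqrt (real n) * (h n)\<^sup>2 / ln (ln (real n))) * h n) = (b n)\<^sup>2 / (sqrt (real n) * h n)"
      using lnln
    proof eventually_elim
      case (elim n)
      then show ?case using h [of n] by (simp add: b_def q_def power_mult_distrib power2_eq_square field_simps)
    qed
    ultimately show ?thesis by (rule Lim_transform_eventually)
  qed
  have L2: "(\<lambda>n. b n * h n) \<longlonglongrightarrow> 0"
    using tendsto_mult [OF tendsto_const [of "C + 1"] h1] by (simp add: b_def q_def mult.assoc)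
  have L3: "(\<lambda>n. (b n)\<^sup>2 / sqrt (real n)) \<longlonglongrightarrow> 0"
  proof -
    have "(\<lambda>n. (q n)\<^sup>2 / sqrt (real n)) \<longlonglongrightarrow> 0" unfolding q_def by real_asymp
    from tendsto_mult [OF tendsto_const [of "(C + 1)\<^sup>2"] this] show ?thesis
      by (simp add: b_def power_mult_distrib)
  qed
  have L0: "(\<lambda>n. b n / sqrt (real n)) \<longlonglongrightarrow> 0"
  proof -
    have "(\<lambda>n. q n / sqrt (real n)) \<longlonglongrightarrow> 0" unfolding q_def by real_asymp
    from tendsto_mult [OF tendsto_const [of "C + 1"] this] show ?thesis by (simp add: b_def)
  qed
  have L4: "(\<lambda>n. C * q n * sqrt (sqrt (b n / sqrt (real n) + 1 / real n))) \<longlonglongrightarrow> 0"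
  proof (rule Lim_null_comparison)
    have "(\<lambda>n::nat. q n * sqrt (sqrt (q n / sqrt (real n)))) \<longlonglongrightarrow> 0" unfolding q_def by real_asymp
    from tendsto_mult [OF tendsto_const [of "C * sqrt (sqrt (C + 2))"] this]
    show "(\<lambda>n. C * sqrt (sqrt (C + 2)) * (q n * sqrt (sqrt (q n / sqrt (real n))))) \<longlonglongrightarrow> 0" by simp
    have "\<forall>\<^sub>F n::nat in sequentially. 1 / real n \<le> q n / sqrt (real n)" unfolding q_def by real_asymp
    then show "\<forall>\<^sub>F n in sequentially. norm (C * q n * sqrt (sqrt (b n / sqrt (real n) + 1 / real n))) \<le> C * sqrt (sqrt (C + 2)) * (q n * sqrt (sqrt (q n / sqrt (real n))))"
      using q1
    proof eventually_elim
      case (elim n)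
      have "b n / sqrt (real n) + 1 / real n \<le> (C + 2) * (q n / sqrt (real n))"
        using elim(1) by (simp add: b_def distrib_right add_divide_distrib)
      then have "sqrt (sqrt (b n / sqrt (real n) + 1 / real n)) \<le> sqrt (sqrt ((C + 2) * (q n / sqrt (real n))))" by simp
      also have "\<dots> = sqrt (sqrt (C + 2)) * sqrt (sqrt (q n / sqrt (real n)))" by (simp only: real_sqrt_mult)
      finally have "C * q n * sqrt (sqrt (b n / sqrt (real n) + 1 / real n)) \<le> C * q n * (sqrt (sqrt (C + 2)) * sqrt (sqrt (q n / sqrt (real n))))"
        using C elim(2) by (intro mult_left_mono) auto
      moreover have "0 \<le> b n / sqrt (real n) + 1 / real n" using C elim(2) by (simp add: b_def)
      ultimately show ?case using C elim(2) by (simp add: abs_mult mult_ac)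
    qed
  qed
  have L5: "(\<lambda>n::nat. 1 / sqrt (real n)) \<longlonglongrightarrow> 0" by real_asymp
  have "delta \<longlonglongrightarrow> K1 * 0 + K2 * 0 + K3 * 0 + (0 + 0 + 0) + 0"
    unfolding delta_def by (intro tendsto_add tendsto_mult tendsto_const L1 L2 L3 L4 L5 eps)
  then have delta0: "delta \<longlonglongrightarrow> 0" by simp
  have ev1: "\<forall>\<^sub>F n in sequentially. b n / sqrt (real n) < l * mm"
    using order_tendstoD(2) [OF L0, of "l * mm"] pos mm by simp
  have ev2: "\<forall>\<^sub>F n in sequentially. D * h n < k * mm"
  proof -
    have "(\<lambda>n. D * h n) \<longlonglongrightarrow> D * 0" by (intro tendsto_mult tendsto_const h0)
    then show ?thesis using order_tendstoD(2) [of "\<lambda>n. D * h n" 0 sequentially "k * mm"] pos mm by simp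
  qed
  have ev3: "\<forall>\<^sub>F n in sequentially. eps n < 1" by (rule order_tendstoD(2) [OF eps]) simp
  have bound: "\<forall>\<^sub>F n in sequentially. \<forall>x\<in>{c..d}. \<bar>sqrt (real n) * (emp_quantile (\<lambda>i. g (Z i)) n (F x) - g x)
       * kde phi (h n) (\<lambda>i. g (Z i)) n (emp_quantile (\<lambda>i. g (Z i)) n (F x)) - kf (F x) n / sqrt (real n)\<bar> \<le> delta n"
    using emp q1 ev1 ev2 ev3 eventually_gt_at_top [of 0]
  proof eventually_elim
    case (elim n)
    have n: "0 < n" by (rule elim(6))
    define s where "s = sqrt (real n)"
    have s: "0 < s" using n by (simp add: s_def)
    define v where "v = (\<lambda>i. F (Z i))"
    have kfb: "\<bar>count_dev v n y + kf y n\<bar> \<le> eps n * s" if "y \<in> {0..1}" for y using elim(1) that by (simp add: v_def s_def)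
    have osc: "\<bar>count_dev v n y - count_dev v n y'\<bar> \<le> (C * q n * sqrt (sqrt \<bar>y - y'\<bar>) + eps n) * sqrt (real n)" if "y \<in> {0..1}" "y' \<in> {0..1}" for y y'
      using elim(1) that by (simp add: v_def q_def)
    have Q: "0 \<le> C * q n" using C elim(2) by simp
    have Qb: "C * q n + eps n \<le> b n" using elim(2,5) by (simp add: b_def distrib_right)
    have b0: "0 \<le> b n" using C elim(2) by (simp add: b_def)
    have B: "\<bar>count_dev v n y\<bar> \<le> b n * sqrt (real n)" if y: "y \<in> {0..1}" for y
    proof -
      have "{i \<in> {1..n}. v i \<le> 1} = {1..n}" using F_range Z by (auto simp: v_def less_imp_le)
      then have "count_dev v n 1 = 0" by (simp add: count_dev_def)
      then have "\<bar>count_dev v n y\<bar> \<le> (C * q n * sqrt (sqrt \<bar>y - 1\<bar>) + eps n) * sqrt (real n)" using osc [OF y, of 1] by simp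
      also have "\<dots> \<le> (C * q n * 1 + eps n) * sqrt (real n)"
        using y Q by (intro mult_right_mono add_right_mono mult_left_mono) auto
      also have "\<dots> \<le> b n * sqrt (real n)" using Qb by (intro mult_right_mono) auto
      finally show ?thesis .
    qed
    show ?case
    proof
      fix x assume x: "x \<in> {c..d}"
      have xJ: "x \<in> {c'..d'}" using x cc by auto
      have xI: "x \<in> I" using xJ J by auto
      define p where "p = F x"
      have p: "0 < p" "p < 1" using F_range [OF xI] by (auto simp: p_def)
      define Y where "Y = (\<lambda>i. g (Z i))"
      have order: "Y i \<le> Y k \<longleftrightarrow> v i \<le> v k" for i k
        using Z by (simp add: Y_def v_def F_le_iff g_le_iff)
      obtain i where i: "i \<in> {1..n}" "emp_quantile Y n p = Y i"
        "p * real n \<le> real (card {k \<in> {1..n}. v k \<le> v i})" "real (card {k \<in> {1..n}. v k < v i}) < p * real n"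
        by (rule emp_quantile_order_statistic [OF n p(1) less_imp_le [OF p(2)] order])
      define z where "z = Z i"
      define u where "u = F z"
      have zI: "z \<in> I" using Z by (simp add: z_def)
      have u: "0 < u" "u < 1" "v i = u" using F_range [OF zI] by (auto simp: u_def v_def z_def)
      have inv: "\<bar>u - p\<bar> \<le> (C * q n + eps n) / sqrt (real n)"
        "\<bar>sqrt (real n) * (u - p) + count_dev v n p / sqrt (real n)\<bar> \<le> C * q n * sqrt (sqrt ((C * q n + eps n) / sqrt (real n) + 1 / real n)) + eps n + 1 / sqrt (real n)"
      proof -
        have v1: "\<And>i. i \<in> {1..n} \<Longrightarrow> v i < 1" using F_range Z by (simp add: v_def)
        show "\<bar>u - p\<bar> \<le> (C * q n + eps n) / sqrt (real n)"
          by (rule quantile_inversion(1) [OF n u(1,2) p v1 i(3,4) [unfolded u(3)] osc Q])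
        show "\<bar>sqrt (real n) * (u - p) + count_dev v n p / sqrt (real n)\<bar> \<le> C * q n * sqrt (sqrt ((C * q n + eps n) / sqrt (real n) + 1 / real n)) + eps n + 1 / sqrt (real n)"
          by (rule quantile_inversion(2) [OF n u(1,2) p v1 i(3,4) [unfolded u(3)] osc Q])
      qed
      have r: "(C * q n + eps n) / sqrt (real n) \<le> b n / s" using Qb s by (simp add: s_def divide_right_mono)
      have up: "\<bar>u - p\<bar> \<le> b n / s" using inv(1) r by linarith
      have small: "\<bar>u - p\<bar> < l * mm" using up elim(3) by (simp add: s_def)
      \<comment> \<open>Leaving the neighbourhood would move \<open>F\<close> by at least
        \<open>l * mm\<close>, which exceeds the quantile deviation for large
        \<open>n\<close>.\<close>
      have zJ: "z \<in> {c'..d'}"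
      proof (rule ccontr)
        assume "z \<notin> {c'..d'}"
        then consider "z < c'" | "d' < z" by fastforce
        then show False
        proof cases
          case 1
          have cJ: "c' \<in> {c'..d'}" using x cc by auto
          then have cI: "c' \<in> I" using J by (rule rev_subsetD)
          have "u < F c'" using 1 zI cI by (simp add: u_def F_less_iff)
          moreover have "F c' < p" using cI xI x cc by (simp add: p_def F_less_iff)
          moreover have "l * \<bar>c' - x\<bar> \<le> \<bar>F c' - F x\<bar>" using est cJ xJ by blast
          moreover have "l * mm \<le> l * \<bar>c' - x\<bar>" using mm x pos cc by (intro mult_left_mono) auto
          ultimately show False using small by (simp add: p_def)
        next
          case 2
          have cJ: "d' \<in> {c'..d'}" using x cc by auto
          then have cI: "d' \<in> I" using J by (rule rev_subsetD)
          have "F d' < u" using 2 zI cI by (simp add: u_def F_less_iff)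
          moreover have "p < F d'" using cI xI x cc by (simp add: p_def F_less_iff)
          moreover have "l * \<bar>d' - x\<bar> \<le> \<bar>F d' - F x\<bar>" using est cJ xJ by blast
          moreover have "l * mm \<le> l * \<bar>d' - x\<bar>" using mm x pos cc by (intro mult_left_mono) auto
          ultimately show False using small by (simp add: p_def)
        qed
      qed
      have zx: "l * \<bar>z - x\<bar> \<le> \<bar>u - p\<bar>" "\<bar>g z - g x\<bar> \<le> G * \<bar>z - x\<bar>" "\<bar>rho z - rho x\<bar> \<le> R2 * \<bar>z - x\<bar>"
        "\<bar>(g z - g x) * rho x - (u - p)\<bar> \<le> T * \<bar>z - x\<bar>\<^sup>2"
        using est zJ xJ unfolding u_def p_def by blast+
      have zmm: "\<bar>z - x\<bar> < mm"
      proof -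
        have "l * \<bar>z - x\<bar> < l * mm" using zx(1) small by linarith
        then show ?thesis using pos by simp
      qed
      define t where "t = b n / s / l"
      have t0: "0 \<le> t" using b0 s pos by (simp add: t_def)
      have zt: "\<bar>z - x\<bar> \<le> t" unfolding t_def pos_le_divide_eq [OF pos(1)] using zx(1) up by (simp add: mult.commute)
      have st: "s * t = b n / l" using s by (simp add: t_def)
      define f where "f = kde phi (h n) Y n (g z)"
      have fr: "\<bar>f - rho z\<bar> \<le> kernel_var * (2 * (b n / (s * h n)) + 2 * T * (D / k)\<^sup>2 * h n)"
        unfolding f_def Y_def s_def
      proof (rule kde_consistency [OF Z n h J zJ pos(2,5) D(1,2)])
        show "k * \<bar>z - x\<bar> \<le> \<bar>g z - g x\<bar> \<and> \<bar>(g z - g x) * rho x - (F z - F x)\<bar> \<le> T * \<bar>z - x\<bar>\<^sup>2" if "z \<in> {c'..d'}" "x \<in> {c'..d'}" for z x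
          using est that by blast
        have "k * mm \<le> k * (z - c')" "k * mm \<le> k * (d' - z)"
          using zmm mm x pos by (intro mult_left_mono; auto simp: abs_less_iff)+
        then show "D * h n \<le> k * (z - c')" "D * h n \<le> k * (d' - z)" using elim(4) by linarith+
        show "\<bar>count_dev (\<lambda>i. F (Z i)) n y\<bar> \<le> b n * sqrt (real n)" if "y \<in> {0..1}" for y using B [OF that] by (simp add: v_def)
      qed (rule b0)
      have gz: "\<bar>s * (g z - g x)\<bar> \<le> G / l * b n"
      proof -
        have "\<bar>g z - g x\<bar> \<le> G * t" using zx(2) mult_left_mono [OF zt pos(3)] by linarith
        then have "s * \<bar>g z - g x\<bar> \<le> s * (G * t)" using s by (intro mult_left_mono) auto
        also have "\<dots> = G * (s * t)" by simp
        finally show ?thesis using s by (simp add: abs_mult st)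
      qed
      have T1: "\<bar>s * (g z - g x) * (f - rho z)\<bar> \<le> K1 * ((b n)\<^sup>2 / (s * h n)) + K2 * (b n * h n)"
      proof -
        have "\<bar>s * (g z - g x) * (f - rho z)\<bar> \<le> (G / l * b n) * (kernel_var * (2 * (b n / (s * h n)) + 2 * T * (D / k)\<^sup>2 * h n))"
          unfolding abs_mult [of "s * (g z - g x)"] using gz fr b0 pos by (intro mult_mono) auto
        also have "\<dots> = K1 * ((b n)\<^sup>2 / (s * h n)) + K2 * (b n * h n)"
          by (simp add: K1_def K2_def power2_eq_square distrib_left mult_ac)
        finally show ?thesis .
      qed
      have T2: "\<bar>s * (g z - g x) * (rho z - rho x)\<bar> \<le> G / l * (R2 / l) * ((b n)\<^sup>2 / s)"
      proof -
        have "\<bar>rho z - rho x\<bar> \<le> R2 * t" using zx(3) mult_left_mono [OF zt pos(4)] by linarith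
        then have "\<bar>s * (g z - g x) * (rho z - rho x)\<bar> \<le> (G / l * b n) * (R2 * t)"
          unfolding abs_mult [of "s * (g z - g x)"] using gz b0 pos by (intro mult_mono) auto
        also have "\<dots> = G / l * (R2 / l) * ((b n)\<^sup>2 / s)" by (simp add: t_def power2_eq_square mult_ac)
        finally show ?thesis .
      qed
      have T3: "\<bar>s * ((g z - g x) * rho x - (u - p))\<bar> \<le> T / l\<^sup>2 * ((b n)\<^sup>2 / s)"
      proof -
        have "\<bar>z - x\<bar>\<^sup>2 \<le> t\<^sup>2" using zt by (intro power_mono) auto
        then have "\<bar>(g z - g x) * rho x - (u - p)\<bar> \<le> T * t\<^sup>2" using zx(4) mult_left_mono [of "\<bar>z - x\<bar>\<^sup>2" "t\<^sup>2" T] pos by linarith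
        then have "s * \<bar>(g z - g x) * rho x - (u - p)\<bar> \<le> s * (T * t\<^sup>2)" using s by (intro mult_left_mono) auto
        also have "s * (T * t\<^sup>2) = T / l\<^sup>2 * ((b n)\<^sup>2 / s)" using s pos(1) by (simp add: t_def power2_eq_square field_simps)
        finally show ?thesis using s by (simp add: abs_mult)
      qed
      have T4: "\<bar>s * (u - p) + count_dev v n p / s\<bar> \<le> C * q n * sqrt (sqrt (b n / s + 1 / real n)) + eps n + 1 / s"
      proof -
        have "C * q n * sqrt (sqrt ((C * q n + eps n) / sqrt (real n) + 1 / real n)) \<le> C * q n * sqrt (sqrt (b n / s + 1 / real n))"
          using r Q by (intro mult_left_mono) auto
        then show ?thesis using inv(2) by (simp add: s_def)
      qed
      have T5: "\<bar>count_dev v n p / s + kf p n / s\<bar> \<le> eps n"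
      proof -
        have "\<bar>count_dev v n p + kf p n\<bar> / s \<le> eps n" using kfb [of p] p s by (simp add: pos_divide_le_eq)
        then show ?thesis using s by (simp add: add_divide_distrib [symmetric])
      qed
      \<comment> \<open>The replacements in order: the estimated density by \<open>rho z\<close>,
        then by \<open>rho x\<close>; the increment of \<open>g\<close> by that of \<open>F\<close>;
        that increment by minus the empirical process; and this finally by the Kiefer value.
        \<open>T1\<close> to \<open>T5\<close> bound them one by one.\<close>
      have eq: "s * (g z - g x) * f - kf p n / s = s * (g z - g x) * (f - rho z) + s * (g z - g x) * (rho z - rho x)
          + s * ((g z - g x) * rho x - (u - p)) + (s * (u - p) + count_dev v n p / s) - (count_dev v n p / s + kf p n / s)"
        by (simp add: algebra_simps)
      have K3e: "K3 * ((b n)\<^sup>2 / s) = G / l * (R2 / l) * ((b n)\<^sup>2 / s) + T / l\<^sup>2 * ((b n)\<^sup>2 / s)"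
        by (simp only: K3_def distrib_right)
      have "\<bar>s * (g z - g x) * f - kf p n / s\<bar> \<le> delta n"
        unfolding eq delta_def K3e [unfolded s_def] s_def [symmetric] using T1 T2 T3 T4 T5 K3e by linarith
      moreover have "emp_quantile Y n p = g z" using i by (simp add: Y_def z_def)
      ultimately show "\<bar>sqrt (real n) * (emp_quantile (\<lambda>i. g (Z i)) n (F x) - g x)
          * kde phi (h n) (\<lambda>i. g (Z i)) n (emp_quantile (\<lambda>i. g (Z i)) n (F x)) - kf (F x) n / sqrt (real n)\<bar> \<le> delta n"
        by (simp add: f_def Y_def p_def s_def)
    qed
  qed
  show ?thesis
  proof (rule tendsto_sandwich)
    show "\<forall>\<^sub>F n in sequentially. 0 \<le> (SUP x\<in>{c..d}. ereal \<bar>sqrt (real n) * (emp_quantile (\<lambda>i. g (Z i)) n (F x) - g x)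
       * kde phi (h n) (\<lambda>i. g (Z i)) n (emp_quantile (\<lambda>i. g (Z i)) n (F x)) - kf (F x) n / sqrt (real n)\<bar>)"
      using cd by (intro always_eventually allI SUP_upper2 [of c]) auto
    show "\<forall>\<^sub>F n in sequentially. (SUP x\<in>{c..d}. ereal \<bar>sqrt (real n) * (emp_quantile (\<lambda>i. g (Z i)) n (F x) - g x)
       * kde phi (h n) (\<lambda>i. g (Z i)) n (emp_quantile (\<lambda>i. g (Z i)) n (F x)) - kf (F x) n / sqrt (real n)\<bar>) \<le> ereal (delta n)"
      using bound by eventually_elim (auto intro!: SUP_least)
    show "(\<lambda>n. ereal (delta n)) \<longlonglongrightarrow> 0" using delta0 by (simp add: zero_ereal_def)
  qed simp
qed

end

section \<open>Probability space and sample\<close>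

lemma prob_density_cdf:
  assumes "f \<in> borel_measurable borel" "\<And>x. 0 \<le> f x" "(\<integral>\<^sup>+ x. ennreal (f x) \<partial>lborel) = 1"
  shows "real_distribution (density lborel f)" "integrable lborel f" "cdf (density lborel f) x = (LBINT t:{..x}. f t)"
    "measure (density lborel f) {x} = 0"
proof -
  have [measurable]: "f \<in> borel_measurable borel" by (rule assms(1))
  show "real_distribution (density lborel f)"
    unfolding real_distribution_def real_distribution_axioms_def
    using assms(3) by (auto intro!: prob_spaceI simp: emeasure_density)
  show int: "integrable lborel f"
    using assms by (intro integrableI_nonneg) auto
  have "emeasure (density lborel f) {..x} = (\<integral>\<^sup>+ t. ennreal (indicator {..x} t * f t) \<partial>lborel)"
    by (subst emeasure_density) (auto intro!: nn_integral_cong split: split_indicator)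
  also have "\<dots> = ennreal (LBINT t:{..x}. f t)"
    unfolding set_lebesgue_integral_def real_scaleR_def
    using assms(2) integrable_mult_indicator [OF _ int, of "{..x}"]
    by (intro nn_integral_eq_integral) auto
  finally show "cdf (density lborel f) x = (LBINT t:{..x}. f t)"
    using assms(2) by (simp add: cdf_def measure_def set_lebesgue_integral_def integral_nonneg_AE)
  have "AE t in lborel. t \<noteq> x" by (rule AE_lborel_singleton)
  then have "emeasure (density lborel f) {x} = 0"
    by (subst emeasure_density) (auto intro!: nn_integral_0_iff_AE [THEN iffD2] elim!: eventually_mono)
  then show "measure (density lborel f) {x} = 0" by (simp add: measure_def)
qed

lemma indep_vars_PiM_coordinates:
  assumes "\<And>i. prob_space (N i)"
  shows "prob_space.indep_vars (\<Pi>\<^sub>M i\<in>UNIV. N i) N (\<lambda>i \<omega>. \<omega> i) (UNIV :: 'i set)"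
proof -
  interpret product_prob_space N UNIV
    using assms by (simp add: product_prob_space_def product_sigma_finite_def product_prob_space_axioms_def prob_space_imp_sigma_finite)
  have "distr (PiM UNIV N) (N i) (\<lambda>\<omega>. \<omega> i) = N i" for i
    using distr_PiM_component [of UNIV N i] assms by simp
  then show ?thesis
    by (subst P.indep_vars_iff_distr_eq_PiM') (auto simp: restrict_UNIV)
qed

text \<open>The coordinates are forced into the open unit interval, which changes them on a null set only.\<close>

definition coord :: "nat list \<Rightarrow> (nat \<Rightarrow> real) \<Rightarrow> real" where
  "coord e \<omega> = (if 0 < \<omega> (to_nat e) \<and> \<omega> (to_nat e) < 1 then \<omega> (to_nat e) else 1/2)"

definition base_space :: "(nat \<Rightarrow> real) measure" where "base_space = (\<Pi>\<^sub>M i\<in>UNIV. unif)"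

lemma space_base_space [simp]: "space base_space = UNIV"
  by (simp add: base_space_def space_PiM)

lemma coupling_base_space: "coupling base_space coord"
proof -
  interpret prob_space base_space unfolding base_space_def by (intro prob_space_PiM unif_prob_space)
  let ?f = "\<lambda>t::real. if 0 < t \<and> t < 1 then t else 1/2"
  have "indep_vars (\<lambda>_. unif) (\<lambda>i \<omega>. \<omega> i) (UNIV :: nat set)"
    unfolding base_space_def by (intro indep_vars_PiM_coordinates unif_prob_space)
  then have "indep_vars (\<lambda>_. unif) (\<lambda>e \<omega>. \<omega> (to_nat e)) (UNIV :: nat list set)"
    by (rule indep_vars_reindex) auto
  then have "indep_vars (\<lambda>_. borel) (\<lambda>e \<omega>. ?f (\<omega> (to_nat e))) (UNIV :: nat list set)"
    by (rule indep_vars_compose2) measurable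
  then have indep: "indep_vars (\<lambda>_. borel) coord UNIV" by (simp add: coord_def [abs_def])
  have distr: "distr base_space borel (coord e) = unif" for e
  proof -
    have m: "(\<lambda>\<omega>. \<omega> (to_nat e)) \<in> base_space \<rightarrow>\<^sub>M unif" unfolding base_space_def by measurable
    have "distr base_space borel (coord e) = distr (distr base_space unif (\<lambda>\<omega>. \<omega> (to_nat e))) borel ?f"
      by (subst distr_distr [OF _ m]) (auto simp: comp_def coord_def [abs_def])
    also have "distr base_space unif (\<lambda>\<omega>. \<omega> (to_nat e)) = unif"
      unfolding base_space_def by (rule distr_PiM_component) (auto intro: unif_prob_space)
    also have "distr unif borel ?f = distr unif borel (\<lambda>t. t)"
    proof (rule distr_cong_AE)
      have "AE t in unif. t \<in> {0<..<1}" unfolding unif_def by (intro AE_uniform_measureI) auto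
      then show "AE t in unif. ?f t = t" by eventually_elim auto
    qed auto
    also have "\<dots> = unif" by (simp add: distr_id2)
    finally show ?thesis .
  qed
  show ?thesis
    unfolding coupling_def
    by unfold_locales (use indep distr in \<open>auto simp: coord_def\<close>)
qed

lemma card_shift_diff:
  fixes P :: "nat \<Rightarrow> bool"
  shows "\<bar>real (card {i. i < n \<and> P i}) - real (card {i \<in> {1..n}. P i})\<bar> \<le> 1"
proof -
  have "card {i. i < n \<and> P i} \<le> card (insert 0 {i \<in> {1..n}. P i})"
    by (intro card_mono) (auto simp: Suc_le_eq)
  also have "\<dots> \<le> Suc (card {i \<in> {1..n}. P i})" by (rule card_insert_le_m1) auto
  finally have 1: "card {i. i < n \<and> P i} \<le> Suc (card {i \<in> {1..n}. P i})" .
  have "card {i \<in> {1..n}. P i} \<le> card (insert n {i. i < n \<and> P i})"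
    by (intro card_mono) auto
  also have "\<dots> \<le> Suc (card {i. i < n \<and> P i})" by (rule card_insert_le_m1) auto
  finally show ?thesis using 1 by linarith
qed

text \<open>"One can define" is rendered as the existence of a space that carries both the sample
  and the process. The sample is the quantile transform of the uniform sample \<open>U\<close>, so
  \<open>F (Z i)\<close> equals \<open>U i\<close> at every point of that space.\<close>

theorem theorem2:
  fixes F fZ fZ' g g' g'' \<phi> \<phi>' :: "real \<Rightarrow> real"
    and h :: "nat \<Rightarrow> real"
    and a b :: ereal
    and c d d1 d2 \<gamma> :: real
  assumes fZ_meas: "fZ \<in> borel_measurable borel"
    and fZ_nonneg: "\<forall>x. 0 \<le> fZ x"
    and fZ_prob: "(\<integral>\<^sup>+ x. ennreal (fZ x) \<partial>lborel) = 1"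
    and F_cdf: "\<forall>x. F x = (LBINT t:{..x}. fZ t)"
    and a_def: "a = Sup {ereal x | x. F x = 0}"
    and b_def: "b = Inf {ereal x | x. F x = 1}"
    and F_strict: "strict_mono_on {x. a < ereal x \<and> ereal x < b} F"
    and g_strict: "strict_mono_on {x. a < ereal x \<and> ereal x < b} g"
    and g_deriv: "\<forall>x. a < ereal x \<and> ereal x < b \<longrightarrow> (g has_real_derivative g' x) (at x)"
    and g'_deriv: "\<forall>x. a < ereal x \<and> ereal x < b \<longrightarrow> (g' has_real_derivative g'' x) (at x)"
    and g''_cont: "continuous_on {x. a < ereal x \<and> ereal x < b} g''"
    and fZ_deriv: "\<forall>x. a < ereal x \<and> ereal x < b \<longrightarrow> (fZ has_real_derivative fZ' x) (at x)"
    and fZ'_cont: "continuous_on {x. a < ereal x \<and> ereal x < b} fZ'"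
    and fZ_pos: "\<forall>x. a < ereal x \<and> ereal x < b \<longrightarrow> fZ x > 0"
    and g'_pos: "\<forall>x. a < ereal x \<and> ereal x < b \<longrightarrow> g' x > 0"
    and gamma_pos: "\<gamma> > 0"
    and gamma_bound: "\<forall>x. a < ereal x \<and> ereal x < b \<longrightarrow>
        F x * (1 - F x) / (fZ x)\<^sup>2 * \<bar>fZ' x - fZ x * g'' x / g' x\<bar> \<le> \<gamma>"
    and d12: "d1 \<le> d2"
    and phi_supp: "\<forall>x. x \<notin> {d1..d2} \<longrightarrow> \<phi> x = 0"
    and phi_deriv: "\<forall>x\<in>{d1..d2}. (\<phi> has_real_derivative \<phi>' x) (at x within {d1..d2})"
    and phi'_cont: "continuous_on {d1..d2} \<phi>'"
    and phi_int: "integral {d1..d2} \<phi> = 1"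
    and h_pos: "\<forall>n. h n > 0"
    and h_lim1: "(\<lambda>n. sqrt (ln (ln (real n))) * h n) \<longlonglongrightarrow> 0"
    and h_lim2: "filterlim (\<lambda>n. sqrt (real n) * (h n)\<^sup>2 / ln (ln (real n))) at_top sequentially"
    and cd: "a < ereal c" "c < d" "ereal d < b"
  shows "\<exists>(M :: (nat \<Rightarrow> real) measure) (Z :: nat \<Rightarrow> (nat \<Rightarrow> real) \<Rightarrow> real)
            (K :: real \<Rightarrow> real \<Rightarrow> (nat \<Rightarrow> real) \<Rightarrow> real).
           prob_space M \<and>
           prob_space.indep_vars M (\<lambda>_. borel) Z UNIV \<and>
           (\<forall>i. distributed M lborel (Z i) (\<lambda>x. ennreal (fZ x))) \<and>
           kiefer_process M K \<and>
           (AE \<omega> in M.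
              (\<lambda>n. SUP x\<in>{c..d}. ereal \<bar>sqrt (real n)
                    * (emp_quantile (\<lambda>i. g (Z i \<omega>)) n (F x) - g x)
                    * kde \<phi> (h n) (\<lambda>i. g (Z i \<omega>)) n (emp_quantile (\<lambda>i. g (Z i \<omega>)) n (F x))
                  - K (F x) (real n) \<omega> / sqrt (real n)\<bar>) \<longlonglongrightarrow> 0)"
proof -
  define I where "I = {x. a < ereal x \<and> ereal x < b}"
  have inI: "x \<in> I \<longleftrightarrow> a < ereal x \<and> ereal x < b" for x by (simp add: I_def)
  define D where "D = density lborel fZ"
  have nn: "\<And>x. 0 \<le> fZ x" using fZ_nonneg by simp
  interpret D: real_distribution D
    unfolding D_def by (rule prob_density_cdf(1) [OF fZ_meas nn fZ_prob])
  have int: "integrable lborel fZ" by (rule prob_density_cdf(2) [OF fZ_meas nn fZ_prob])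
  have F: "F x = cdf D x" for x
    using F_cdf by (simp add: D_def prob_density_cdf(3) [OF fZ_meas nn fZ_prob])
  have F_mono: "F x \<le> F y" if "x \<le> y" for x y
    using that by (simp add: F D.cdf_nondecreasing)
  have F_isCont: "isCont F x" for x
  proof -
    have "isCont (cdf D) x"
      by (simp add: D.isCont_cdf) (simp add: D_def prob_density_cdf(4) [OF fZ_meas nn fZ_prob])
    then show ?thesis by (simp add: F [abs_def])
  qed
  have F_01: "0 \<le> F x" "F x \<le> 1" for x by (simp_all add: F D.cdf_nonneg D.cdf_bounded_prob)
  have F_ex: "\<exists>x. F x = u" if u: "0 < u" "u < 1" for u
  proof -
    have "\<forall>\<^sub>F x in at_bot. cdf D x < u" by (rule order_tendstoD(2) [OF D.cdf_lim_at_bot u(1)])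
    then obtain x where x: "F x < u" unfolding eventually_at_bot_linorder by (auto simp: F)
    have "\<forall>\<^sub>F x in at_top. u < cdf D x" by (rule order_tendstoD(1) [OF D.cdf_lim_at_top_prob u(2)])
    then obtain y where y: "u < F y" unfolding eventually_at_top_linorder by (auto simp: F)
    have "x \<le> y" using F_mono [of y x] x y by linarith
    then show ?thesis using IVT [of F x u y] x y F_isCont by auto
  qed
  \<comment> \<open>By continuity \<open>F\<close> takes intermediate values on both sides of
    \<open>x\<close>. The corresponding points \<open>y < x < z\<close> separate \<open>x\<close>
    strictly from \<open>a\<close> and \<open>b\<close>.\<close>
  have F_mem: "x \<in> I" if u: "0 < F x" "F x < 1" for x
  proof -
    obtain y where y: "F y = F x / 2" using F_ex [of "F x / 2"] u by auto
    obtain z where z: "F z = (F x + 1) / 2" using F_ex [of "(F x + 1) / 2"] u by auto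
    have yx: "y < x" using F_mono [of x y] y u by (cases "x \<le> y") auto
    have xz: "x < z" using F_mono [of z x] z u by (cases "z \<le> x") auto
    have "a \<le> ereal y"
      unfolding a_def
    proof (intro Sup_least, elim CollectE exE conjE)
      fix s t assume "s = ereal t" "F t = 0"
      then show "s \<le> ereal y" using F_mono [of y t] y u by (cases "y \<le> t") auto
    qed
    moreover have "ereal z \<le> b"
      unfolding b_def
    proof (intro Inf_greatest, elim CollectE exE conjE)
      fix s t assume "s = ereal t" "F t = 1"
      then show "ereal z \<le> s" using F_mono [of t z] z u by (cases "t \<le> z") auto
    qed
    ultimately show ?thesis
      unfolding inI using yx xz by (meson ereal_less_eq(3) le_less_trans less_ereal.simps(1) less_le_trans)
  qed
  have F_range: "0 < F x \<and> F x < 1" if x: "x \<in> I" for x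
  proof -
    have "F x \<noteq> 0"
    proof
      assume "F x = 0"
      then have "ereal x \<le> a" unfolding a_def by (intro Sup_upper) auto
      then show False using x by (simp add: inI not_less [symmetric])
    qed
    moreover have "F x \<noteq> 1"
    proof
      assume "F x = 1"
      then have "b \<le> ereal x" unfolding b_def by (intro Inf_lower) auto
      then show False using x by (simp add: inI not_less [symmetric])
    qed
    ultimately show ?thesis using F_01 [of x] by linarith
  qed
  have I_open: "open I"
  proof -
    have "I = ereal -` {a<..<b}" by (auto simp: I_def)
    then show ?thesis by (simp add: open_vimage continuous_on_ereal)
  qed
  have I_interval: "is_interval I"
    unfolding is_interval_1
  proof (intro ballI allI impI)
    fix p q x assume "p \<in> I" "q \<in> I" "p \<le> x \<and> x \<le> q"
    then have "a < ereal p" "ereal p \<le> ereal x" "ereal x \<le> ereal q" "ereal q < b" by (simp_all add: inI)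
    then show "x \<in> I" unfolding inI by (intro conjI) (rule less_le_trans le_less_trans, assumption, assumption)+
  qed
  have cI: "c \<in> I" "d \<in> I"
    using cd by (auto simp: inI intro: less_trans [of a "ereal c"] less_trans [of _ "ereal d" b])
  have fZ_cont: "continuous_on I fZ"
    using fZ_deriv by (intro continuous_at_imp_continuous_on ballI DERIV_isCont) (auto simp: inI)
  have F_eq: "F = (\<lambda>x. LBINT t:{..x}. fZ t)" using F_cdf by (intro ext) (rule spec)
  have F_deriv: "(F has_real_derivative fZ x) (at x)" if "x \<in> I" for x
    unfolding F_eq by (rule LBINT_cdf_has_derivative [OF int I_open that fZ_cont])
  interpret quantile_setup \<phi> \<phi>' d1 d2 F fZ fZ' g g' g'' I c d
    by unfold_locales
       (fact d12 phi_supp phi_deriv phi'_cont phi_int I_open I_interval cI cd F_deriv F_range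
          fZ'_cont [folded I_def] g''_cont [folded I_def] fZ_deriv [folded inI, rule_format]
          g_deriv [folded inI, rule_format] g'_deriv [folded inI, rule_format]
          fZ_pos [folded inI, rule_format] g'_pos [folded inI, rule_format])+
  interpret coupling base_space coord by (rule coupling_base_space)

  \<comment> \<open>The quantile function. The default \<open>c\<close> keeps all values inside
    \<open>I\<close>, and the choice is harmless because \<open>F\<close> is injective
    there.\<close>
  define Q where "Q = (\<lambda>u. if 0 < u \<and> u < 1 then SOME x. F x = u else c)"
  have FQ: "F (Q u) = u" if "0 < u" "u < 1" for u
    using that someI_ex [OF F_ex [OF that]] by (simp add: Q_def)
  have QI: "Q u \<in> I" for u
  proof (cases "0 < u \<and> u < 1")
    case True
    then show ?thesis using FQ [of u] by (intro F_mem) auto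
  next
    case False
    then have "Q u = c" by (simp only: Q_def if_False)
    then show ?thesis using cI by simp
  qed
  have Q_le: "Q u \<le> x \<longleftrightarrow> u \<le> F x" if u: "0 < u" "u < 1" for u x
  proof
    assume "Q u \<le> x"
    then show "u \<le> F x" using F_mono [of "Q u" x] FQ [OF u] by simp
  next
    assume le: "u \<le> F x"
    show "Q u \<le> x"
    proof (rule ccontr)
      assume n: "\<not> Q u \<le> x"
      then have "F x \<le> u" using F_mono [of x "Q u"] FQ [OF u] by simp
      then have eq: "F x = u" using le by simp
      then have "x \<in> I" using u by (intro F_mem) auto
      then have "F x < F (Q u)" using n QI by (simp add: F_less_iff)
      then show False using eq FQ [OF u] by simp
    qed
  qed
  have Q_meas: "Q \<in> borel_measurable borel"
    unfolding borel_measurable_iff_le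
  proof
    fix x
    have "{u \<in> space borel. Q u \<le> x} = {u. 0 < u \<and> u < 1 \<and> u \<le> F x} \<union> {u. \<not> (0 < u \<and> u < 1) \<and> c \<le> x}"
      using Q_le by (auto simp: Q_def)
    then show "{u \<in> space borel. Q u \<le> x} \<in> sets borel" by simp
  qed
  define Z where "Z = (\<lambda>i \<omega>. Q (U i \<omega>))"
  have FZ: "F (Z i \<omega>) = U i \<omega>" for i \<omega> using FQ U_range [of \<omega> i] by (simp add: Z_def)
  have indep_Z: "indep_vars (\<lambda>_. borel) Z UNIV"
    unfolding Z_def by (rule indep_vars_compose2 [OF indep_U]) (simp add: Q_meas)
  have Z_meas: "Z i \<in> borel_measurable base_space" for i
    using indep_Z unfolding indep_vars_def2 by simp
  have dens: "distributed base_space lborel (Z i) (\<lambda>x. ennreal (fZ x))" for i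
    unfolding distributed_def
  proof (intro conjI)
    have "cdf (distr base_space borel (Z i)) x = cdf D x" for x
    proof -
      have "cdf (distr base_space borel (Z i)) x = prob {\<omega> \<in> space base_space. Z i \<omega> \<le> x}"
        using Z_meas [of i] by (simp add: cdf_def measure_distr vimage_def)
      also have "\<dots> = prob {\<omega> \<in> space base_space. U i \<omega> \<le> F x}"
        using Q_le U_range [of _ i] by (simp add: Z_def)
      also have "\<dots> = F x" using F_01 [of x] by (simp only: prob_U) (simp add: clamp01_def)
      finally show ?thesis by (simp add: F)
    qed
    then have "distr base_space borel (Z i) = D"
      by (intro cdf_unique real_distribution_distr Z_meas ext) unfold_locales
    moreover have "distr base_space lborel (Z i) = distr base_space borel (Z i)" by (rule distr_cong) auto
    ultimately show "distr base_space lborel (Z i) = density lborel (\<lambda>x. ennreal (fZ x))" by (simp add: D_def)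
  qed (use fZ_meas Z_meas [of i] in auto)

  define K where "K = (\<lambda>y t. if y \<in> {0..1} \<and> 0 \<le> t then kiefer_sum y t else (\<lambda>_. 0))"
  have kiefer: "kiefer_process base_space K" unfolding K_def by (rule kiefer_sum_kiefer_process [OF block_size_pos])
  have C: "0 \<le> lil_const" using holder_const_pos size_ratio_pos by (simp add: lil_const_def)
  have conv: "(\<lambda>n. SUP x\<in>{c..d}. ereal \<bar>sqrt (real n)
                    * (emp_quantile (\<lambda>i. g (Z i \<omega>)) n (F x) - g x)
                    * kde \<phi> (h n) (\<lambda>i. g (Z i \<omega>)) n (emp_quantile (\<lambda>i. g (Z i \<omega>)) n (F x))
                  - K (F x) (real n) \<omega> / sqrt (real n)\<bar>) \<longlonglongrightarrow> 0"
    if eps: "eps \<longlonglongrightarrow> 0"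
      and emp: "\<forall>\<^sub>F n in sequentially. (\<forall>y\<in>{0..1}. \<bar>emp_dev n y \<omega> + kiefer_sum y (real n) \<omega>\<bar> \<le> eps n * sqrt (real n)) \<and>
        (\<forall>y\<in>{0..1}. \<forall>y'\<in>{0..1}. \<bar>emp_dev n y \<omega> - emp_dev n y' \<omega>\<bar> \<le>
          (lil_const * sqrt (ln (ln (real n))) * sqrt (sqrt \<bar>y - y'\<bar>) + eps n) * sqrt (real n))" for \<omega> eps
  \<comment> \<open>The extra \<open>2 / sqrt n\<close> pays for the index shift between
    \<open>emp_dev\<close> and \<open>count_dev\<close>, at most 1 for each of the two points in the
    modulus.\<close>
  proof (rule quantile_estimator_limit [where eps = "\<lambda>n. eps n + 2 / sqrt (real n)" and C = lil_const and kf = "\<lambda>y n. K y (real n) \<omega>"])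
    have "(\<lambda>n. 2 / sqrt (real n)) \<longlonglongrightarrow> 0" by real_asymp
    from tendsto_add [OF eps this] show "(\<lambda>n. eps n + 2 / sqrt (real n)) \<longlonglongrightarrow> 0" by simp
    show "Z i \<omega> \<in> I" for i by (simp add: Z_def QI)
    show "0 < h n" for n using h_pos by simp
    have shift: "\<bar>emp_dev n y \<omega> - count_dev (\<lambda>i. F (Z i \<omega>)) n y\<bar> \<le> 1" for n y
      using card_shift_diff [of n "\<lambda>i. U i \<omega> \<le> y"] by (simp add: emp_dev_def count_dev_def FZ)
    show "\<forall>\<^sub>F n in sequentially.
      (\<forall>y\<in>{0..1}. \<bar>count_dev (\<lambda>i. F (Z i \<omega>)) n y + K y (real n) \<omega>\<bar> \<le> (eps n + 2 / sqrt (real n)) * sqrt (real n)) \<and>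
      (\<forall>y\<in>{0..1}. \<forall>y'\<in>{0..1}. \<bar>count_dev (\<lambda>i. F (Z i \<omega>)) n y - count_dev (\<lambda>i. F (Z i \<omega>)) n y'\<bar> \<le>
         (lil_const * sqrt (ln (ln (real n))) * sqrt (sqrt \<bar>y - y'\<bar>) + (eps n + 2 / sqrt (real n))) * sqrt (real n))"
      using emp eventually_gt_at_top [of 0]
    proof eventually_elim
      case (elim n)
      have e: "(s + 2 / sqrt (real n)) * sqrt (real n) = s * sqrt (real n) + 2" for s using elim(2) by (simp add: distrib_right)
      show ?case
        unfolding add.assoc [symmetric] e
      proof (intro conjI ballI)
        fix y :: real assume y: "y \<in> {0..1}"
        have "\<bar>emp_dev n y \<omega> + K y (real n) \<omega>\<bar> \<le> eps n * sqrt (real n)" using elim(1) y by (simp add: K_def)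
        then show "\<bar>count_dev (\<lambda>i. F (Z i \<omega>)) n y + K y (real n) \<omega>\<bar> \<le> eps n * sqrt (real n) + 2"
          using shift [of n y] by linarith
        fix y' :: real assume "y' \<in> {0..1}"
        then have "\<bar>emp_dev n y \<omega> - emp_dev n y' \<omega>\<bar> \<le> (lil_const * sqrt (ln (ln (real n))) * sqrt (sqrt \<bar>y - y'\<bar>) + eps n) * sqrt (real n)"
          using elim(1) y by simp
        then show "\<bar>count_dev (\<lambda>i. F (Z i \<omega>)) n y - count_dev (\<lambda>i. F (Z i \<omega>)) n y'\<bar> \<le>
            (lil_const * sqrt (ln (ln (real n))) * sqrt (sqrt \<bar>y - y'\<bar>) + eps n) * sqrt (real n) + 2"
          using shift [of n y] shift [of n y'] by linarith
      qed
    qed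
  qed (use h_lim1 h_lim2 C in auto)
  show ?thesis
  proof (intro exI conjI allI)
    show "AE \<omega> in base_space. (\<lambda>n. SUP x\<in>{c..d}. ereal \<bar>sqrt (real n)
                    * (emp_quantile (\<lambda>i. g (Z i \<omega>)) n (F x) - g x)
                    * kde \<phi> (h n) (\<lambda>i. g (Z i \<omega>)) n (emp_quantile (\<lambda>i. g (Z i \<omega>)) n (F x))
                  - K (F x) (real n) \<omega> / sqrt (real n)\<bar>) \<longlonglongrightarrow> 0"
      using AE_empirical
    proof eventually_elim
      case (elim \<omega>)
      then show ?case by (elim exE conjE) (rule conv)
    qed
  qed (use indep_Z dens kiefer in \<open>auto intro: prob_space_axioms\<close>)
qed

end
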